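(* There exist functions $f_1,f_2':(0,1)\to(0,\infty)$ with $f_1(\delta)=O(1/\delta)$ and $f_2'(\delta)=O(1/\delta^2)$ such that the following holds for every $d\ge1$, $\delta\in(0,1)$, $\mathbb{F}\in\{\mathbb{R},\mathbb{C}\}$ and every target $\Sigma\in\mathbb{F}^{d\times d}$ all of whose singular values equal $\sigma_1(\Sigma)>0$. Write $f_1=f_1(\delta)$, $f_2'=f_2'(\delta)$. Consider four-layer matrix factorization under gradient flow with balanced Gaussian initialization with scaling factor $0<\epsilon \le \frac{\sigma_1^{1/4}(\Sigma)}{4 f_1^2 f_2' d^{29/8}}$. Then: 1. If $\mathbb{F}=\mathbb{R}$, with probability at least $\frac12$ the loss does not converge to zero; specifically, $\mathcal{L}(t)\ge\frac12\sigma_1^2(\Sigma)$ for all $t\in[0,+\infty)$. 2. If $\mathbb{F}=\mathbb{C}$ with probability at least $1-\delta$, and if $\mathbb{F}=\mathbb{R}$ with probability at least $\frac12(1-\delta)$, the following holds: with $$T(\epsilon_{\rm conv})=\frac{16 f_2'^2 d^3}{\sigma_1(\Sigma)\epsilon^2}+\frac{1}{8\sigma_1^{3/2}(\Sigma)}\ln\Big(\frac{d\sigma_1^2(\Sigma)}{\epsilon_{\rm conv}}\Big),$$ for any $\epsilon_{\rm conv}>0$ one has $\mathcal{L}(t)<\epsilon_{\rm conv}$ whenever $t>T(\epsilon_{\rm conv})$.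
   Context: $M^H$ denotes the conjugate transpose (transpose if $\mathbb{F}=\mathbb{R}$). Loss, for $W_1,\dots,W_4\in\mathbb{F}^{d\times d}$ and a constant $a\ge0$: $\mathcal{L}=\tfrac12\|W_4W_3W_2W_1-\Sigma\|_F^2+\tfrac14 a\sum_{j=1}^{3}\|W_jW_j^H-W_{j+1}^HW_{j+1}\|_F^2$. Gradient flow: $\frac{\mathrm{d}W_j}{\mathrm{d}t}=-\nabla_{W_j}\mathcal{L}$ for $t\ge0$, where $\nabla_M=\frac{\partial}{\partial \Re M}+i\frac{\partial}{\partial\Im M}$ if $\mathbb{F}=\mathbb{C}$ and the ordinary gradient if $\mathbb{F}=\mathbb{R}$. $\mathcal{L}(t)$ is the loss at time $t$. Balanced Gaussian initialization (here $N=4$) with scaling factor $\epsilon>0$: sample independently $G\in\mathbb{F}^{d\times d}$ with i.i.d. entries $\mathcal{N}(0,1)_{\mathbb{F}}$ (standard normal if $\mathbb{F}=\mathbb{R}$; independent real and imaginary parts each $\mathcal{N}(0,1/2)$ if $\mathbb{F}=\mathbb{C}$) and $Q_{k,k+1}$, $k=0,1,\dots,N$, i.i.d. from Haar measure on the unitary group $U(d,\mathbb{C})$ if $\mathbb{F}=\mathbb{C}$, or the orthogonal group $O(d,\mathbb{R})$ if $\mathbb{F}=\mathbb{R}$; let $s_1,\dots,s_N\in\mathbb{F}$ be arbitrary constants with $|s_j|=1$; set $W_j(0)=s_j\epsilon Q_{j,j+1}GQ_{j-1,j}^H$ for $j$ odd and $W_j(0)=s_j\epsilon Q_{j,j+1}G^HQ_{j-1,j}^H$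 for $j$ even. Implied constants are absolute. *)

theory Defs
  imports
    "HOL-Probability.Probability"
    "HOL-Library.Landau_Symbols"
    "Jordan_Normal_Form.Schur_Decomposition"
begin

hide_const (open) Finite_Cartesian_Product.mat Finite_Cartesian_Product.vec

(* The scalar field is a type 'a that is both a normed field and a Euclidean space over the reals;
   the results only instantiate it with real (conjugate = identity, Basis = {1}) and complex
   (conjugate = cnj, Basis = {1, i}). *)

definition frob_sq :: "'a::real_normed_field mat \<Rightarrow> real" where
  "frob_sq A = (\<Sum>i<dim_row A. \<Sum>j<dim_col A. (norm (A $$ (i, j)))\<^sup>2)"

definition singular_values :: "'a::{real_normed_field, conjugatable_field} mat \<Rightarrow> real set" where
  "singular_values A = {s. s \<ge> 0 \<and> eigenvalue (mat_adjoint A * A) (of_real (s\<^sup>2))}"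

definition sigma_max :: "'a::{real_normed_field, conjugatable_field} mat \<Rightarrow> real" where
  "sigma_max A = Max (singular_values A)"

(* This is O(d) over real and U(d) over complex. *)
definition unitary_group :: "nat \<Rightarrow> 'a::conjugatable_field mat set" where
  "unitary_group d =
     {U \<in> carrier_mat d d. mat_adjoint U * U = 1\<^sub>m d \<and> U * mat_adjoint U = 1\<^sub>m d}"

definition loss :: "real \<Rightarrow> 'a::{real_normed_field, conjugatable_field} mat \<Rightarrow> (nat \<Rightarrow> 'a mat) \<Rightarrow> real"
  where
  "loss a \<Sigma> W =
     1 / 2 * frob_sq (W 4 * W 3 * W 2 * W 1 - \<Sigma>)
     + 1 / 4 * a * (\<Sum>j = 1..3. frob_sq (W j * mat_adjoint (W j)
                                        - mat_adjoint (W (j + 1)) * W (j + 1)))"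

definition mat_unit :: "nat \<Rightarrow> nat \<Rightarrow> nat \<Rightarrow> 'a::zero \<Rightarrow> 'a mat" where
  "mat_unit d r c x = mat d d (\<lambda>p. if p = (r, c) then x else 0)"

(* Gradient of F in the j-th matrix. Summing over Basis yields the ordinary gradient over real and
   d/d(Re) + i d/d(Im), entry by entry, over complex. *)
definition grad_wrt ::
  "nat \<Rightarrow> ((nat \<Rightarrow> 'a::{real_normed_field, euclidean_space} mat) \<Rightarrow> real)
     \<Rightarrow> (nat \<Rightarrow> 'a mat) \<Rightarrow> nat \<Rightarrow> 'a mat" where
  "grad_wrt d F W j = mat d d (\<lambda>(r, c).
     \<Sum>b\<in>Basis. deriv (\<lambda>h::real. F (W(j := W j + mat_unit d r c (h *\<^sub>R b)))) 0 *\<^sub>R b)"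

definition gradient_flow ::
  "nat \<Rightarrow> real \<Rightarrow> 'a::{real_normed_field, euclidean_space, conjugatable_field} mat
     \<Rightarrow> (real \<Rightarrow> nat \<Rightarrow> 'a mat) \<Rightarrow> bool" where
  "gradient_flow d a \<Sigma> W \<longleftrightarrow>
     (\<forall>t\<ge>0. \<forall>j\<in>{1..4}. W t j \<in> carrier_mat d d) \<and>
     (\<forall>t\<ge>0. \<forall>j\<in>{1..4}. \<forall>r<d. \<forall>c<d.
        ((\<lambda>u. W u j $$ (r, c)) has_vector_derivative
           - (grad_wrt d (loss a \<Sigma>) (W t) j $$ (r, c))) (at t within {0..}))"

(* Borel sigma-algebra of the d x d matrices, i.e. the one generated by the entries. *)
definition mat_borel :: "nat \<Rightarrow> 'a::topological_space mat measure" where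
  "mat_borel d =
     vimage_algebra (carrier_mat d d) (\<lambda>A. \<lambda>p\<in>{..<d} \<times> {..<d}. A $$ p)
       (PiM ({..<d} \<times> {..<d}) (\<lambda>_. borel))"

definition std_gaussian_real :: "real measure" where
  "std_gaussian_real = density lborel (normal_density 0 1)"

(* normal_density takes the standard deviation as its second argument. *)
definition std_gaussian_complex :: "complex measure" where
  "std_gaussian_complex =
     distr (density lborel (normal_density 0 (sqrt (1 / 2)))
              \<Otimes>\<^sub>M density lborel (normal_density 0 (sqrt (1 / 2))))
       borel (\<lambda>(x, y). Complex x y)"

definition iid_mat :: "'a::topological_space measure \<Rightarrow> nat \<Rightarrow> 'a mat measure" where
  "iid_mat \<nu> d = distr (PiM ({..<d} \<times> {..<d}) (\<lambda>_. \<nu>)) (mat_borel d) (mat d d)"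

(* The normalised Haar measure: the unique left-invariant Borel probability measure on the
   compact group O(d) or U(d). *)
definition is_haar ::
  "nat \<Rightarrow> 'a::{topological_space, conjugatable_field} mat measure \<Rightarrow> bool" where
  "is_haar d \<mu> \<longleftrightarrow>
     prob_space \<mu> \<and>
     sets \<mu> = sets (restrict_space (mat_borel d) (unitary_group d)) \<and>
     (\<forall>U\<in>unitary_group d. distr \<mu> \<mu> (\<lambda>V. U * V) = \<mu>)"

(* Joint law of (G, Q), where Q k stands for the matrix indexed by (k, k + 1), k = 0, ..., 4. *)
definition init_law ::
  "'a::topological_space measure \<Rightarrow> 'a mat measure \<Rightarrow> nat \<Rightarrow> ('a mat \<times> (nat \<Rightarrow> 'a mat)) measure"
  where "init_law \<nu> \<mu> d = iid_mat \<nu> d \<Otimes>\<^sub>M PiM {0..4} (\<lambda>_. \<mu>)"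

definition balanced_init ::
  "(nat \<Rightarrow> 'a) \<Rightarrow> real \<Rightarrow> 'a::{real_normed_field, conjugatable_field} mat \<times> (nat \<Rightarrow> 'a mat)
     \<Rightarrow> nat \<Rightarrow> 'a mat" where
  "balanced_init s \<epsilon> = (\<lambda>(G, Q) j.
     (s j * of_real \<epsilon>) \<cdot>\<^sub>m
       (Q j * (if odd j then G else mat_adjoint G) * mat_adjoint (Q (j - 1))))"

(* E itself need not be measurable: it has to contain a measurable event of probability
   at least p. *)
definition with_prob_at_least :: "'w measure \<Rightarrow> real \<Rightarrow> ('w \<Rightarrow> bool) \<Rightarrow> bool" where
  "with_prob_at_least M p E \<longleftrightarrow> (\<exists>A\<in>sets M. measure M A \<ge> p \<and> (\<forall>\<omega>\<in>A. E \<omega>))"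

(* P is a property of t |-> loss along the flow. The loss is nonnegative and polynomial in the
   entries, so the flow from W0 exists for all t >= 0 and is unique; "all solutions" is "the
   solution". *)
definition along_flow ::
  "nat \<Rightarrow> real \<Rightarrow> 'a::{real_normed_field, euclidean_space, conjugatable_field} mat
     \<Rightarrow> (nat \<Rightarrow> 'a mat) \<Rightarrow> ((real \<Rightarrow> real) \<Rightarrow> bool) \<Rightarrow> bool" where
  "along_flow d a \<Sigma> W0 P \<longleftrightarrow>
     (\<forall>W. gradient_flow d a \<Sigma> W \<and> (\<forall>j\<in>{1..4}. W 0 j = W0 j) \<longrightarrow> P (\<lambda>t. loss a \<Sigma> (W t)))"

(* f2 stands for the number f_2'(delta). *)
definition conv_time :: "real \<Rightarrow> nat \<Rightarrow> real \<Rightarrow> real \<Rightarrow> real \<Rightarrow> real" where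
  "conv_time f2 d \<sigma> \<epsilon> e =
     16 * f2\<^sup>2 * real d ^ 3 / (\<sigma> * \<epsilon>\<^sup>2)
     + 1 / (8 * \<sigma> powr (3 / 2)) * ln (real d * \<sigma>\<^sup>2 / e)"

definition fast_convergence :: "real \<Rightarrow> nat \<Rightarrow> real \<Rightarrow> real \<Rightarrow> (real \<Rightarrow> real) \<Rightarrow> bool" where
  "fast_convergence f2 d \<sigma> \<epsilon> L \<longleftrightarrow>
     (\<forall>e>0. \<forall>t\<ge>0. t > conv_time f2 d \<sigma> \<epsilon> e \<longrightarrow> L t < e)"

(* f1 and f2 stand for the numbers f_1(delta) and f_2'(delta). *)
definition setting ::
  "real \<Rightarrow> real \<Rightarrow> nat \<Rightarrow> 'a::{real_normed_field, conjugatable_field, topological_space} mat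
     \<Rightarrow> real \<Rightarrow> (nat \<Rightarrow> 'a) \<Rightarrow> real \<Rightarrow> 'a mat measure \<Rightarrow> bool" where
  "setting f1 f2 d \<Sigma> a s \<epsilon> \<mu> \<longleftrightarrow>
     \<Sigma> \<in> carrier_mat d d \<and> sigma_max \<Sigma> > 0 \<and> (\<forall>\<sigma>\<in>singular_values \<Sigma>. \<sigma> = sigma_max \<Sigma>) \<and>
     a \<ge> 0 \<and> (\<forall>j\<in>{1..4}. norm (s j) = 1) \<and> is_haar d \<mu> \<and>
     0 < \<epsilon> \<and> \<epsilon> \<le> sigma_max \<Sigma> powr (1 / 4) / (4 * f1\<^sup>2 * f2 * real d powr (29 / 8))"

end

theory Submission
  imports Defs
begin

text \<open>
  The flow preserves balancedness, so with \<open>A = W\<^sub>2 W\<^sub>1\<close>, \<open>B = W\<^sub>4 W\<^sub>3\<close> and \<open>\<Sigma> = \<sigma> U\<close>, \<open>U\<close> absorbed into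
  \<open>W\<^sub>4\<close>, everything is governed by \<open>P = A + B\<^sup>H\<close> and \<open>D = A - B\<^sup>H\<close>, where \<open>D\<close> only decays. If \<open>P(0)\<close> is
  singular, \<open>P(t)\<close> stays singular, which keeps the loss above \<open>\<sigma>\<^sup>2 / 2\<close>. Otherwise the smallest singular
  value of \<open>P\<close> obeys a comparison argument at the first time it would touch a lower barrier: it first
  grows linearly in time, then like the solution of \<open>q' = \<sigma> q\<^sup>2 / 2\<close>, until it is of order \<open>\<surd>\<sigma>\<close>, and
  from then on the loss decays exponentially.

  Up to invertible factors, \<open>P(0)\<close> is \<open>Q\<^sub>0\<^sup>H + (V Q\<^sub>4)\<^sup>H\<close> for a fixed unitary \<open>V\<close>. Over the reals this is
  singular when \<open>det Q\<^sub>0 \<cdot> det (V Q\<^sub>4) = -1\<close>, an event of probability one half. On the other half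
  of the real case, and in the complex case, its smallest singular value is bounded below by averaging
  over subgroups that preserve the Haar measure; for the Gaussian factor \<open>G\<close> one uses the distance from
  one column to the span of the others.\<close>


section \<open>Finitely supported matrices\<close>

text \<open>The smallest singular value is not differentiable in time, so the comparison runs over
  pairs of a time and a matrix \<open>X\<close> on a compact unit sphere. At the first contact of
  \<open>norm (P t * X)\<close> with the barrier, \<open>X\<close> minimizes a quadratic form and
  hence is an eigenvector of the Gram matrix; with \<open>X\<close> frozen, the derivative can be
  computed.

  The early growth takes the smallest singular value of \<open>P\<close> from order \<open>p\<close>
  to order \<open>sqrt (m * p)\<close>, with \<open>m\<close> the scale of the squared singular
  values of \<open>W1\<close>. The factor \<gamma> by which the sum of two unitary matrices degrades
  \<open>P 0\<close> thus enters the waiting time only as \<open>sqrt \<gamma>\<close>. This makes a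
  failure probability of order d^2 \<gamma> affordable over the reals: with \<gamma> of order
  (\<delta> / d)^2 and the smallest singular value of \<open>G\<close> of order \<delta> / d, the
  wait is of order d^3 / (\<delta>^3 \<sigma> \<epsilon>^2), within the d^3 / (\<delta>^4 \<sigma>
  \<epsilon>^2) on offer.

  The claimed rate 8 \<sigma>^(3/2) is exactly the limiting one, so no constant may be lost in the
  exponent; all losses go into the waiting time.\<close>

class rc_field = real_normed_field + euclidean_space + conjugatable_field +
  assumes inner_mult_conjugate: "inner (a * x) y = inner x (conjugate a * y)"
    and conjugate_mult_self: "conjugate a * a = scaleR ((norm a)\<^sup>2) 1"
    and conjugate_scaleR: "conjugate (scaleR r a) = scaleR r (conjugate a)"

instance real :: rc_field
  by standard (auto simp: power2_eq_square)

instance complex :: rc_field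
proof
  fix a x y :: complex and r :: real
  show "inner (a * x) y = inner x (conjugate a * y)"
    by (simp add: inner_complex_def algebra_simps)
  show "conjugate a * a = scaleR ((norm a)\<^sup>2) 1"
    unfolding scaleR_conv_of_real complex_norm_square by (simp add: mult.commute)
  show "conjugate (r *\<^sub>R a) = r *\<^sub>R conjugate a"
    by (simp add: complex_eq_iff)
qed

lemma norm_conjugate [simp]: "norm (conjugate a) = norm (a :: 'a::rc_field)"
proof (cases "a = 0")
  case False
  have "norm (conjugate a * a) = norm (scaleR ((norm a)\<^sup>2) (1::'a))"
    by (simp only: conjugate_mult_self)
  then have "norm (conjugate a) * norm a = norm a * norm a"
    by (simp add: norm_mult power2_eq_square)
  with False show ?thesis by simp
qed simp

lemma conjugate_one [simp]: "conjugate (1 :: 'a::rc_field) = 1"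
  using conjugate_dist_mul[of 1 "conjugate 1 :: 'a"] by simp

lemma conjugate_of_real [simp]: "conjugate (of_real r :: 'a::rc_field) = of_real r"
  by (simp add: of_real_def conjugate_scaleR)

text \<open>Moving \<open>y\<close> across gives \<open>inner (x * conjugate y) 1\<close>; for the
  conjugated pair commutativity of the field gives the same expression with \<open>x\<close> and
  \<open>y\<close> exchanged.\<close>

lemma inner_conjugate: "inner (conjugate x) (conjugate y) = inner x (y :: 'a::rc_field)"
proof -
  have "inner x y = inner (x * conjugate y * 1) 1" for x y :: 'a
    by (metis inner_mult_conjugate inner_commute mult.right_neutral mult.commute conjugate_id)
  then show ?thesis
    by (metis conjugate_id inner_commute mult.commute mult.right_neutral)
qed

text \<open>One type for square matrices of every size: the dimension becomes the predicate
  \<open>supp_le\<close> and is not part of the type. The matrices then form a real inner product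
  space and a normed algebra, so the general rules for derivatives and norms apply. The price is
  that there is no unit: \<open>one_fm d\<close> acts as one only on matrices supported in the first
  \<open>d\<close> indices.\<close>

typedef (overloaded) 'a fm =
  "{f :: nat \<Rightarrow> nat \<Rightarrow> 'a::zero. \<exists>n. \<forall>i j. n \<le> i \<or> n \<le> j \<longrightarrow> f i j = 0}"
  morphisms ent Fm_abs by (rule exI[of _ "\<lambda>_ _. 0"]) auto

setup_lifting type_definition_fm

definition supp_le :: "nat \<Rightarrow> 'a::zero fm \<Rightarrow> bool" where
  "supp_le n A \<longleftrightarrow> (\<forall>i j. n \<le> i \<or> n \<le> j \<longrightarrow> ent A i j = 0)"

lemma supp_leD: "supp_le n A \<Longrightarrow> n \<le> i \<or> n \<le> j \<Longrightarrow> ent A i j = 0"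
  unfolding supp_le_def by blast

lemma supp_le_mono: "supp_le n A \<Longrightarrow> n \<le> m \<Longrightarrow> supp_le m A"
  unfolding supp_le_def by (meson order_trans)

lemma ex_supp_le: "\<exists>n. supp_le n A"
  using ent[of A] unfolding supp_le_def by simp

lemma ex_supp_le2: "\<exists>n. supp_le n A \<and> supp_le n B"
  by (meson ex_supp_le supp_le_mono max.cobounded1 max.cobounded2)

lemma ex_supp_le3: "\<exists>n. supp_le n A \<and> supp_le n B \<and> supp_le n C"
  by (meson ex_supp_le ex_supp_le2 supp_le_mono max.cobounded1 max.cobounded2)

lemma fm_eqI: "(\<And>i j. ent A i j = ent B i j) \<Longrightarrow> A = B"
  by (metis ent_inject ext)

lift_definition unit_fm :: "nat \<Rightarrow> nat \<Rightarrow> 'a::zero \<Rightarrow> 'a fm" is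
  "\<lambda>r c x i j. if i = r \<and> j = c then x else 0"
proof -
  fix r c :: nat and x :: 'a
  show "\<exists>n. \<forall>i j. n \<le> i \<or> n \<le> j \<longrightarrow> (if i = r \<and> j = c then x else 0) = 0"
    by (rule exI[of _ "Suc (max r c)"]) auto
qed

instantiation fm :: (rc_field) real_vector
begin
lift_definition zero_fm :: "'a fm" is "\<lambda>_ _. 0" by auto
lift_definition plus_fm :: "'a fm \<Rightarrow> 'a fm \<Rightarrow> 'a fm" is "\<lambda>f g i j. f i j + g i j"
proof -
  fix f g :: "nat \<Rightarrow> nat \<Rightarrow> 'a"
  assume "\<exists>n. \<forall>i j. n \<le> i \<or> n \<le> j \<longrightarrow> f i j = 0" "\<exists>n. \<forall>i j. n \<le> i \<or> n \<le> j \<longrightarrow> g i j = 0"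
  then obtain n m where *: "\<forall>i j. n \<le> i \<or> n \<le> j \<longrightarrow> f i j = 0" "\<forall>i j. m \<le> i \<or> m \<le> j \<longrightarrow> g i j = 0"
    by blast
  then have "\<forall>i j. max n m \<le> i \<or> max n m \<le> j \<longrightarrow> f i j + g i j = 0" by simp
  then show "\<exists>n. \<forall>i j. n \<le> i \<or> n \<le> j \<longrightarrow> f i j + g i j = 0" by blast
qed
lift_definition uminus_fm :: "'a fm \<Rightarrow> 'a fm" is "\<lambda>f i j. - f i j" by auto
definition minus_fm :: "'a fm \<Rightarrow> 'a fm \<Rightarrow> 'a fm" where "minus_fm A B = A + - B"
lift_definition scaleR_fm :: "real \<Rightarrow> 'a fm \<Rightarrow> 'a fm" is "\<lambda>r f i j. scaleR r (f i j)" by auto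
instance
  by standard (unfold minus_fm_def, (transfer, auto simp: algebra_simps)+)
end

lemma ent_simps [simp]:
  fixes A B :: "'a::rc_field fm"
  shows "ent 0 i j = (0::'a)" "ent (A + B) i j = ent A i j + ent B i j"
    "ent (- A) i j = - ent A i j" "ent (scaleR r A) i j = scaleR r (ent A i j)"
  by (transfer, simp)+

lemma ent_diff [simp]: "ent (A - B) i j = ent A i j - ent (B :: 'a::rc_field fm) i j"
  by (simp only: minus_fm_def ent_simps) simp

lemma ent_unit: "ent (unit_fm r c x) i j = (if i = r \<and> j = c then x else 0)"
  by transfer simp

lemma ent_sum: "ent (sum f S) i j = (\<Sum>s\<in>S. ent (f s :: 'a::rc_field fm) i j)"
  by (induction S rule: infinite_finite_induct) auto

definition supp_bd :: "'a::zero fm \<Rightarrow> nat" where "supp_bd A = (LEAST n. supp_le n A)"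

lemma supp_le_bd: "supp_le (supp_bd A) A"
  unfolding supp_bd_def by (rule LeastI_ex) (rule ex_supp_le)

lemma supp_bd_le: "supp_le n A \<Longrightarrow> supp_bd A \<le> n"
  unfolding supp_bd_def by (rule Least_le)

instantiation fm :: (rc_field) real_inner
begin
definition inner_fm :: "'a fm \<Rightarrow> 'a fm \<Rightarrow> real" where
  "inner_fm A B = (\<Sum>i<supp_bd A. \<Sum>j<supp_bd A. inner (ent A i j) (ent B i j))"
definition norm_fm :: "'a fm \<Rightarrow> real" where "norm_fm A = sqrt (inner A A)"
definition sgn_fm :: "'a fm \<Rightarrow> 'a fm" where "sgn_fm A = A /\<^sub>R norm A"
definition dist_fm :: "'a fm \<Rightarrow> 'a fm \<Rightarrow> real" where "dist_fm A B = norm (A - B)"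
definition uniformity_fm :: "('a fm \<times> 'a fm) filter" where
  "uniformity_fm = (INF e\<in>{0 <..}. principal {(x, y). dist x y < e})"
definition open_fm :: "'a fm set \<Rightarrow> bool" where
  "open_fm U = (\<forall>x\<in>U. eventually (\<lambda>(x', y). x' = x \<longrightarrow> y \<in> U) uniformity)"

text \<open>Any bound on the support of the first argument gives the same sum, so two matrices can
  be compared over a common index range. Symmetry and additivity of the inner product rest on
  this.\<close>

lemma inner_fm_supp:
  assumes "supp_le n A"
  shows "inner A B = (\<Sum>i<n. \<Sum>j<n. inner (ent A i j) (ent (B :: 'a fm) i j))"
proof -
  have "(\<Sum>i<supp_bd A. \<Sum>j<supp_bd A. inner (ent A i j) (ent B i j)) =
        (\<Sum>i<supp_bd A. \<Sum>j<n. inner (ent A i j) (ent B i j))"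
    using supp_bd_le[OF assms] supp_leD[OF supp_le_bd, of A]
    by (intro sum.cong sum.mono_neutral_left) auto
  also have "\<dots> = (\<Sum>i<n. \<Sum>j<n. inner (ent A i j) (ent B i j))"
    using supp_bd_le[OF assms] supp_leD[OF supp_le_bd, of A]
    by (intro sum.mono_neutral_left) auto
  finally show ?thesis unfolding inner_fm_def .
qed

instance
proof
  fix A B C :: "'a fm" and r :: real
  show "inner A B = inner B A"
  proof -
    obtain n where "supp_le n A" "supp_le n B" using ex_supp_le2 by blast
    then show ?thesis by (simp add: inner_fm_supp inner_commute)
  qed
  show "inner (A + B) C = inner A C + inner B C"
  proof -
    obtain n where n: "supp_le n A" "supp_le n B" using ex_supp_le2 by blast
    then have "supp_le n (A + B)" by (simp add: supp_le_def)
    with n show ?thesis by (simp add: inner_fm_supp inner_add_left sum.distrib)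
  qed
  obtain n where n: "supp_le n A" using ex_supp_le by blast
  then have "supp_le n (r *\<^sub>R A)" by (simp add: supp_le_def)
  with n show "inner (r *\<^sub>R A) B = r * inner A B"
    by (simp add: inner_fm_supp sum_distrib_left)
  show "0 \<le> inner A A" using n by (simp add: inner_fm_supp sum_nonneg)
  show "inner A A = 0 \<longleftrightarrow> A = 0"
  proof
    assume "inner A A = 0"
    then have "\<forall>i<n. \<forall>j<n. ent A i j = 0"
      using n by (simp add: inner_fm_supp sum_nonneg_eq_0_iff sum_nonneg)
    with n have "ent A i j = 0" for i j
      by (metis supp_leD linorder_not_le)
    then show "A = 0" by (intro fm_eqI) simp
  next
    assume "A = 0" then show "inner A A = 0" using n by (simp add: inner_fm_supp)
  qed
qed (simp_all add: norm_fm_def sgn_fm_def dist_fm_def uniformity_fm_def open_fm_def)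
end

lemma norm_fm_sq:
  "supp_le n A \<Longrightarrow> (norm (A :: 'a::rc_field fm))\<^sup>2 = (\<Sum>i<n. \<Sum>j<n. (norm (ent A i j))\<^sup>2)"
  by (simp add: power2_norm_eq_inner inner_fm_supp)

lemma inner_unit: "inner (unit_fm r c x) A = inner x (ent (A :: 'a::rc_field fm) r c)"
proof -
  obtain n where n: "r < n" "c < n" by (meson less_Suc_eq_le max.cobounded1 max.cobounded2)
  then have "supp_le n (unit_fm r c x)" by (auto simp: supp_le_def ent_unit)
  then have "inner (unit_fm r c x) A = (\<Sum>i<n. \<Sum>j<n. inner (ent (unit_fm r c x) i j) (ent A i j))"
    by (rule inner_fm_supp)
  also have "\<dots> = (\<Sum>i<n. if i = r then inner x (ent A r c) else 0)"
  proof (rule sum.cong[OF refl])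
    fix i
    have "(\<Sum>j<n. inner (ent (unit_fm r c x) i j) (ent A i j)) =
        (\<Sum>j<n. if j = c then (if i = r then inner x (ent A r c) else 0) else 0)"
      by (rule sum.cong[OF refl]) (simp add: ent_unit)
    with n show "(\<Sum>j<n. inner (ent (unit_fm r c x) i j) (ent A i j)) =
        (if i = r then inner x (ent A r c) else 0)" by (simp add: sum.delta)
  qed
  also have "\<dots> = inner x (ent A r c)" using n by (simp add: sum.delta)
  finally show ?thesis .
qed

lemma norm_ent_le: "norm (ent A i j) \<le> norm (A :: 'a::rc_field fm)"
proof -
  have "(norm (ent A i j))\<^sup>2 = inner (unit_fm i j (ent A i j)) A"
    by (simp add: inner_unit power2_norm_eq_inner)
  also have "\<dots> \<le> norm (unit_fm i j (ent A i j)) * norm A" by (rule norm_cauchy_schwarz)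
  also have "norm (unit_fm i j (ent A i j)) = norm (ent A i j)"
    by (simp add: norm_eq_sqrt_inner inner_unit ent_unit)
  finally have "norm (ent A i j) * norm (ent A i j) \<le> norm (ent A i j) * norm A"
    by (simp add: power2_eq_square)
  then show ?thesis
    by (metis mult_left_le_imp_le norm_ge_zero order_le_less norm_zero)
qed

lemma norm_unit [simp]: "norm (unit_fm i j x) = norm (x::'a::rc_field)"
  by (simp add: norm_eq_sqrt_inner inner_unit ent_unit)

instantiation fm :: (rc_field) ring
begin
text \<open>Summing over the nonzero entries of a row keeps the index set finite without choosing a
  bound on the support; \<open>ent_mult\<close> recovers the usual sum over an initial
  segment.\<close>

lift_definition times_fm :: "'a fm \<Rightarrow> 'a fm \<Rightarrow> 'a fm" is
  "\<lambda>f g i j. \<Sum>k\<in>{k. f i k \<noteq> 0}. f i k * g k j"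
proof -
  fix f g :: "nat \<Rightarrow> nat \<Rightarrow> 'a"
  assume "\<exists>n. \<forall>i j. n \<le> i \<or> n \<le> j \<longrightarrow> f i j = 0" "\<exists>n. \<forall>i j. n \<le> i \<or> n \<le> j \<longrightarrow> g i j = 0"
  then obtain n m where *: "\<forall>i j. n \<le> i \<or> n \<le> j \<longrightarrow> f i j = 0" "\<forall>i j. m \<le> i \<or> m \<le> j \<longrightarrow> g i j = 0"
    by blast
  then have "\<forall>i j. max n m \<le> i \<or> max n m \<le> j \<longrightarrow> (\<Sum>k\<in>{k. f i k \<noteq> 0}. f i k * g k j) = 0" by auto
  then show "\<exists>n. \<forall>i j. n \<le> i \<or> n \<le> j \<longrightarrow> (\<Sum>k\<in>{k. f i k \<noteq> 0}. f i k * g k j) = 0" by blast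
qed

lemma ent_mult:
  assumes "supp_le n A"
  shows "ent (A * B) i j = (\<Sum>k<n. ent A i k * ent (B::'a fm) k j)"
proof -
  have "ent (A * B) i j = (\<Sum>k\<in>{k. ent A i k \<noteq> 0}. ent A i k * ent B k j)"
    by transfer simp
  also have "\<dots> = (\<Sum>k<n. ent A i k * ent B k j)"
    using supp_leD[OF assms] by (intro sum.mono_neutral_left) (auto simp: not_less[symmetric])
  finally show ?thesis .
qed

lemma ent_mult':
  assumes "supp_le n B"
  shows "ent (A * B) i j = (\<Sum>k<n. ent A i k * ent (B::'a fm) k j)"
proof -
  obtain m where m: "supp_le m A" using ex_supp_le by blast
  have "ent (A * B) i j = (\<Sum>k<max n m. ent A i k * ent B k j)"
    using m by (intro ent_mult) (auto intro: supp_le_mono)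
  also have "\<dots> = (\<Sum>k<n. ent A i k * ent B k j)"
    using supp_leD[OF assms] by (intro sum.mono_neutral_right) auto
  finally show ?thesis .
qed

instance
proof
  fix A B C :: "'a fm"
  obtain n where n: "supp_le n A" "supp_le n B" "supp_le n C" using ex_supp_le3 by blast
  then have s: "supp_le n (A + B)" "supp_le n (B + C)" "supp_le n (A * B)"
    by (simp_all add: supp_le_def ent_mult[OF n(1)])
  show "(A + B) * C = A * C + B * C"
    using n s by (intro fm_eqI) (simp add: ent_mult algebra_simps sum.distrib)
  show "A * (B + C) = A * B + A * C"
    using n s by (intro fm_eqI) (simp add: ent_mult algebra_simps sum.distrib)
  show "A * B * C = A * (B * C)"
  proof (rule fm_eqI)
    fix i j
    have "ent (A * B * C) i j = (\<Sum>k<n. \<Sum>l<n. ent A i l * ent B l k * ent C k j)"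
      using n s by (simp add: ent_mult sum_distrib_right)
    also have "\<dots> = (\<Sum>l<n. \<Sum>k<n. ent A i l * ent B l k * ent C k j)" by (rule sum.swap)
    also have "\<dots> = ent (A * (B * C)) i j"
      using n s by (simp add: ent_mult sum_distrib_left mult.assoc)
    finally show "ent (A * B * C) i j = ent (A * (B * C)) i j" .
  qed
qed
end

lemma supp_le_mult [intro]: "supp_le n A \<Longrightarrow> supp_le n B \<Longrightarrow> supp_le n (A * B :: 'a::rc_field fm)"
  by (simp add: supp_le_def ent_mult)

lemma supp_le_arith [intro]:
  fixes A B :: "'a::rc_field fm"
  shows "supp_le n 0" "supp_le n A \<Longrightarrow> supp_le n B \<Longrightarrow> supp_le n (A + B)"
    "supp_le n A \<Longrightarrow> supp_le n B \<Longrightarrow> supp_le n (A - B)" "supp_le n A \<Longrightarrow> supp_le n (- A)"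
    "supp_le n A \<Longrightarrow> supp_le n (scaleR r A)"
  by (simp_all add: supp_le_def)

lemma norm_sq_rows:
  fixes A :: "'a::rc_field fm"
  assumes "supp_le n A" shows "(norm A)\<^sup>2 = (\<Sum>i<n. (L2_set (\<lambda>k. norm (ent A i k)) {..<n})\<^sup>2)"
    and "(norm A)\<^sup>2 = (\<Sum>j<n. (L2_set (\<lambda>k. norm (ent A k j)) {..<n})\<^sup>2)"
proof -
  show "(norm A)\<^sup>2 = (\<Sum>i<n. (L2_set (\<lambda>k. norm (ent A i k)) {..<n})\<^sup>2)"
    by (simp add: norm_fm_sq[OF assms] L2_set_def sum_nonneg)
  show "(norm A)\<^sup>2 = (\<Sum>j<n. (L2_set (\<lambda>k. norm (ent A k j)) {..<n})\<^sup>2)"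
    by (simp add: norm_fm_sq[OF assms] L2_set_def sum_nonneg) (rule sum.swap)
qed

text \<open>The Frobenius norm is submultiplicative: Cauchy-Schwarz bounds each entry of the product
  by a row norm times a column norm, and the squares of these sum to the product of the squared
  norms.\<close>

instance fm :: (rc_field) real_normed_algebra
proof
  fix A B :: "'a fm" and r :: real
  obtain n where n: "supp_le n A" "supp_le n B" using ex_supp_le2 by blast
  have "supp_le n (r *\<^sub>R A)" using n by auto
  with n show "r *\<^sub>R A * B = r *\<^sub>R (A * B)" "A * r *\<^sub>R B = r *\<^sub>R (A * B)"
    by (auto intro!: fm_eqI simp: ent_mult scaleR_sum_right)
  have "(norm (A * B))\<^sup>2 = (\<Sum>i<n. \<Sum>j<n. (norm (\<Sum>k<n. ent A i k * ent B k j))\<^sup>2)"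
    using n by (subst norm_fm_sq[of n]) (auto simp: ent_mult)
  also have "\<dots> \<le> (\<Sum>i<n. \<Sum>j<n. (L2_set (\<lambda>k. norm (ent A i k)) {..<n} * L2_set (\<lambda>k. norm (ent B k j)) {..<n})\<^sup>2)"
  proof (intro sum_mono power_mono norm_ge_zero)
    fix i j
    have "norm (\<Sum>k<n. ent A i k * ent B k j) \<le> (\<Sum>k<n. \<bar>norm (ent A i k)\<bar> * \<bar>norm (ent B k j)\<bar>)"
      by (rule order_trans[OF norm_sum]) (simp add: norm_mult)
    also have "\<dots> \<le> L2_set (\<lambda>k. norm (ent A i k)) {..<n} * L2_set (\<lambda>k. norm (ent B k j)) {..<n}"
      by (rule L2_set_mult_ineq)
    finally show "norm (\<Sum>k<n. ent A i k * ent B k j) \<le> \<dots>" .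
  qed
  also have "\<dots> = (norm A)\<^sup>2 * (norm B)\<^sup>2"
    unfolding norm_sq_rows(1)[OF n(1)] norm_sq_rows(2)[OF n(2)] power_mult_distrib sum_product ..
  also have "\<dots> = (norm A * norm B)\<^sup>2" by (simp add: power_mult_distrib)
  finally show "norm (A * B) \<le> norm A * norm B"
    by (rule power2_le_imp_le) simp
qed

lift_definition adj :: "'a::rc_field fm \<Rightarrow> 'a fm" is "\<lambda>f i j. conjugate (f j i)"
proof -
  fix f :: "nat \<Rightarrow> nat \<Rightarrow> 'a"
  assume "\<exists>n. \<forall>i j. n \<le> i \<or> n \<le> j \<longrightarrow> f i j = 0"
  then obtain n where "\<forall>i j. n \<le> i \<or> n \<le> j \<longrightarrow> f i j = 0" ..
  then have "\<forall>i j. n \<le> i \<or> n \<le> j \<longrightarrow> conjugate (f j i) = 0" by simp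
  then show "\<exists>n. \<forall>i j. n \<le> i \<or> n \<le> j \<longrightarrow> conjugate (f j i) = 0" ..
qed

lemma ent_adj [simp]: "ent (adj A) i j = conjugate (ent A j i)" by transfer simp

lemma supp_le_adj [intro]: "supp_le n A \<Longrightarrow> supp_le n (adj A)"
  by (simp add: supp_le_def)

lemma adj_simps [simp]:
  fixes A B :: "'a::rc_field fm"
  shows "adj (adj A) = A" "adj 0 = (0 :: 'a fm)" "adj (A + B) = adj A + adj B"
    "adj (- A) = - adj A" "adj (scaleR r A) = scaleR r (adj A)"
  by (rule fm_eqI; simp add: conjugate_dist_add conjugate_neg conjugate_scaleR)+

lemma adj_diff [simp]: "adj (A - B) = adj A - adj (B :: 'a::rc_field fm)"
  by (rule fm_eqI) (simp add: conjugate_dist_add conjugate_neg flip: add_uminus_conv_diff)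

lemma adj_mult [simp]: "adj (A * B) = adj B * adj (A :: 'a::rc_field fm)"
proof -
  obtain n where n: "supp_le n A" "supp_le n B" using ex_supp_le2 by blast
  then have "supp_le n (adj B)" by auto
  with n show ?thesis
    by (intro fm_eqI) (simp add: ent_mult sum_conjugate conjugate_dist_mul mult.commute)
qed

lemma inner_adj: "inner (adj A) (adj B) = inner A (B :: 'a::rc_field fm)"
proof -
  obtain n where n: "supp_le n A" "supp_le n B" using ex_supp_le2 by blast
  then have "supp_le n (adj A)" by auto
  with n show ?thesis
    by (simp add: inner_fm_supp inner_conjugate) (rule sum.swap)
qed

lemma norm_adj [simp]: "norm (adj A) = norm (A :: 'a::rc_field fm)"
  by (simp add: norm_eq_sqrt_inner inner_adj)

lemma inner_mult_left_adj: "inner (A * X) Y = inner X (adj A * (Y :: 'a::rc_field fm))"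
proof -
  obtain n where n: "supp_le n A" "supp_le n X" "supp_le n Y" using ex_supp_le3 by blast
  then have s: "supp_le n (A * X)" "supp_le n (adj A)" by auto
  have "inner (A * X) Y = (\<Sum>i<n. \<Sum>j<n. \<Sum>k<n. inner (ent A i k * ent X k j) (ent Y i j))"
    using n s by (simp add: inner_fm_supp ent_mult inner_sum_left)
  also have "\<dots> = (\<Sum>i<n. \<Sum>j<n. \<Sum>k<n. inner (ent X k j) (conjugate (ent A i k) * ent Y i j))"
    by (simp add: inner_mult_conjugate)
  also have "\<dots> = (\<Sum>i<n. \<Sum>k<n. \<Sum>j<n. inner (ent X k j) (conjugate (ent A i k) * ent Y i j))"
    by (rule sum.cong[OF refl], rule sum.swap)
  also have "\<dots> = (\<Sum>k<n. \<Sum>i<n. \<Sum>j<n. inner (ent X k j) (conjugate (ent A i k) * ent Y i j))"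
    by (rule sum.swap)
  also have "\<dots> = (\<Sum>k<n. \<Sum>j<n. \<Sum>i<n. inner (ent X k j) (conjugate (ent A i k) * ent Y i j))"
    by (rule sum.cong[OF refl], rule sum.swap)
  also have "\<dots> = inner X (adj A * Y)"
    using n s by (simp add: inner_fm_supp ent_mult inner_sum_right)
  finally show ?thesis .
qed

lemma inner_mult_right_adj: "inner (X * A) Y = inner X (Y * adj (A :: 'a::rc_field fm))"
proof -
  have "inner (X * A) Y = inner (adj A * adj X) (adj Y)"
    by (metis inner_adj adj_mult)
  also have "\<dots> = inner (adj X) (A * adj Y)" by (simp add: inner_mult_left_adj)
  also have "\<dots> = inner X (Y * adj A)" by (metis inner_adj adj_mult adj_simps(1))
  finally show ?thesis .
qed

lemma bounded_linear_adj: "bounded_linear (adj :: 'a::rc_field fm \<Rightarrow> _)"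
  by (rule bounded_linear_intro[of _ 1]) auto

lemma bounded_linear_ent: "bounded_linear (\<lambda>A. ent (A :: 'a::rc_field fm) i j)"
  by (rule bounded_linear_intro[of _ 1]) (auto simp: norm_ent_le)

lemma fm_expansion: "supp_le n A \<Longrightarrow> A = (\<Sum>i<n. \<Sum>j<n. unit_fm i j (ent A i j))" for A :: "'a::rc_field fm"
proof (rule fm_eqI)
  fix a b assume n: "supp_le n A"
  have "ent (\<Sum>i<n. \<Sum>j<n. unit_fm i j (ent A i j)) a b =
     (\<Sum>i<n. \<Sum>j<n. if i = a then (if j = b then ent A a b else 0) else 0)"
    unfolding ent_sum by (intro sum.cong refl) (auto simp: ent_unit)
  also have "\<dots> = (\<Sum>i<n. if i = a then (if b < n then ent A a b else 0) else 0)"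
    by (intro sum.cong refl) (auto simp: sum.delta)
  also have "\<dots> = ent A a b" using supp_leD[OF n] by (auto simp: sum.delta not_less)
  finally show "ent A a b = ent (\<Sum>i<n. \<Sum>j<n. unit_fm i j (ent A i j)) a b" ..
qed

lemma bounded_linear_unit: "bounded_linear (unit_fm i j :: 'a::rc_field \<Rightarrow> _)"
  by (rule bounded_linear_intro[of _ 1]) (auto intro!: fm_eqI simp: ent_unit)

definition one_fm :: "nat \<Rightarrow> 'a::rc_field fm" where "one_fm n = (\<Sum>i<n. unit_fm i i 1)"

lemma ent_one: "ent (one_fm n) i j = (if i = j \<and> i < n then 1 else 0 :: 'a::rc_field)"
proof -
  have "ent (one_fm n) i j = (\<Sum>k<n. if k = i then (if i = j then 1 else 0 :: 'a) else 0)"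
    unfolding one_fm_def ent_sum by (intro sum.cong refl) (auto simp: ent_unit)
  then show ?thesis by (auto simp: sum.delta)
qed

lemma supp_le_one [intro, simp]: "supp_le n (one_fm n)" by (auto simp: supp_le_def ent_one)

lemma one_fm_mult:
  assumes "supp_le n A" shows "one_fm n * A = A"
proof (rule fm_eqI)
  fix i j
  have "ent (one_fm n * A) i j = (\<Sum>k<n. if k = i then ent A i j else 0)"
    unfolding ent_mult[OF supp_le_one] by (rule sum.cong[OF refl]) (simp add: ent_one)
  also have "\<dots> = ent A i j" using supp_leD[OF assms, of i j] by (simp add: sum.delta not_less)
  finally show "ent (one_fm n * A) i j = ent A i j" .
qed

lemma adj_one [simp]: "adj (one_fm n) = one_fm n"
  by (rule fm_eqI) (auto simp: ent_one)

lemma mult_one_fm: "supp_le n A \<Longrightarrow> A * one_fm n = A"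
  by (metis adj_mult adj_one adj_simps(1) one_fm_mult supp_le_adj)

lemma norm_one_fm: "(norm (one_fm n :: 'a::rc_field fm))\<^sup>2 = n"
proof -
  have "(norm (one_fm n :: 'a fm))\<^sup>2 = (\<Sum>i<n. \<Sum>j<n. if j = i then 1 else 0)"
    unfolding norm_fm_sq[OF supp_le_one] by (intro sum.cong refl) (simp add: ent_one)
  then show ?thesis by (simp add: sum.delta)
qed

section \<open>Compact spheres, extremal eigenvectors and the first contact argument\<close>

definition sph :: "nat \<Rightarrow> 'a::rc_field fm set" where
  "sph d = {X. supp_le d X \<and> norm X = 1}"

lemma closed_supp_le: "closed {X :: 'a::rc_field fm. supp_le d X}"
proof -
  have "{X :: 'a fm. supp_le d X} = (\<Inter>i. \<Inter>j. {X. d \<le> i \<or> d \<le> j \<longrightarrow> ent X i j = 0})"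
    by (auto simp: supp_le_def)
  moreover have "closed {X :: 'a fm. d \<le> i \<or> d \<le> j \<longrightarrow> ent X i j = 0}" for i j
  proof (cases "d \<le> i \<or> d \<le> j")
    case True
    have "closed ((\<lambda>X :: 'a fm. ent X i j) -` {0})"
      by (intro continuous_closed_vimage closed_singleton linear_continuous_at bounded_linear_ent)
    with True show ?thesis by (simp add: vimage_def)
  qed simp
  ultimately show ?thesis by (simp only:) (intro closed_INT ballI, blast)
qed

text \<open>The type is infinite dimensional, so closed and bounded does not suffice. The sphere is
  a closed subset of the continuous image of a product of closed unit balls of scalars, which is
  compact by Tychonoff.\<close>

lemma compact_sph: "compact (sph d :: 'a::rc_field fm set)"
proof -
  define K :: "(nat \<times> nat \<Rightarrow> 'a) set" where "K = (\<Pi>\<^sub>E p\<in>UNIV. cball 0 1)"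
  have "compactin (product_topology (\<lambda>_. euclidean) UNIV) K"
    unfolding K_def compactin_PiE by simp
  then have K: "compact K" by (simp add: euclidean_product_topology compactin_euclidean_iff)
  define \<Phi> :: "(nat \<times> nat \<Rightarrow> 'a) \<Rightarrow> 'a fm" where "\<Phi> f = (\<Sum>i<d. \<Sum>j<d. unit_fm i j (f (i, j)))" for f
  have "continuous_on K \<Phi>"
    unfolding \<Phi>_def
    by (intro continuous_on_sum continuous_on_compose2[OF linear_continuous_on[OF bounded_linear_unit, of UNIV]]
        continuous_on_subset[OF continuous_on_product_coordinates]) auto
  then have "compact (\<Phi> ` K)" using K by (rule compact_continuous_image)
  moreover have "closed (sph d :: 'a fm set)"
  proof -
    have "sph d = {X :: 'a fm. supp_le d X} \<inter> norm -` {1}" by (auto simp: sph_def)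
    then show ?thesis
      by (simp only:) (intro closed_Int closed_supp_le continuous_closed_vimage closed_singleton continuous_intros)
  qed
  moreover have "sph d \<subseteq> \<Phi> ` K"
  proof
    fix X :: "'a fm" assume X: "X \<in> sph d"
    then have "X = \<Phi> (\<lambda>(i, j). ent X i j)"
      unfolding \<Phi>_def using fm_expansion[of d X] by (simp add: sph_def)
    moreover have "(\<lambda>(i, j). ent X i j) \<in> K"
      using X norm_ent_le[of X] by (auto simp: K_def sph_def)
    ultimately show "X \<in> \<Phi> ` K" by blast
  qed
  ultimately show ?thesis by (metis closed_Int_compact inf.absorb_iff1 inf_commute)
qed

lemma sph_nonempty: "d > 0 \<Longrightarrow> sph d \<noteq> ({} :: 'a::rc_field fm set)"
proof -
  assume "d > 0"
  then have "unit_fm 0 0 1 \<in> (sph d :: 'a fm set)" by (auto simp: sph_def supp_le_def ent_unit)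
  then show ?thesis by blast
qed

lemma normalize_sph:
  assumes "supp_le d X" "X \<noteq> 0" shows "(1 / norm X) *\<^sub>R X \<in> sph d"
  using assms by (auto simp: sph_def)

text \<open>With \<open>Z = H * X - l *\<^sub>R X\<close>, moving \<open>X\<close> by a multiple
  \<open>s\<close> of \<open>Z\<close> changes the nonnegative form by
  \<open>2 * s * (norm Z)\<^sup>2\<close> to first order. A small negative \<open>s\<close> would
  make it negative unless \<open>Z = 0\<close>.\<close>

lemma form_eigen:
  fixes H :: "'a::rc_field fm"
  assumes H: "supp_le d H" "adj H = H"
    and ge: "\<And>Y. supp_le d Y \<Longrightarrow> inner Y (H * Y) \<ge> l * (norm Y)\<^sup>2"
    and X: "supp_le d X" "inner X (H * X) = l * (norm X)\<^sup>2"
  shows "H * X = l *\<^sub>R X"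
proof (rule ccontr)
  define Z where "Z = H * X - l *\<^sub>R X"
  define c where "c = inner Z (H * Z) - l * (norm Z)\<^sup>2"
  have Z: "supp_le d Z" unfolding Z_def using H X by auto
  assume "H * X \<noteq> l *\<^sub>R X"
  then have z: "(norm Z)\<^sup>2 > 0" by (simp add: Z_def)
  have c: "c \<ge> 0" using ge[OF Z] by (simp add: c_def)
  have sym: "inner X (H * Z) = inner Z (H * X)"
    using inner_mult_left_adj[of H X Z] H by (simp add: inner_commute)
  have zz: "inner Z (H * X) - l * inner X Z = (norm Z)\<^sup>2"
    by (simp add: Z_def power2_norm_eq_inner inner_diff_left inner_diff_right inner_commute algebra_simps)
  have "2 * s * (norm Z)\<^sup>2 + s\<^sup>2 * c \<ge> 0" for s :: real
  proof -
    have "supp_le d (X + s *\<^sub>R Z)" using X Z by auto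
    from ge[OF this] have "inner (X + s *\<^sub>R Z) (H * (X + s *\<^sub>R Z)) - l * (norm (X + s *\<^sub>R Z))\<^sup>2 \<ge> 0"
      by simp
    also have "inner (X + s *\<^sub>R Z) (H * (X + s *\<^sub>R Z)) - l * (norm (X + s *\<^sub>R Z))\<^sup>2
      = (inner X (H * X) - l * (norm X)\<^sup>2) + s * (inner X (H * Z) + inner Z (H * X) - 2 * l * inner X Z) + s\<^sup>2 * c"
      unfolding c_def power2_norm_eq_inner
      by (simp add: inner_add_left inner_add_right inner_commute[of Z X] algebra_simps power2_eq_square
          del: power2_norm_eq_inner)
        (simp add: algebra_simps flip: power2_norm_eq_inner)?
    also have "\<dots> = s * (2 * (norm Z)\<^sup>2) + s\<^sup>2 * c"
      using X(2) unfolding sym zz[symmetric] by (simp add: algebra_simps)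
    finally show ?thesis by (simp add: mult_ac)
  qed
  \<comment> \<open>Every negative \<open>s\<close> with
    \<open>\<bar>s\<bar> * c < 2 * (norm Z)\<^sup>2\<close> refutes the inequality; the
    \<open>+ 1\<close> covers \<open>c = 0\<close>.\<close>
  from this[of "- (norm Z)\<^sup>2 / (c + 1)"]
  have "0 \<le> 2 * (- (norm Z)\<^sup>2 / (c + 1)) * (norm Z)\<^sup>2 + (- (norm Z)\<^sup>2 / (c + 1))\<^sup>2 * c" .
  also have "\<dots> = - ((norm Z)\<^sup>2)\<^sup>2 * (c + 2) / (c + 1)\<^sup>2"
    using c by (simp add: divide_simps) (simp add: algebra_simps power2_eq_square power4_eq_xxxx)
  also have "\<dots> < 0" using z c by (simp add: divide_neg_pos mult_neg_pos)
  finally show False by simp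
qed

text \<open>The minimum of the Rayleigh quotient over the compact sphere is attained at an
  eigenvector. This takes the place of the spectral theorem.\<close>

lemma min_form:
  fixes H :: "'a::rc_field fm"
  assumes H: "supp_le d H" "adj H = H" and d: "d > 0"
  obtains l X where "X \<in> sph d" "H * X = l *\<^sub>R X"
    "\<And>Y. supp_le d Y \<Longrightarrow> inner Y (H * Y) \<ge> l * (norm Y)\<^sup>2"
proof -
  have "continuous_on (sph d) (\<lambda>X. inner X (H * X))" by (intro continuous_intros)
  then obtain X where X: "X \<in> sph d" "\<And>Y. Y \<in> sph d \<Longrightarrow> inner X (H * X) \<le> inner Y (H * Y)"
    using continuous_attains_inf[OF compact_sph sph_nonempty[OF d]] by blast
  define l where "l = inner X (H * X)"
  have ge: "inner Y (H * Y) \<ge> l * (norm Y)\<^sup>2" if "supp_le d Y" for Y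
  proof (cases "Y = 0")
    case False
    have "l \<le> inner ((1 / norm Y) *\<^sub>R Y) (H * ((1 / norm Y) *\<^sub>R Y))"
      unfolding l_def by (rule X(2)[OF normalize_sph[OF that False]])
    also have "\<dots> = inner Y (H * Y) / (norm Y)\<^sup>2"
      by (simp add: power2_eq_square)
    finally show ?thesis using False by (simp add: field_simps)
  qed simp
  have "H * X = l *\<^sub>R X"
    using X(1) by (intro form_eigen[OF H ge]) (auto simp: sph_def l_def)
  with X(1) ge show ?thesis using that by blast
qed

text \<open>If \<open>f\<close> ever became nonpositive, there would be an earliest such time. There
  \<open>f\<close> vanishes at some \<open>x\<close> and is nonnegative elsewhere, while it was
  positive before, which a positive derivative forbids. The derivative is required only at a
  minimizer \<open>x\<close> of a first contact, where in the applications \<open>x\<close> is known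
  to be an eigenvector.\<close>

lemma crossing:
  fixes f :: "real \<Rightarrow> 'b::t2_space \<Rightarrow> real"
  assumes S: "compact S" and cont: "continuous_on ({a..b} \<times> S) (\<lambda>(t, x). f t x)"
    and init: "\<And>x. x \<in> S \<Longrightarrow> f a x > 0"
    and cross: "\<And>t x. a < t \<Longrightarrow> t \<le> b \<Longrightarrow> x \<in> S \<Longrightarrow> f t x = 0 \<Longrightarrow> (\<And>y. y \<in> S \<Longrightarrow> f t y \<ge> 0) \<Longrightarrow>
      \<exists>D>0. ((\<lambda>s. f s x) has_real_derivative D) (at t within {a..b})"
    and t: "t \<in> {a..b}" and x: "x \<in> S"
  shows "f t x > 0"
proof (rule ccontr)
  define B where "B = ({a..b} \<times> S) \<inter> (\<lambda>(t, x). f t x) -` {..0}"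
  assume "\<not> f t x > 0"
  then have "(t, x) \<in> B" using t x by (auto simp: B_def)
  moreover have KC: "compact ({a..b} \<times> S)" by (intro compact_Times S compact_Icc)
  have "compact B"
  proof -
    have "closedin (top_of_set ({a..b} \<times> S)) B"
      unfolding B_def by (rule continuous_closedin_preimage[OF cont]) simp
    then show ?thesis using KC closedin_compact by blast
  qed
  \<comment> \<open>Compactness of the set of nonpositive points provides one with the smallest
    time.\<close>
  ultimately obtain p where p: "p \<in> B" "\<And>q. q \<in> B \<Longrightarrow> fst p \<le> fst q"
    using continuous_attains_inf[of B fst] continuous_on_fst[OF continuous_on_id] by blast
  obtain t0 x0 where p0: "p = (t0, x0)" by (cases p)
  have t0: "t0 \<in> {a..b}" "x0 \<in> S" "f t0 x0 \<le> 0" using p(1) by (auto simp: B_def p0)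
  have before: "f s y > 0" if "a \<le> s" "s < t0" "y \<in> S" for s y
    using p(2)[of "(s, y)"] that t0(1) by (force simp: B_def p0)
  have "a < t0" using init[OF t0(2)] t0 by (cases "a = t0") auto
  have ct: "continuous_on {a..b} (\<lambda>s. f s y)" if "y \<in> S" for y
  proof -
    have "continuous_on {a..b} (\<lambda>s. (s, y))" by (intro continuous_intros)
    from continuous_on_compose2[OF cont this] that show ?thesis by auto
  qed
  \<comment> \<open>A negative value at \<open>t0\<close> would, by the intermediate value theorem,
    come with a zero at an earlier time.\<close>
  have nonneg: "f t0 y \<ge> 0" if y: "y \<in> S" for y
  proof (rule ccontr)
    assume neg: "\<not> f t0 y \<ge> 0"
    have "continuous_on {a..t0} (\<lambda>s. f s y)"
      using continuous_on_subset[OF ct[OF y], of "{a..t0}"] t0(1) by auto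
    then obtain s where s: "a \<le> s" "s \<le> t0" "f s y = 0"
      using IVT2'[of "\<lambda>s. f s y" t0 0 a] neg init[OF y] \<open>a < t0\<close> by force
    with before[of s y] y neg show False by (cases "s = t0") auto
  qed
  then have "f t0 x0 = 0" using t0 by force
  with nonneg t0 \<open>a < t0\<close> obtain D where D: "D > 0" "((\<lambda>s. f s x0) has_real_derivative D) (at t0 within {a..b})"
    using cross[of t0 x0] by auto
  from has_real_derivative_pos_inc_left[OF D(2,1)] obtain e where
    e: "e > 0" "\<And>h. h > 0 \<Longrightarrow> t0 - h \<in> {a..b} \<Longrightarrow> h < e \<Longrightarrow> f (t0 - h) x0 < f t0 x0" by blast
  define h where "h = min (e / 2) (t0 - a)"
  have "f (t0 - h) x0 < 0" "f (t0 - h) x0 > 0"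
    using e \<open>a < t0\<close> t0 before[of "t0 - h" x0] \<open>f t0 x0 = 0\<close> by (auto simp: h_def min_def)
  then show False by simp
qed

section \<open>Passage between ordinary and finitely supported matrices\<close>

definition Fm :: "nat \<Rightarrow> 'a::rc_field mat \<Rightarrow> 'a fm" where
  "Fm d A = (\<Sum>i<d. \<Sum>j<d. unit_fm i j (A $$ (i, j)))"

lemma ent_sum_unit:
  "ent (\<Sum>i<n. \<Sum>j<m. unit_fm i j (f i j)) a b = (if a < n \<and> b < m then f a b else (0::'a::rc_field))"
proof -
  have "ent (\<Sum>i<n. \<Sum>j<m. unit_fm i j (f i j)) a b =
     (\<Sum>i<n. \<Sum>j<m. if j = b then (if i = a then f a b else 0) else 0)"
    unfolding ent_sum by (intro sum.cong refl) (auto simp: ent_unit)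
  also have "\<dots> = (\<Sum>i<n. if i = a then (if b < m then f a b else 0) else 0)"
    by (intro sum.cong refl) (auto simp: sum.delta)
  also have "\<dots> = (if a < n \<and> b < m then f a b else 0)" by (auto simp: sum.delta)
  finally show ?thesis .
qed

lemma ent_Fm: "ent (Fm d A) i j = (if i < d \<and> j < d then A $$ (i, j) else 0)"
  unfolding Fm_def by (rule ent_sum_unit)

lemma supp_le_Fm [intro, simp]: "supp_le d (Fm d A)"
  by (auto simp: supp_le_def ent_Fm)

lemma Fm_arith:
  assumes "A \<in> carrier_mat d d" "B \<in> carrier_mat d d"
  shows "Fm d (A + B) = Fm d A + Fm d B" "Fm d (A - B) = Fm d A - Fm d B"
    "Fm d (A * B) = Fm d A * Fm d B"
proof -
  show "Fm d (A + B) = Fm d A + Fm d B" "Fm d (A - B) = Fm d A - Fm d B"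
    using assms by (auto intro!: fm_eqI simp: ent_Fm)
  have "ent (Fm d (A * B)) i j = ent (Fm d A * Fm d B) i j" for i j
  proof (cases "i < d \<and> j < d")
    case True
    then show ?thesis using assms
      by (simp add: ent_Fm ent_mult[OF supp_le_Fm] scalar_prod_def atLeast0LessThan)
  next
    case False
    then show ?thesis by (auto simp: ent_Fm ent_mult[OF supp_le_Fm])
  qed
  then show "Fm d (A * B) = Fm d A * Fm d B" by (rule fm_eqI)
qed

lemma adjoint_carrier [simp]: "A \<in> carrier_mat n m \<Longrightarrow> mat_adjoint A \<in> carrier_mat m n"
  unfolding mat_adjoint_def by (auto simp: mat_of_rows_def)

lemma index_adjoint [simp]:
  "A \<in> carrier_mat n m \<Longrightarrow> i < m \<Longrightarrow> j < n \<Longrightarrow> mat_adjoint A $$ (i, j) = conjugate (A $$ (j, i))"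
  unfolding mat_adjoint_def by (auto simp: mat_of_rows_def)

lemma Fm_adjoint: "A \<in> carrier_mat d d \<Longrightarrow> Fm d (mat_adjoint A) = adj (Fm d A)"
  by (rule fm_eqI) (auto simp: ent_Fm)

lemma Fm_one: "Fm d (1\<^sub>m d) = one_fm d"
  by (rule fm_eqI) (auto simp: ent_Fm ent_one)

lemma Fm_inj: "A \<in> carrier_mat d d \<Longrightarrow> B \<in> carrier_mat d d \<Longrightarrow> Fm d A = Fm d B \<Longrightarrow> A = B"
  by (rule eq_matI) (auto simp: ent_Fm dest!: arg_cong[where f=ent] dest: fun_cong split: if_splits, metis ent_Fm)

lemma Fm_surj:
  assumes "supp_le d X"
  obtains A where "A \<in> carrier_mat d d" "Fm d A = X"
proof
  show "Fm d (mat d d (\<lambda>(i, j). ent X i j)) = X"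
    using supp_leD[OF assms] by (intro fm_eqI) (auto simp: ent_Fm not_less[symmetric])
qed simp

lemma frob_sq_Fm: "A \<in> carrier_mat d d \<Longrightarrow> frob_sq A = (norm (Fm d A))\<^sup>2"
  by (auto simp: norm_fm_sq[OF supp_le_Fm] frob_sq_def ent_Fm intro!: sum.cong)

text \<open>A vector is encoded as a matrix living in column 0, so that Euclidean norms of vectors
  are instances of the Frobenius norm.\<close>

definition vec_fm :: "nat \<Rightarrow> (nat \<Rightarrow> 'a::rc_field) \<Rightarrow> 'a fm" where
  "vec_fm d x = (\<Sum>i<d. \<Sum>j<1. unit_fm i j (x i))"

lemma ent_vec_fm: "ent (vec_fm d x) i j = (if i < d \<and> j < 1 then x i else 0)"
  unfolding vec_fm_def by (rule ent_sum_unit)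

lemma supp_le_vec_fm: "d > 0 \<Longrightarrow> supp_le d (vec_fm d x)"
  by (auto simp: supp_le_def ent_vec_fm)

lemma norm_vec_fm: "d > 0 \<Longrightarrow> (norm (vec_fm d x))\<^sup>2 = (\<Sum>i<d. (norm (x i))\<^sup>2)"
proof -
  assume d: "d > 0"
  have "(norm (vec_fm d x))\<^sup>2 = (\<Sum>i<d. \<Sum>j<d. if j = 0 then (norm (x i))\<^sup>2 else 0)"
    unfolding norm_fm_sq[OF supp_le_vec_fm[OF d]] by (intro sum.cong refl) (auto simp: ent_vec_fm)
  with d show ?thesis by (simp add: sum.delta)
qed

text \<open>The squared Frobenius norm is a sum over columns and multiplication acts on each column
  separately. Hence bounds tested on vectors and bounds tested on matrices are equivalent.\<close>

lemma lower_bound_columns: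
  fixes A :: "'a::rc_field fm"
  assumes A: "supp_le d A" and X: "supp_le d X" and c: "c \<ge> 0"
    and v: "\<And>x. c\<^sup>2 * (\<Sum>i<d. (norm (x i))\<^sup>2) \<le> (\<Sum>i<d. (norm (\<Sum>k<d. ent A i k * x k))\<^sup>2)"
  shows "c * norm X \<le> norm (A * X)"
proof -
  have "c\<^sup>2 * (norm X)\<^sup>2 = (\<Sum>j<d. c\<^sup>2 * (\<Sum>i<d. (norm (ent X i j))\<^sup>2))"
    unfolding norm_fm_sq[OF X] sum_distrib_left[symmetric] by (subst sum.swap) (rule refl)
  also have "\<dots> \<le> (\<Sum>j<d. \<Sum>i<d. (norm (\<Sum>k<d. ent A i k * ent X k j))\<^sup>2)"
    by (intro sum_mono v)
  also have "\<dots> = (norm (A * X))\<^sup>2"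
    unfolding norm_fm_sq[OF supp_le_mult[OF A X]] ent_mult[OF A] by (rule sum.swap)
  finally have "(c * norm X)\<^sup>2 \<le> (norm (A * X))\<^sup>2" by (simp add: power_mult_distrib)
  then show ?thesis by (rule power2_le_imp_le) simp
qed

lemma mult_vec_fm_ent:
  "supp_le d A \<Longrightarrow> d > 0 \<Longrightarrow> A * vec_fm d x = vec_fm d (\<lambda>i. \<Sum>k<d. ent A i k * x k)"
proof (rule fm_eqI)
  fix i j assume A: "supp_le d A" "d > 0"
  show "ent (A * vec_fm d x) i j = ent (vec_fm d (\<lambda>i. \<Sum>k<d. ent A i k * x k)) i j"
    unfolding ent_mult[OF A(1)] ent_vec_fm
    by (cases "i < d"; cases "j < 1") (auto simp: supp_leD[OF A(1)] intro!: sum.cong)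
qed

text \<open>A zero determinant would produce a kernel vector, which \<open>vec_fm\<close> turns into
  a matrix contradicting injectivity. With nonzero determinant, the adjugate gives the
  inverse.\<close>

lemma right_inverse_fm:
  fixes A :: "'a::rc_field fm"
  assumes A: "supp_le d A" and d: "d > 0"
    and inj: "\<And>X. supp_le d X \<Longrightarrow> A * X = 0 \<Longrightarrow> X = 0"
  obtains B where "supp_le d B" "A * B = one_fm d"
proof -
  obtain M where M: "M \<in> carrier_mat d d" "Fm d M = A" using Fm_surj[OF A] .
  have "det M \<noteq> 0"
  proof
    assume "det M = 0"
    then obtain v where v: "v \<in> carrier_vec d" "v \<noteq> 0\<^sub>v d" "M *\<^sub>v v = 0\<^sub>v d"
      using det_0_iff_vec_prod_zero_field[OF M(1)] by blast
    have "(\<Sum>k<d. ent A i k * v $ k) = 0" if "i < d" for i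
    proof -
      have "(M *\<^sub>v v) $ i = 0" using v(3) that by simp
      then show ?thesis using that M v(1)
        by (auto simp: scalar_prod_def atLeast0LessThan M(2)[symmetric] ent_Fm intro!: trans[OF sum.cong[OF refl]])
    qed
    then have "A * vec_fm d (\<lambda>k. v $ k) = 0"
      unfolding mult_vec_fm_ent[OF A d] by (intro fm_eqI) (auto simp: ent_vec_fm)
    then have "vec_fm d (\<lambda>k. v $ k) = 0" by (rule inj[OF supp_le_vec_fm[OF d]])
    then have "v $ k = 0" if "k < d" for k
      using that ent_vec_fm[of d "\<lambda>k. v $ k" k 0] by simp
    then have "v = 0\<^sub>v d" using v(1) by (intro eq_vecI) auto
    with v(2) show False by simp
  qed
  define N where "N = (1 / det M) \<cdot>\<^sub>m adj_mat M"
  have adjM: "adj_mat M \<in> carrier_mat d d" using adj_mat(1)[OF M(1)] .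
  then have N: "N \<in> carrier_mat d d" by (simp add: N_def)
  have "M * N = (1 / det M) \<cdot>\<^sub>m (M * adj_mat M)"
    unfolding N_def using mult_smult_distrib[OF M(1) adjM] .
  also have "\<dots> = 1\<^sub>m d" using \<open>det M \<noteq> 0\<close> unfolding adj_mat(2)[OF M(1)] by (intro eq_matI) auto
  finally have "A * Fm d N = one_fm d"
    using Fm_arith(3)[OF M(1) N] M(2) by (simp add: Fm_one)
  then show ?thesis using that[of "Fm d N"] by simp
qed

text \<open>A square matrix and its adjoint have the same smallest singular value. The bound makes
  \<open>adj W\<close> injective, hence \<open>X = adj W * Y\<close> for some \<open>Y\<close> with
  \<open>c * norm Y \<le> norm X\<close>, and \<open>(norm X)\<^sup>2 = inner (W * X) Y\<close>
  finishes by Cauchy-Schwarz.\<close>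

lemma lower_bound_adj:
  fixes W :: "'a::rc_field fm"
  assumes W: "supp_le d W" and c: "c > 0"
    and low: "\<And>X. supp_le d X \<Longrightarrow> c * norm X \<le> norm (adj W * X)"
    and X: "supp_le d X"
  shows "c * norm X \<le> norm (W * X)"
proof (cases "d = 0")
  case True
  then have "X = 0" using supp_leD[OF X] by (intro fm_eqI) auto
  then show ?thesis by simp
next
  case False
  have "X = 0" if "supp_le d X" "adj W * X = 0" for X
    using low[OF that(1)] that(2) c by (simp add: mult_le_0_iff)
  then obtain B where B: "supp_le d B" "adj W * B = one_fm d"
    using right_inverse_fm[OF supp_le_adj[OF W]] False by blast
  define Y where "Y = B * X"
  have Y: "supp_le d Y" "adj W * Y = X"
    using B X by (auto simp: Y_def mult.assoc[symmetric] one_fm_mult)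
  have "c * (norm X)\<^sup>2 = c * inner X (adj W * Y)" by (simp add: Y power2_norm_eq_inner)
  also have "\<dots> = c * inner (W * X) Y" by (simp add: inner_mult_left_adj)
  also have "\<dots> \<le> c * (norm (W * X) * norm Y)" using c norm_cauchy_schwarz by simp
  also have "\<dots> = norm (W * X) * (c * norm Y)" by simp
  also have "\<dots> \<le> norm (W * X) * norm X" using low[OF Y(1)] by (intro mult_left_mono) (auto simp: Y)
  finally show ?thesis by (cases "X = 0") (auto simp: power2_eq_square)
qed

section \<open>Balanced flows\<close>

lemma nonincreasing_within:
  fixes g :: "real \<Rightarrow> real"
  assumes ab: "a \<le> b" and der: "\<And>t. a \<le> t \<Longrightarrow> t \<le> b \<Longrightarrow> (g has_real_derivative g' t) (at t within {a..b})"
    and le: "\<And>t. a \<le> t \<Longrightarrow> t \<le> b \<Longrightarrow> g' t \<le> 0"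
  shows "g b \<le> g a"
proof (rule DERIV_nonpos_imp_decreasing_open[OF ab])
  fix t assume t: "a < t" "t < b"
  then have "(g has_real_derivative g' t) (at t)"
    using der[of t] at_within_interior[of t "{a..b}"] by (simp add: interior_atLeastAtMost_real)
  with le[of t] t show "\<exists>y. (g has_real_derivative y) (at t) \<and> y \<le> 0" by auto
next
  show "continuous_on {a..b} g"
    unfolding continuous_on_eq_continuous_within
    using der by (auto intro!: DERIV_continuous)
qed

text \<open>Gronwall with integrating factor \<open>exp (h t)\<close>. Allowing a nonconstant rate
  \<open>h'\<close> is what later preserves the sharp exponent of the loss.\<close>

lemma exp_decay:
  fixes g h :: "real \<Rightarrow> real"
  assumes ab: "a \<le> b"
    and g: "\<And>t. a \<le> t \<Longrightarrow> t \<le> b \<Longrightarrow> (g has_real_derivative g' t) (at t within {a..b})"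
    and h: "\<And>t. a \<le> t \<Longrightarrow> t \<le> b \<Longrightarrow> (h has_real_derivative h' t) (at t within {a..b})"
    and le: "\<And>t. a \<le> t \<Longrightarrow> t \<le> b \<Longrightarrow> g' t \<le> - h' t * g t"
  shows "g b \<le> g a * exp (h a - h b)"
proof -
  have "g b * exp (h b) \<le> g a * exp (h a)"
  proof (rule nonincreasing_within[OF ab])
    fix t assume t: "a \<le> t" "t \<le> b"
    show "((\<lambda>t. g t * exp (h t)) has_real_derivative (g' t + h' t * g t) * exp (h t)) (at t within {a..b})"
      using g[OF t] h[OF t] by (auto intro!: derivative_eq_intros simp: algebra_simps)
    show "(g' t + h' t * g t) * exp (h t) \<le> 0"
      using le[OF t] by (intro mult_nonpos_nonneg) auto
  qed
  then have "g b * exp (h b) * exp (- h b) \<le> g a * exp (h a) * exp (- h b)"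
    by (rule mult_right_mono) simp
  then show ?thesis by (simp add: mult.assoc flip: exp_add)
qed

text \<open>\<open>c\<close> is a lower bound for the smallest singular value of the
  \<open>d\<close> by \<open>d\<close> block. Testing on matrices instead of vectors gives the same
  notion, since the columns decouple.\<close>

definition low :: "nat \<Rightarrow> real \<Rightarrow> 'a::rc_field fm \<Rightarrow> bool" where
  "low d c W \<longleftrightarrow> (\<forall>X. supp_le d X \<longrightarrow> c * norm X \<le> norm (W * X))"

lemma lowD: "low d c W \<Longrightarrow> supp_le d X \<Longrightarrow> c * norm X \<le> norm (W * X)"
  by (simp add: low_def)

lemma low_adj: "supp_le d W \<Longrightarrow> c > 0 \<Longrightarrow> low d c (adj W) \<longleftrightarrow> low d c W"
  using lower_bound_adj[of d W c] lower_bound_adj[of d "adj W" c] by (auto simp: low_def supp_le_adj)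

lemma low_right: "low d c W \<Longrightarrow> supp_le d X \<Longrightarrow> c * norm X \<le> norm (X * adj W)"
  using lowD[of d c W "adj X"] by (metis adj_mult adj_simps(1) norm_adj supp_le_adj)

lemma low_sphI:
  assumes "\<And>X. X \<in> sph d \<Longrightarrow> c \<le> norm (W * X)" shows "low d c (W :: 'a::rc_field fm)"
  unfolding low_def
proof (intro allI impI)
  fix X :: "'a fm" assume X: "supp_le d X"
  show "c * norm X \<le> norm (W * X)"
  proof (cases "X = 0")
    case False
    have "c \<le> norm (W * ((1 / norm X) *\<^sub>R X))" by (rule assms[OF normalize_sph[OF X False]])
    then show ?thesis using False by (simp add: field_simps)
  qed simp
qed

lemma norm_mult_sq: "(norm (W * X))\<^sup>2 = inner X (adj W * W * (X :: 'a::rc_field fm))"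
  by (simp add: power2_norm_eq_inner inner_mult_left_adj mult.assoc)

text \<open>The smallest eigenvalue \<open>l\<close> of the positive semidefinite matrix
  \<open>adj W * W\<close> is attained at an eigenvector, so the hypothesis gives
  \<open>c \<le> l\<close>; and \<open>l\<close> bounds the form
  \<open>(norm (W * Y))\<^sup>2\<close> from below.\<close>

lemma low_gram:
  fixes W :: "'a::rc_field fm"
  assumes W: "supp_le d W" and d: "d > 0" and c: "c > 0"
    and "low d c (adj W * W)"
  shows "low d (sqrt c) W"
proof -
  define H where "H = adj W * W"
  have "supp_le d H" "adj H = H" using W by (auto simp: H_def)
  then obtain l X where X: "X \<in> sph d" "H * X = l *\<^sub>R X"
    "\<And>Y. supp_le d Y \<Longrightarrow> inner Y (H * Y) \<ge> l * (norm Y)\<^sup>2" using min_form[OF _ _ d] by blast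
  have "inner X X = 1" using X(1) power2_norm_eq_inner[of X] by (simp add: sph_def)
  then have l: "inner X (H * X) = l" unfolding X(2) by simp
  have "inner X (H * X) \<ge> 0" unfolding H_def norm_mult_sq[symmetric] by simp
  then have "l \<ge> 0" by (simp only: l)
  moreover have "c \<le> norm (H * X)" using lowD[OF assms(4), of X] X(1) by (simp add: H_def sph_def)
  ultimately have "c \<le> l" using X(1) unfolding X(2) by (simp add: sph_def)
  show ?thesis
  proof (rule low_sphI)
    fix Y :: "'a fm" assume Y: "Y \<in> sph d"
    have "(sqrt c)\<^sup>2 \<le> (norm (W * Y))\<^sup>2"
      using X(3)[of Y] Y \<open>c \<le> l\<close> c unfolding norm_mult_sq H_def by (simp add: sph_def)
    then show "sqrt c \<le> norm (W * Y)" by (rule power2_le_imp_le) simp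
  qed
qed

lemma has_derivative_norm_mult_sq:
  fixes F :: "real \<Rightarrow> 'a::rc_field fm"
  assumes "(F has_vector_derivative F') (at t within S)"
  shows "((\<lambda>t. (norm (F t * X))\<^sup>2) has_real_derivative 2 * inner (F t * X) (F' * X)) (at t within S)"
proof -
  have "((\<lambda>t. F t * X) has_vector_derivative F' * X) (at t within S)"
    using assms by (auto intro!: derivative_eq_intros)
  from bounded_bilinear.has_vector_derivative[OF bounded_bilinear_inner this this]
  show ?thesis
    by (simp add: power2_norm_eq_inner has_real_derivative_iff_has_vector_derivative inner_commute)
qed

text \<open>The noncommutative bookkeeping behind the equations for \<open>A\<close> and the adjoint
  \<open>B'\<close> of \<open>B\<close>. The intertwining relations move all Gram matrices to one
  side. The driving term of \<open>A\<close> then contains \<open>B'\<close> and that of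
  \<open>B'\<close> contains \<open>A\<close>, with the same right factor, so sum and difference of
  the two decouple.\<close>

lemma flow_algebra:
  fixes A B A' B' K M N E R R' :: "'a::real_algebra"
  assumes h: "A * N = M * A" "B' * K = M * B'" "A * A' = M * M" "B' * B = M * M"
    and E: "B' * E = B'" "A * E = A"
    and R: "R = s *\<^sub>R E - B * A" "R' = s *\<^sub>R E - A' * B'"
  shows "B' * R * N + M * B' * R = s *\<^sub>R (B' * (K + N)) - 2 *\<^sub>R (M * M * M * A)"
    and "M * A * R' + A * R' * K = s *\<^sub>R (A * (K + N)) - 2 *\<^sub>R (M * M * M * B')"
proof -
  have "B' * R * N = s *\<^sub>R (B' * N) - (B' * B) * (A * N)"
    unfolding R by (simp add: algebra_simps E flip: mult.assoc)
  also have "\<dots> = s *\<^sub>R (B' * N) - M * M * M * A" by (simp add: h mult.assoc)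
  finally have 1: "B' * R * N = s *\<^sub>R (B' * N) - M * M * M * A" .
  have "M * B' * R = s *\<^sub>R (M * B') - M * (B' * B) * A"
    unfolding R by (simp add: algebra_simps E)
  also have "\<dots> = s *\<^sub>R (B' * K) - M * M * M * A" by (simp add: h mult.assoc)
  finally show "B' * R * N + M * B' * R = s *\<^sub>R (B' * (K + N)) - 2 *\<^sub>R (M * M * M * A)"
    using 1 by (simp add: algebra_simps scaleR_2)
  have "M * A * R' = s *\<^sub>R (M * A) - M * (A * A') * B'"
    unfolding R by (simp add: algebra_simps E)
  also have "\<dots> = s *\<^sub>R (A * N) - M * M * M * B'" by (simp add: h mult.assoc)
  finally have 2: "M * A * R' = s *\<^sub>R (A * N) - M * M * M * B'" .
  have "A * R' * K = s *\<^sub>R (A * K) - (A * A') * (B' * K)"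
    unfolding R by (simp add: algebra_simps E flip: mult.assoc)
  also have "\<dots> = s *\<^sub>R (A * K) - M * M * M * B'" by (simp add: h mult.assoc)
  finally show "M * A * R' + A * R' * K = s *\<^sub>R (A * (K + N)) - 2 *\<^sub>R (M * M * M * B')"
    using 2 by (simp add: algebra_simps scaleR_2)
qed

text \<open>The equations contain no term with the parameter \<open>a\<close>, because the gradient
  of the regularizer vanishes at balanced factors.\<close>

locale balanced_flow =
  fixes d :: nat and \<sigma> :: real and W1 W2 W3 W4 :: "real \<Rightarrow> 'a::rc_field fm"
  assumes d: "d > 0" and \<sigma>: "\<sigma> > 0"
    and supp: "t \<ge> 0 \<Longrightarrow> supp_le d (W1 t)" "t \<ge> 0 \<Longrightarrow> supp_le d (W2 t)"
      "t \<ge> 0 \<Longrightarrow> supp_le d (W3 t)" "t \<ge> 0 \<Longrightarrow> supp_le d (W4 t)"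
    and flow: "t \<ge> 0 \<Longrightarrow> (W1 has_vector_derivative
        adj (W4 t * W3 t * W2 t) * (\<sigma> *\<^sub>R one_fm d - W4 t * W3 t * W2 t * W1 t)) (at t within {0..})"
      "t \<ge> 0 \<Longrightarrow> (W2 has_vector_derivative
        adj (W4 t * W3 t) * (\<sigma> *\<^sub>R one_fm d - W4 t * W3 t * W2 t * W1 t) * adj (W1 t)) (at t within {0..})"
      "t \<ge> 0 \<Longrightarrow> (W3 has_vector_derivative
        adj (W4 t) * (\<sigma> *\<^sub>R one_fm d - W4 t * W3 t * W2 t * W1 t) * adj (W2 t * W1 t)) (at t within {0..})"
      "t \<ge> 0 \<Longrightarrow> (W4 has_vector_derivative
        (\<sigma> *\<^sub>R one_fm d - W4 t * W3 t * W2 t * W1 t) * adj (W3 t * W2 t * W1 t)) (at t within {0..})"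
    and bal: "t \<ge> 0 \<Longrightarrow> W1 t * adj (W1 t) = adj (W2 t) * W2 t"
      "t \<ge> 0 \<Longrightarrow> W2 t * adj (W2 t) = adj (W3 t) * W3 t"
      "t \<ge> 0 \<Longrightarrow> W3 t * adj (W3 t) = adj (W4 t) * W4 t"
begin

definition "R t = \<sigma> *\<^sub>R one_fm d - W4 t * W3 t * W2 t * W1 t"
definition "A t = W2 t * W1 t"
definition "B t = W4 t * W3 t"
definition "M t = W2 t * adj (W2 t)"
definition "K t = W4 t * adj (W4 t)"
definition "N t = adj (W1 t) * W1 t"
definition "P t = A t + adj (B t)"
definition "D t = A t - adj (B t)"
definition "L t = 1 / 2 * (norm (R t))\<^sup>2"

lemma supps:
  assumes "t \<ge> 0"
  shows "supp_le d (A t)" "supp_le d (B t)" "supp_le d (M t)" "supp_le d (K t)" "supp_le d (N t)"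
    "supp_le d (P t)" "supp_le d (D t)" "supp_le d (R t)"
  using supp[OF assms]
  by (auto simp: A_def B_def M_def K_def N_def P_def D_def R_def intro!: supp_le_mult supp_le_arith supp_le_adj)

text \<open>Balancedness replaces a factor times its adjoint by the adjoint of the next factor times
  that factor; \<open>b1\<close> to \<open>b3\<close> do this in front of an arbitrary matrix. In
  the formula for \<open>4 *\<^sub>R (M t * M t)\<close> the cross terms of \<open>P\<close> and
  \<open>D\<close> cancel.\<close>

lemma rels:
  assumes t: "t \<ge> 0"
  shows "A t * N t = M t * A t" "adj (B t) * K t = M t * adj (B t)" "A t * adj (A t) = M t * M t"
    "adj (B t) * B t = M t * M t" "adj (A t) * A t = N t * N t" "adj (A t) * M t = N t * adj (A t)"
    "4 *\<^sub>R (M t * M t) = P t * adj (P t) + D t * adj (D t)"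
    "adj (M t) = M t" "adj (N t) = N t" "adj (K t) = K t"
proof -
  have b1: "W1 t * (adj (W1 t) * X) = adj (W2 t) * (W2 t * X)" for X
    by (simp add: bal(1)[OF t] flip: mult.assoc)
  have b2: "W2 t * (adj (W2 t) * X) = adj (W3 t) * (W3 t * X)" for X
    by (simp add: bal(2)[OF t] flip: mult.assoc)
  have b3: "W3 t * (adj (W3 t) * X) = adj (W4 t) * (W4 t * X)" for X
    by (simp add: bal(3)[OF t] flip: mult.assoc)
  show 1: "A t * N t = M t * A t" by (simp add: A_def N_def M_def mult.assoc b1)
  show "adj (B t) * K t = M t * adj (B t)" by (simp add: B_def K_def M_def mult.assoc b2 b3)
  show 3: "A t * adj (A t) = M t * M t" by (simp add: A_def M_def mult.assoc b1)
  show 4: "adj (B t) * B t = M t * M t" by (simp add: B_def M_def mult.assoc b2 bal(2)[OF t] flip: b3)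
  show "adj (A t) * A t = N t * N t" by (simp add: A_def N_def mult.assoc flip: b1)
  show sym: "adj (M t) = M t" "adj (N t) = N t" "adj (K t) = K t" by (simp_all add: M_def N_def K_def)
  show "adj (A t) * M t = N t * adj (A t)" using arg_cong[OF 1, of adj] by (simp add: sym)
  have "P t * adj (P t) + D t * adj (D t) = 2 *\<^sub>R (A t * adj (A t)) + 2 *\<^sub>R (adj (B t) * B t)"
    by (simp add: P_def D_def algebra_simps scaleR_2)
  then show "4 *\<^sub>R (M t * M t) = P t * adj (P t) + D t * adj (D t)"
    by (simp add: 3 4 flip: scaleR_add_left)
qed

lemma R_eq: "R t = \<sigma> *\<^sub>R one_fm d - B t * A t"
  by (simp add: R_def A_def B_def mult.assoc)

lemma deriv_AB:
  assumes t: "t \<ge> 0"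
  shows "(A has_vector_derivative \<sigma> *\<^sub>R (adj (B t) * (K t + N t)) - 2 *\<^sub>R (M t * M t * M t * A t)) (at t within {0..})"
    and "((\<lambda>t. adj (B t)) has_vector_derivative
      \<sigma> *\<^sub>R (A t * (K t + N t)) - 2 *\<^sub>R (M t * M t * M t * adj (B t))) (at t within {0..})"
proof -
  have R': "adj (R t) = \<sigma> *\<^sub>R one_fm d - adj (A t) * adj (B t)" by (simp add: R_eq)
  note alg = flow_algebra[OF rels(1-4)[OF t] mult_one_fm[OF supp_le_adj[OF supps(2)[OF t]]]
      mult_one_fm[OF supps(1)[OF t]] R_eq R']
  note f = flow[OF t, folded R_def]
  have "(A has_vector_derivative W2 t * (adj (W4 t * W3 t * W2 t) * R t) + adj (W4 t * W3 t) * R t * adj (W1 t) * W1 t)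
      (at t within {0..})"
    using has_vector_derivative_mult[OF f(2) f(1)] by (simp add: A_def[abs_def])
  also have "W2 t * (adj (W4 t * W3 t * W2 t) * R t) + adj (W4 t * W3 t) * R t * adj (W1 t) * W1 t
      = adj (B t) * R t * N t + M t * adj (B t) * R t"
    by (simp add: B_def N_def M_def mult.assoc)
  finally show "(A has_vector_derivative \<sigma> *\<^sub>R (adj (B t) * (K t + N t)) - 2 *\<^sub>R (M t * M t * M t * A t)) (at t within {0..})"
    by (simp only: alg)
  have "((\<lambda>t. adj (B t)) has_vector_derivative
      adj (W4 t * (adj (W4 t) * R t * adj (W2 t * W1 t)) + R t * adj (W3 t * W2 t * W1 t) * W3 t)) (at t within {0..})"
    unfolding B_def
    by (intro bounded_linear.has_vector_derivative[OF bounded_linear_adj] has_vector_derivative_mult[OF f(4) f(3)])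
  also have "adj (W4 t * (adj (W4 t) * R t * adj (W2 t * W1 t)) + R t * adj (W3 t * W2 t * W1 t) * W3 t)
      = M t * A t * adj (R t) + A t * adj (R t) * K t"
    by (simp add: A_def K_def M_def bal(2)[OF t] mult.assoc)
      (simp add: bal(2)[OF t, symmetric] flip: mult.assoc)?
  finally show "((\<lambda>t. adj (B t)) has_vector_derivative
      \<sigma> *\<^sub>R (A t * (K t + N t)) - 2 *\<^sub>R (M t * M t * M t * adj (B t))) (at t within {0..})"
    by (simp only: alg)
qed

lemma deriv_P:
  assumes t: "t \<ge> 0"
  shows "(P has_vector_derivative \<sigma> *\<^sub>R (P t * (K t + N t)) - 2 *\<^sub>R (M t * M t * M t * P t)) (at t within {0..})"
proof -
  have "\<sigma> *\<^sub>R (adj (B t) * (K t + N t)) - 2 *\<^sub>R (M t * M t * M t * A t) +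
    (\<sigma> *\<^sub>R (A t * (K t + N t)) - 2 *\<^sub>R (M t * M t * M t * adj (B t)))
    = \<sigma> *\<^sub>R (P t * (K t + N t)) - 2 *\<^sub>R (M t * M t * M t * P t)"
    by (simp add: P_def algebra_simps)
  then show ?thesis
    using has_vector_derivative_add[OF deriv_AB(1)[OF t] deriv_AB(2)[OF t]] by (simp add: P_def[abs_def])
qed

text \<open>Compared with \<open>P\<close>, the sign of \<sigma> is reversed: the term that makes
  \<open>P\<close> grow damps \<open>D\<close>.\<close>

lemma deriv_D:
  assumes t: "t \<ge> 0"
  shows "(D has_vector_derivative - \<sigma> *\<^sub>R (D t * (K t + N t)) - 2 *\<^sub>R (M t * M t * M t * D t)) (at t within {0..})"
proof -
  have "\<sigma> *\<^sub>R (adj (B t) * (K t + N t)) - 2 *\<^sub>R (M t * M t * M t * A t) -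
    (\<sigma> *\<^sub>R (A t * (K t + N t)) - 2 *\<^sub>R (M t * M t * M t * adj (B t)))
    = - \<sigma> *\<^sub>R (D t * (K t + N t)) - 2 *\<^sub>R (M t * M t * M t * D t)"
    by (simp add: D_def algebra_simps)
  then show ?thesis
    using has_vector_derivative_diff[OF deriv_AB(1)[OF t] deriv_AB(2)[OF t]] by (simp add: D_def[abs_def])
qed

lemma M3_nonneg: "t \<ge> 0 \<Longrightarrow> inner U (M t * M t * M t * U) \<ge> 0"
proof -
  assume t: "t \<ge> 0"
  have "inner U (M t * M t * M t * U) = inner (M t * U) (M t * (M t * U))"
    by (simp add: inner_mult_left_adj rels(8)[OF t] mult.assoc)
  also have "\<dots> = (norm (adj (W2 t) * (M t * U)))\<^sup>2"
    unfolding norm_mult_sq by (simp add: M_def)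
  finally show ?thesis by simp
qed

text \<open>Both contributions to the derivative of \<open>(norm (D t))\<^sup>2\<close> have a sign:
  pairing \<open>D\<close> with \<open>D * (K + N)\<close> gives a sum of two squares, and the cube
  of the positive semidefinite \<open>M\<close> is positive semidefinite.\<close>

lemma D_nonincreasing: "0 \<le> s \<Longrightarrow> norm (D s) \<le> norm (D 0)"
proof -
  assume s: "0 \<le> s"
  have "(norm (D s * one_fm d))\<^sup>2 \<le> (norm (D 0 * one_fm d))\<^sup>2"
  proof (rule nonincreasing_within[OF s])
    fix t assume t: "0 \<le> t" "t \<le> s"
    let ?D' = "- \<sigma> *\<^sub>R (D t * (K t + N t)) - 2 *\<^sub>R (M t * M t * M t * D t)"
    show "((\<lambda>t. (norm (D t * one_fm d))\<^sup>2) has_real_derivative 2 * inner (D t * one_fm d) (?D' * one_fm d)) (at t within {0..s})"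
      by (rule has_derivative_norm_mult_sq, rule has_vector_derivative_within_subset[OF deriv_D[OF t(1)]]) auto
    have "supp_le d ?D'" using supps[OF t(1)] by (intro supp_le_arith supp_le_mult) auto
    then have eq: "inner (D t * one_fm d) (?D' * one_fm d) =
       - \<sigma> * inner (D t) (D t * (K t + N t)) - 2 * inner (D t) (M t * M t * M t * D t)"
      by (simp add: mult_one_fm supps t inner_diff_right)
    have "inner (D t) (D t * (K t + N t)) = (norm (D t * W4 t))\<^sup>2 + (norm (D t * adj (W1 t)))\<^sup>2"
      by (simp add: power2_norm_eq_inner K_def N_def distrib_left inner_add_right inner_mult_right_adj mult.assoc)
    then have "\<sigma> * inner (D t) (D t * (K t + N t)) \<ge> 0" using \<sigma> by simp
    then show "2 * inner (D t * one_fm d) (?D' * one_fm d) \<le> 0"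
      unfolding eq using M3_nonneg[OF t(1), of "D t"] by simp
  qed
  then show ?thesis using s by (simp add: mult_one_fm supps)
qed

lemma norm_shift:
  assumes t: "t \<ge> 0"
  shows "norm (adj (W1 t) * X) = norm (W2 t * X)" "norm (adj (W2 t) * X) = norm (W3 t * X)"
    "norm (adj (W3 t) * X) = norm (W4 t * X)"
proof -
  have "(norm (adj (W1 t) * X))\<^sup>2 = (norm (W2 t * X))\<^sup>2" "(norm (adj (W2 t) * X))\<^sup>2 = (norm (W3 t * X))\<^sup>2"
    "(norm (adj (W3 t) * X))\<^sup>2 = (norm (W4 t * X))\<^sup>2"
    unfolding norm_mult_sq using bal[OF t] by simp_all
  then show "norm (adj (W1 t) * X) = norm (W2 t * X)" "norm (adj (W2 t) * X) = norm (W3 t * X)"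
    "norm (adj (W3 t) * X) = norm (W4 t * X)" by simp_all
qed

text \<open>Balancedness gives the adjoint of each factor the same Gram matrix as the next factor,
  and \<open>low_adj\<close> removes the adjoint. So all four factors share their smallest singular
  value.\<close>

lemma low_all:
  assumes t: "t \<ge> 0" and c: "c > 0"
    and "low d c (W1 t) \<or> low d c (W2 t) \<or> low d c (W3 t) \<or> low d c (W4 t)"
  shows "low d c (W1 t)" "low d c (W2 t)" "low d c (W3 t)" "low d c (W4 t)"
    "low d c (adj (W1 t))" "low d c (adj (W2 t))" "low d c (adj (W3 t))" "low d c (adj (W4 t))"
proof -
  have "low d c (adj (W1 t)) = low d c (W2 t)" "low d c (adj (W2 t)) = low d c (W3 t)"
    "low d c (adj (W3 t)) = low d c (W4 t)"
    by (simp_all add: low_def norm_shift[OF t])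
  then show "low d c (W1 t)" "low d c (W2 t)" "low d c (W3 t)" "low d c (W4 t)"
    "low d c (adj (W1 t))" "low d c (adj (W2 t))" "low d c (adj (W3 t))" "low d c (adj (W4 t))"
    using assms(3) low_adj[OF supp(1)[OF t] c] low_adj[OF supp(2)[OF t] c] low_adj[OF supp(3)[OF t] c]
      low_adj[OF supp(4)[OF t] c] by auto
qed

text \<open>In \<open>4 M^2 = P P^H + D D^H\<close> the \<open>D\<close> part only helps, so
  \<open>M\<close> is bounded below by \<open>q / 2\<close>. Since \<open>M\<close> is also the Gram
  matrix of \<open>W3\<close>, a square root gives the bound on the factor.\<close>

lemma low_from_P:
  assumes t: "t \<ge> 0" and q: "q > 0" and P: "low d q (P t)"
  shows "low d (sqrt (q / 2)) (W3 t)"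
proof (rule low_gram[OF supp(3)[OF t] d])
  have P': "low d q (adj (P t))" using low_adj[OF supps(6)[OF t] q] P by simp
  show "low d (q / 2) (adj (W3 t) * W3 t)"
    unfolding low_def
  proof (intro allI impI)
    fix X :: "'a fm" assume X: "supp_le d X"
    have "(q * norm X)\<^sup>2 \<le> (norm (adj (P t) * X))\<^sup>2"
      using lowD[OF P' X] q by (intro power_mono) auto
    also have "\<dots> \<le> (norm (adj (P t) * X))\<^sup>2 + (norm (adj (D t) * X))\<^sup>2" by simp
    also have "\<dots> = inner X ((P t * adj (P t) + D t * adj (D t)) * X)"
      unfolding norm_mult_sq by (simp add: distrib_right inner_add_right)
    also have "\<dots> = 4 * (norm (M t * X))\<^sup>2"
      unfolding rels(7)[OF t, symmetric] norm_mult_sq rels(8)[OF t] by simp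
    finally have "(q * norm X)\<^sup>2 \<le> (2 * norm (M t * X))\<^sup>2" by (simp add: power_mult_distrib)
    then have "q * norm X \<le> 2 * norm (M t * X)" by (rule power2_le_imp_le) simp
    then show "q / 2 * norm X \<le> norm (adj (W3 t) * W3 t * X)"
      by (simp add: M_def bal(2)[OF t])
  qed
qed (use q in simp)

section \<open>Barriers for the singular values of \<open>W1\<close> and \<open>P\<close>\<close>

lemma continuous_W:
  "continuous_on {0..} W1" "continuous_on {0..} W2" "continuous_on {0..} W3" "continuous_on {0..} W4"
  unfolding continuous_on_eq_continuous_within using flow
  by (auto intro!: has_vector_derivative_continuous)

lemma continuous_P: "continuous_on {0..} P"
  unfolding continuous_on_eq_continuous_within using deriv_P
  by (auto intro!: has_vector_derivative_continuous)

lemma continuous_norm_prod: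
  fixes F :: "real \<Rightarrow> 'a fm"
  assumes "continuous_on {0..} F" "0 \<le> a" "continuous_on {a..b} g"
  shows "continuous_on ({a..b} \<times> S) (\<lambda>(t, X). (norm (F t * (X :: 'a fm)))\<^sup>2 - g t)"
proof -
  have "continuous_on {a..b} F" using assms(2) by (intro continuous_on_subset[OF assms(1)]) auto
  then have "continuous_on ({a..b} \<times> S) (\<lambda>p. F (fst p))" "continuous_on ({a..b} \<times> S) (\<lambda>p. g (fst p))"
    using assms(3) by (auto intro!: continuous_on_compose2[of _ _ "{a..b} \<times> S" fst] continuous_intros)
  then show ?thesis unfolding case_prod_beta by (intro continuous_intros)
qed

text \<open>The form in which a first contact is used: a minimizer of \<open>norm (W * X)\<close>
  over the sphere consists of right singular vectors.\<close>

lemma gram_min: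
  fixes W X :: "'a fm"
  assumes W: "supp_le d W" and ge: "\<And>Y. Y \<in> sph d \<Longrightarrow> (norm (W * Y))\<^sup>2 \<ge> v" and X: "X \<in> sph d" "(norm (W * X))\<^sup>2 = v"
  shows "adj W * W * X = v *\<^sub>R X"
proof (rule form_eigen[of d])
  show "supp_le d (adj W * W)" "adj (adj W * W) = adj W * W" "supp_le d X" using W X by (auto simp: sph_def)
  show "inner X (adj W * W * X) = v * (norm X)\<^sup>2" using X by (simp add: sph_def flip: norm_mult_sq)
  fix Y :: "'a fm" assume Y: "supp_le d Y"
  show "v * (norm Y)\<^sup>2 \<le> inner Y (adj W * W * Y)"
  proof (cases "Y = 0")
    case False
    have "v \<le> (norm (W * ((1 / norm Y) *\<^sub>R Y)))\<^sup>2" by (rule ge[OF normalize_sph[OF Y False]])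
    also have "\<dots> = (norm (W * Y))\<^sup>2 / (norm Y)\<^sup>2" by (simp add: power_divide)
    finally show ?thesis using False by (simp add: field_simps norm_mult_sq)
  qed simp
qed

text \<open>Balancedness turns the Gram matrix of the whole product into that of
  \<open>N t * N t\<close>. So the singular values of the product are the fourth powers of those of
  \<open>W1\<close>.\<close>

lemma prod_norm:
  assumes t: "t \<ge> 0" shows "norm (W4 t * W3 t * W2 t * W1 t * X) = norm (N t * N t * X)"
proof -
  have "adj (A t) * (adj (B t) * B t) * A t = (adj (A t) * M t) * (M t * A t)"
    by (simp add: rels(4)[OF t] mult.assoc)
  also have "\<dots> = N t * (adj (A t) * A t) * N t"
    unfolding rels(6)[OF t] rels(1)[OF t, symmetric] by (simp add: mult.assoc)
  finally have "adj (A t) * (adj (B t) * B t) * A t = N t * N t * (N t * N t)"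
    by (simp add: rels(5)[OF t] mult.assoc)
  then have "adj (B t * A t) * (B t * A t) = adj (N t * N t) * (N t * N t)"
    by (simp add: rels(9)[OF t] mult.assoc)
  then have "(norm (B t * A t * X))\<^sup>2 = (norm (N t * N t * X))\<^sup>2"
    unfolding norm_mult_sq by simp
  then show ?thesis by (simp add: A_def B_def mult.assoc)
qed

text \<open>At a first contact \<open>N t * X = m t *\<^sub>R X\<close>, so the image
  \<open>Y\<close> of \<open>X\<close> under the whole product has norm
  \<open>(m t)\<^sup>2\<close>. The derivative of \<open>(norm (W1 t * X))\<^sup>2\<close> is
  \<open>2 * inner Y (R t * X)\<close>, at least
  \<open>- 2 * \<sigma> * (m t)\<^sup>2 - 2 * (m t) ^ 4\<close> even in the worst alignment of
  \<open>Y\<close> and \<open>X\<close>. A barrier falling faster than this is never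
  touched.\<close>

lemma N_lower:
  assumes b: "0 \<le> b"
    and m: "\<And>t. 0 \<le> t \<Longrightarrow> t \<le> b \<Longrightarrow> m t > 0"
      "\<And>t. 0 \<le> t \<Longrightarrow> t \<le> b \<Longrightarrow> (m has_real_derivative m' t) (at t within {0..b})"
      "\<And>t. 0 \<le> t \<Longrightarrow> t \<le> b \<Longrightarrow> m' t < - 2 * \<sigma> * (m t)\<^sup>2 - 2 * (m t) ^ 4"
    and init: "\<And>X. X \<in> sph d \<Longrightarrow> m 0 < (norm (W1 0 * X))\<^sup>2"
    and t: "0 \<le> t" "t \<le> b"
  shows "low d (sqrt (m t)) (W1 t)"
proof (rule low_sphI)
  fix X :: "'a fm" assume X: "X \<in> sph d"
  have "(norm (W1 t * X))\<^sup>2 - m t > 0"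
  proof (rule crossing[OF compact_sph[of d] continuous_norm_prod[OF continuous_W(1), of 0 b m] _ _ _ X])
    show "continuous_on {0..b} m"
      unfolding continuous_on_eq_continuous_within using m(2) by (auto intro!: DERIV_continuous)
    show "t \<in> {0..b}" using t by simp
    fix X :: "'a fm" assume "X \<in> sph d" then show "0 < (norm (W1 0 * X))\<^sup>2 - m 0" using init by force
  next
    fix t and X :: "'a fm"
    assume t: "0 < t" "t \<le> b" and X: "X \<in> sph d" "(norm (W1 t * X))\<^sup>2 - m t = 0"
      and ge: "\<And>Y. Y \<in> sph d \<Longrightarrow> 0 \<le> (norm (W1 t * Y))\<^sup>2 - m t"
    have t0: "t \<ge> 0" using t by simp
    have NX: "N t * X = m t *\<^sub>R X"
      unfolding N_def using X ge by (intro gram_min[OF supp(1)[OF t0]]) force+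
    define Y where "Y = W4 t * W3 t * W2 t * W1 t * X"
    have sX: "supp_le d X" "norm X = 1" using X by (auto simp: sph_def)
    have nY: "norm Y = (m t)\<^sup>2"
      unfolding Y_def prod_norm[OF t0] using m(1)[of t] t sX by (simp add: mult.assoc NX power2_eq_square)
    have "- \<sigma> * (m t)\<^sup>2 \<le> \<sigma> * inner Y X"
      using mult_left_mono[OF norm_cauchy_schwarz[of "- Y" X], of \<sigma>] \<sigma> by (simp add: nY sX)
    then have 1: "- \<sigma> * (m t)\<^sup>2 - m t ^ 4 \<le> inner Y (R t * X)"
      using nY by (simp add: R_def Y_def[symmetric] left_diff_distrib one_fm_mult sX inner_diff_right
          power2_norm_eq_inner[symmetric])
    let ?D = "2 * inner (W1 t * X) (adj (W4 t * W3 t * W2 t) * R t * X) - m' t"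
    have "inner (W1 t * X) (adj (W4 t * W3 t * W2 t) * R t * X) = inner Y (R t * X)"
      by (simp add: Y_def mult.assoc inner_mult_left_adj)
    then have "?D > 0" using 1 m(3)[of t] t by simp
    moreover have "((\<lambda>s. (norm (W1 s * X))\<^sup>2 - m s) has_real_derivative ?D) (at t within {0..b})"
    proof (intro derivative_intros has_derivative_norm_mult_sq m(2))
      show "(W1 has_vector_derivative adj (W4 t * W3 t * W2 t) * R t) (at t within {0..b})"
        unfolding R_def by (rule has_vector_derivative_within_subset[OF flow(1)[OF t0]]) auto
    qed (use t in auto)
    ultimately show "\<exists>D>0. ((\<lambda>s. (norm (W1 s * X))\<^sup>2 - m s) has_real_derivative D) (at t within {0..b})" by blast
  qed simp_all
  then have "(sqrt (m t))\<^sup>2 \<le> (norm (W1 t * X))\<^sup>2" using m(1)[OF t] by simp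
  then show "sqrt (m t) \<le> norm (W1 t * X)" by (rule power2_le_imp_le) simp
qed

text \<open>At a first contact \<open>X\<close> is a right singular vector of \<open>P\<close> and
  \<open>U = P t * X\<close> a left one. The drive is at least \<open>2 * k t\<close> times
  \<sigma>, since \<open>K\<close> and \<open>N\<close> are both bounded below by
  \<open>k t\<close>. The damping comes from \<open>M\<close>, which \<open>P\<close> and
  \<open>D\<close> control on \<open>U\<close>. The bound \<open>k\<close> may itself be derived
  from the current bound on \<open>P\<close>; this is used in the later phase.\<close>

lemma P_lower:
  assumes a: "0 \<le> a"
    and q: "\<And>t. a \<le> t \<Longrightarrow> t \<le> b \<Longrightarrow> q t > 0"
      "\<And>t. a \<le> t \<Longrightarrow> t \<le> b \<Longrightarrow> (q has_real_derivative q' t) (at t within {a..b})"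
      "\<And>t. a \<le> t \<Longrightarrow> t \<le> b \<Longrightarrow> q' t < q t * (2 * \<sigma> * k t - (q t + norm (D 0)) ^ 3 / 4)"
    and k: "\<And>t. a \<le> t \<Longrightarrow> t \<le> b \<Longrightarrow> k t > 0"
      "\<And>t. a \<le> t \<Longrightarrow> t \<le> b \<Longrightarrow> low d (q t) (P t) \<Longrightarrow> low d (sqrt (k t)) (W1 t)"
    and init: "\<And>X. X \<in> sph d \<Longrightarrow> q a < norm (P a * X)"
    and t: "a \<le> t" "t \<le> b"
  shows "low d (q t) (P t)"
proof (rule low_sphI)
  fix X :: "'a fm" assume X: "X \<in> sph d"
  have "(norm (P t * X))\<^sup>2 - (q t)\<^sup>2 > 0"
  proof (rule crossing[OF compact_sph[of d] continuous_norm_prod[OF continuous_P, of a b "\<lambda>t. (q t)\<^sup>2"] _ _ _ X])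
    have "continuous_on {a..b} q"
      unfolding continuous_on_eq_continuous_within using q(2) by (auto intro!: DERIV_continuous)
    then show "continuous_on {a..b} (\<lambda>t. (q t)\<^sup>2)" by (intro continuous_intros)
    show "t \<in> {a..b}" using t by simp
    fix X :: "'a fm" assume "X \<in> sph d"
    then have "(q a)\<^sup>2 < (norm (P a * X))\<^sup>2"
      using init[of X] q(1)[of a] t by (intro power_strict_mono) auto
    then show "0 < (norm (P a * X))\<^sup>2 - (q a)\<^sup>2" by simp
  next
    fix t and X :: "'a fm"
    assume t: "a < t" "t \<le> b" and X: "X \<in> sph d" "(norm (P t * X))\<^sup>2 - (q t)\<^sup>2 = 0"
      and ge: "\<And>Y. Y \<in> sph d \<Longrightarrow> 0 \<le> (norm (P t * Y))\<^sup>2 - (q t)\<^sup>2"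
    have t0: "t \<ge> 0" "a \<le> t" using t a by auto
    have qt: "q t > 0" "k t > 0" using q(1) k(1) t by auto
    have PPX: "adj (P t) * P t * X = (q t)\<^sup>2 *\<^sub>R X"
      using X ge by (intro gram_min[OF supps(6)[OF t0(1)]]) force+
    have "low d (q t) (P t)"
      using ge qt by (intro low_sphI power2_le_imp_le[of "q t"]) force+
    then have "low d (sqrt (k t)) (W1 t)" using k(2) t0 t by blast
    note lw = low_all[OF t0(1) _ disjI1[OF this]]
    have sX: "supp_le d X" "norm X = 1" using X by (auto simp: sph_def)
    have "k t \<le> inner X (N t * X)"
    proof -
      have "(sqrt (k t))\<^sup>2 \<le> (norm (W1 t * X))\<^sup>2"
        using lowD[OF lw(1) sX(1)] qt sX by (intro power_mono) auto
      then show ?thesis using qt by (simp add: norm_mult_sq N_def)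
    qed
    moreover have "k t \<le> inner X (K t * X)"
    proof -
      have "(sqrt (k t))\<^sup>2 \<le> (norm (adj (W4 t) * X))\<^sup>2"
        using lowD[OF lw(8) sX(1)] qt sX by (intro power_mono) auto
      then show ?thesis using qt by (simp add: norm_mult_sq K_def)
    qed
    ultimately have KN: "2 * k t \<le> inner X ((K t + N t) * X)" by (simp add: distrib_right inner_add_right)
    define U where "U = P t * X"
    define \<Delta> where "\<Delta> = norm (D 0)"
    \<comment> \<open>\<open>z\<close> plays the role of an upper bound for \<open>M\<close> on
      \<open>U\<close>, because \<open>M^2\<close> is a quarter of \<open>P P^H + D D^H\<close> and
      \<open>D\<close> is at most \<Delta>.\<close>
    define z where "z = (q t + \<Delta>) / 2"
    have \<Delta>: "norm (D t) \<le> \<Delta>" "\<Delta> \<ge> 0" using D_nonincreasing[OF t0(1)] by (auto simp: \<Delta>_def)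
    have z: "z \<ge> 0" using \<Delta> qt by (simp add: z_def)
    have nU: "norm U = q t" using X qt by (simp add: U_def) 
    have PPU: "P t * adj (P t) * U = (q t)\<^sup>2 *\<^sub>R U"
      using arg_cong[OF PPX, of "\<lambda>Y. P t * Y"] by (simp add: U_def mult.assoc)
    have DU: "norm (adj (D t) * U) \<le> \<Delta> * q t"
      using order_trans[OF norm_mult_ineq[of "adj (D t)" U], of "\<Delta> * q t"] mult_right_mono[OF \<Delta>(1), of "q t"] qt
      by (simp add: nU)
    have z2: "(q t)\<^sup>2 + \<Delta>\<^sup>2 \<le> 4 * z\<^sup>2"
      using \<Delta> qt by (simp add: z_def power2_sum power_divide)
    have "4 * (norm (M t * U))\<^sup>2 = inner U ((P t * adj (P t) + D t * adj (D t)) * U)"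
      unfolding rels(7)[OF t0(1), symmetric] norm_mult_sq rels(8)[OF t0(1)] by simp
    also have "\<dots> = (q t)\<^sup>2 * (norm U)\<^sup>2 + (norm (adj (D t) * U))\<^sup>2"
      by (simp add: distrib_right inner_add_right PPU power2_norm_eq_inner[of U] norm_mult_sq)
    also have "\<dots> \<le> (q t)\<^sup>2 * (q t)\<^sup>2 + (\<Delta> * q t)\<^sup>2"
      using DU by (intro add_mono power_mono) (auto simp: nU)
    also have "\<dots> = ((q t)\<^sup>2 + \<Delta>\<^sup>2) * (q t)\<^sup>2" by (simp add: algebra_simps)
    also have "\<dots> \<le> 4 * z\<^sup>2 * (q t)\<^sup>2" using z2 by (rule mult_right_mono) simp
    finally have "(norm (M t * U))\<^sup>2 \<le> (z * q t)\<^sup>2" by (simp add: power_mult_distrib)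
    then have MU: "norm (M t * U) \<le> z * q t" by (rule power2_le_imp_le) (use z qt in simp)
    have "4 * norm (M t * (M t * U)) = norm ((P t * adj (P t) + D t * adj (D t)) * U)"
      unfolding rels(7)[OF t0(1), symmetric] by (simp add: mult.assoc)
    also have "\<dots> = norm ((q t)\<^sup>2 *\<^sub>R U + D t * (adj (D t) * U))" by (simp only: distrib_right PPU) (simp add: mult.assoc)
    also have "\<dots> \<le> (q t)\<^sup>2 * q t + \<Delta> * (\<Delta> * q t)"
      using norm_mult_ineq[of "D t" "adj (D t) * U"] DU \<Delta> mult_mono[OF \<Delta>(1) DU]
      by (intro norm_triangle_le add_mono) (auto simp: nU)
    also have "\<dots> = ((q t)\<^sup>2 + \<Delta>\<^sup>2) * q t" by (simp add: algebra_simps power2_eq_square)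
    also have "\<dots> \<le> 4 * z\<^sup>2 * q t" using z2 by (rule mult_right_mono) (use qt in simp)
    finally have MMU: "norm (M t * (M t * U)) \<le> z\<^sup>2 * q t" by simp
    \<comment> \<open>\<open>U\<close> need not be an eigenvector of \<open>M\<close>, because of
      \<open>D\<close>. The cube is therefore split into \<open>M * U\<close> and
      \<open>M * M * U\<close>, whose norms have just been bounded.\<close>
    have "inner U (M t * M t * M t * U) = inner (M t * U) (M t * (M t * U))"
      by (simp add: inner_mult_left_adj rels(8)[OF t0(1)] mult.assoc)
    also have "\<dots> \<le> norm (M t * U) * norm (M t * (M t * U))" by (rule norm_cauchy_schwarz)
    also have "\<dots> \<le> (z * q t) * (z\<^sup>2 * q t)" using MU MMU z qt by (intro mult_mono) auto
    finally have M3: "inner U (M t * M t * M t * U) \<le> z ^ 3 * (q t)\<^sup>2"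
      by (simp add: power2_eq_square power3_eq_cube mult_ac)
    let ?P' = "\<sigma> *\<^sub>R (P t * (K t + N t)) - 2 *\<^sub>R (M t * M t * M t * P t)"
    let ?D = "2 * inner (P t * X) (?P' * X) - (2 * q t * q' t)"
    have "inner (P t * X) (P t * (K t + N t) * X) = inner (adj (P t) * P t * X) ((K t + N t) * X)"
      using inner_mult_left_adj[of "adj (P t)" "P t * X" "(K t + N t) * X"] by (simp add: mult.assoc)
    also have "\<dots> = (q t)\<^sup>2 * inner X ((K t + N t) * X)" by (simp add: PPX)
    finally have 1: "inner (P t * X) (P t * (K t + N t) * X) = (q t)\<^sup>2 * inner X ((K t + N t) * X)" .
    have "inner (P t * X) (?P' * X) = \<sigma> * inner (P t * X) (P t * (K t + N t) * X) - 2 * inner U (M t * M t * M t * U)"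
      unfolding U_def by (simp only: left_diff_distrib inner_diff_right mult_scaleR_left inner_scaleR_right mult.assoc)
    also have "\<dots> \<ge> \<sigma> * ((q t)\<^sup>2 * (2 * k t)) - 2 * (z ^ 3 * (q t)\<^sup>2)"
      unfolding 1 using KN M3 \<sigma> by (intro diff_mono mult_left_mono) auto
    finally have "2 * inner (P t * X) (?P' * X) \<ge> 2 * q t * (q t * (2 * \<sigma> * k t - (q t + \<Delta>) ^ 3 / 4))"
      by (simp add: z_def algebra_simps power2_eq_square power_divide)
    moreover have "q' t < q t * (2 * \<sigma> * k t - (q t + \<Delta>) ^ 3 / 4)" using q(3) t0 t by (simp add: \<Delta>_def)
    then have "2 * q t * q' t < 2 * q t * (q t * (2 * \<sigma> * k t - (q t + \<Delta>) ^ 3 / 4))"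
      using qt by (intro mult_strict_left_mono) auto
    ultimately have "?D > 0" by simp
    moreover have "((\<lambda>s. (norm (P s * X))\<^sup>2 - (q s)\<^sup>2) has_real_derivative ?D) (at t within {a..b})"
    proof (rule DERIV_diff)
      show "((\<lambda>s. (norm (P s * X))\<^sup>2) has_real_derivative 2 * inner (P t * X) (?P' * X)) (at t within {a..b})"
        by (rule has_derivative_norm_mult_sq, rule has_vector_derivative_within_subset[OF deriv_P[OF t0(1)]]) (use a in auto)
      show "((\<lambda>s. (q s)\<^sup>2) has_real_derivative 2 * q t * q' t) (at t within {a..b})"
        using q(2)[of t] t by (auto intro!: derivative_eq_intros)
    qed
    ultimately show "\<exists>D>0. ((\<lambda>s. (norm (P s * X))\<^sup>2 - (q s)\<^sup>2) has_real_derivative D) (at t within {a..b})" by blast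
  qed (use a in simp_all)
  then have "(q t)\<^sup>2 \<le> (norm (P t * X))\<^sup>2" by simp
  then show "q t \<le> norm (P t * X)" by (rule power2_le_imp_le) simp
qed

end

section \<open>Decay of the loss, growth of \<open>P\<close>, and persistence of its kernel\<close>

context balanced_flow
begin

lemma deriv_L:
  assumes t: "t \<ge> 0"
  shows "(L has_real_derivative
    - ((norm (adj (W4 t * W3 t * W2 t) * R t))\<^sup>2 + (norm (adj (W4 t * W3 t) * R t * adj (W1 t)))\<^sup>2
      + (norm (adj (W4 t) * R t * adj (W2 t * W1 t)))\<^sup>2 + (norm (R t * adj (W3 t * W2 t * W1 t)))\<^sup>2))
    (at t within {0..})"
proof -
  note f = flow[OF t, folded R_def]
  let ?F1 = "adj (W4 t * W3 t * W2 t) * R t" and ?F2 = "adj (W4 t * W3 t) * R t * adj (W1 t)"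
  let ?F3 = "adj (W4 t) * R t * adj (W2 t * W1 t)" and ?F4 = "R t * adj (W3 t * W2 t * W1 t)"
  let ?R' = "- (W4 t * W3 t * W2 t * ?F1 + (W4 t * W3 t * ?F2 + (W4 t * ?F3 + ?F4 * W3 t) * W2 t) * W1 t)"
  have R': "(R has_vector_derivative ?R') (at t within {0..})"
    unfolding R_def[abs_def]
    using has_vector_derivative_diff[OF has_vector_derivative_const
        has_vector_derivative_mult[OF has_vector_derivative_mult[OF has_vector_derivative_mult[OF f(4) f(3)] f(2)] f(1)]]
    by (simp add: R_def)
  have l: "inner Y (X * Z) = inner (adj X * Y) Z" and r: "inner Y (Z * X) = inner (Y * adj X) Z" for X Y Z :: "'a fm"
    using inner_mult_left_adj[of "adj X" Y Z] inner_mult_right_adj[of Y "adj X" Z] by simp_all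
  have "inner (R t) (W4 t * W3 t * W2 t * ?F1) = (norm ?F1)\<^sup>2"
    by (subst l) (simp add: power2_norm_eq_inner)
  moreover have "inner (R t) (W4 t * W3 t * ?F2 * W1 t) = (norm ?F2)\<^sup>2"
    by (subst r, subst l) (simp add: power2_norm_eq_inner mult.assoc)
  moreover have "inner (R t) (W4 t * ?F3 * W2 t * W1 t) = (norm ?F3)\<^sup>2"
    by (subst r, subst r, subst l) (simp add: power2_norm_eq_inner mult.assoc)
  moreover have "inner (R t) (?F4 * W3 t * W2 t * W1 t) = (norm ?F4)\<^sup>2"
    by (subst r, subst r, subst r) (simp add: power2_norm_eq_inner mult.assoc)
  ultimately have in': "inner (R t) ?R' = - ((norm ?F1)\<^sup>2 + (norm ?F2)\<^sup>2 + (norm ?F3)\<^sup>2 + (norm ?F4)\<^sup>2)"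
    by (simp only: inner_minus_right inner_add_right distrib_right)
  from bounded_bilinear.has_vector_derivative[OF bounded_bilinear_inner R' R']
  have "((\<lambda>t. 1 / 2 * inner (R t) (R t)) has_real_derivative inner (R t) ?R') (at t within {0..})"
    unfolding has_real_derivative_iff_has_vector_derivative[symmetric]
    by (auto intro!: derivative_eq_intros simp: inner_commute)
  then show ?thesis
    unfolding in' by (simp add: L_def[abs_def] power2_norm_eq_inner)
qed

definition "L' t = - ((norm (adj (W4 t * W3 t * W2 t) * R t))\<^sup>2 + (norm (adj (W4 t * W3 t) * R t * adj (W1 t)))\<^sup>2
      + (norm (adj (W4 t) * R t * adj (W2 t * W1 t)))\<^sup>2 + (norm (R t * adj (W3 t * W2 t * W1 t)))\<^sup>2)"

lemma deriv_L_within: "0 \<le> a \<Longrightarrow> a \<le> t \<Longrightarrow> (L has_real_derivative L' t) (at t within {a..b})"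
  unfolding L'_def by (rule has_field_derivative_subset[OF deriv_L]) auto

lemma L'_nonpos: "L' t \<le> 0"
  unfolding L'_def neg_le_0_iff_le by (intro add_nonneg_nonneg zero_le_power2)

lemma L_nonincreasing: "0 \<le> a \<Longrightarrow> a \<le> b \<Longrightarrow> L b \<le> L a"
  by (rule nonincreasing_within[where g' = L'], assumption, erule deriv_L_within)
    (simp_all add: L'_nonpos)

text \<open>Each of the four gradients is \<open>R t\<close> multiplied by three factors with
  smallest singular value at least \<open>c\<close>, so their squares sum to at least
  \<open>4 * (c ^ 3 * norm (R t))\<^sup>2\<close>.\<close>

lemma L'_le:
  assumes t: "t \<ge> 0" and c: "c > 0" and low: "low d c (W1 t)"
  shows "L' t \<le> - (8 * c ^ 6) * L t"
proof -
  note lw = low_all[OF t c disjI1[OF low]]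
  note s = supp[OF t] supps(8)[OF t]
  have ll: "c * a \<le> norm (W * X)" if "low d c W" "supp_le d X" "a \<le> norm X" for W X :: "'a fm" and a
    using order_trans[OF mult_left_mono[OF that(3)] lowD[OF that(1,2)]] c by simp
  have rr: "c * a \<le> norm (X * adj W)" if "low d c W" "supp_le d X" "a \<le> norm X" for W X :: "'a fm" and a
    using order_trans[OF mult_left_mono[OF that(3)] low_right[OF that(1,2)]] c by simp
  have "c * (c * (c * norm (R t))) \<le> norm (adj (W2 t) * (adj (W3 t) * (adj (W4 t) * R t)))"
    by (intro ll lw order_refl) (use s in auto)
  moreover have "c * (c * (c * norm (R t))) \<le> norm (adj (W3 t) * (adj (W4 t) * R t) * adj (W1 t))"
    by (intro rr ll lw order_refl) (use s in auto)
  moreover have "c * (c * (c * norm (R t))) \<le> norm (adj (W4 t) * R t * adj (W1 t) * adj (W2 t))"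
    by (intro rr ll lw order_refl) (use s in auto)
  moreover have "c * (c * (c * norm (R t))) \<le> norm (R t * adj (W1 t) * adj (W2 t) * adj (W3 t))"
    by (intro rr lw order_refl) (use s in auto)
  ultimately have "(c ^ 3 * norm (R t))\<^sup>2 \<le> (norm (adj (W4 t * W3 t * W2 t) * R t))\<^sup>2"
    "(c ^ 3 * norm (R t))\<^sup>2 \<le> (norm (adj (W4 t * W3 t) * R t * adj (W1 t)))\<^sup>2"
    "(c ^ 3 * norm (R t))\<^sup>2 \<le> (norm (adj (W4 t) * R t * adj (W2 t * W1 t)))\<^sup>2"
    "(c ^ 3 * norm (R t))\<^sup>2 \<le> (norm (R t * adj (W3 t * W2 t * W1 t)))\<^sup>2"
    using c by (auto intro!: power_mono simp: mult.assoc power3_eq_cube)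
  then have "L' t \<le> - (4 * (c ^ 3 * norm (R t))\<^sup>2)" unfolding L'_def by simp
  also have "\<dots> = - (8 * c ^ 6) * L t" by (simp add: L_def power_mult_distrib flip: power_mult)
  finally show ?thesis .
qed

text \<open>The whole product is \<sigma> times the identity minus \<open>R t\<close>, hence bounded
  below by \<open>\<sigma> - norm (R t)\<close>. Its singular values are fourth powers of those of
  \<open>W1\<close>, which accounts for the two square roots.\<close>

lemma low_from_R:
  assumes t: "t \<ge> 0" and R: "norm (R t) < \<sigma>"
  shows "low d (sqrt (sqrt (\<sigma> - norm (R t)))) (W1 t)"
proof -
  let ?r = "\<sigma> - norm (R t)"
  have r: "?r > 0" using R by simp
  have "low d ?r (adj (N t) * N t)"
    unfolding low_def
  proof (intro allI impI)
    fix X :: "'a fm" assume X: "supp_le d X"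
    have eq: "W4 t * W3 t * W2 t * W1 t * X = \<sigma> *\<^sub>R X - R t * X"
      by (simp add: R_def left_diff_distrib one_fm_mult X)
    have "\<sigma> * norm X - norm (R t) * norm X \<le> norm (\<sigma> *\<^sub>R X) - norm (R t * X)"
      using norm_mult_ineq[of "R t" X] \<sigma> by simp
    also have "\<dots> \<le> norm (\<sigma> *\<^sub>R X - R t * X)" by (rule norm_triangle_ineq2)
    also have "\<dots> = norm (adj (N t) * N t * X)"
      unfolding rels(9)[OF t] prod_norm[OF t, symmetric] eq ..
    finally show "?r * norm X \<le> norm (adj (N t) * N t * X)" by (simp add: left_diff_distrib)
  qed
  from low_gram[OF supps(5)[OF t] d r this] have "low d (sqrt ?r) (adj (W1 t) * W1 t)"
    by (simp add: N_def)
  from low_gram[OF supp(1)[OF t] d _ this] r show ?thesis by simp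
qed

text \<open>Three stages. A crude rate from the bound on \<open>P\<close> shrinks the loss until the
  residual is at most a third of \<sigma>. From then on the residual itself controls the factors and
  gives half the final rate. Feeding this decay back, the rate differs from the final one by an
  integrable amount, which costs only a constant factor.\<close>

lemma loss_decay:
  assumes T0: "0 \<le> T0" and lowP: "\<And>t. t \<ge> T0 \<Longrightarrow> low d (sqrt \<sigma> / 5) (P t)"
    and L0: "L T0 \<le> d * \<sigma>\<^sup>2"
    and T1: "T1 \<ge> T0 + 125 * ln (18 * d) / (\<sigma> * sqrt \<sigma>)" and t: "t \<ge> T1"
  shows "L t < d * \<sigma>\<^sup>2 * exp (- (8 * (\<sigma> * sqrt \<sigma>) * (t - T1)))"
proof -
  define w where "w = \<sigma> * sqrt \<sigma>"
  have w: "w > 0" using \<sigma> by (simp add: w_def)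
  have ln: "ln (18 * real d) \<ge> 0" using d by simp
  have T: "0 \<le> T1" "T0 \<le> T1" "0 \<le> t"
  proof -
    have "0 \<le> 125 * ln (18 * real d) / (\<sigma> * sqrt \<sigma>)"
      using ln w unfolding w_def by (intro divide_nonneg_pos) auto
    then have "T0 \<le> T1" using T1 by simp
    with T0 t show "0 \<le> T1" "T0 \<le> T1" "0 \<le> t" by auto
  qed
  have "L T1 \<le> L T0 * exp (w / 125 * T0 - w / 125 * T1)"
  proof (rule exp_decay[OF T(2), where g' = L' and h' = "\<lambda>_. w / 125"])
    fix t assume t: "T0 \<le> t" "t \<le> T1"
    show "(L has_real_derivative L' t) (at t within {T0..T1})" using T0 t by (intro deriv_L_within)
    show "((*) (w / 125) has_real_derivative w / 125) (at t within {T0..T1})"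
      by (auto intro!: derivative_eq_intros)
    have t0: "t \<ge> 0" using T0 t by simp
    have "low d (sqrt (sqrt \<sigma> / 5 / 2)) (W3 t)"
      by (rule low_from_P[OF t0 _ lowP[OF t(1)]]) (use \<sigma> in simp)
    moreover have "sqrt (sqrt \<sigma> / 5 / 2) > 0" using \<sigma> by simp
    ultimately have "low d (sqrt (sqrt \<sigma> / 5 / 2)) (W1 t)" using low_all(1)[OF t0] by blast
    from L'_le[OF t0 _ this] \<sigma> have "L' t \<le> - (8 * sqrt (sqrt \<sigma> / 5 / 2) ^ 6) * L t" by simp
    also have "sqrt (sqrt \<sigma> / 5 / 2) ^ 6 = ((sqrt (sqrt \<sigma> / 5 / 2))\<^sup>2) ^ 3" by (simp flip: power_mult)
    also have "\<dots> = (sqrt \<sigma> / 5 / 2) ^ 3" using \<sigma> by simp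
    \<comment> \<open>Multiplied by the 8 of \<open>L'_le\<close>, this is the crude rate
      \<open>w / 125\<close> and the origin of the factor 125 in the waiting time.\<close>
    also have "\<dots> = w / 1000" using \<sigma> by (simp add: w_def power3_eq_cube)
    finally show "L' t \<le> - (w / 125) * L t" by simp
  qed
  also have "\<dots> \<le> d * \<sigma>\<^sup>2 * exp (- ln (18 * d))"
  proof (intro mult_mono L0)
    have "125 * ln (18 * d) / w \<le> T1 - T0" using T1 by (simp add: w_def)
    then have "ln (18 * d) \<le> w / 125 * (T1 - T0)" using w by (simp add: field_simps)
    then show "exp (w / 125 * T0 - w / 125 * T1) \<le> exp (- ln (18 * d))" by (simp add: algebra_simps)
  qed simp_all
  also have "\<dots> = \<sigma>\<^sup>2 / 18" using d by (simp add: exp_minus)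
  finally have LT1: "L T1 \<le> \<sigma>\<^sup>2 / 18" .
  \<comment> \<open>\<open>y\<close> is a bound for the residual relative to \<sigma>. The true rate
    is \<open>8 * w\<close> times the 3/2 power of \<open>1 - y\<close>, estimated here by its
    tangent at \<open>y = 0\<close>.\<close>
  have step: "L' u \<le> - (8 * w * (1 - 3 / 2 * y)) * L u"
    if u: "u \<ge> 0" and y: "0 \<le> y" "y \<le> 1 / 3" and Ly: "L u \<le> \<sigma>\<^sup>2 * y\<^sup>2 / 2" for u y
  proof -
    have "(norm (R u))\<^sup>2 \<le> (\<sigma> * y)\<^sup>2" using Ly by (simp add: L_def power_mult_distrib)
    then have R: "norm (R u) \<le> \<sigma> * y" by (rule power2_le_imp_le) (use \<sigma> y in simp)
    have "\<sigma> * y \<le> \<sigma> * (1 / 3)" using y \<sigma> by (intro mult_left_mono) auto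
    with R \<sigma> have R': "norm (R u) < \<sigma>" by linarith
    define z where "z = sqrt (1 - y)"
    have z: "z > 0" "y = 1 - z\<^sup>2" using y by (auto simp: z_def)
    let ?c = "sqrt (sqrt (\<sigma> - norm (R u)))"
    have c: "?c > 0" using R' by simp
    have "\<sigma> * (1 - y) \<le> \<sigma> - norm (R u)" using R by (simp add: algebra_simps)
    then have "sqrt \<sigma> * z \<le> sqrt (\<sigma> - norm (R u))"
      unfolding z_def by (metis real_sqrt_mult real_sqrt_le_mono)
    then have "(sqrt \<sigma> * z) ^ 3 \<le> sqrt (\<sigma> - norm (R u)) ^ 3" using \<sigma> z by (intro power_mono) auto
    also have "\<dots> = (?c\<^sup>2) ^ 3" using R' by simp
    also have "\<dots> = ?c ^ 6" by (simp only: power_mult[symmetric]) simp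
    also have "(sqrt \<sigma> * z) ^ 3 = w * z ^ 3" using \<sigma> by (simp add: w_def power3_eq_cube)
    finally have "w * z ^ 3 \<le> ?c ^ 6" .
    moreover have "w * (1 - 3 / 2 * y) \<le> w * z ^ 3"
    proof (rule mult_left_mono)
      \<comment> \<open>Bernoulli's inequality for the exponent 3/2, made polynomial by the
        substitution \<open>z = sqrt (1 - y)\<close>.\<close>
      have "0 \<le> (z - 1)\<^sup>2 * (z + 1 / 2)" using z by simp
      also have "\<dots> = z ^ 3 - (1 - 3 / 2 * y)"
        unfolding z(2) by (simp add: power2_eq_square power3_eq_cube field_simps)
      finally show "1 - 3 / 2 * y \<le> z ^ 3" by simp
    qed (use w in simp)
    ultimately have "8 * w * (1 - 3 / 2 * y) * L u \<le> 8 * ?c ^ 6 * L u"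
      by (intro mult_right_mono) (auto simp: L_def)
    with L'_le[OF u c low_from_R[OF u R']] show ?thesis by simp
  qed
  have fast: "L u \<le> \<sigma>\<^sup>2 * (1 / 3 * exp (- (2 * w * (u - T1))))\<^sup>2 / 2" if u: "T1 \<le> u" for u
  proof -
    have "L u \<le> L T1 * exp (4 * w * T1 - 4 * w * u)"
    proof (rule exp_decay[OF u, where g' = L' and h' = "\<lambda>_. 4 * w"])
      fix v assume v: "T1 \<le> v" "v \<le> u"
      show "(L has_real_derivative L' v) (at v within {T1..u})" using T v by (intro deriv_L_within)
      show "((*) (4 * w) has_real_derivative 4 * w) (at v within {T1..u})"
        by (auto intro!: derivative_eq_intros)
      have "L v \<le> \<sigma>\<^sup>2 * (1 / 3)\<^sup>2 / 2"
        using L_nonincreasing[OF T(1) v(1)] LT1 by (simp add: power2_eq_square)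
      from step[OF _ _ _ this] v T show "L' v \<le> - (4 * w) * L v" by simp
    qed
    also have "\<dots> \<le> \<sigma>\<^sup>2 / 18 * exp (4 * w * T1 - 4 * w * u)"
      using LT1 by (rule mult_right_mono) simp
    also have "\<dots> = \<sigma>\<^sup>2 * (1 / 3 * exp (- (2 * w * (u - T1))))\<^sup>2 / 2"
      by (simp add: power_mult_distrib exp_double[symmetric] power_divide algebra_simps)
    finally show ?thesis .
  qed
  \<comment> \<open>The deficit of the rate, \<open>4 * w * exp (- (2 * w * (v - T1)))\<close>, has
    total integral 2. The resulting factor \<open>exp 2\<close> is beaten by the 18 gained before
    \<open>T1\<close>.\<close>
  have "L t \<le> L T1 * exp ((8 * w * T1 + 2 * exp (- (2 * w * (T1 - T1)))) - (8 * w * t + 2 * exp (- (2 * w * (t - T1)))))"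
  proof (rule exp_decay[OF t, where g' = L' and h' = "\<lambda>v. 8 * w - 4 * w * exp (- (2 * w * (v - T1)))"])
    fix v assume v: "T1 \<le> v" "v \<le> t"
    show "(L has_real_derivative L' v) (at v within {T1..t})" using T v by (intro deriv_L_within)
    show "((\<lambda>v. 8 * w * v + 2 * exp (- (2 * w * (v - T1)))) has_real_derivative
        8 * w - 4 * w * exp (- (2 * w * (v - T1)))) (at v within {T1..t})"
      by (auto intro!: derivative_eq_intros)
    have "L' v \<le> - (8 * w * (1 - 3 / 2 * (1 / 3 * exp (- (2 * w * (v - T1)))))) * L v"
      by (rule step[OF _ _ _ fast[OF v(1)]]) (use v T w in auto)
    then show "L' v \<le> - (8 * w - 4 * w * exp (- (2 * w * (v - T1)))) * L v"
      by (simp add: algebra_simps)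
  qed
  also have "\<dots> \<le> \<sigma>\<^sup>2 / 18 * exp (2 - 8 * w * (t - T1))"
    using LT1 by (intro mult_mono) (auto simp: algebra_simps)
  also have "\<dots> = \<sigma>\<^sup>2 * (exp 2 / 18) * exp (- (8 * w * (t - T1)))"
  proof -
    have "exp (2 - a) = exp 2 * exp (- a)" for a :: real by (simp flip: exp_add)
    then show ?thesis by simp
  qed
  also have "\<dots> < \<sigma>\<^sup>2 * 1 * exp (- (8 * w * (t - T1)))"
  proof -
    have "exp (2::real) = exp 1 * exp 1" by (simp flip: exp_add)
    also have "\<dots> \<le> 3 * 3" using exp_le by (intro mult_mono) auto
    finally have "exp 2 / 18 < (1::real)" by simp
    then show ?thesis using \<sigma> by (intro mult_strict_right_mono mult_strict_left_mono) auto
  qed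
  also have "\<dots> \<le> d * \<sigma>\<^sup>2 * exp (- (8 * w * (t - T1)))"
    using d by (intro mult_right_mono) (auto simp: mult_le_cancel_right1 Suc_le_eq)
  finally show ?thesis by (simp add: w_def)
qed

text \<open>Nothing prevents \<open>W1\<close> from shrinking at first, at worst like
  \<open>m / g t\<close>. But \<open>P\<close> is driven by \<open>W1\<close> and grows like
  \<open>p * g t\<close>: up to exponential corrections the two barriers have constant product
  \<open>m * p\<close>. They are followed until they meet at \<open>sqrt (m * p)\<close>.\<close>

lemma P_growth_early:
  assumes p: "0 < p" "p \<le> m"
    and N0: "\<And>X. X \<in> sph d \<Longrightarrow> m < (norm (W1 0 * X))\<^sup>2"
    and P0: "\<And>X. X \<in> sph d \<Longrightarrow> p < norm (P 0 * X)"
    and small: "9 * (m + norm (D 0)) ^ 3 \<le> \<sigma> * sqrt (m * p)"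
  obtains T where "0 \<le> T" "T \<le> 1 / (2 * \<sigma> * sqrt (m * p))"
    "\<And>X. X \<in> sph d \<Longrightarrow> sqrt (m * p) / 2 < norm (P T * X)"
proof -
  define \<Delta> where "\<Delta> = norm (D 0)"
  \<comment> \<open>\<beta> dominates all the cubic damping terms, both in the equation of
    \<open>W1\<close> and in that of \<open>P\<close>.\<close>
  define \<beta> where "\<beta> = 3 * (m + \<Delta>) ^ 3"
  define g where "g t = 1 + 2 * \<sigma> * m * t" for t
  define \<mu> where "\<mu> t = m * exp (- \<beta> * t) / g t" for t
  define q where "q t = p * g t * exp (- 3 * \<beta> * t)" for t
  define h where "h = sqrt (m / p)"
  define s where "s = sqrt (m * p)"
  \<comment> \<open>The time at which \<open>p * g t\<close> and \<open>m / g t\<close> agree, that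
    is, \<open>g T = h\<close>.\<close>
  define T where "T = (h - 1) / (2 * \<sigma> * m)"
  have m: "m > 0" using p by simp
  have \<Delta>: "\<Delta> \<ge> 0" by (simp add: \<Delta>_def)
  have \<beta>: "\<beta> > 0" "\<beta> \<ge> 3 * m ^ 3"
    using m \<Delta> by (auto simp: \<beta>_def intro!: power_mono)
  have s: "s > 0" using p m by (simp add: s_def)
  have sm: "s \<le> m" using p m mult_left_mono[of p m m] unfolding s_def by (intro real_le_lsqrt) (auto simp: power2_eq_square)
  have h: "h \<ge> 1" using p by (simp add: h_def)
  have h2: "h\<^sup>2 = m / p" using p by (simp add: h_def)
  have ph: "p * h = s"
    unfolding s_def using p h h2
    by (intro real_sqrt_unique[symmetric]) (auto simp: power_mult_distrib power2_eq_square[of p])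
  have hs: "h * s = m"
  proof -
    have "h * s = h\<^sup>2 * p" unfolding ph[symmetric] by (simp add: power2_eq_square)
    then show ?thesis using h2 p by simp
  qed
  have T: "T \<ge> 0" "g T = h" using h m \<sigma> by (auto simp: T_def g_def)
  have Ts: "T \<le> 1 / (2 * \<sigma> * s)"
  proof -
    have "T \<le> h / (2 * \<sigma> * m)" using m \<sigma> by (auto simp: T_def intro!: divide_right_mono)
    also have "\<dots> = 1 / (2 * \<sigma> * s)" unfolding hs[symmetric] using h s \<sigma> by (simp add: field_simps)
    finally show ?thesis .
  qed
  \<comment> \<open>The smallness hypothesis is \<open>3 * \<beta> \<le> \<sigma> * s\<close>. So
    the accumulated exponential loss is at most \<open>exp (- 1 / 2)\<close>, which explains the
    factor 1/2 in the conclusion.\<close>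
  have \<beta>T: "3 * \<beta> * T \<le> 1 / 2"
  proof -
    have "3 * \<beta> \<le> \<sigma> * s" using small by (simp add: \<beta>_def s_def \<Delta>_def)
    then have "3 * \<beta> * T \<le> \<sigma> * s * (1 / (2 * \<sigma> * s))"
      by (rule mult_mono[OF _ Ts]) (use T s \<sigma> in auto)
    also have "\<dots> = 1 / 2" using s \<sigma> by (simp add: field_simps)
    finally show ?thesis .
  qed
  have g: "g t \<ge> 1" if "0 \<le> t" for t using that m \<sigma> by (simp add: g_def)
  have \<mu>: "\<mu> t > 0" "\<mu> t \<le> m / g t" "\<mu> t \<le> m" if t: "0 \<le> t" for t
  proof -
    show "\<mu> t > 0" using m g[OF t] by (simp add: \<mu>_def)
    have "exp (- \<beta> * t) \<le> 1" using \<beta> t by simp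
    then have "m * exp (- \<beta> * t) \<le> m * 1" using m by (intro mult_left_mono) auto
    then show *: "\<mu> t \<le> m / g t" using g[OF t] by (auto simp: \<mu>_def intro!: divide_right_mono)
    have "m / g t \<le> m" using g[OF t] m by (simp add: divide_le_eq mult_le_cancel_left1)
    with * show "\<mu> t \<le> m" by simp
  qed
  have lowN: "low d (sqrt (\<mu> t)) (W1 t)" if t: "0 \<le> t" "t \<le> T" for t
  proof (rule N_lower[OF T(1), of \<mu> "\<lambda>t. - \<beta> * \<mu> t - 2 * \<sigma> * (m / g t) * \<mu> t"])
    fix t assume t: "0 \<le> t" "t \<le> T"
    show "\<mu> t > 0" using \<mu> t by simp
    show "(\<mu> has_real_derivative - \<beta> * \<mu> t - 2 * \<sigma> * (m / g t) * \<mu> t) (at t within {0..T})"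
    proof -
      have "(g has_real_derivative 2 * \<sigma> * m) (at t within {0..T})"
        unfolding g_def[abs_def] by (auto intro!: derivative_eq_intros)
      then have "(\<mu> has_real_derivative
          (m * (exp (- \<beta> * t) * - \<beta>) * g t - m * exp (- \<beta> * t) * (2 * \<sigma> * m)) / (g t * g t)) (at t within {0..T})"
        using g[OF t(1)] unfolding \<mu>_def[abs_def] by (auto intro!: derivative_eq_intros)
      then show ?thesis
        by (rule DERIV_cong) (use g[OF t(1)] in \<open>simp add: \<mu>_def diff_divide_distrib mult_ac\<close>)
    qed
    have "\<mu> t ^ 3 \<le> m ^ 3" using \<mu>[OF t(1)] by (intro power_mono) auto
    then have "2 * \<mu> t ^ 3 < \<beta>" using \<beta> m zero_less_power[OF m, of 3] by linarith
    then have "2 * \<mu> t ^ 3 * \<mu> t < \<beta> * \<mu> t" using \<mu>[OF t(1)] by (intro mult_strict_right_mono) auto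
    moreover have "2 * \<sigma> * \<mu> t * \<mu> t \<le> 2 * \<sigma> * (m / g t) * \<mu> t"
      using \<mu>[OF t(1)] \<sigma> by (intro mult_right_mono mult_left_mono) auto
    ultimately show "- \<beta> * \<mu> t - 2 * \<sigma> * (m / g t) * \<mu> t < - 2 * \<sigma> * (\<mu> t)\<^sup>2 - 2 * \<mu> t ^ 4"
      by (simp add: power2_eq_square power4_eq_xxxx power3_eq_cube mult.assoc)
  next
    fix X :: "'a fm" assume "X \<in> sph d"
    then show "\<mu> 0 < (norm (W1 0 * X))\<^sup>2" using N0 by (simp add: \<mu>_def g_def)
  qed (use t in auto)
  have "low d (q T) (P T)"
  proof (rule P_lower[of 0 T q "\<lambda>t. q t * (2 * \<sigma> * (m / g t) - 3 * \<beta>)" \<mu>])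
    fix t assume t: "0 \<le> t" "t \<le> T"
    show qt: "q t > 0" using g[OF t(1)] p by (simp add: q_def)
    show "(q has_real_derivative q t * (2 * \<sigma> * (m / g t) - 3 * \<beta>)) (at t within {0..T})"
      using g[OF t(1)] unfolding q_def[abs_def] g_def
      by (auto intro!: derivative_eq_intros simp: field_simps)
    have "g t \<le> h" using t m \<sigma> unfolding T(2)[symmetric] g_def by simp
    then have "p * g t * exp (- 3 * \<beta> * t) \<le> p * h * 1"
      using p g[OF t(1)] \<beta> t by (intro mult_mono) auto
    then have "q t \<le> m" using ph sm by (simp add: q_def)
    then have 1: "(q t + \<Delta>) ^ 3 \<le> (m + \<Delta>) ^ 3" using qt \<Delta> by (intro power_mono) auto
    have "1 - \<beta> * t \<le> exp (- \<beta> * t)" using exp_ge_add_one_self[of "- \<beta> * t"] by simp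
    then have "m / g t * (1 - \<beta> * t) \<le> m / g t * exp (- \<beta> * t)"
      using m g[OF t(1)] by (intro mult_left_mono) auto
    then have "2 * \<sigma> * (m / g t * (1 - \<beta> * t)) \<le> 2 * \<sigma> * \<mu> t"
      using \<sigma> by (intro mult_left_mono) (auto simp: \<mu>_def)
    moreover have "2 * \<sigma> * (m / g t * (1 - \<beta> * t)) = 2 * \<sigma> * (m / g t) - \<beta> * ((2 * \<sigma> * m * t) / g t)"
      using g[OF t(1)] by (simp add: field_simps)
    \<comment> \<open>The factor \<open>exp (- \<beta> * t)\<close> in \<mu> loses a term linear in
      \<open>t\<close>, but \<open>2 * \<sigma> * m * t\<close> is below \<open>g t\<close>, so the
      loss is at most \<beta> uniformly in time.\<close>
    moreover have "\<beta> * ((2 * \<sigma> * m * t) / g t) \<le> \<beta> * 1"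
      using g[OF t(1)] \<beta> by (intro mult_left_mono) (auto simp: g_def)
    moreover have "(q t + \<Delta>) ^ 3 \<le> \<beta> / 3" using 1 by (simp add: \<beta>_def)
    ultimately have "2 * \<sigma> * (m / g t) - 3 * \<beta> < 2 * \<sigma> * \<mu> t - (q t + \<Delta>) ^ 3 / 4"
      using \<beta>(1) by linarith
    then show "q t * (2 * \<sigma> * (m / g t) - 3 * \<beta>) < q t * (2 * \<sigma> * \<mu> t - (q t + norm (D 0)) ^ 3 / 4)"
      using qt by (simp add: \<Delta>_def)
    show "\<mu> t > 0" "low d (sqrt (\<mu> t)) (W1 t)" using \<mu> lowN t by auto
  next
    fix X :: "'a fm" assume "X \<in> sph d"
    then show "q 0 < norm (P 0 * X)" using P0 by (simp add: q_def g_def)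
  qed (use T in auto)
  moreover have "s / 2 < q T"
  proof -
    have "(1/2 :: real) < exp (-1/2)" using exp_minus_greater[of "1/2"] by simp
    also have "\<dots> \<le> exp (- 3 * \<beta> * T)" using \<beta>T by simp
    finally have "s * (1 / 2) < s * exp (- 3 * \<beta> * T)" using s by (rule mult_strict_left_mono)
    then show ?thesis by (simp add: q_def T(2) ph)
  qed
  ultimately have "s / 2 < norm (P T * X)" if "X \<in> sph d" for X
    using lowD[of d "q T" "P T" X] that by (auto simp: sph_def)
  then show ?thesis using that[OF T(1)] Ts by (simp add: s_def)
qed

lemma cube_sum_le: "0 \<le> x \<Longrightarrow> 0 \<le> y \<Longrightarrow> (x + y) ^ 3 \<le> 4 * (x ^ 3 + y ^ 3)" for x y :: real
proof -
  assume "0 \<le> x" "0 \<le> y"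
  then have "0 \<le> 3 * ((x + y) * (x - y)\<^sup>2)" by simp
  also have "\<dots> = 4 * (x ^ 3 + y ^ 3) - (x + y) ^ 3"
    by (simp add: power2_eq_square power3_eq_cube algebra_simps)
  finally show ?thesis by simp
qed

text \<open>Now \<open>P\<close> supports itself: its bound \<open>q\<close> yields the bound
  \<open>q / 2\<close> for the squared singular values of the factors, so the drive is \<sigma> q^2.
  Half of it pays for the damping and the other half gives a solution that would blow up within time
  \<open>4 / (\<sigma> * s)\<close>. It is stopped at \<open>sqrt \<sigma> / 4\<close> and continued
  by a constant barrier.\<close>

lemma P_growth_late:
  assumes T: "0 \<le> T" and s: "0 < s" "s \<le> sqrt \<sigma> / 3"
    and PT: "\<And>X. X \<in> sph d \<Longrightarrow> s / 2 < norm (P T * X)"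
    and small: "9 * (norm (D 0)) ^ 3 \<le> \<sigma> * s"
    and t: "t \<ge> T + 4 / (\<sigma> * s)"
  shows "low d (sqrt \<sigma> / 5) (P t)"
proof -
  define \<Delta> where "\<Delta> = norm (D 0)"
  have \<Delta>: "\<Delta> \<ge> 0" by (simp add: \<Delta>_def)
  \<comment> \<open>The upper limit on \<open>q\<close> controls its cube by \<sigma> q / 16. The
    lower limit converts the smallness of \<Delta> relative to \<open>s\<close> into smallness
    relative to \<open>q\<close>.\<close>
  have rate: "(q + \<Delta>) ^ 3 / 4 < \<sigma> * q / 2" if q: "s / 2 \<le> q" "q \<le> sqrt \<sigma> / 4" for q
  proof -
    have q0: "q > 0" using q s by simp
    have "q\<^sup>2 \<le> (sqrt \<sigma> / 4)\<^sup>2" using q q0 by (intro power_mono) auto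
    then have "q\<^sup>2 * q \<le> \<sigma> / 16 * q" using q0 \<sigma> by (intro mult_right_mono) (auto simp: power_divide)
    then have 1: "q ^ 3 \<le> \<sigma> * q / 16" by (simp add: power2_eq_square power3_eq_cube)
    have "\<sigma> * s \<le> \<sigma> * (2 * q)" using q \<sigma> by (intro mult_left_mono) auto
    then have 2: "9 * \<Delta> ^ 3 \<le> 2 * (\<sigma> * q)" using small by (simp add: \<Delta>_def)
    have "\<sigma> * q > 0" using q0 \<sigma> by simp
    with cube_sum_le[of q \<Delta>] 1 2 q0 \<Delta> show ?thesis by simp
  qed
  have kP: "low d (sqrt (q / 2)) (W1 t)" if "t \<ge> 0" "q > 0" "low d q (P t)" for t q
    using low_all(1)[OF that(1), of "sqrt (q / 2)"] low_from_P[OF that] that by simp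
  \<comment> \<open>The time at which the barrier, started at \<open>s / 2\<close>, reaches
    \<open>sqrt \<sigma> / 4\<close>.\<close>
  define T' where "T' = T + (2 / \<sigma>) * (2 / s - 4 / sqrt \<sigma>)"
  have "sqrt \<sigma> > 0" using \<sigma> by simp
  then have "4 / sqrt \<sigma> \<le> 2 / s" using s by (simp add: field_simps)
  then have "T \<le> T'" using \<sigma> by (simp add: T'_def)
  moreover have "(2 / \<sigma>) * (2 / s - 4 / sqrt \<sigma>) \<le> (2 / \<sigma>) * (2 / s)"
    using \<sigma> by (intro mult_left_mono) auto
  ultimately have T': "T \<le> T'" "T' \<le> T + 4 / (\<sigma> * s)" by (auto simp: T'_def)
  define q where "q u = 1 / (2 / s - \<sigma> * (u - T) / 2)" for u
  have den: "4 / sqrt \<sigma> \<le> 2 / s - \<sigma> * (u - T) / 2" "2 / s - \<sigma> * (u - T) / 2 \<le> 2 / s" if "T \<le> u" "u \<le> T'" for u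
  proof -
    have "\<sigma> * (u - T) \<le> \<sigma> * (T' - T)" using that \<sigma> by simp
    also have "\<dots> = 2 * (2 / s - 4 / sqrt \<sigma>)" using \<sigma> by (simp add: T'_def)
    finally show "4 / sqrt \<sigma> \<le> 2 / s - \<sigma> * (u - T) / 2" by simp
    show "2 / s - \<sigma> * (u - T) / 2 \<le> 2 / s" using that \<sigma> by simp
  qed
  have q: "s / 2 \<le> q u" "q u \<le> sqrt \<sigma> / 4" "q u > 0" "2 / s - \<sigma> * (u - T) / 2 > 0" if u: "T \<le> u" "u \<le> T'" for u
  proof -
    have "4 / sqrt \<sigma> > 0" using \<sigma> by simp
    with den[OF u] show pos: "2 / s - \<sigma> * (u - T) / 2 > 0" by linarith
    then show "q u > 0" by (simp add: q_def)
    have "1 / (2 / s) \<le> q u" unfolding q_def by (rule divide_left_mono[OF den(2)[OF u]]) (use pos s in auto)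
    then show "s / 2 \<le> q u" by simp
    have "q u \<le> 1 / (4 / sqrt \<sigma>)" unfolding q_def by (rule divide_left_mono[OF den(1)[OF u]]) (use pos \<sigma> in auto)
    then show "q u \<le> sqrt \<sigma> / 4" by simp
  qed
  have "low d (q T') (P T')"
  proof (rule P_lower[OF T, of T' q "\<lambda>u. \<sigma> * (q u)\<^sup>2 / 2" "\<lambda>u. q u / 2"])
    fix u assume u: "T \<le> u" "u \<le> T'"
    show "q u > 0" "q u / 2 > 0" using q[OF u] by auto
    show "(q has_real_derivative \<sigma> * (q u)\<^sup>2 / 2) (at u within {T..T'})"
      using q(4)[OF u] unfolding q_def[abs_def]
      by (auto intro!: derivative_eq_intros simp: power2_eq_square)
    have "\<sigma> * q u / 2 < 2 * \<sigma> * (q u / 2) - (q u + \<Delta>) ^ 3 / 4"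
      using rate[OF q(1,2)[OF u]] by simp
    from mult_strict_left_mono[OF this q(3)[OF u]]
    show "\<sigma> * (q u)\<^sup>2 / 2 < q u * (2 * \<sigma> * (q u / 2) - (q u + norm (D 0)) ^ 3 / 4)"
      by (simp add: \<Delta>_def power2_eq_square mult_ac)
    show "low d (sqrt (q u / 2)) (W1 u)" if "low d (q u) (P u)" using kP[OF _ _ that] q[OF u] u T by simp
  next
    fix X :: "'a fm" assume "X \<in> sph d" then show "q T < norm (P T * X)" using PT by (simp add: q_def)
  qed (use T' in auto)
  moreover have "\<sigma> * (T' - T) / 2 = 2 / s - 4 / sqrt \<sigma>" using \<sigma> by (simp add: T'_def)
  then have "q T' = 1 / (2 / s - (2 / s - 4 / sqrt \<sigma>))" by (simp only: q_def)
  then have "q T' = sqrt \<sigma> / 4" by simp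
  ultimately have lowT': "low d (sqrt \<sigma> / 4) (P T')" by simp
  show ?thesis
  \<comment> \<open>The barrier is lowered from 1/4 to 1/5 because the comparison needs a strict
    inequality at its start.\<close>
  proof (rule P_lower[of T' t "\<lambda>_. sqrt \<sigma> / 5" "\<lambda>_. 0" "\<lambda>_. sqrt \<sigma> / 5 / 2"])
    fix u assume u: "T' \<le> u" "u \<le> t"
    have "(sqrt \<sigma> / 5 + \<Delta>) ^ 3 / 4 < \<sigma> * (sqrt \<sigma> / 5) / 2"
      by (rule rate) (use s \<sigma> in auto)
    moreover have "\<sigma> * (sqrt \<sigma> / 5) > 0" using \<sigma> by simp
    ultimately have "2 * \<sigma> * (sqrt \<sigma> / 5 / 2) - (sqrt \<sigma> / 5 + \<Delta>) ^ 3 / 4 > 0" by simp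
    then show "0 < sqrt \<sigma> / 5 * (2 * \<sigma> * (sqrt \<sigma> / 5 / 2) - (sqrt \<sigma> / 5 + norm (D 0)) ^ 3 / 4)"
      using \<sigma> by (simp add: \<Delta>_def)
    show "low d (sqrt (sqrt \<sigma> / 5 / 2)) (W1 u)" if "low d (sqrt \<sigma> / 5) (P u)"
      using kP[OF _ _ that] u T' T \<sigma> by simp
  next
    fix X :: "'a fm" assume "X \<in> sph d"
    then have "sqrt \<sigma> / 4 \<le> norm (P T' * X)" using lowD[OF lowT', of X] by (simp add: sph_def)
    with real_sqrt_gt_zero[OF \<sigma>] show "sqrt \<sigma> / 5 < norm (P T' * X)" by linarith
  qed (use T T' t \<sigma> in auto)
qed

text \<open>The two growth phases take at most 1/2 and 4 units of
  \<open>1 / (\<sigma> * sqrt (m * p))\<close>. The smallness hypothesis serves both of them, and it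
  also forces \<open>m\<close> to be at most a third of \<open>sqrt \<sigma>\<close>, which the
  later phase requires of its starting value.\<close>

theorem convergence:
  assumes p: "0 < p" "p \<le> m"
    and N0: "\<And>X. X \<in> sph d \<Longrightarrow> m < (norm (W1 0 * X))\<^sup>2"
    and P0: "\<And>X. X \<in> sph d \<Longrightarrow> p < norm (P 0 * X)"
    and small: "9 * (m + norm (D 0)) ^ 3 \<le> \<sigma> * sqrt (m * p)"
    and L0: "L 0 \<le> d * \<sigma>\<^sup>2"
    and T1: "T1 \<ge> 5 / (\<sigma> * sqrt (m * p)) + 125 * ln (18 * d) / (\<sigma> * sqrt \<sigma>)" and t: "t \<ge> T1"
  shows "L t < d * \<sigma>\<^sup>2 * exp (- (8 * (\<sigma> * sqrt \<sigma>) * (t - T1)))"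
proof -
  define s where "s = sqrt (m * p)"
  have m: "m > 0" using p by simp
  have s: "s > 0" using p m by (simp add: s_def)
  have sm: "s \<le> m" using p m mult_left_mono[of p m m] unfolding s_def
    by (intro real_le_lsqrt) (auto simp: power2_eq_square)
  obtain T where T: "0 \<le> T" "T \<le> 1 / (2 * \<sigma> * s)" "\<And>X. X \<in> sph d \<Longrightarrow> s / 2 < norm (P T * X)"
    using P_growth_early[OF p N0 P0 small] unfolding s_def by blast
  have "9 * m ^ 3 \<le> 9 * (m + norm (D 0)) ^ 3" "9 * (norm (D 0)) ^ 3 \<le> 9 * (m + norm (D 0)) ^ 3"
    using m by (auto intro!: power_mono)
  then have sm': "9 * m ^ 3 \<le> \<sigma> * s" "9 * (norm (D 0)) ^ 3 \<le> \<sigma> * s" using small by (auto simp: s_def)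
  have "9 * m\<^sup>2 * m \<le> \<sigma> * m"
    using order_trans[OF sm'(1) mult_left_mono[OF sm, of \<sigma>]] \<sigma> by (simp add: power2_eq_square power3_eq_cube mult.assoc)
  then have "(3 * m)\<^sup>2 \<le> \<sigma>" using m by (simp add: power_mult_distrib)
  then have "3 * m \<le> sqrt \<sigma>" by (rule real_le_rsqrt)
  then have s3: "s \<le> sqrt \<sigma> / 3" using sm by simp
  let ?T0 = "T + 4 / (\<sigma> * s)"
  have "T \<le> 1 / (\<sigma> * s)" using T(2) s \<sigma> by (simp add: field_simps)
  then have "?T0 \<le> 1 / (\<sigma> * s) + 4 / (\<sigma> * s)" by simp
  also have "\<dots> = 5 / (\<sigma> * s)" by (simp add: add_divide_distrib[symmetric])
  finally have T0: "?T0 \<le> 5 / (\<sigma> * s)" .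
  have T00: "0 \<le> ?T0" using T s \<sigma> by simp
  show ?thesis
  proof (rule loss_decay[OF T00 _ _ _ t])
    show "low d (sqrt \<sigma> / 5) (P t)" if "t \<ge> ?T0" for t
      using P_growth_late[OF T(1) s s3 T(3) sm'(2) that] .
    show "L ?T0 \<le> d * \<sigma>\<^sup>2" using L_nonincreasing[OF order_refl T00] L0 by simp
    show "T1 \<ge> ?T0 + 125 * ln (18 * d) / (\<sigma> * sqrt \<sigma>)" using T1 T0 by (simp add: s_def)
  qed
qed

text \<open>Run backwards in time, the equation for \<^term>\<open>P\<close> cannot make a nonsingular matrix singular.\<close>

lemma P_singular_persists:
  assumes X0: "X0 \<in> sph d" "P 0 * X0 = 0" and t1: "0 \<le> t1"
  obtains X where "X \<in> sph d" "P t1 * X = 0"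
proof (rule ccontr)
  note rule = that
  assume no: "\<not> thesis"
  have nz: "P t1 * X \<noteq> 0" if "X \<in> sph d" for X using rule[OF that] no by blast
  have "continuous_on (sph d) (\<lambda>X. norm (P t1 * X))" by (intro continuous_intros)
  then obtain Y where Y: "Y \<in> sph d" "\<And>X. X \<in> sph d \<Longrightarrow> norm (P t1 * Y) \<le> norm (P t1 * X)"
    using continuous_attains_inf[OF compact_sph sph_nonempty[OF d]] by blast
  define q0 where "q0 = norm (P t1 * Y)"
  have q0: "q0 > 0" using nz[OF Y(1)] by (simp add: q0_def)
  have cW: "continuous_on {0..t1} W1" "continuous_on {0..t1} W4"
    using continuous_on_subset[OF continuous_W(1), of "{0..t1}"] continuous_on_subset[OF continuous_W(4), of "{0..t1}"]
    by auto
  have cadj: "continuous_on {0..t1} (\<lambda>t. adj (F t))" if "continuous_on {0..t1} F" for F :: "real \<Rightarrow> 'a fm"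
    by (rule bounded_linear.continuous_on[OF bounded_linear_adj that])
  have "continuous_on {0..t1} (\<lambda>t. norm (K t + N t))"
    unfolding K_def N_def by (intro continuous_on_norm continuous_on_add continuous_on_mult cadj cW)
  then obtain u where u: "\<And>t. t \<in> {0..t1} \<Longrightarrow> norm (K t + N t) \<le> norm (K u + N u)"
    using continuous_attains_sup[of "{0..t1}" "\<lambda>t. norm (K t + N t)"] t1 by force
  define c where "c = norm (K u + N u)"
  have c: "norm (K t + N t) \<le> c" if "0 \<le> t" "t \<le> t1" for t using u[of t] that by (simp add: c_def)
  \<comment> \<open>Forward in time \<open>(norm (P t * X))\<^sup>2\<close> grows at logarithmic
    rate at most \<open>2 * \<sigma> * c\<close> at a minimizer. In reversed time a barrier decaying
    at a strictly larger rate cannot be touched, and it is positive at the end.\<close>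
  define C where "C = 2 * \<sigma> * c + 1"
  define v where "v s = q0\<^sup>2 / 2 * exp (- C * s)" for s
  have v: "v s > 0" for s using q0 by (simp add: v_def)
  have "(norm (P (t1 - t1) * X0))\<^sup>2 - v t1 > 0"
  proof (rule crossing[OF compact_sph[of d], of 0 t1 "\<lambda>s X. (norm (P (t1 - s) * X))\<^sup>2 - v s"])
    have "continuous_on {0..t1} (\<lambda>s. t1 - s)" by (intro continuous_intros)
    then have "continuous_on {0..t1} (\<lambda>s. P (t1 - s))"
      by (rule continuous_on_compose2[OF continuous_P]) auto
    then have "continuous_on ({0..t1} \<times> (sph d :: 'a fm set)) (\<lambda>p. P (t1 - fst p))"
      by (rule continuous_on_compose2[OF _ continuous_on_fst[OF continuous_on_id]]) auto
    then show "continuous_on ({0..t1} \<times> sph d) (\<lambda>(s, X). (norm (P (t1 - s) * X))\<^sup>2 - v s)"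
      unfolding case_prod_beta v_def by (intro continuous_intros)
    fix X :: "'a fm" assume X: "X \<in> sph d"
    have "q0\<^sup>2 \<le> (norm (P t1 * X))\<^sup>2" using Y(2)[OF X] q0 by (intro power_mono) (auto simp: q0_def)
    moreover have "v 0 < q0\<^sup>2" using q0 by (simp add: v_def)
    ultimately show "0 < (norm (P (t1 - 0) * X))\<^sup>2 - v 0" by simp
  next
    fix s and X :: "'a fm"
    assume s: "0 < s" "s \<le> t1" and X: "X \<in> sph d" "(norm (P (t1 - s) * X))\<^sup>2 - v s = 0"
      and ge: "\<And>Y. Y \<in> sph d \<Longrightarrow> 0 \<le> (norm (P (t1 - s) * Y))\<^sup>2 - v s"
    define t where "t = t1 - s"
    have t: "t \<ge> 0" "t \<le> t1" using s by (auto simp: t_def)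
    have PPX: "adj (P t) * P t * X = v s *\<^sub>R X"
      using X ge by (intro gram_min[OF supps(6)[OF t(1)]]) (force simp: t_def)+
    have X1: "norm X = 1" using X by (simp add: sph_def)
    let ?P' = "\<sigma> *\<^sub>R (P t * (K t + N t)) - 2 *\<^sub>R (M t * M t * M t * P t)"
    have "inner (P t * X) (P t * (K t + N t) * X) = inner (adj (P t) * P t * X) ((K t + N t) * X)"
      using inner_mult_left_adj[of "adj (P t)" "P t * X" "(K t + N t) * X"] by (simp add: mult.assoc)
    also have "\<dots> = v s * inner X ((K t + N t) * X)" by (simp add: PPX)
    also have "\<dots> \<le> v s * (norm X * norm ((K t + N t) * X))"
      using v[of s] by (intro mult_left_mono norm_cauchy_schwarz) auto
    also have "\<dots> \<le> v s * (1 * (c * 1))"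
      using v[of s] c[OF t] order_trans[OF norm_mult_ineq[of "K t + N t" X]] X1
      by (intro mult_left_mono) auto
    finally have 1: "inner (P t * X) (P t * (K t + N t) * X) \<le> v s * c" by simp
    have "inner (P t * X) (?P' * X) = \<sigma> * inner (P t * X) (P t * (K t + N t) * X)
        - 2 * inner (P t * X) (M t * M t * M t * (P t * X))"
      by (simp only: left_diff_distrib inner_diff_right mult_scaleR_left inner_scaleR_right mult.assoc)
    also have "\<dots> \<le> \<sigma> * (v s * c)"
      using M3_nonneg[OF t(1), of "P t * X"] mult_left_mono[OF 1, of \<sigma>] \<sigma> by linarith
    finally have "2 * inner (P t * X) (?P' * X) \<le> 2 * \<sigma> * c * v s" by (simp add: mult_ac)
    then have pos: "2 * inner (P t * X) (?P' * X) * (- 1) + C * v s > 0"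
      using v[of s] by (simp add: C_def algebra_simps)
    have im: "(\<lambda>s. t1 - s) ` {0..t1} \<subseteq> {0..}" by auto
    have "((\<lambda>t. (norm (P t * X))\<^sup>2) has_real_derivative 2 * inner (P t * X) (?P' * X)) (at (t1 - s) within (\<lambda>s. t1 - s) ` {0..t1})"
      unfolding t_def[symmetric]
      by (rule has_derivative_norm_mult_sq, rule has_vector_derivative_within_subset[OF deriv_P[OF t(1)] im])
    moreover have "((\<lambda>s. t1 - s) has_real_derivative -1) (at s within {0..t1})"
      by (auto intro!: derivative_eq_intros)
    ultimately
    have "((\<lambda>s. (norm (P (t1 - s) * X))\<^sup>2) has_real_derivative 2 * inner (P t * X) (?P' * X) * (- 1)) (at s within {0..t1})"
      using DERIV_image_chain[of "\<lambda>t. (norm (P t * X))\<^sup>2" _ "\<lambda>s. t1 - s" s "{0..t1}" "-1"] by (simp only: o_def)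
    moreover have "(v has_real_derivative - (C * v s)) (at s within {0..t1})"
      unfolding v_def[abs_def] by (auto intro!: derivative_eq_intros)
    ultimately have "((\<lambda>s. (norm (P (t1 - s) * X))\<^sup>2 - v s) has_real_derivative
        2 * inner (P t * X) (?P' * X) * (- 1) - (- (C * v s))) (at s within {0..t1})"
      by (rule DERIV_diff)
    then show "\<exists>D>0. ((\<lambda>s. (norm (P (t1 - s) * X))\<^sup>2 - v s) has_real_derivative D) (at s within {0..t1})"
      using pos by (intro exI[of _ "2 * inner (P t * X) (?P' * X) * (- 1) - (- (C * v s))"]) simp
  qed (use X0 t1 in auto)
  then show False using X0 v[of t1] by simp
qed

text \<open>A kernel vector \<open>X\<close> of \<open>P t\<close> satisfies
  \<open>A t * X = - (adj (B t) * X)\<close>, so the product is negative semidefinite along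
  \<open>X\<close>. Hence \<open>inner X (R t * X)\<close> is at least \<sigma>.\<close>

lemma loss_lower_bound:
  assumes X0: "X0 \<in> sph d" "P 0 * X0 = 0" and t: "0 \<le> t"
  shows "L t \<ge> 1 / 2 * \<sigma>\<^sup>2"
proof -
  obtain X where X: "X \<in> sph d" "P t * X = 0" using P_singular_persists[OF X0 t] .
  then have AX: "A t * X = - (adj (B t) * X)" by (simp add: P_def distrib_right eq_neg_iff_add_eq_0)
  have sX: "supp_le d X" "norm X = 1" using X by (auto simp: sph_def)
  have "R t * X = \<sigma> *\<^sub>R X + B t * (adj (B t) * X)"
    by (simp add: R_eq left_diff_distrib one_fm_mult sX mult.assoc AX)
  then have "inner X (R t * X) = \<sigma> + (norm (adj (B t) * X))\<^sup>2"
    using norm_mult_sq[of "adj (B t)" X] power2_norm_eq_inner[of X] by (simp add: inner_add_right sX mult.assoc)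
  moreover have "inner X (R t * X) \<le> norm X * (norm (R t) * norm X)"
    using order_trans[OF norm_cauchy_schwarz[of X "R t * X"] mult_left_mono[OF norm_mult_ineq]] by simp
  ultimately have "\<sigma> \<le> norm (R t)" using zero_le_power2[of "norm (adj (B t) * X)"] unfolding sX by linarith
  then have "\<sigma>\<^sup>2 \<le> (norm (R t))\<^sup>2" using \<sigma> by (intro power_mono) auto
  then show ?thesis by (simp add: L_def)
qed

end

section \<open>Reduction of the gradient flow to a balanced flow\<close>

lemma inner_adj_swap:
  fixes X Y Z :: "'a::rc_field fm"
  shows inner_left_swap: "inner Y (X * Z) = inner (adj X * Y) Z"
    and inner_right_swap: "inner Y (Z * X) = inner (Y * adj X) Z"
  using inner_mult_left_adj[of "adj X" Y Z] inner_mult_right_adj[of Y "adj X" Z] by simp_all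

lemma inner_hermitian: "adj H = H \<Longrightarrow> inner H (adj X) = inner H (X :: 'a::rc_field fm)"
  using inner_adj[of H X] by simp

lemma has_derivative_norm_sq:
  fixes F :: "real \<Rightarrow> 'a::rc_field fm"
  assumes "(F has_vector_derivative F') (at t within S)"
  shows "((\<lambda>t. (norm (F t))\<^sup>2) has_real_derivative 2 * inner (F t) F') (at t within S)"
  using bounded_bilinear.has_vector_derivative[OF bounded_bilinear_inner assms assms]
  by (simp add: power2_norm_eq_inner has_real_derivative_iff_has_vector_derivative inner_commute)

lemma has_derivative_product4:
  fixes F1 F2 F3 F4 :: "real \<Rightarrow> 'a::rc_field fm"
  assumes F: "(F1 has_vector_derivative E1) (at t within S)" "(F2 has_vector_derivative E2) (at t within S)"
    "(F3 has_vector_derivative E3) (at t within S)" "(F4 has_vector_derivative E4) (at t within S)"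
  shows "((\<lambda>t. 1 / 2 * (norm (F4 t * F3 t * F2 t * F1 t - Z))\<^sup>2) has_real_derivative
    inner (adj (F4 t * F3 t * F2 t) * (F4 t * F3 t * F2 t * F1 t - Z)) E1
    + inner (adj (F4 t * F3 t) * (F4 t * F3 t * F2 t * F1 t - Z) * adj (F1 t)) E2
    + inner (adj (F4 t) * (F4 t * F3 t * F2 t * F1 t - Z) * adj (F2 t * F1 t)) E3
    + inner ((F4 t * F3 t * F2 t * F1 t - Z) * adj (F3 t * F2 t * F1 t)) E4) (at t within S)"
proof -
  let ?R = "F4 t * F3 t * F2 t * F1 t - Z"
  let ?E = "F4 t * F3 t * F2 t * E1 + (F4 t * F3 t * E2 + (F4 t * E3 + E4 * F3 t) * F2 t) * F1 t"
  have "((\<lambda>t. F4 t * F3 t * F2 t * F1 t - Z) has_vector_derivative ?E - 0) (at t within S)"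
    by (intro has_vector_derivative_diff has_vector_derivative_mult has_vector_derivative_const F)
  from DERIV_cmult[OF has_derivative_norm_sq[OF this], of "1 / 2"]
  have d: "((\<lambda>t. 1 / 2 * (norm (F4 t * F3 t * F2 t * F1 t - Z))\<^sup>2) has_real_derivative inner ?R ?E) (at t within S)"
    by simp
  have "inner ?R (F4 t * F3 t * F2 t * E1) = inner (adj (F4 t * F3 t * F2 t) * ?R) E1"
    by (rule inner_left_swap)
  moreover have "inner ?R (F4 t * F3 t * E2 * F1 t) = inner (adj (F4 t * F3 t) * ?R * adj (F1 t)) E2"
    by (subst inner_right_swap, subst inner_left_swap) (simp add: mult.assoc)
  moreover have "inner ?R (F4 t * E3 * F2 t * F1 t) = inner (adj (F4 t) * ?R * adj (F2 t * F1 t)) E3"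
    by (subst inner_right_swap, subst inner_right_swap, subst inner_left_swap) (simp add: mult.assoc)
  moreover have "inner ?R (E4 * F3 t * F2 t * F1 t) = inner (?R * adj (F3 t * F2 t * F1 t)) E4"
    by (subst inner_right_swap, subst inner_right_swap, subst inner_right_swap) (simp add: mult.assoc)
  ultimately have "inner ?R ?E = inner (adj (F4 t * F3 t * F2 t) * ?R) E1
    + inner (adj (F4 t * F3 t) * ?R * adj (F1 t)) E2
    + inner (adj (F4 t) * ?R * adj (F2 t * F1 t)) E3 + inner (?R * adj (F3 t * F2 t * F1 t)) E4"
    by (simp only: distrib_right inner_add_right)
  with d show ?thesis by simp
qed

definition imb :: "'a::rc_field fm \<Rightarrow> 'a fm \<Rightarrow> 'a fm" where
  "imb X Y = X * adj X - adj Y * Y"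

lemma adj_imb: "adj (imb X Y) = imb X Y"
  by (simp add: imb_def)

lemma has_derivative_imb:
  fixes X Y :: "real \<Rightarrow> 'a::rc_field fm"
  assumes X: "(X has_vector_derivative X') (at t within S)" and Y: "(Y has_vector_derivative Y') (at t within S)"
  shows "((\<lambda>t. 1 / 4 * (norm (imb (X t) (Y t)))\<^sup>2) has_real_derivative
    inner (imb (X t) (Y t) * X t) X' - inner (Y t * imb (X t) (Y t)) Y') (at t within S)"
proof -
  let ?D = "imb (X t) (Y t)"
  have "((\<lambda>t. imb (X t) (Y t)) has_vector_derivative
      (X t * adj X' + X' * adj (X t)) - (adj (Y t) * Y' + adj Y' * Y t)) (at t within S)"
    unfolding imb_def
    by (intro has_vector_derivative_diff has_vector_derivative_mult
        bounded_linear.has_vector_derivative[OF bounded_linear_adj] X Y)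
  from DERIV_cmult[OF has_derivative_norm_sq[OF this], of "1 / 4"]
  have d: "((\<lambda>t. 1 / 4 * (norm (imb (X t) (Y t)))\<^sup>2) has_real_derivative
      1 / 2 * inner ?D ((X t * adj X' + X' * adj (X t)) - (adj (Y t) * Y' + adj Y' * Y t))) (at t within S)"
    by simp
  have "inner ?D (X t * adj X') = inner ?D (X' * adj (X t))"
    using inner_hermitian[OF adj_imb, of "X t" "Y t" "X' * adj (X t)"] by simp
  moreover have "inner ?D (adj Y' * Y t) = inner ?D (adj (Y t) * Y')"
    using inner_hermitian[OF adj_imb, of "X t" "Y t" "adj (Y t) * Y'"] by simp
  moreover have "inner ?D (X' * adj (X t)) = inner (?D * X t) X'"
    by (subst inner_right_swap) simp
  moreover have "inner ?D (adj (Y t) * Y') = inner (Y t * ?D) Y'"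
    by (subst inner_left_swap) simp
  ultimately show ?thesis by (intro DERIV_cong[OF d]) (simp add: inner_diff_right inner_add_right)
qed

text \<open>The gradient of the imbalance energy has three shapes: the first and the last factor
  occur in one imbalance, each inner factor in two.\<close>

definition imb_grad1 :: "'a::rc_field fm \<Rightarrow> 'a fm \<Rightarrow> 'a fm" where
  "imb_grad1 F1 F2 = imb F1 F2 * F1"
definition imb_grad :: "'a::rc_field fm \<Rightarrow> 'a fm \<Rightarrow> 'a fm \<Rightarrow> 'a fm" where
  "imb_grad F1 F2 F3 = imb F2 F3 * F2 - F2 * imb F1 F2"
definition imb_grad4 :: "'a::rc_field fm \<Rightarrow> 'a fm \<Rightarrow> 'a fm" where
  "imb_grad4 F3 F4 = - (F4 * imb F3 F4)"

lemma has_derivative_imbalance: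
  fixes F1 F2 F3 F4 :: "real \<Rightarrow> 'a::rc_field fm"
  assumes F: "(F1 has_vector_derivative E1) (at t within S)" "(F2 has_vector_derivative E2) (at t within S)"
    "(F3 has_vector_derivative E3) (at t within S)" "(F4 has_vector_derivative E4) (at t within S)"
  shows "((\<lambda>t. 1 / 4 * (norm (imb (F1 t) (F2 t)))\<^sup>2 + 1 / 4 * (norm (imb (F2 t) (F3 t)))\<^sup>2
      + 1 / 4 * (norm (imb (F3 t) (F4 t)))\<^sup>2) has_real_derivative
    inner (imb_grad1 (F1 t) (F2 t)) E1 + inner (imb_grad (F1 t) (F2 t) (F3 t)) E2
    + inner (imb_grad (F2 t) (F3 t) (F4 t)) E3 + inner (imb_grad4 (F3 t) (F4 t)) E4) (at t within S)"
  by (rule DERIV_cong[OF DERIV_add[OF DERIV_add[OF has_derivative_imb[OF F(1,2)] has_derivative_imb[OF F(2,3)]]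
        has_derivative_imb[OF F(3,4)]]])
    (simp add: imb_grad1_def imb_grad_def imb_grad4_def inner_diff_left)

definition loss_fm :: "real \<Rightarrow> 'a::rc_field fm \<Rightarrow> 'a fm \<Rightarrow> 'a fm \<Rightarrow> 'a fm \<Rightarrow> 'a fm \<Rightarrow> real" where
  "loss_fm a Z F1 F2 F3 F4 = 1 / 2 * (norm (F4 * F3 * F2 * F1 - Z))\<^sup>2
    + a * (1 / 4 * (norm (imb F1 F2))\<^sup>2 + 1 / 4 * (norm (imb F2 F3))\<^sup>2 + 1 / 4 * (norm (imb F3 F4))\<^sup>2)"

lemma mult_carrier_square:
  "A \<in> carrier_mat d d \<Longrightarrow> B \<in> carrier_mat d d \<Longrightarrow> A * B \<in> carrier_mat d d"
  by (rule mult_carrier_mat)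

lemma Fm_imb:
  "A \<in> carrier_mat d d \<Longrightarrow> B \<in> carrier_mat d d \<Longrightarrow>
    frob_sq (A * mat_adjoint A - mat_adjoint B * B) = (norm (imb (Fm d A) (Fm d B)))\<^sup>2"
  by (subst frob_sq_Fm[of _ d]) (simp_all add: imb_def Fm_arith Fm_adjoint mult_carrier_square minus_carrier_mat)

lemma loss_eq_loss_fm:
  assumes "\<Sigma> \<in> carrier_mat d d" "\<forall>j\<in>{1..4}. W j \<in> carrier_mat d d"
  shows "loss a \<Sigma> W = loss_fm a (Fm d \<Sigma>) (Fm d (W 1)) (Fm d (W 2)) (Fm d (W 3)) (Fm d (W 4))"
proof -
  have W: "W 1 \<in> carrier_mat d d" "W 2 \<in> carrier_mat d d" "W 3 \<in> carrier_mat d d" "W 4 \<in> carrier_mat d d"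
    using assms(2) by auto
  have W': "W (Suc 0) \<in> carrier_mat d d" using W(1) by simp
  have "frob_sq (W 4 * W 3 * W 2 * W 1 - \<Sigma>) = (norm (Fm d (W 4) * Fm d (W 3) * Fm d (W 2) * Fm d (W 1) - Fm d \<Sigma>))\<^sup>2"
    using W W' assms(1) by (subst frob_sq_Fm[of _ d]) (simp_all add: Fm_arith mult_carrier_square minus_carrier_mat mult.assoc)
  moreover have "(\<Sum>j = 1..3. frob_sq (W j * mat_adjoint (W j) - mat_adjoint (W (j + 1)) * W (j + 1)))
    = (norm (imb (Fm d (W 1)) (Fm d (W 2))))\<^sup>2 + (norm (imb (Fm d (W 2)) (Fm d (W 3))))\<^sup>2
      + (norm (imb (Fm d (W 3)) (Fm d (W 4))))\<^sup>2"
  proof -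
    have "{1..3} = {1, 2, 3 :: nat}" by auto
    then show ?thesis using Fm_imb[OF W(1,2)] Fm_imb[OF W(2,3)] Fm_imb[OF W(3,4)] by (simp del: One_nat_def)
  qed
  ultimately show ?thesis by (simp add: loss_def loss_fm_def algebra_simps)
qed

definition grad_fm :: "real \<Rightarrow> 'a::rc_field fm \<Rightarrow> 'a fm \<Rightarrow> 'a fm \<Rightarrow> 'a fm \<Rightarrow> 'a fm \<Rightarrow> nat \<Rightarrow> 'a fm" where
  "grad_fm a Z F1 F2 F3 F4 j =
    (if j = 1 then adj (F4 * F3 * F2) * (F4 * F3 * F2 * F1 - Z) + a *\<^sub>R imb_grad1 F1 F2
     else if j = 2 then adj (F4 * F3) * (F4 * F3 * F2 * F1 - Z) * adj F1 + a *\<^sub>R imb_grad F1 F2 F3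
     else if j = 3 then adj F4 * (F4 * F3 * F2 * F1 - Z) * adj (F2 * F1) + a *\<^sub>R imb_grad F2 F3 F4
     else (F4 * F3 * F2 * F1 - Z) * adj (F3 * F2 * F1) + a *\<^sub>R imb_grad4 F3 F4)"

lemma has_derivative_loss_fm:
  fixes F1 F2 F3 F4 :: "real \<Rightarrow> 'a::rc_field fm"
  assumes F: "(F1 has_vector_derivative E1) (at t within S)" "(F2 has_vector_derivative E2) (at t within S)"
    "(F3 has_vector_derivative E3) (at t within S)" "(F4 has_vector_derivative E4) (at t within S)"
  shows "((\<lambda>t. loss_fm a Z (F1 t) (F2 t) (F3 t) (F4 t)) has_real_derivative
    inner (grad_fm a Z (F1 t) (F2 t) (F3 t) (F4 t) 1) E1 + inner (grad_fm a Z (F1 t) (F2 t) (F3 t) (F4 t) 2) E2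
    + inner (grad_fm a Z (F1 t) (F2 t) (F3 t) (F4 t) 3) E3 + inner (grad_fm a Z (F1 t) (F2 t) (F3 t) (F4 t) 4) E4)
    (at t within S)"
  unfolding loss_fm_def
  by (rule DERIV_cong[OF DERIV_add[OF has_derivative_product4[OF F] DERIV_cmult[OF has_derivative_imbalance[OF F]]]])
    (simp add: grad_fm_def inner_add_left algebra_simps)

lemma Fm_add_unit:
  assumes "A \<in> carrier_mat d d" "r < d" "c < d"
  shows "Fm d (A + mat_unit d r c x) = Fm d A + unit_fm r c (x :: 'a::rc_field)"
  using assms by (intro fm_eqI) (auto simp: ent_Fm ent_unit mat_unit_def)

lemma supp_le_grad_fm:
  assumes "supp_le d Z" "supp_le d F1" "supp_le d F2" "supp_le d F3" "supp_le d F4"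
  shows "supp_le d (grad_fm a Z F1 F2 F3 F4 j)"
  using assms unfolding grad_fm_def imb_grad_def imb_grad1_def imb_grad4_def imb_def
  by (auto intro!: supp_le_arith supp_le_mult supp_le_adj)

text \<open>Differentiating along an elementary matrix with entry \<open>b\<close> pairs the
  gradient with that matrix, which reads off the \<open>b\<close> component of one entry. Summing
  over \<open>Basis\<close> reassembles the entry, for both scalar fields at once.\<close>

lemma grad_wrt_loss:
  assumes \<Sigma>: "\<Sigma> \<in> carrier_mat d d" and W: "\<forall>j\<in>{1..4}. W j \<in> carrier_mat d d"
    and j: "j \<in> {1..4}" and rc: "r < d" "c < d"
  shows "grad_wrt d (loss a \<Sigma>) W j $$ (r, c) =
    ent (grad_fm a (Fm d \<Sigma>) (Fm d (W 1)) (Fm d (W 2)) (Fm d (W 3)) (Fm d (W 4)) j) r (c :: nat) "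
    (is "_ = ent ?G r c")
proof -
  have der: "deriv (\<lambda>h. loss a \<Sigma> (W(j := W j + mat_unit d r c (h *\<^sub>R b)))) 0 = inner (ent ?G r c) b" for b
  proof -
    let ?u = "unit_fm r c b"
    define f where "f k h = Fm d (W k) + (if k = j then h *\<^sub>R ?u else 0)" for k and h :: real
    have eq: "loss a \<Sigma> (W(j := W j + mat_unit d r c (h *\<^sub>R b))) = loss_fm a (Fm d \<Sigma>) (f 1 h) (f 2 h) (f 3 h) (f 4 h)" for h
    proof -
      let ?W = "W(j := W j + mat_unit d r c (h *\<^sub>R b))"
      have W': "\<forall>k\<in>{1..4}. ?W k \<in> carrier_mat d d" using W j by (auto simp: mat_unit_def)
      have *: "Fm d (?W k) = f k h" if "k \<in> {1..4}" for k
      proof (cases "k = j")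
        case True
        have "Fm d (W j + mat_unit d r c (h *\<^sub>R b)) = Fm d (W j) + unit_fm r c (h *\<^sub>R b)"
          using W j rc by (intro Fm_add_unit) auto
        also have "unit_fm r c (h *\<^sub>R b) = h *\<^sub>R ?u" by (rule fm_eqI) (simp add: ent_unit)
        finally show ?thesis using True by (simp add: f_def)
      qed (simp add: f_def)
      have "Fm d (?W 1) = f 1 h" "Fm d (?W 2) = f 2 h" "Fm d (?W 3) = f 3 h" "Fm d (?W 4) = f 4 h"
        by (rule *, simp)+
      then show ?thesis unfolding loss_eq_loss_fm[OF \<Sigma> W'] by (simp only:)
    qed
    have fd: "(f k has_vector_derivative (if k = j then ?u else 0)) (at 0)" for k
      unfolding f_def by (cases "k = j") (auto intro!: derivative_eq_intros)
    have f0: "f k 0 = Fm d (W k)" for k by (simp add: f_def)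
    have "((\<lambda>h. loss_fm a (Fm d \<Sigma>) (f 1 h) (f 2 h) (f 3 h) (f 4 h)) has_real_derivative inner ?G ?u) (at 0)"
    proof (rule DERIV_cong[OF has_derivative_loss_fm[OF fd fd fd fd]])
      have "j = 1 \<or> j = 2 \<or> j = 3 \<or> j = 4" using j by auto
      then show "inner (grad_fm a (Fm d \<Sigma>) (f 1 0) (f 2 0) (f 3 0) (f 4 0) 1) (if 1 = j then ?u else 0)
        + inner (grad_fm a (Fm d \<Sigma>) (f 1 0) (f 2 0) (f 3 0) (f 4 0) 2) (if 2 = j then ?u else 0)
        + inner (grad_fm a (Fm d \<Sigma>) (f 1 0) (f 2 0) (f 3 0) (f 4 0) 3) (if 3 = j then ?u else 0)
        + inner (grad_fm a (Fm d \<Sigma>) (f 1 0) (f 2 0) (f 3 0) (f 4 0) 4) (if 4 = j then ?u else 0)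
        = inner ?G ?u"
        by (elim disjE) (simp_all add: f0 del: One_nat_def)
    qed
    then have "deriv (\<lambda>h. loss_fm a (Fm d \<Sigma>) (f 1 h) (f 2 h) (f 3 h) (f 4 h)) 0 = inner ?G ?u"
      by (rule DERIV_imp_deriv)
    then show ?thesis unfolding eq by (simp add: inner_commute[of ?G] inner_unit inner_commute)
  qed
  show ?thesis using rc by (simp add: grad_wrt_def der euclidean_representation)
qed

lemma gradient_flow_fm:
  assumes gf: "gradient_flow d a \<Sigma> W" and \<Sigma>: "\<Sigma> \<in> carrier_mat d d" and t: "t \<ge> 0" and j: "j \<in> {1..4}"
  shows "((\<lambda>u. Fm d (W u j)) has_vector_derivative
    - grad_fm a (Fm d \<Sigma>) (Fm d (W t 1)) (Fm d (W t 2)) (Fm d (W t 3)) (Fm d (W t 4)) j) (at t within {0..})"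
proof -
  let ?G = "grad_fm a (Fm d \<Sigma>) (Fm d (W t 1)) (Fm d (W t 2)) (Fm d (W t 3)) (Fm d (W t 4)) j"
  have W: "\<forall>j\<in>{1..4}. W t j \<in> carrier_mat d d" using gf t unfolding gradient_flow_def by blast
  have "((\<lambda>u. W u j $$ (r, c)) has_vector_derivative - ent ?G r c) (at t within {0..})" if "r < d" "c < d" for r c
  proof -
    have "((\<lambda>u. W u j $$ (r, c)) has_vector_derivative - (grad_wrt d (loss a \<Sigma>) (W t) j $$ (r, c))) (at t within {0..})"
      using gf t j that unfolding gradient_flow_def by blast
    then show ?thesis unfolding grad_wrt_loss[OF \<Sigma> W j that] .
  qed
  then have "((\<lambda>u. \<Sum>r<d. \<Sum>c<d. unit_fm r c (W u j $$ (r, c))) has_vector_derivative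
      (\<Sum>r<d. \<Sum>c<d. unit_fm r c (- ent ?G r c))) (at t within {0..})"
    by (intro has_vector_derivative_sum bounded_linear.has_vector_derivative[OF bounded_linear_unit]) auto
  also have "(\<Sum>r<d. \<Sum>c<d. unit_fm r c (- ent ?G r c)) = - ?G"
  proof -
    have "supp_le d (- ?G)" by (intro supp_le_arith supp_le_grad_fm) auto
    from fm_expansion[OF this] show ?thesis by simp
  qed
  finally show ?thesis by (simp add: Fm_def)
qed

text \<open>The imbalance is a Lyapunov function: the product part of the flow is tangent to its level
  sets, and the regularizing part is a gradient descent for it.\<close>

lemma gradient_flow_stays_balanced:
  assumes gf: "gradient_flow d a \<Sigma> W" and \<Sigma>: "\<Sigma> \<in> carrier_mat d d" and a: "a \<ge> 0"
    and init: "\<And>j. j \<in> {1..3} \<Longrightarrow> imb (Fm d (W 0 j)) (Fm d (W 0 (j + 1))) = 0"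
    and t: "t \<ge> 0"
  shows "imb (Fm d (W t 1)) (Fm d (W t 2)) = 0" "imb (Fm d (W t 2)) (Fm d (W t 3)) = 0"
    "imb (Fm d (W t 3)) (Fm d (W t 4)) = 0"
proof -
  define F where "F j t = Fm d (W t j)" for j t
  define y where "y t = 1 / 4 * (norm (imb (F 1 t) (F 2 t)))\<^sup>2 + 1 / 4 * (norm (imb (F 2 t) (F 3 t)))\<^sup>2
      + 1 / 4 * (norm (imb (F 3 t) (F 4 t)))\<^sup>2" for t
  define g where "g t = (norm (imb_grad1 (F 1 t) (F 2 t)))\<^sup>2 + (norm (imb_grad (F 1 t) (F 2 t) (F 3 t)))\<^sup>2
      + (norm (imb_grad (F 2 t) (F 3 t) (F 4 t)))\<^sup>2 + (norm (imb_grad4 (F 3 t) (F 4 t)))\<^sup>2" for t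
  have "y t \<le> y 0"
  proof (rule nonincreasing_within[OF t, where g' = "\<lambda>t. - a * g t"])
    fix u assume u: "0 \<le> u" "u \<le> t"
    let ?R = "F 4 u * F 3 u * F 2 u * F 1 u - Fm d \<Sigma>"
    have der: "(F j has_vector_derivative - grad_fm a (Fm d \<Sigma>) (F 1 u) (F 2 u) (F 3 u) (F 4 u) j) (at u within {0..t})"
      if "j \<in> {1..4}" for j
      unfolding F_def[abs_def] by (rule has_vector_derivative_within_subset[OF gradient_flow_fm[OF gf \<Sigma> u(1) that]]) auto
    have d4: "(F 1 has_vector_derivative - grad_fm a (Fm d \<Sigma>) (F 1 u) (F 2 u) (F 3 u) (F 4 u) 1) (at u within {0..t})"
      "(F 2 has_vector_derivative - grad_fm a (Fm d \<Sigma>) (F 1 u) (F 2 u) (F 3 u) (F 4 u) 2) (at u within {0..t})"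
      "(F 3 has_vector_derivative - grad_fm a (Fm d \<Sigma>) (F 1 u) (F 2 u) (F 3 u) (F 4 u) 3) (at u within {0..t})"
      "(F 4 has_vector_derivative - grad_fm a (Fm d \<Sigma>) (F 1 u) (F 2 u) (F 3 u) (F 4 u) 4) (at u within {0..t})"
      by (rule der, simp)+
    define f1 where "f1 = F 1 u"
    define f2 where "f2 = F 2 u"
    define f3 where "f3 = F 3 u"
    define f4 where "f4 = F 4 u"
    note f = f1_def[symmetric] f2_def[symmetric] f3_def[symmetric] f4_def[symmetric]
    define R where "R = f4 * f3 * f2 * f1 - Fm d \<Sigma>"
    have gu: "g u = (norm (imb_grad1 f1 f2))\<^sup>2 + (norm (imb_grad f1 f2 f3))\<^sup>2
      + (norm (imb_grad f2 f3 f4))\<^sup>2 + (norm (imb_grad4 f3 f4))\<^sup>2"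
      unfolding g_def f ..
    have sl: "inner X (adj Y * V) = inner (Y * X) V" and sr: "inner X (V * adj Z) = inner (X * Z) V" for X Y Z V :: "'a fm"
      using inner_left_swap[of X "adj Y" V] inner_right_swap[of X V "adj Z"] by simp_all
    have "inner (imb_grad1 f1 f2) (adj (f4 * f3 * f2) * R) = inner (f4 * f3 * f2 * imb_grad1 f1 f2) R"
      "inner (imb_grad f1 f2 f3) (adj (f4 * f3) * R * adj f1) = inner (f4 * f3 * (imb_grad f1 f2 f3 * f1)) R"
      "inner (imb_grad f2 f3 f4) (adj f4 * R * adj (f2 * f1)) = inner (f4 * (imb_grad f2 f3 f4 * (f2 * f1))) R"
      "inner (imb_grad4 f3 f4) (R * adj (f3 * f2 * f1)) = inner (imb_grad4 f3 f4 * (f3 * f2 * f1)) R"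
      by (rule sl, subst sr, rule sl, subst sr, rule sl, rule sr)
    \<comment> \<open>Tangency: once all factors are multiplied out, each imbalance appears twice
      with opposite signs inside the four-factor product, so the sum telescopes to zero.\<close>
    moreover have "inner (f4 * f3 * f2 * imb_grad1 f1 f2) R + inner (f4 * f3 * (imb_grad f1 f2 f3 * f1)) R
      + inner (f4 * (imb_grad f2 f3 f4 * (f2 * f1))) R + inner (imb_grad4 f3 f4 * (f3 * f2 * f1)) R = 0"
      unfolding imb_grad1_def imb_grad_def imb_grad4_def
      by (simp add: left_diff_distrib right_diff_distrib inner_diff_left mult.assoc)
    ultimately have "inner (imb_grad1 f1 f2) (adj (f4 * f3 * f2) * R) + inner (imb_grad f1 f2 f3) (adj (f4 * f3) * R * adj f1)
      + inner (imb_grad f2 f3 f4) (adj f4 * R * adj (f2 * f1)) + inner (imb_grad4 f3 f4) (R * adj (f3 * f2 * f1)) = 0"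
      by simp
    then have eq: "inner (imb_grad1 f1 f2) (- grad_fm a (Fm d \<Sigma>) f1 f2 f3 f4 1)
      + inner (imb_grad f1 f2 f3) (- grad_fm a (Fm d \<Sigma>) f1 f2 f3 f4 2)
      + inner (imb_grad f2 f3 f4) (- grad_fm a (Fm d \<Sigma>) f1 f2 f3 f4 3)
      + inner (imb_grad4 f3 f4) (- grad_fm a (Fm d \<Sigma>) f1 f2 f3 f4 4) = - a * g u"
      unfolding grad_fm_def R_def[symmetric] gu
      by (simp add: inner_add_right power2_norm_eq_inner algebra_simps del: adj_mult)
    show "(y has_real_derivative - a * g u) (at u within {0..t})"
      unfolding y_def[abs_def] by (rule DERIV_cong[OF has_derivative_imbalance[OF d4]]) (unfold f eq, rule refl)
    show "- a * g u \<le> 0" using a by (simp add: g_def)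
  qed
  moreover have "y 0 = 0" using init[of 1] init[of 2] init[of 3] by (simp add: y_def F_def numeral_2_eq_2[symmetric])
  ultimately have "y t \<le> 0" by simp
  moreover have "(norm (imb (F 1 t) (F 2 t)))\<^sup>2 \<ge> 0" "(norm (imb (F 2 t) (F 3 t)))\<^sup>2 \<ge> 0"
    "(norm (imb (F 3 t) (F 4 t)))\<^sup>2 \<ge> 0" by simp_all
  ultimately have "(norm (imb (F 1 t) (F 2 t)))\<^sup>2 = 0" "(norm (imb (F 2 t) (F 3 t)))\<^sup>2 = 0"
    "(norm (imb (F 3 t) (F 4 t)))\<^sup>2 = 0"
    unfolding y_def by linarith+
  then show "imb (Fm d (W t 1)) (Fm d (W t 2)) = 0" "imb (Fm d (W t 2)) (Fm d (W t 3)) = 0"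
    "imb (Fm d (W t 3)) (Fm d (W t 4)) = 0" by (simp_all add: F_def)
qed

text \<open>Multiplying the fourth factor by \<open>adj U\<close> turns the target into a multiple
  of the identity. It changes neither the Gram matrix \<open>adj (W4) * W4\<close>, so balancedness
  survives, nor the norm of the residual.\<close>

lemma balanced_flow_of_gradient_flow:
  fixes \<Sigma> :: "'a::rc_field mat" and U :: "'a fm"
  assumes gf: "gradient_flow d a \<Sigma> W" and \<Sigma>: "\<Sigma> \<in> carrier_mat d d" and a: "a \<ge> 0"
    and d: "d > 0" and \<sigma>: "\<sigma> > 0"
    and U: "supp_le d U" "Fm d \<Sigma> = \<sigma> *\<^sub>R U" "adj U * U = one_fm d" "U * adj U = one_fm d"
    and init: "\<And>j. j \<in> {1..3} \<Longrightarrow> imb (Fm d (W 0 j)) (Fm d (W 0 (j + 1))) = 0"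
  shows "balanced_flow d \<sigma> (\<lambda>t. Fm d (W t 1)) (\<lambda>t. Fm d (W t 2)) (\<lambda>t. Fm d (W t 3)) (\<lambda>t. adj U * Fm d (W t 4))"
    and "t \<ge> 0 \<Longrightarrow> loss a \<Sigma> (W t) = balanced_flow.L d \<sigma> (\<lambda>t. Fm d (W t 1)) (\<lambda>t. Fm d (W t 2))
      (\<lambda>t. Fm d (W t 3)) (\<lambda>t. adj U * Fm d (W t 4)) t"
proof -
  let ?W1 = "\<lambda>t. Fm d (W t 1)" and ?W2 = "\<lambda>t. Fm d (W t 2)" and ?W3 = "\<lambda>t. Fm d (W t 3)"
    and ?W4 = "\<lambda>t. adj U * Fm d (W t 4)"
  define F where "F j t = Fm d (W t j)" for j t
  define R where "R t = \<sigma> *\<^sub>R U - F 4 t * F 3 t * F 2 t * F 1 t" for t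
  have sR: "supp_le d (R t)" for t unfolding R_def F_def using U by (intro supp_le_arith supp_le_mult) auto
  have R': "\<sigma> *\<^sub>R one_fm d - adj U * F 4 t * F 3 t * F 2 t * F 1 t = adj U * R t" for t
    by (simp add: R_def right_diff_distrib U mult.assoc)
  have UU: "U * (adj U * R t) = R t" for t
    using one_fm_mult[OF sR] by (simp add: U(4) flip: mult.assoc)
  have bal0: "imb (F 1 t) (F 2 t) = 0" "imb (F 2 t) (F 3 t) = 0" "imb (F 3 t) (F 4 t) = 0" if "t \<ge> 0" for t
    unfolding F_def using gradient_flow_stays_balanced[OF gf \<Sigma> a init that] by auto
  have flow: "(F j has_vector_derivative - grad_fm a (Fm d \<Sigma>) (F 1 t) (F 2 t) (F 3 t) (F 4 t) j) (at t within {0..})"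
    if "t \<ge> 0" "j \<in> {1..4}" for t j
    unfolding F_def[abs_def] by (rule gradient_flow_fm[OF gf \<Sigma> that])
  have flow': "(F 1 has_vector_derivative adj (F 4 t * F 3 t * F 2 t) * R t) (at t within {0..})"
    "(F 2 has_vector_derivative adj (F 4 t * F 3 t) * R t * adj (F 1 t)) (at t within {0..})"
    "(F 3 has_vector_derivative adj (F 4 t) * R t * adj (F 2 t * F 1 t)) (at t within {0..})"
    "(F 4 has_vector_derivative R t * adj (F 3 t * F 2 t * F 1 t)) (at t within {0..})" if t: "t \<ge> 0" for t
  proof -
    have "F 4 t * F 3 t * F 2 t * F 1 t - Fm d \<Sigma> = - R t" by (simp add: R_def U)
    then show "(F 1 has_vector_derivative adj (F 4 t * F 3 t * F 2 t) * R t) (at t within {0..})"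
      "(F 2 has_vector_derivative adj (F 4 t * F 3 t) * R t * adj (F 1 t)) (at t within {0..})"
      "(F 3 has_vector_derivative adj (F 4 t) * R t * adj (F 2 t * F 1 t)) (at t within {0..})"
      "(F 4 has_vector_derivative R t * adj (F 3 t * F 2 t * F 1 t)) (at t within {0..})"
      using flow[OF t, of 1] flow[OF t, of 2] flow[OF t, of 3] flow[OF t, of 4]
      by (simp_all add: grad_fm_def imb_grad1_def imb_grad_def imb_grad4_def bal0[OF t] del: One_nat_def)
  qed
  have W: "?W1 = F 1" "?W2 = F 2" "?W3 = F 3" "?W4 = (\<lambda>t. adj U * F 4 t)" by (auto simp: F_def)
  note R0_def = R_def
  interpret balanced_flow d \<sigma> "F 1" "F 2" "F 3" "\<lambda>t. adj U * F 4 t"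
  proof
    show "supp_le d (F 1 t)" "supp_le d (F 2 t)" "supp_le d (F 3 t)" "supp_le d (adj U * F 4 t)" for t
      using U(1) by (auto simp: F_def)
    fix t :: real assume t: "t \<ge> 0"
    note f = flow'[OF t]
    show "(F 1 has_vector_derivative adj (adj U * F 4 t * F 3 t * F 2 t) *
        (\<sigma> *\<^sub>R one_fm d - adj U * F 4 t * F 3 t * F 2 t * F 1 t)) (at t within {0..})"
      using f(1) unfolding R' by (simp add: mult.assoc UU)
    show "(F 2 has_vector_derivative adj (adj U * F 4 t * F 3 t) *
        (\<sigma> *\<^sub>R one_fm d - adj U * F 4 t * F 3 t * F 2 t * F 1 t) * adj (F 1 t)) (at t within {0..})"
    proof -
      have "adj (adj U * F 4 t * F 3 t) * (adj U * R t) * adj (F 1 t) = adj (F 4 t * F 3 t) * (U * (adj U * R t)) * adj (F 1 t)"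
        by (simp add: mult.assoc)
      then show ?thesis using f(2) unfolding R' UU by simp
    qed
    show "(F 3 has_vector_derivative adj (adj U * F 4 t) *
        (\<sigma> *\<^sub>R one_fm d - adj U * F 4 t * F 3 t * F 2 t * F 1 t) * adj (F 2 t * F 1 t)) (at t within {0..})"
    proof -
      have "adj (adj U * F 4 t) * (adj U * R t) * adj (F 2 t * F 1 t) = adj (F 4 t) * (U * (adj U * R t)) * adj (F 2 t * F 1 t)"
        by (simp add: mult.assoc)
      then show ?thesis using f(3) unfolding R' UU by simp
    qed
    show "((\<lambda>t. adj U * F 4 t) has_vector_derivative
        (\<sigma> *\<^sub>R one_fm d - adj U * F 4 t * F 3 t * F 2 t * F 1 t) * adj (F 3 t * F 2 t * F 1 t)) (at t within {0..})"
      using has_vector_derivative_mult_right[OF f(4), of "adj U"] unfolding R' by (simp add: mult.assoc)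
    show "F 1 t * adj (F 1 t) = adj (F 2 t) * F 2 t" "F 2 t * adj (F 2 t) = adj (F 3 t) * F 3 t"
      using bal0[OF t] by (simp_all add: imb_def)
    have "supp_le d (F 4 t)" by (simp add: F_def)
    then have "U * (adj U * F 4 t) = F 4 t" by (simp add: U(4) one_fm_mult flip: mult.assoc)
    then show "F 3 t * adj (F 3 t) = adj (adj U * F 4 t) * (adj U * F 4 t)"
      using bal0(3)[OF t] by (simp add: imb_def mult.assoc)
  qed (use d \<sigma> in auto)
  show "balanced_flow d \<sigma> ?W1 ?W2 ?W3 ?W4" unfolding W by (rule balanced_flow_axioms)
  show "loss a \<Sigma> (W t) = balanced_flow.L d \<sigma> ?W1 ?W2 ?W3 ?W4 t" if t: "t \<ge> 0"
  proof -
    have "\<forall>j\<in>{1..4}. W t j \<in> carrier_mat d d" using gf t unfolding gradient_flow_def by blast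
    then have "loss a \<Sigma> (W t) = 1 / 2 * (norm (- R t))\<^sup>2"
      using norm_minus_commute[of "F 4 t * F 3 t * F 2 t * F 1 t" "\<sigma> *\<^sub>R U"]
      by (simp add: loss_eq_loss_fm[OF \<Sigma>] loss_fm_def bal0[OF t] R0_def U F_def[symmetric] del: One_nat_def)
    moreover have "(norm (adj U * R t))\<^sup>2 = (norm (R t))\<^sup>2"
      unfolding norm_mult_sq using one_fm_mult[OF sR] by (simp add: U(4) power2_norm_eq_inner)
    ultimately show ?thesis
      unfolding W L_def balanced_flow.R_def[OF balanced_flow_axioms] R' by simp
  qed
qed

text \<open>The unit matrix \<open>X\<close> has a nonzero column, and each column satisfies the
  eigenvalue equation on its own.\<close>

lemma eigenvalue_of_fm:
  assumes A: "A \<in> carrier_mat d d" and X: "X \<in> sph d" "Fm d A * X = l *\<^sub>R X"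
  shows "eigenvalue A (of_real l :: 'a::rc_field)"
proof -
  have sX: "supp_le d X" "X \<noteq> 0" using X by (auto simp: sph_def)
  then obtain i j where ij: "ent X i j \<noteq> 0" by (metis ent_simps(1) fm_eqI)
  then have i: "i < d" using supp_leD[OF sX(1), of i j] by (meson not_less)
  define v where "v = vec d (\<lambda>i. ent X i j)"
  have "v \<noteq> 0\<^sub>v d"
  proof
    assume "v = 0\<^sub>v d"
    then have "v $ i = 0" using i by simp
    then show False using ij i by (simp add: v_def)
  qed
  moreover have "A *\<^sub>v v = of_real l \<cdot>\<^sub>v v"
  proof (rule eq_vecI)
    fix k assume "k < dim_vec (of_real l \<cdot>\<^sub>v v)"
    then have k: "k < d" by (simp add: v_def)
    have "(A *\<^sub>v v) $ k = (\<Sum>m<d. A $$ (k, m) * ent X m j)"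
      using A k by (simp add: v_def scalar_prod_def atLeast0LessThan)
    also have "\<dots> = ent (Fm d A * X) k j"
      unfolding ent_mult[OF supp_le_Fm] using k by (intro sum.cong) (auto simp: ent_Fm)
    also have "\<dots> = (of_real l \<cdot>\<^sub>v v) $ k" unfolding X(2) using k by (simp add: v_def scaleR_conv_of_real)
    finally show "(A *\<^sub>v v) $ k = (of_real l \<cdot>\<^sub>v v) $ k" .
  qed (use A in \<open>simp add: v_def\<close>)
  ultimately show ?thesis
    unfolding eigenvalue_def eigenvector_def using A by (intro exI[of _ v]) (auto simp: v_def)
qed

text \<open>The square root of every eigenvalue of \<open>H = adj S * S\<close> is a singular value,
  so both the least and the greatest eigenvalue equal \<sigma>^2; the greatest is found by
  minimizing the form of \<open>- H\<close>. Hence \<open>H\<close> is scalar. Squareness supplies a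
  right inverse, which gives the identity for \<open>S * adj S\<close>.\<close>

lemma scaled_unitary_of_singular_values:
  fixes \<Sigma> :: "'a::rc_field mat"
  assumes \<Sigma>: "\<Sigma> \<in> carrier_mat d d" and d: "d > 0" and \<sigma>: "\<sigma> > 0"
    and sv: "\<forall>s\<in>singular_values \<Sigma>. s = \<sigma>"
  obtains U where "supp_le d U" "Fm d \<Sigma> = \<sigma> *\<^sub>R U" "adj U * U = one_fm d" "U * adj U = one_fm d"
proof -
  define S where "S = Fm d \<Sigma>"
  define H where "H = adj S * S"
  have S: "supp_le d S" by (simp add: S_def)
  have H: "supp_le d H" "adj H = H" using S by (auto simp: H_def)
  have FH: "Fm d (mat_adjoint \<Sigma> * \<Sigma>) = H" "mat_adjoint \<Sigma> * \<Sigma> \<in> carrier_mat d d"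
    using \<Sigma> by (auto simp: H_def S_def Fm_arith Fm_adjoint intro!: mult_carrier_square)
  have ev: "l = \<sigma>\<^sup>2" if X: "X \<in> sph d" "H * X = l *\<^sub>R X" for l X
  proof -
    have "inner X X = 1" using X(1) power2_norm_eq_inner[of X] by (simp add: sph_def)
    then have l: "l = (norm (S * X))\<^sup>2" using X(2) unfolding norm_mult_sq H_def by simp
    have "eigenvalue (mat_adjoint \<Sigma> * \<Sigma>) (of_real l :: 'a)"
      using eigenvalue_of_fm[OF FH(2) X(1)] X(2) FH(1) by simp
    then have "norm (S * X) \<in> singular_values \<Sigma>" by (simp add: singular_values_def l)
    with sv show ?thesis by (simp add: l)
  qed
  obtain l X where lX: "X \<in> sph d" "H * X = l *\<^sub>R X" "\<And>Y. supp_le d Y \<Longrightarrow> inner Y (H * Y) \<ge> l * (norm Y)\<^sup>2"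
    using min_form[OF H d] by blast
  obtain k Z where kZ: "Z \<in> sph d" "- H * Z = k *\<^sub>R Z" "\<And>Y. supp_le d Y \<Longrightarrow> inner Y (- H * Y) \<ge> k * (norm Y)\<^sup>2"
    using min_form[of d "- H"] H d by (metis adj_simps(4) supp_le_arith(4))
  have "H * Z = (- k) *\<^sub>R Z" using kZ(2) by (metis minus_mult_left scaleR_minus_left add.inverse_inverse)
  then have "- k = \<sigma>\<^sup>2" using ev kZ(1) by blast
  moreover have "l = \<sigma>\<^sup>2" using ev lX by blast
  ultimately have form: "inner Y (H * Y) = \<sigma>\<^sup>2 * (norm Y)\<^sup>2" if "supp_le d Y" for Y
  proof -
    have "k * (norm Y)\<^sup>2 \<le> - inner Y (H * Y)" using kZ(3)[OF that] by simp
    moreover have "k = - \<sigma>\<^sup>2" using \<open>- k = \<sigma>\<^sup>2\<close> by simp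
    ultimately show ?thesis using lX(3)[OF that] \<open>l = \<sigma>\<^sup>2\<close> by simp
  qed
  have "H * one_fm d = \<sigma>\<^sup>2 *\<^sub>R one_fm d"
    by (rule form_eigen[OF H]) (use form in auto)
  then have SS: "adj S * S = \<sigma>\<^sup>2 *\<^sub>R one_fm d" using mult_one_fm[OF H(1)] by (simp add: H_def)
  have inj: "X = 0" if "supp_le d X" "S * X = 0" for X
  proof -
    have "\<sigma>\<^sup>2 *\<^sub>R X = adj S * S * X" by (simp add: SS one_fm_mult that)
    also have "\<dots> = 0" by (simp add: mult.assoc that)
    finally show ?thesis using \<sigma> by simp
  qed
  obtain B where B: "supp_le d B" "S * B = one_fm d" using right_inverse_fm[OF S d inj] .
  have "adj S = adj S * (S * B)" using B mult_one_fm[OF supp_le_adj[OF S]] by simp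
  also have "\<dots> = adj S * S * B" by (simp add: mult.assoc)
  also have "\<dots> = \<sigma>\<^sup>2 *\<^sub>R B" by (simp add: SS one_fm_mult B)
  finally have SS': "S * adj S = \<sigma>\<^sup>2 *\<^sub>R one_fm d" by (simp add: B)
  show ?thesis
  proof
    show "supp_le d ((1 / \<sigma>) *\<^sub>R S)" using S by auto
    show "Fm d \<Sigma> = \<sigma> *\<^sub>R ((1 / \<sigma>) *\<^sub>R S)" using \<sigma> by (simp add: S_def)
    show "adj ((1 / \<sigma>) *\<^sub>R S) * ((1 / \<sigma>) *\<^sub>R S) = one_fm d" "(1 / \<sigma>) *\<^sub>R S * adj ((1 / \<sigma>) *\<^sub>R S) = one_fm d"
      using \<sigma> by (simp_all add: SS SS' power2_eq_square)
  qed
qed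

section \<open>Scalar multiples and unitary matrices\<close>

lift_definition smult_fm :: "'a::rc_field \<Rightarrow> 'a fm \<Rightarrow> 'a fm" is "\<lambda>c f i j. c * f i j" by auto

lemma ent_smult [simp]: "ent (smult_fm c A) i j = c * ent A i j" by transfer simp

lemma supp_le_smult [intro]: "supp_le n A \<Longrightarrow> supp_le n (smult_fm c A)"
  by (simp add: supp_le_def)

lemma smult_fm_mult: "smult_fm c A * B = smult_fm c (A * B)" "A * smult_fm c B = smult_fm c (A * B)"
proof -
  obtain n where n: "supp_le n A" "supp_le n B" using ex_supp_le2 by blast
  then have s: "supp_le n (smult_fm c A)" by auto
  show "smult_fm c A * B = smult_fm c (A * B)"
    by (rule fm_eqI) (simp add: ent_mult[OF n(1)] ent_mult[OF s] sum_distrib_left mult.assoc)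
  show "A * smult_fm c B = smult_fm c (A * B)"
    by (rule fm_eqI) (simp add: ent_mult[OF n(1)] sum_distrib_left mult_ac)
qed

lemma smult_fm_simps [simp]:
  "smult_fm c (smult_fm e A) = smult_fm (c * e) A" "adj (smult_fm c A) = smult_fm (conjugate c) (adj A)"
  "smult_fm 1 A = A"
  by (rule fm_eqI; simp add: conjugate_dist_mul)+

lemma smult_fm_add: "smult_fm c (A + B) = smult_fm c A + smult_fm c B"
  by (rule fm_eqI) (simp add: distrib_left)

lemma smult_of_real: "smult_fm (of_real r) A = r *\<^sub>R A"
  by (rule fm_eqI) (simp add: scaleR_conv_of_real)

lemma norm_smult_fm: "norm (smult_fm c A) = norm c * norm A"
proof -
  obtain n where n: "supp_le n A" using ex_supp_le by blast
  then have s: "supp_le n (smult_fm c A)" by auto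
  have "(norm (smult_fm c A))\<^sup>2 = (norm c * norm A)\<^sup>2"
    by (simp add: norm_fm_sq[OF s] norm_fm_sq[OF n] norm_mult power_mult_distrib sum_distrib_left)
  then show ?thesis by (simp add: power2_eq_iff_nonneg)
qed

lemma conjugate_mult_unit: "norm c = 1 \<Longrightarrow> conjugate c * c = (1 :: 'a::rc_field)"
  by (simp add: conjugate_mult_self)

lemma Fm_smult_fm: "A \<in> carrier_mat d d \<Longrightarrow> Fm d (k \<cdot>\<^sub>m A) = smult_fm k (Fm d A)"
  by (rule fm_eqI) (simp add: ent_Fm)

definition unitary_fm :: "nat \<Rightarrow> 'a::rc_field fm \<Rightarrow> bool" where
  "unitary_fm d U \<longleftrightarrow> supp_le d U \<and> adj U * U = one_fm d \<and> U * adj U = one_fm d"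

lemma unitary_fm_Fm: "U \<in> unitary_group d \<Longrightarrow> unitary_fm d (Fm d U)"
  unfolding unitary_group_def unitary_fm_def
  by (auto simp: Fm_one Fm_adjoint simp flip: Fm_arith(3))
    (metis Fm_adjoint Fm_arith(3) Fm_one adjoint_carrier)+

lemma unitary_group_of_fm:
  assumes U: "U \<in> carrier_mat d d" and "unitary_fm d (Fm d U)" shows "U \<in> unitary_group d"
proof -
  have "Fm d (mat_adjoint U * U) = Fm d (1\<^sub>m d)" "Fm d (U * mat_adjoint U) = Fm d (1\<^sub>m d)"
    using assms by (simp_all add: Fm_arith Fm_adjoint Fm_one unitary_fm_def)
  then show ?thesis
    unfolding unitary_group_def using U by (auto intro!: Fm_inj[of _ d] mult_carrier_square)
qed

lemma unitary_cancel:
  assumes "unitary_fm d U" "supp_le d X"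
  shows "adj U * (U * X) = X" "U * (adj U * X) = X"
  using assms one_fm_mult[of d X] by (simp_all add: unitary_fm_def flip: mult.assoc)

lemma norm_unitary_mult:
  assumes "unitary_fm d U" "supp_le d X" shows "norm (U * X) = norm X" "norm (adj U * X) = norm X"
proof -
  have "(norm (U * X))\<^sup>2 = (norm X)\<^sup>2" "(norm (adj U * X))\<^sup>2 = (norm X)\<^sup>2"
    unfolding norm_mult_sq using unitary_cancel[OF assms]
    by (simp_all add: mult.assoc power2_norm_eq_inner)
  then show "norm (U * X) = norm X" "norm (adj U * X) = norm X" by simp_all
qed

lemma norm_mult_unitary:
  assumes "unitary_fm d U" "supp_le d X" shows "norm (X * U) = norm X" "norm (X * adj U) = norm X"
  using norm_unitary_mult[OF assms(1) supp_le_adj[OF assms(2)]]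
  by (metis adj_mult adj_simps(1) norm_adj)+

lemma unitary_fm_adj: "unitary_fm d U \<Longrightarrow> unitary_fm d (adj U)"
  by (auto simp: unitary_fm_def)

lemma unitary_fm_mult:
  assumes "unitary_fm d U" "unitary_fm d V" shows "unitary_fm d (U * V)"
proof -
  have s: "supp_le d U" "supp_le d V" using assms by (auto simp: unitary_fm_def)
  have "adj V * (adj U * (U * V)) = one_fm d" "U * (V * (adj V * adj U)) = one_fm d"
    using unitary_cancel[OF assms(1)] unitary_cancel[OF assms(2)] s assms
    by (simp_all add: unitary_fm_def supp_le_adj)
  then show ?thesis using s by (auto simp: unitary_fm_def mult.assoc)
qed

lemma unitary_fm_smult: "norm c = 1 \<Longrightarrow> unitary_fm d U \<Longrightarrow> unitary_fm d (smult_fm c U)"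
  using conjugate_mult_unit[of c] by (auto simp: unitary_fm_def smult_fm_mult mult.commute)

lemma low_unitary_mult:
  "unitary_fm d U \<Longrightarrow> low d c X \<Longrightarrow> supp_le d X \<Longrightarrow> low d c (U * X)"
  unfolding low_def by (simp add: mult.assoc norm_unitary_mult supp_le_mult)

lemma low_mult_unitary:
  assumes "unitary_fm d U" "low d c X" shows "low d c (X * U)"
  unfolding low_def
proof (intro allI impI)
  fix Y :: "'a fm" assume Y: "supp_le d Y"
  have "supp_le d (U * Y)" using assms Y by (auto simp: unitary_fm_def)
  from lowD[OF assms(2) this] show "c * norm Y \<le> norm (X * U * Y)"
    using norm_unitary_mult[OF assms(1) Y] by (simp add: mult.assoc)
qed

lemma low_smult: "low d c A \<Longrightarrow> c \<ge> 0 \<Longrightarrow> low d (norm k * c) (smult_fm k A)"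
  unfolding low_def by (auto simp: smult_fm_mult norm_smult_fm mult.assoc intro!: mult_left_mono)

lemma low_mult:
  assumes "low d a A" "low d b B" "a \<ge> 0" "supp_le d B" shows "low d (a * b) (A * B)"
  unfolding low_def
proof (intro allI impI)
  fix X :: "'a fm" assume X: "supp_le d X"
  have "a * (b * norm X) \<le> a * norm (B * X)" using lowD[OF assms(2) X] assms(3) by (rule mult_left_mono)
  also have "\<dots> \<le> norm (A * (B * X))" using assms(4) X by (intro lowD[OF assms(1)]) auto
  finally show "a * b * norm X \<le> norm (A * B * X)" by (simp add: mult.assoc)
qed

section \<open>The balanced initialization\<close>

lemma Fm_balanced_init:
  assumes G: "G \<in> carrier_mat d d" and Q: "\<And>k. k \<le> 4 \<Longrightarrow> Q k \<in> unitary_group d"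
  shows "Fm d (balanced_init s \<epsilon> (G, Q) 1) = smult_fm (s 1 * of_real \<epsilon>) (Fm d (Q 1) * Fm d G * adj (Fm d (Q 0)))"
    "Fm d (balanced_init s \<epsilon> (G, Q) 2) = smult_fm (s 2 * of_real \<epsilon>) (Fm d (Q 2) * adj (Fm d G) * adj (Fm d (Q 1)))"
    "Fm d (balanced_init s \<epsilon> (G, Q) 3) = smult_fm (s 3 * of_real \<epsilon>) (Fm d (Q 3) * Fm d G * adj (Fm d (Q 2)))"
    "Fm d (balanced_init s \<epsilon> (G, Q) 4) = smult_fm (s 4 * of_real \<epsilon>) (Fm d (Q 4) * adj (Fm d G) * adj (Fm d (Q 3)))"
proof -
  have c: "Q k \<in> carrier_mat d d" if "k \<le> 4" for k using Q[OF that] by (simp add: unitary_group_def)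
  have *: "Fm d (k \<cdot>\<^sub>m (Q i * H * mat_adjoint (Q j))) = smult_fm k (Fm d (Q i) * Fm d H * adj (Fm d (Q j)))"
    if "i \<le> 4" "j \<le> 4" "H \<in> carrier_mat d d" for k i j H
    using c[OF that(1)] c[OF that(2)] that(3)
    by (simp add: Fm_smult_fm Fm_arith(3) Fm_adjoint mult_carrier_square)
  show "Fm d (balanced_init s \<epsilon> (G, Q) 1) = smult_fm (s 1 * of_real \<epsilon>) (Fm d (Q 1) * Fm d G * adj (Fm d (Q 0)))"
    "Fm d (balanced_init s \<epsilon> (G, Q) 2) = smult_fm (s 2 * of_real \<epsilon>) (Fm d (Q 2) * adj (Fm d G) * adj (Fm d (Q 1)))"
    "Fm d (balanced_init s \<epsilon> (G, Q) 3) = smult_fm (s 3 * of_real \<epsilon>) (Fm d (Q 3) * Fm d G * adj (Fm d (Q 2)))"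
    "Fm d (balanced_init s \<epsilon> (G, Q) 4) = smult_fm (s 4 * of_real \<epsilon>) (Fm d (Q 4) * adj (Fm d G) * adj (Fm d (Q 3)))"
    unfolding balanced_init_def using G *[of 1 0 G] *[of 2 1 "mat_adjoint G"] *[of 3 2 G] *[of 4 3 "mat_adjoint G"]
    by (simp_all add: Fm_adjoint)
qed

locale initialized =
  fixes d :: nat and \<Sigma> :: "'a::rc_field mat" and \<sigma> a \<epsilon> :: real and s :: "nat \<Rightarrow> 'a" and G :: "'a mat"
    and Q :: "nat \<Rightarrow> 'a mat" and W :: "real \<Rightarrow> nat \<Rightarrow> 'a mat" and U :: "'a fm"
  assumes d: "d > 0" and \<Sigma>: "\<Sigma> \<in> carrier_mat d d" and \<sigma>: "\<sigma> > 0" and a: "a \<ge> 0" and \<epsilon>: "\<epsilon> > 0"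
    and s: "\<forall>j\<in>{1..4}. norm (s j) = 1"
    and G: "G \<in> carrier_mat d d" and Q: "\<And>k. k \<le> 4 \<Longrightarrow> Q k \<in> unitary_group d"
    and gf: "gradient_flow d a \<Sigma> W" and init: "\<forall>j\<in>{1..4}. W 0 j = balanced_init s \<epsilon> (G, Q) j"
    and U: "unitary_fm d U" "Fm d \<Sigma> = \<sigma> *\<^sub>R U"
begin

abbreviation "q k \<equiv> Fm d (Q k)"
abbreviation "g \<equiv> Fm d G"

lemma uq: "k \<le> 4 \<Longrightarrow> unitary_fm d (q k)"
  using Q unitary_fm_Fm by blast

lemma supq: "supp_le d g" "supp_le d (q k)" by auto

lemma init_fm:
  "Fm d (W 0 1) = smult_fm (s 1 * of_real \<epsilon>) (q 1 * g * adj (q 0))"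
  "Fm d (W 0 2) = smult_fm (s 2 * of_real \<epsilon>) (q 2 * adj g * adj (q 1))"
  "Fm d (W 0 3) = smult_fm (s 3 * of_real \<epsilon>) (q 3 * g * adj (q 2))"
  "Fm d (W 0 4) = smult_fm (s 4 * of_real \<epsilon>) (q 4 * adj g * adj (q 3))"
  using init Fm_balanced_init[OF G Q] by simp_all

lemma sk:
  assumes "j \<in> {1..4}"
  shows "s j * of_real \<epsilon> * (conjugate (s j * of_real \<epsilon>)) = of_real (\<epsilon>\<^sup>2)" "norm (s j * of_real \<epsilon>) = \<epsilon>"
proof -
  show n: "norm (s j * of_real \<epsilon>) = \<epsilon>" using s assms \<epsilon> by (simp add: norm_mult)
  show "s j * of_real \<epsilon> * (conjugate (s j * of_real \<epsilon>)) = of_real (\<epsilon>\<^sup>2)"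
    using conjugate_mult_self[of "s j * of_real \<epsilon>"] unfolding n
    by (simp add: scaleR_conv_of_real mult.commute)
qed

lemma gram:
  assumes j: "j \<in> {1..4}" "m \<le> 4" "n \<le> 4" and X: "supp_le d X"
    and A: "A = smult_fm (s j * of_real \<epsilon>) (q m * X * adj (q n))"
  shows "A * adj A = \<epsilon>\<^sup>2 *\<^sub>R (q m * (X * adj X) * adj (q m))" "adj A * A = \<epsilon>\<^sup>2 *\<^sub>R (q n * (adj X * X) * adj (q n))"
proof -
  have "adj (q n) * (q n * (adj X * adj (q m))) = adj X * adj (q m)"
    "adj (q m) * (q m * (X * adj (q n))) = X * adj (q n)"
    using X by (auto intro!: unitary_cancel(1) uq j)
  then show "A * adj A = \<epsilon>\<^sup>2 *\<^sub>R (q m * (X * adj X) * adj (q m))" "adj A * A = \<epsilon>\<^sup>2 *\<^sub>R (q n * (adj X * X) * adj (q n))"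
    using sk(1)[OF j(1)] unfolding A smult_of_real[symmetric]
    by (simp_all add: smult_fm_mult mult.assoc mult.commute[of "conjugate _"])
qed

text \<open>Neighbouring factors share the unitary matrix between them, and alternating
  \<open>G\<close> with its adjoint makes the two Gram matrices equal. The phases have modulus one
  and cancel.\<close>

lemma balanced0: "j \<in> {1..3} \<Longrightarrow> imb (Fm d (W 0 j)) (Fm d (W 0 (j + 1))) = 0"
proof -
  assume "j \<in> {1..3}"
  then have "j = 1 \<or> j = 2 \<or> j = 3" by auto
  moreover have "imb (Fm d (W 0 1)) (Fm d (W 0 2)) = 0"
    using gram(1)[OF _ _ _ supq(1) init_fm(1)] gram(2)[OF _ _ _ supp_le_adj[OF supq(1)] init_fm(2)]
    by (simp add: imb_def)
  moreover have "imb (Fm d (W 0 2)) (Fm d (W 0 3)) = 0"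
    using gram(1)[OF _ _ _ supp_le_adj[OF supq(1)] init_fm(2)] gram(2)[OF _ _ _ supq(1) init_fm(3)]
    by (simp add: imb_def)
  moreover have "imb (Fm d (W 0 3)) (Fm d (W 0 4)) = 0"
    using gram(1)[OF _ _ _ supq(1) init_fm(3)] gram(2)[OF _ _ _ supp_le_adj[OF supq(1)] init_fm(4)]
    by (simp add: imb_def)
  ultimately show ?thesis by (elim disjE) (simp_all del: One_nat_def)
qed

sublocale bf: balanced_flow d \<sigma> "\<lambda>t. Fm d (W t 1)" "\<lambda>t. Fm d (W t 2)" "\<lambda>t. Fm d (W t 3)" "\<lambda>t. adj U * Fm d (W t 4)"
  using U unfolding unitary_fm_def
  by (intro balanced_flow_of_gradient_flow(1)[OF gf \<Sigma> a d \<sigma> _ _ _ _ balanced0]) auto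

lemma loss_eq_L: "t \<ge> 0 \<Longrightarrow> loss a \<Sigma> (W t) = bf.L t"
  using U unfolding unitary_fm_def
  by (intro balanced_flow_of_gradient_flow(2)[OF gf \<Sigma> a d \<sigma> _ _ _ _ balanced0]) auto

definition "twist = smult_fm (s 1 * s 2 * s 3 * s 4) (adj U)"

text \<open>The unitary matrices at positions 1 and 3 cancel, and the common left factor
  \<open>q 2 * (adj g * g)\<close> splits off. Invertibility of \<open>P\<close> at time 0 is
  therefore decided by \<open>q 0\<close> and \<open>q 4\<close> once \<open>G\<close> is
  invertible.\<close>

lemma P0_eq: "bf.P 0 = smult_fm (s 1 * s 2 * of_real (\<epsilon>\<^sup>2)) (q 2 * (adj g * g) * (adj (q 0) + adj (twist * q 4)))"
proof -
  have c: "adj (q 1) * (q 1 * X) = X" "adj (q 3) * (q 3 * X) = X" if "supp_le d X" for X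
    using that by (auto intro!: unitary_cancel(1) uq)
  have "Fm d (W 0 2) * Fm d (W 0 1) = smult_fm (s 1 * s 2 * of_real (\<epsilon>\<^sup>2)) (q 2 * (adj g * g) * adj (q 0))"
    unfolding init_fm using c(1)[of "g * adj (q 0)"] supq
    by (simp add: smult_fm_mult mult.assoc supp_le_mult supp_le_adj power2_eq_square mult_ac)
  moreover have "adj (adj U * Fm d (W 0 4) * Fm d (W 0 3)) =
      smult_fm (s 1 * s 2 * of_real (\<epsilon>\<^sup>2)) (q 2 * (adj g * g) * adj (twist * q 4))"
  proof -
    have e: "Fm d (W 0 4) * Fm d (W 0 3) = smult_fm (s 4 * s 3 * of_real (\<epsilon>\<^sup>2)) (q 4 * (adj g * (g * adj (q 2))))"
      unfolding init_fm using c(2)[of "g * adj (q 2)"] supq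
      by (simp add: smult_fm_mult mult.assoc supp_le_mult supp_le_adj power2_eq_square mult_ac)
    have "conjugate (s 1) * s 1 = 1" "conjugate (s 2) * s 2 = 1"
      using s by (auto intro!: conjugate_mult_unit)
    \<comment> \<open>Factoring the phases of \<open>A\<close> out of \<open>P\<close> leaves a unit
      complex factor on the \<open>B\<close> part, which \<open>twist\<close> was defined to
      carry.\<close>
    have "s 1 * s 2 * of_real (\<epsilon>\<^sup>2) * conjugate (s 1 * s 2 * s 3 * s 4)
        = (conjugate (s 1) * s 1) * (conjugate (s 2) * s 2) * of_real (\<epsilon>\<^sup>2) * conjugate (s 4 * s 3)"
      by (simp only: conjugate_dist_mul mult_ac)
    also have "\<dots> = of_real (\<epsilon>\<^sup>2) * conjugate (s 4 * s 3)"
      by (simp only: \<open>conjugate (s 1) * s 1 = 1\<close> \<open>conjugate (s 2) * s 2 = 1\<close> mult_1_left)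
    also have "\<dots> = conjugate (s 4 * s 3 * of_real (\<epsilon>\<^sup>2))"
      by (simp only: conjugate_dist_mul conjugate_of_real mult_ac)
    finally have "s 1 * s 2 * of_real (\<epsilon>\<^sup>2) * conjugate (s 1 * s 2 * s 3 * s 4) = conjugate (s 4 * s 3 * of_real (\<epsilon>\<^sup>2))" .
    then show ?thesis
      unfolding twist_def using e by (simp add: smult_fm_mult mult.assoc)
  qed
  ultimately show ?thesis
    unfolding bf.P_def bf.A_def bf.B_def by (simp add: distrib_left smult_fm_add)
qed

lemma norm_W0: "norm (Fm d (W 0 1)) = \<epsilon> * norm g" "norm (Fm d (W 0 2)) = \<epsilon> * norm g"
  "norm (Fm d (W 0 3)) = \<epsilon> * norm g" "norm (adj U * Fm d (W 0 4)) = \<epsilon> * norm g"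
proof -
  have *: "norm (q m * X * adj (q n)) = norm X" if "m \<le> 4" "n \<le> 4" "supp_le d X" for m n X
    using that uq[of m] uq[of n] supq by (simp add: norm_mult_unitary norm_unitary_mult supp_le_mult)
  show "norm (Fm d (W 0 1)) = \<epsilon> * norm g" "norm (Fm d (W 0 2)) = \<epsilon> * norm g" "norm (Fm d (W 0 3)) = \<epsilon> * norm g"
    using sk(2)[of 1] sk(2)[of 2] sk(2)[of 3] unfolding init_fm
    by (simp_all add: norm_smult_fm * supp_le_adj)
  have "norm (adj U * Fm d (W 0 4)) = norm (Fm d (W 0 4))" by (rule norm_unitary_mult(2)[OF U(1)]) simp
  then show "norm (adj U * Fm d (W 0 4)) = \<epsilon> * norm g"
    using sk(2)[of 4] unfolding init_fm by (simp add: norm_smult_fm * supp_le_adj)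
qed

lemma norm_D0: "norm (bf.D 0) \<le> 2 * \<epsilon>\<^sup>2 * (norm g)\<^sup>2"
proof -
  have "norm (bf.A 0) \<le> (\<epsilon> * norm g) * (\<epsilon> * norm g)"
    unfolding bf.A_def using norm_mult_ineq[of "Fm d (W 0 2)" "Fm d (W 0 1)"] by (simp add: norm_W0 del: One_nat_def)
  moreover have "norm (adj (bf.B 0)) \<le> (\<epsilon> * norm g) * (\<epsilon> * norm g)"
    unfolding bf.B_def norm_adj using norm_mult_ineq[of "adj U * Fm d (W 0 4)" "Fm d (W 0 3)"] by (simp add: norm_W0)
  ultimately show ?thesis
    unfolding bf.D_def using norm_triangle_ineq4[of "bf.A 0" "adj (bf.B 0)"]
    by (simp add: power2_eq_square algebra_simps)
qed

lemma L0_less: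
  assumes small: "\<epsilon> ^ 4 * (norm g) ^ 4 \<le> 2 / 5 * \<sigma>"
  shows "bf.L 0 < d * \<sigma>\<^sup>2"
proof -
  let ?Y = "adj U * Fm d (W 0 4) * Fm d (W 0 3) * Fm d (W 0 2) * Fm d (W 0 1)"
  have "norm ?Y \<le> norm (adj U * Fm d (W 0 4)) * norm (Fm d (W 0 3)) * norm (Fm d (W 0 2)) * norm (Fm d (W 0 1))"
    by (intro order_trans[OF norm_mult_ineq] mult_right_mono norm_ge_zero order_refl)
  also have "\<dots> = \<epsilon> ^ 4 * (norm g) ^ 4" unfolding norm_W0 by (simp add: power4_eq_xxxx)
  finally have Y: "norm ?Y \<le> 2 / 5 * \<sigma>" using small by simp
  have "norm (bf.R 0) \<le> norm (\<sigma> *\<^sub>R one_fm d :: 'a fm) + norm ?Y"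
    unfolding bf.R_def by (rule norm_triangle_ineq4)
  also have "norm (\<sigma> *\<^sub>R one_fm d :: 'a fm) = \<sigma> * sqrt d"
    using \<sigma> norm_one_fm[of d, where 'a = 'a] by (simp add: real_sqrt_unique)
  \<comment> \<open>The allowance 2/5 keeps half of the square of 7/5, which is 49/50, below
    one.\<close>
  also have "\<sigma> * sqrt d + norm ?Y \<le> \<sigma> * (7 / 5 * sqrt d)"
  proof -
    have "1 \<le> sqrt d" using d by simp
    then have "2 / 5 * \<sigma> * 1 \<le> 2 / 5 * \<sigma> * sqrt d" using \<sigma> by (intro mult_left_mono) auto
    with Y show ?thesis by (simp add: algebra_simps)
  qed
  finally have "(norm (bf.R 0))\<^sup>2 \<le> (\<sigma> * (7 / 5 * sqrt d))\<^sup>2" by (intro power_mono) auto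
  also have "\<dots> = 49 / 25 * (d * \<sigma>\<^sup>2)" by (simp add: power_mult_distrib power_divide)
  finally have "bf.L 0 \<le> 49 / 50 * (d * \<sigma>\<^sup>2)" by (simp add: bf.L_def del: One_nat_def)
  also have "\<dots> < d * \<sigma>\<^sup>2" using d \<sigma> by simp
  finally show ?thesis .
qed

lemma stuck:
  assumes "X \<in> sph d" "(adj (q 0) + adj (twist * q 4)) * X = 0" "t \<ge> 0"
  shows "loss a \<Sigma> (W t) \<ge> 1 / 2 * \<sigma>\<^sup>2"
proof -
  have "bf.P 0 * X = smult_fm (s 1 * s 2 * of_real (\<epsilon>\<^sup>2)) (q 2 * (adj g * g) * ((adj (q 0) + adj (twist * q 4)) * X))"
    unfolding P0_eq by (simp add: smult_fm_mult mult.assoc)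
  also have "\<dots> = 0" unfolding assms(2) by (auto intro: fm_eqI)
  finally show ?thesis using bf.loss_lower_bound[OF assms(1) _ assms(3)] loss_eq_L[OF assms(3)] by simp
qed

text \<open>\<eta> bounds the singular values of \<open>G\<close> and \<gamma> those of the sum of
  the two unitary matrices. The starting values \<open>m\<close> and \<open>p\<close> of the
  barriers are half of the resulting bounds for \<open>W1\<close> and \<open>P\<close>, so that the
  initial inequalities are strict.\<close>

lemma converges:
  assumes gl: "low d \<eta> g" "\<eta> > 0" and z: "low d \<gamma> (adj (q 0) + adj (twist * q 4))" "0 < \<gamma>" "\<gamma> \<le> 1"
    and small: "9 * (\<epsilon>\<^sup>2 * \<eta>\<^sup>2 / 2 + 2 * \<epsilon>\<^sup>2 * (norm g)\<^sup>2) ^ 3 \<le> \<sigma> * (\<epsilon>\<^sup>2 * \<eta>\<^sup>2 * sqrt \<gamma> / 2)"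
      "\<epsilon> ^ 4 * (norm g) ^ 4 \<le> 2 / 5 * \<sigma>"
    and T: "T \<ge> 10 / (\<sigma> * (\<epsilon>\<^sup>2 * \<eta>\<^sup>2 * sqrt \<gamma>)) + 125 * ln (18 * d) / (\<sigma> * sqrt \<sigma>)"
  shows "t \<ge> 0 \<Longrightarrow> loss a \<Sigma> (W t) < d * \<sigma>\<^sup>2"
    and "t \<ge> T \<Longrightarrow> loss a \<Sigma> (W t) < d * \<sigma>\<^sup>2 * exp (- (8 * (\<sigma> * sqrt \<sigma>) * (t - T)))"
proof -
  show "t \<ge> 0 \<Longrightarrow> loss a \<Sigma> (W t) < d * \<sigma>\<^sup>2"
    using bf.L_nonincreasing[OF order_refl, of t] L0_less[OF small(2)] loss_eq_L by simp
  define m where "m = \<epsilon>\<^sup>2 * \<eta>\<^sup>2 / 2"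
  define p where "p = \<epsilon>\<^sup>2 * \<eta>\<^sup>2 * \<gamma> / 2"
  have pm: "0 < p" "p \<le> m" "0 < m"
    using \<epsilon> gl z by (auto simp: m_def p_def mult_le_cancel_left1)
  have "m * p = (\<epsilon>\<^sup>2 * \<eta>\<^sup>2 / 2)\<^sup>2 * \<gamma>" by (simp add: m_def p_def power2_eq_square)
  then have smp: "sqrt (m * p) = \<epsilon>\<^sup>2 * \<eta>\<^sup>2 * sqrt \<gamma> / 2" by (simp add: real_sqrt_mult)
  have gl': "low d \<eta> (adj g)" using low_adj[OF supq(1) gl(2)] gl(1) by simp
  have N0: "m < (norm (Fm d (W 0 1) * X))\<^sup>2" if X: "X \<in> sph d" for X
  proof -
    have "low d (norm (s 1 * of_real \<epsilon> :: 'a) * \<eta>) (Fm d (W 0 1))"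
      unfolding init_fm using gl uq[of 1] uq[of 0]
      by (intro low_smult low_mult_unitary low_unitary_mult unitary_fm_adj) auto
    from lowD[OF this, of X] have "\<epsilon> * \<eta> \<le> norm (Fm d (W 0 1) * X)"
      using X sk(2)[of 1] by (simp add: sph_def)
    then have "(\<epsilon> * \<eta>)\<^sup>2 \<le> (norm (Fm d (W 0 1) * X))\<^sup>2" using \<epsilon> gl by (intro power_mono) auto
    moreover have "m < (\<epsilon> * \<eta>)\<^sup>2" using \<epsilon> gl by (simp add: m_def power_mult_distrib)
    ultimately show ?thesis by simp
  qed
  have P0: "p < norm (bf.P 0 * X)" if X: "X \<in> sph d" for X
  proof -
    have sz: "supp_le d (adj (q 0) + adj (twist * q 4))"
      using U(1) supq unfolding twist_def unitary_fm_def by (intro supp_le_arith supp_le_adj supp_le_mult supp_le_smult) auto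
    have "low d (norm (s 1 * s 2 * of_real (\<epsilon>\<^sup>2) :: 'a) * ((\<eta> * \<eta>) * \<gamma>)) (bf.P 0)"
      unfolding P0_eq using gl gl' z uq[of 2] sz supq
      by (intro low_smult low_mult low_unitary_mult) auto
    moreover have "norm (s 1 * s 2 * of_real (\<epsilon>\<^sup>2) :: 'a) = \<epsilon>\<^sup>2" using s by (simp add: norm_mult norm_power)
    ultimately have "low d (\<epsilon>\<^sup>2 * ((\<eta> * \<eta>) * \<gamma>)) (bf.P 0)" by (simp only:)
    from lowD[OF this, of X] have "\<epsilon>\<^sup>2 * ((\<eta> * \<eta>) * \<gamma>) \<le> norm (bf.P 0 * X)"
      using X by (simp add: sph_def del: One_nat_def)
    moreover have "p < \<epsilon>\<^sup>2 * ((\<eta> * \<eta>) * \<gamma>)" using \<epsilon> gl z by (simp add: p_def power2_eq_square)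
    ultimately show ?thesis by simp
  qed
  have "m + norm (bf.D 0) \<le> \<epsilon>\<^sup>2 * \<eta>\<^sup>2 / 2 + 2 * \<epsilon>\<^sup>2 * (norm g)\<^sup>2" using norm_D0 by (simp add: m_def)
  then have "(m + norm (bf.D 0)) ^ 3 \<le> (\<epsilon>\<^sup>2 * \<eta>\<^sup>2 / 2 + 2 * \<epsilon>\<^sup>2 * (norm g)\<^sup>2) ^ 3"
    using pm by (intro power_mono) auto
  then have sm: "9 * (m + norm (bf.D 0)) ^ 3 \<le> \<sigma> * sqrt (m * p)" using small(1) by (simp add: smp)
  have T': "T \<ge> 5 / (\<sigma> * sqrt (m * p)) + 125 * ln (18 * d) / (\<sigma> * sqrt \<sigma>)" using T by (simp add: smp)
  assume t: "t \<ge> T"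
  have "0 \<le> ln (18 * real d)" using d by simp
  then have "0 \<le> 10 / (\<sigma> * (\<epsilon>\<^sup>2 * \<eta>\<^sup>2 * sqrt \<gamma>))" "0 \<le> 125 * ln (real (18 * d)) / (\<sigma> * sqrt \<sigma>)"
    using \<sigma> z by simp_all
  then have "T \<ge> 0" using T by linarith
  then show "loss a \<Sigma> (W t) < d * \<sigma>\<^sup>2 * exp (- (8 * (\<sigma> * sqrt \<sigma>) * (t - T)))"
    using bf.convergence[OF pm(1,2) N0 P0 sm _ T' t] L0_less[OF small(2)] loss_eq_L[of t] t by simp
qed

end

section \<open>Haar measure on the unitary group\<close>

lemma unitary_group_carrier: "U \<in> unitary_group d \<Longrightarrow> U \<in> carrier_mat d d"
  by (simp add: unitary_group_def)

lemma unitary_group_mult: "U \<in> unitary_group d \<Longrightarrow> V \<in> unitary_group d \<Longrightarrow> (U * V :: 'a::rc_field mat) \<in> unitary_group d"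
  by (rule unitary_group_of_fm)
    (auto simp: Fm_arith(3) unitary_group_carrier intro!: mult_carrier_square unitary_fm_mult unitary_fm_Fm)

lemma space_mat_borel [simp]: "space (mat_borel d) = carrier_mat d d"
  by (simp add: mat_borel_def)

lemma measurable_entry:
  assumes "i < d" "j < d"
  shows "(\<lambda>A. A $$ (i, j)) \<in> borel_measurable (mat_borel d :: 'a::rc_field mat measure)"
proof -
  have 1: "(\<lambda>A :: 'a mat. \<lambda>p\<in>{..<d} \<times> {..<d}. A $$ p) \<in> measurable (mat_borel d) (PiM ({..<d} \<times> {..<d}) (\<lambda>_. borel))"
    unfolding mat_borel_def by (rule measurable_vimage_algebra1) (auto simp: space_PiM)
  have "(\<lambda>f. f (i, j)) \<in> measurable (PiM ({..<d} \<times> {..<d}) (\<lambda>_. borel :: 'a measure)) borel"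
    using assms by (intro measurable_component_singleton) auto
  from measurable_compose[OF 1 this] show ?thesis using assms by simp
qed

lemma measurable_mat_borelI:
  fixes f :: "'b \<Rightarrow> 'a::rc_field mat"
  assumes "\<And>\<omega>. \<omega> \<in> space M \<Longrightarrow> f \<omega> \<in> carrier_mat d d"
    and "\<And>i j. i < d \<Longrightarrow> j < d \<Longrightarrow> (\<lambda>\<omega>. f \<omega> $$ (i, j)) \<in> borel_measurable M"
  shows "f \<in> measurable M (mat_borel d)"
  unfolding mat_borel_def
proof (rule measurable_vimage_algebra2)
  show "(\<lambda>\<omega>. \<lambda>p\<in>{..<d} \<times> {..<d}. f \<omega> $$ p) \<in> measurable M (PiM ({..<d} \<times> {..<d}) (\<lambda>_. borel))"
    using assms(2) by (intro measurable_restrict) auto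
qed (use assms(1) in auto)

text \<open>A lower bound on all vectors need only be tested on a countable dense set of them.\<close>

lemma ex_dense_vectors: "\<exists>D :: (nat \<Rightarrow> 'a::rc_field) set. countable D \<and> (\<forall>X. open X \<longrightarrow> X \<noteq> {} \<longrightarrow> (\<exists>x\<in>D. x \<in> X))"
  using countable_dense_setE by metis

definition dense_vectors :: "(nat \<Rightarrow> 'a::rc_field) set" where
  "dense_vectors = (SOME D. countable D \<and> (\<forall>X. open X \<longrightarrow> X \<noteq> {} \<longrightarrow> (\<exists>x\<in>D. x \<in> X)))"

lemma dense_vectors: "countable (dense_vectors :: (nat \<Rightarrow> 'a::rc_field) set)"
    "open X \<Longrightarrow> X \<noteq> {} \<Longrightarrow> \<exists>x\<in>dense_vectors. x \<in> (X :: (nat \<Rightarrow> 'a) set)"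
  using someI_ex[OF ex_dense_vectors[where 'a = 'a]] unfolding dense_vectors_def[symmetric] by auto

definition sqv :: "nat \<Rightarrow> (nat \<Rightarrow> 'a::rc_field) \<Rightarrow> real" where
  "sqv d x = (\<Sum>i<d. (norm (x i))\<^sup>2)"

definition mulv :: "nat \<Rightarrow> 'a::rc_field fm \<Rightarrow> (nat \<Rightarrow> 'a) \<Rightarrow> nat \<Rightarrow> 'a" where
  "mulv d A x i = (\<Sum>k<d. ent A i k * x k)"

lemma mulv_vec_fm: "supp_le d A \<Longrightarrow> d > 0 \<Longrightarrow> A * vec_fm d x = vec_fm d (mulv d A x)"
  by (simp add: mult_vec_fm_ent mulv_def[abs_def])

lemma sqv_vec_fm: "d > 0 \<Longrightarrow> (norm (vec_fm d x))\<^sup>2 = sqv d x"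
  by (simp add: norm_vec_fm sqv_def)

text \<open>The strict inequality defines an open set of vectors in the product topology, because it
  involves finitely many coordinates. A violation can thus be moved into the countable dense set,
  which makes the event measurable.\<close>

lemma not_low_dense:
  fixes A :: "'a::rc_field fm"
  assumes A: "supp_le d A" and d: "d > 0" and c: "c \<ge> 0"
  shows "\<not> low d c A \<longleftrightarrow> (\<exists>x\<in>dense_vectors. sqv d (mulv d A x) < c\<^sup>2 * sqv d x)"
proof
  assume "\<exists>x\<in>dense_vectors. sqv d (mulv d A x) < c\<^sup>2 * sqv d x"
  then obtain x where x: "sqv d (mulv d A x) < c\<^sup>2 * sqv d x" by blast
  show "\<not> low d c A"
  proof
    assume "low d c A"
    from lowD[OF this supp_le_vec_fm[OF d]]
    have "(c * norm (vec_fm d x))\<^sup>2 \<le> (norm (A * vec_fm d x))\<^sup>2"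
      using c by (intro power_mono) auto
    then show False using x by (simp add: mulv_vec_fm A d power_mult_distrib sqv_vec_fm)
  qed
next
  assume nl: "\<not> low d c A"
  have "\<exists>x. sqv d (mulv d A x) < c\<^sup>2 * sqv d x"
  proof (rule ccontr)
    assume "\<nexists>x. sqv d (mulv d A x) < c\<^sup>2 * sqv d x"
    then have "c\<^sup>2 * sqv d x \<le> sqv d (mulv d A x)" for x by (simp add: not_less)
    then have "low d c A" unfolding low_def
      using lower_bound_columns[OF A _ c] by (simp add: sqv_def mulv_def)
    with nl show False ..
  qed
  moreover have "open {x. sqv d (mulv d A x) < c\<^sup>2 * sqv d x}"
    unfolding sqv_def mulv_def
    by (intro open_Collect_less continuous_intros continuous_on_product_coordinates)
  ultimately show "\<exists>x\<in>dense_vectors. sqv d (mulv d A x) < c\<^sup>2 * sqv d x"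
    using dense_vectors(2)[of "{x. sqv d (mulv d A x) < c\<^sup>2 * sqv d x}"] by auto
qed

lemma measurable_sqv_mulv:
  assumes "\<And>i k. i < d \<Longrightarrow> k < d \<Longrightarrow> (\<lambda>\<omega>. ent (A \<omega> :: 'a::rc_field fm) i k) \<in> borel_measurable M"
  shows "(\<lambda>\<omega>. sqv d (mulv d (A \<omega>) x)) \<in> borel_measurable M"
  unfolding sqv_def mulv_def using assms
  by (intro borel_measurable_sum borel_measurable_power borel_measurable_norm borel_measurable_times) auto

text \<open>The predicate \<open>R\<close> selects test vectors; later it keeps those having one
  relatively large coordinate.\<close>

lemma measurable_low_event:
  fixes A :: "'b \<Rightarrow> 'a::rc_field fm"
  assumes m: "\<And>i k. i < d \<Longrightarrow> k < d \<Longrightarrow> (\<lambda>\<omega>. ent (A \<omega>) i k) \<in> borel_measurable M"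
  shows "{\<omega> \<in> space M. \<exists>x\<in>dense_vectors. R x \<and> sqv d (mulv d (A \<omega>) x) < c x} \<in> sets M"
proof -
  have "{\<omega> \<in> space M. \<exists>x\<in>dense_vectors. R x \<and> sqv d (mulv d (A \<omega>) x) < c x} =
    (\<Union>x\<in>{x \<in> dense_vectors. R x}. {\<omega> \<in> space M. sqv d (mulv d (A \<omega>) x) < c x})" by auto
  moreover have "{\<omega> \<in> space M. sqv d (mulv d (A \<omega>) x) < c x} \<in> sets M" for x
    using borel_measurable_less[OF measurable_sqv_mulv[OF m, of d x] borel_measurable_const[of "c x"]] by auto
  ultimately show ?thesis
    using dense_vectors(1)[where 'a = 'a]
    by (simp only:) (intro sets.countable_UN'', auto intro: countable_subset)
qed

text \<open>All preimages of \<open>E\<close> under the measure preserving maps \<open>T k\<close>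
  have the same probability. Averaging them reduces a probability bound to counting, for a fixed
  point, the maps that send it into \<open>E\<close>.\<close>

lemma (in prob_space) prob_le_average:
  assumes n: "n > 0" and T: "\<And>k. k < n \<Longrightarrow> T k \<in> measurable M M" "\<And>k. k < n \<Longrightarrow> distr M M (T k) = M"
    and E: "E \<in> sets M" and c: "c \<ge> 0"
    and count: "\<And>\<omega>. \<omega> \<in> space M \<Longrightarrow> real (card {k. k < n \<and> T k \<omega> \<in> E}) \<le> c * real n"
  shows "prob E \<le> c"
proof -
  have "emeasure M E = (\<integral>\<^sup>+\<omega>. indicator E (T k \<omega>) \<partial>M)" if "k < n" for k
  proof -
    have "emeasure M E = (\<integral>\<^sup>+\<omega>. indicator E \<omega> \<partial>distr M M (T k))" using T(2)[OF that] E by simp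
    also have "\<dots> = (\<integral>\<^sup>+\<omega>. indicator E (T k \<omega>) \<partial>M)" using T(1)[OF that] E by (intro nn_integral_distr) auto
    finally show ?thesis .
  qed
  note eq = this
  have "of_nat n * emeasure M E = (\<Sum>k<n. emeasure M E)" by simp
  also have "\<dots> = (\<Sum>k<n. \<integral>\<^sup>+\<omega>. indicator E (T k \<omega>) \<partial>M)" using eq by (intro sum.cong) auto
  also have "\<dots> = (\<integral>\<^sup>+\<omega>. (\<Sum>k<n. indicator E (T k \<omega>)) \<partial>M)"
    using T(1) E by (intro nn_integral_sum[symmetric]) (auto intro: measurable_compose)
  also have "\<dots> \<le> (\<integral>\<^sup>+\<omega>. ennreal (c * n) \<partial>M)"
  proof (rule nn_integral_mono)
    fix \<omega> assume \<omega>: "\<omega> \<in> space M"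
    have "(\<Sum>k<n. indicator E (T k \<omega>) :: ennreal) = (\<Sum>k<n. if T k \<omega> \<in> E then 1 else 0)"
      by (intro sum.cong) (auto simp: indicator_def)
    also have "\<dots> = of_nat (card {k. k < n \<and> T k \<omega> \<in> E})"
      by (simp add: sum.If_cases Int_def conj_commute lessThan_def)
    also have "\<dots> \<le> ennreal (c * n)"
      using count[OF \<omega>] by (simp add: ennreal_of_nat_eq_real_of_nat ennreal_leI)
    finally show "(\<Sum>k<n. indicator E (T k \<omega>)) \<le> ennreal (c * n)" .
  qed
  also have "\<dots> = ennreal (c * n)" by (simp add: emeasure_space_1)
  finally have "ennreal (real n * prob E) \<le> ennreal (c * n)"
    by (simp add: emeasure_eq_measure ennreal_of_nat_eq_real_of_nat ennreal_mult)
  then have "real n * prob E \<le> c * n" using c by (simp add: ennreal_le_iff)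
  then show ?thesis using n by (simp add: mult.commute)
qed

locale haar =
  fixes d :: nat and \<mu> :: "'a::rc_field mat measure"
  assumes haar: "is_haar d \<mu>" and d: "d > 0"
begin

sublocale prob_space \<mu> using haar by (simp add: is_haar_def)

lemma sets_haar: "sets \<mu> = sets (restrict_space (mat_borel d) (unitary_group d))"
  using haar by (simp add: is_haar_def)

lemma space_haar: "space \<mu> = unitary_group d"
proof -
  have "space \<mu> = unitary_group d \<inter> carrier_mat d d"
    unfolding sets_eq_imp_space_eq[OF sets_haar] by (simp add: space_restrict_space)
  then show ?thesis using unitary_group_carrier by blast
qed

lemma measurable_entry_haar: "i < d \<Longrightarrow> j < d \<Longrightarrow> (\<lambda>A. A $$ (i, j)) \<in> borel_measurable \<mu>"
  using measurable_restrict_space1[OF measurable_entry] measurable_cong_sets[OF sets_haar refl] by blast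

lemma measurable_haarI:
  assumes "\<And>\<omega>. \<omega> \<in> space M \<Longrightarrow> f \<omega> \<in> unitary_group d"
    and "\<And>i j. i < d \<Longrightarrow> j < d \<Longrightarrow> (\<lambda>\<omega>. f \<omega> $$ (i, j)) \<in> borel_measurable M"
  shows "f \<in> measurable M \<mu>"
proof -
  have "f \<in> measurable M (restrict_space (mat_borel d) (unitary_group d))"
    using assms assms(1)[THEN unitary_group_carrier] by (intro measurable_restrict_space2 measurable_mat_borelI) auto
  then show ?thesis using measurable_cong_sets[OF refl sets_haar] by blast
qed

lemma measurable_entry_compose:
  assumes "X \<in> measurable M \<mu>" "i < d" "j < d" shows "(\<lambda>\<omega>. X \<omega> $$ (i, j)) \<in> borel_measurable M"
  using measurable_compose[OF assms(1) measurable_entry_haar[OF assms(2,3)]] .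

lemma measurable_mult_haar:
  assumes X: "X \<in> measurable M \<mu>" and Y: "Y \<in> measurable M \<mu>"
  shows "(\<lambda>\<omega>. X \<omega> * Y \<omega>) \<in> measurable M \<mu>"
proof (rule measurable_haarI)
  have u: "X \<omega> \<in> unitary_group d" "Y \<omega> \<in> unitary_group d" if "\<omega> \<in> space M" for \<omega>
    using measurable_space[OF X that] measurable_space[OF Y that] by (auto simp: space_haar)
  then show "\<omega> \<in> space M \<Longrightarrow> X \<omega> * Y \<omega> \<in> unitary_group d" for \<omega> by (simp add: unitary_group_mult)
  fix i j assume ij: "i < d" "j < d"
  have "(\<lambda>\<omega>. \<Sum>k<d. X \<omega> $$ (i, k) * Y \<omega> $$ (k, j)) \<in> borel_measurable M"
    using ij by (intro borel_measurable_sum borel_measurable_times measurable_entry_compose X Y) auto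
  moreover have "(X \<omega> * Y \<omega>) $$ (i, j) = (\<Sum>k<d. X \<omega> $$ (i, k) * Y \<omega> $$ (k, j))" if "\<omega> \<in> space M" for \<omega>
    using u[OF that, THEN unitary_group_carrier] ij by (simp add: scalar_prod_def atLeast0LessThan)
  ultimately show "(\<lambda>\<omega>. (X \<omega> * Y \<omega>) $$ (i, j)) \<in> borel_measurable M"
    by (subst measurable_cong) auto
qed

lemma measurable_const_mult: "U \<in> unitary_group d \<Longrightarrow> (\<lambda>V. U * V) \<in> measurable \<mu> \<mu>"
  by (rule measurable_mult_haar) (auto simp: space_haar)

lemma distr_mult: "U \<in> unitary_group d \<Longrightarrow> distr \<mu> \<mu> (\<lambda>V. U * V) = \<mu>"
  using haar by (simp add: is_haar_def)

abbreviation "Om \<equiv> PiM {0..4::nat} (\<lambda>_. \<mu>)"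

sublocale P: product_sigma_finite "\<lambda>_ :: nat. \<mu>" ..

sublocale Q: prob_space Om by (rule prob_space_PiM) (rule prob_space_axioms)

text \<open>Only the components 0 and 4 are moved, because they are the ones that enter the
  singularity of \<open>P\<close>.\<close>

definition "act U V Q = Q(0 := U * Q 0, 4 := V * Q (4::nat))"

lemma measurable_component: "k \<le> 4 \<Longrightarrow> (\<lambda>Q. Q k) \<in> measurable Om \<mu>"
  by (rule measurable_component_singleton) simp

lemma component_unitary: "Q \<in> space Om \<Longrightarrow> k \<le> 4 \<Longrightarrow> Q k \<in> unitary_group d"
  by (auto simp: space_PiM PiE_iff space_haar)

lemma measurable_PiI:
  assumes "\<And>k. k \<le> 4 \<Longrightarrow> (\<lambda>\<omega>. F \<omega> k) \<in> measurable M \<mu>" "\<And>\<omega>. \<omega> \<in> space M \<Longrightarrow> F \<omega> \<in> extensional {0..4}"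
  shows "F \<in> measurable M Om"
  by (rule measurable_PiM_single') (use assms measurable_space[OF assms(1)] in \<open>auto simp: PiE_iff\<close>)

lemma measurable_act_pair:
  assumes U: "U \<in> measurable M \<mu>" and V: "V \<in> measurable M \<mu>" and F: "F \<in> measurable M Om"
  shows "(\<lambda>\<omega>. act (U \<omega>) (V \<omega>) (F \<omega>)) \<in> measurable M Om"
proof (rule measurable_PiI)
  fix k :: nat assume k: "k \<le> 4"
  have "(\<lambda>\<omega>. F \<omega> k) \<in> measurable M \<mu>" if "k \<le> 4" for k
    using measurable_compose[OF F measurable_component[OF that]] .
  then show "(\<lambda>\<omega>. act (U \<omega>) (V \<omega>) (F \<omega>) k) \<in> measurable M \<mu>"
    using k by (cases "k = 0"; cases "k = 4") (auto simp: act_def intro!: measurable_mult_haar U V)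
next
  fix \<omega> assume "\<omega> \<in> space M"
  then show "act (U \<omega>) (V \<omega>) (F \<omega>) \<in> extensional {0..4}"
    using measurable_space[OF F] by (auto simp: space_PiM PiE_iff act_def extensional_def)
qed

lemma measurable_act: "U \<in> unitary_group d \<Longrightarrow> V \<in> unitary_group d \<Longrightarrow> act U V \<in> measurable Om Om"
  by (rule measurable_act_pair) (auto simp: space_haar)

lemma distr_act:
  assumes U: "U \<in> unitary_group d" and V: "V \<in> unitary_group d"
  shows "distr Om Om (act U V) = Om"
proof (rule P.PiM_eqI)
  fix A :: "nat \<Rightarrow> 'a mat set" assume A: "\<And>k. k \<in> {0..4} \<Longrightarrow> A k \<in> sets \<mu>"
  define t where "t k = (if k = 0 then (\<lambda>X. U * X) else if k = 4 then (\<lambda>X. V * X) else (\<lambda>X. X :: 'a mat))" for k :: nat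
  have t: "t k \<in> measurable \<mu> \<mu>" "distr \<mu> \<mu> (t k) = \<mu>" for k
    using U V by (auto simp: t_def measurable_const_mult distr_mult distr_id2)
  have "act U V -` Pi\<^sub>E {0..4} A \<inter> space Om = Pi\<^sub>E {0..4} (\<lambda>k. t k -` A k \<inter> space \<mu>)"
  proof -
    have act_t: "act U V Q k = t k (Q k)" for Q k by (simp add: act_def t_def)
    have t_id: "t k X = X" if "\<not> k \<le> 4" for k X using that by (auto simp: t_def)
    show ?thesis
      by (auto simp: space_PiM PiE_iff act_t t_id extensional_def)
  qed
  then have "emeasure (distr Om Om (act U V)) (Pi\<^sub>E {0..4} A) = emeasure Om (Pi\<^sub>E {0..4} (\<lambda>k. t k -` A k \<inter> space \<mu>))"
    using A by (subst emeasure_distr) (auto intro!: measurable_act[OF U V] sets_PiM_I_finite)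
  also have "\<dots> = (\<Prod>k\<in>{0..4}. emeasure \<mu> (t k -` A k \<inter> space \<mu>))"
    using A t by (intro P.emeasure_PiM) (auto intro: measurable_sets)
  also have "\<dots> = (\<Prod>k\<in>{0..4}. emeasure \<mu> (A k))"
    using A t by (intro prod.cong refl) (metis emeasure_distr)
  finally show "emeasure (distr Om Om (act U V)) (Pi\<^sub>E {0..4} A) = (\<Prod>k\<in>{0..4}. emeasure \<mu> (A k))" .
qed auto

end

section \<open>Near-singularity counted over roots of unity\<close>

primrec pow_fm :: "nat \<Rightarrow> 'a::rc_field fm \<Rightarrow> nat \<Rightarrow> 'a fm" where
  "pow_fm d U 0 = one_fm d"
| "pow_fm d U (Suc j) = U * pow_fm d U j"

lemma unitary_pow_fm: "unitary_fm d U \<Longrightarrow> unitary_fm d (pow_fm d U j)"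
proof (induction j)
  case 0 show ?case by (simp add: unitary_fm_def one_fm_mult)
qed (simp add: unitary_fm_mult)

lemma norm_unitary_fm: "unitary_fm d U \<Longrightarrow> (norm U)\<^sup>2 = d"
  using norm_mult_unitary(1)[of d U "one_fm d"] norm_one_fm[of d, where 'a = 'a]
  by (simp add: unitary_fm_def one_fm_mult)

lemma pow_fm_commute: "supp_le d U \<Longrightarrow> pow_fm d U j * U = U * pow_fm d U j"
  by (induction j) (simp_all add: one_fm_mult mult_one_fm mult.assoc)

lemma root_of_unity_orthogonality:
  fixes n :: nat assumes n: "n > 0" and jl: "j < n" "l < n"
  shows "(\<Sum>k<n. (cis (2 * pi / n) ^ k) ^ j * cnj ((cis (2 * pi / n) ^ k) ^ l)) = (if j = l then of_nat n else 0)"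
proof -
  define w where "w = cis (2 * pi * (real j - real l) / n)"
  have "(cis (2 * pi / n) ^ k) ^ j * cnj ((cis (2 * pi / n) ^ k) ^ l) = w ^ k" for k
  proof -
    have "(cis (2 * pi / n) ^ k) ^ j * cnj ((cis (2 * pi / n) ^ k) ^ l)
      = cis (real (k * j) * (2 * pi / n)) * cis (- (real (k * l) * (2 * pi / n)))"
      by (simp only: power_mult[symmetric] Complex.DeMoivre cis_cnj of_nat_mult mult_ac)
    also have "\<dots> = cis (real k * (2 * pi * (real j - real l) / n))"
      unfolding cis_mult by (rule arg_cong[where f = cis]) (simp add: right_diff_distrib diff_divide_distrib mult_ac)
    finally show ?thesis unfolding w_def Complex.DeMoivre .
  qed
  then have eq: "(\<Sum>k<n. (cis (2 * pi / n) ^ k) ^ j * cnj ((cis (2 * pi / n) ^ k) ^ l)) = (\<Sum>k<n. w ^ k)" by simp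
  show ?thesis
  proof (cases "j = l")
    case False
    have wn: "w ^ n = 1"
    proof -
      have "w ^ n = cis (real n * (2 * pi * (real j - real l) / n))" unfolding w_def by (rule Complex.DeMoivre)
      also have "real n * (2 * pi * (real j - real l) / n) = 2 * pi * (real j - real l)" using n by simp
      also have "cis \<dots> = 1" by (rule cis_multiple_2pi) auto
      finally show ?thesis .
    qed
    \<comment> \<open>\<open>w = 1\<close> would make \<open>n\<close> divide \<open>j - l\<close>,
      whose absolute value is below \<open>n\<close>.\<close>
    have "w \<noteq> 1"
    proof
      assume "w = 1"
      then have "cos (2 * pi * (real j - real l) / n) = 1" by (simp add: w_def complex_eq_iff)
      then obtain x :: int where x: "2 * pi * (real j - real l) / n = of_int x * 2 * pi"
        using cos_one_2pi_int by blast
      have "2 * pi * (real j - real l) = 2 * pi * (real j - real l) / n * n" using n by simp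
      also have "\<dots> = 2 * pi * (of_int x * n)" unfolding x by simp
      finally have "real j - real l = of_int x * n" by simp
      then have "real_of_int (int j - int l) = real_of_int (x * int n)" by simp
      then have "int j - int l = x * int n" by linarith
      moreover have "\<bar>int j - int l\<bar> < int n" using jl by linarith
      ultimately have lt: "\<bar>x\<bar> * int n < int n" by (simp add: abs_mult)
      have "x = 0"
      proof (rule ccontr)
        assume "x \<noteq> 0"
        then have "1 * int n \<le> \<bar>x\<bar> * int n" by (intro mult_right_mono) auto
        with lt show False by simp
      qed
      with \<open>int j - int l = x * int n\<close> False show False by simp
    qed
    with False show ?thesis unfolding eq using wn by (simp add: geometric_sum)
  next
    case True
    then show ?thesis unfolding eq by (simp add: w_def)
  qed
qed

lemma norm_sum_sq_complex:
  fixes f :: "nat \<Rightarrow> complex"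
  shows "complex_of_real ((norm (\<Sum>j<n. f j))\<^sup>2) = (\<Sum>j<n. \<Sum>l<n. f j * cnj (f l))"
  unfolding complex_norm_square by (simp add: sum_product)

lemma parseval:
  fixes y :: "nat \<Rightarrow> complex"
  assumes n: "n > 0"
  shows "(\<Sum>k<n. (norm (\<Sum>j<n. (cis (2 * pi / n) ^ k) ^ j * y j))\<^sup>2) = n * (\<Sum>j<n. (norm (y j))\<^sup>2)"
proof -
  let ?z = "\<lambda>k. cis (2 * pi / n) ^ k"
  have "complex_of_real (\<Sum>k<n. (norm (\<Sum>j<n. ?z k ^ j * y j))\<^sup>2)
    = (\<Sum>k<n. \<Sum>j<n. \<Sum>l<n. (?z k ^ j * y j) * cnj (?z k ^ l * y l))"
    unfolding of_real_sum norm_sum_sq_complex ..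
  also have "\<dots> = (\<Sum>j<n. \<Sum>k<n. \<Sum>l<n. (?z k ^ j * y j) * cnj (?z k ^ l * y l))" by (rule sum.swap)
  also have "\<dots> = (\<Sum>j<n. \<Sum>l<n. \<Sum>k<n. (?z k ^ j * y j) * cnj (?z k ^ l * y l))"
    by (intro sum.cong refl sum.swap)
  also have "\<dots> = (\<Sum>j<n. \<Sum>l<n. (y j * cnj (y l)) * (\<Sum>k<n. ?z k ^ j * cnj (?z k ^ l)))"
    by (simp add: sum_distrib_left mult_ac)
  also have "\<dots> = (\<Sum>j<n. \<Sum>l<n. if j = l then of_nat n * (y j * cnj (y j)) else 0)"
    by (intro sum.cong refl) (subst root_of_unity_orthogonality[OF n], auto)
  also have "\<dots> = (\<Sum>j<n. of_nat n * (y j * cnj (y j)))" by (simp add: sum.delta)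
  also have "\<dots> = complex_of_real (n * (\<Sum>j<n. (norm (y j))\<^sup>2))"
    by (simp add: complex_norm_square sum_distrib_left del: of_real_power)
  finally show ?thesis by (simp only: of_real_eq_iff)
qed

lemma parseval_fm:
  fixes Y :: "nat \<Rightarrow> complex fm"
  assumes n: "n > 0" and Y: "\<And>j. j < n \<Longrightarrow> supp_le d (Y j)"
  shows "(\<Sum>k<n. (norm (\<Sum>j<n. smult_fm ((cis (2 * pi / n) ^ k) ^ j) (Y j)))\<^sup>2) = n * (\<Sum>j<n. (norm (Y j))\<^sup>2)"
proof -
  let ?z = "\<lambda>k. cis (2 * pi / n) ^ k"
  have s: "supp_le d (\<Sum>j<n. smult_fm (?z k ^ j) (Y j))" for k
    using Y by (auto simp: supp_le_def ent_sum)
  have "(\<Sum>k<n. (norm (\<Sum>j<n. smult_fm (?z k ^ j) (Y j)))\<^sup>2)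
    = (\<Sum>k<n. \<Sum>a<d. \<Sum>b<d. (norm (\<Sum>j<n. ?z k ^ j * ent (Y j) a b))\<^sup>2)"
    by (simp add: norm_fm_sq[OF s] ent_sum)
  also have "\<dots> = (\<Sum>a<d. \<Sum>k<n. \<Sum>b<d. (norm (\<Sum>j<n. ?z k ^ j * ent (Y j) a b))\<^sup>2)" by (rule sum.swap)
  also have "\<dots> = (\<Sum>a<d. \<Sum>b<d. \<Sum>k<n. (norm (\<Sum>j<n. ?z k ^ j * ent (Y j) a b))\<^sup>2)"
    by (intro sum.cong refl sum.swap)
  also have "\<dots> = (\<Sum>a<d. \<Sum>b<d. n * (\<Sum>j<n. (norm (ent (Y j) a b))\<^sup>2))"
    by (simp only: parseval[OF n])
  also have "\<dots> = n * (\<Sum>a<d. \<Sum>j<n. \<Sum>b<d. (norm (ent (Y j) a b))\<^sup>2)"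
    by (simp add: sum_distrib_left) (intro sum.cong refl sum.swap)
  also have "\<dots> = n * (\<Sum>j<n. \<Sum>a<d. \<Sum>b<d. (norm (ent (Y j) a b))\<^sup>2)"
    by (simp only: sum.swap[of _ "{..<n}" "{..<d}"])
  also have "\<dots> = n * (\<Sum>j<n. (norm (Y j))\<^sup>2)"
    using Y by (intro arg_cong[where f="\<lambda>x. real n * x"] sum.cong refl) (simp add: norm_fm_sq[OF Y])
  finally show ?thesis .
qed

text \<open>Inverting \<open>1 + r z U\<close> with \<open>r = 1 - \<kappa>\<close> by a truncated Neumann series, near-singularity of
  \<open>1 + z U\<close> makes the series large, while Parseval's identity bounds its mean square over the roots
  of unity \<open>z\<close>.\<close>

lemma count_near_singular:
  fixes U :: "complex fm"
  assumes U: "unitary_fm d U" and \<kappa>: "0 < \<kappa>" "\<kappa> < 1" and n: "n > 0" "(1 - \<kappa>) ^ n \<le> 1 / 2"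
  shows "real (card {k. k < n \<and> \<not> low d \<kappa> (one_fm d + smult_fm (cis (2 * pi / n) ^ k) U)}) \<le> 16 * \<kappa> * d * n"
proof -
  define r where "r = 1 - \<kappa>"
  have r: "0 < r" "r < 1" using \<kappa> by (auto simp: r_def)
  let ?z = "\<lambda>k. cis (2 * pi / n) ^ k"
  \<comment> \<open>The coefficients of the Neumann series of the inverse of
    \<open>1 + r z U\<close>, as a polynomial in \<open>z\<close>.\<close>
  define Y where "Y j = smult_fm ((- of_real r) ^ j) (pow_fm d U j)" for j
  define T where "T k = (\<Sum>j<n. smult_fm (?z k ^ j) (Y j))" for k
  have sU: "supp_le d U" using U by (simp add: unitary_fm_def)
  have sp: "supp_le d (pow_fm d U j)" for j using unitary_pow_fm[OF U] by (simp add: unitary_fm_def)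
  \<comment> \<open>Being \<open>n\<close>-th powers, the phases disappear from the remainder of the
    truncated series.\<close>
  have zn: "?z k ^ n = 1" for k
  proof -
    have "?z k ^ n = (cis (2 * pi / n) ^ n) ^ k" by (simp add: power_mult[symmetric] mult.commute)
    also have "cis (2 * pi / n) ^ n = 1" using Complex.DeMoivre[of "2 * pi / n" n] n by simp
    finally show ?thesis by simp
  qed
  have nY: "(norm (Y j))\<^sup>2 = d * (r\<^sup>2) ^ j" for j
    using norm_unitary_fm[OF unitary_pow_fm[OF U, of j]] r
    by (simp add: Y_def norm_smult_fm norm_power power_mult_distrib power_mult[symmetric] mult.commute)
  \<comment> \<open>Every power of \<open>U\<close> has squared Frobenius norm \<open>d\<close>, and
    the geometric series of \<open>r\<^sup>2\<close> is at most \<open>1 / \<kappa>\<close>.\<close>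
  have sumT: "(\<Sum>k<n. (norm (T k))\<^sup>2) \<le> n * (d / \<kappa>)"
  proof -
    have "(\<Sum>k<n. (norm (T k))\<^sup>2) = n * (\<Sum>j<n. (norm (Y j))\<^sup>2)"
      unfolding T_def by (rule parseval_fm[OF n(1), of d]) (auto simp: Y_def intro: sp)
    also have "(\<Sum>j<n. (norm (Y j))\<^sup>2) \<le> d / \<kappa>"
    proof -
      have "r * r \<le> r * 1" using r by (intro mult_left_mono) auto
      then have r2: "r\<^sup>2 < 1" "r\<^sup>2 \<le> r" "0 \<le> r\<^sup>2" using r mult_strict_mono[of r 1 r 1] by (auto simp: power2_eq_square)
      have "(\<Sum>j<n. (norm (Y j))\<^sup>2) = d * (\<Sum>j<n. (r\<^sup>2) ^ j)" by (simp add: nY sum_distrib_left)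
      also have "(\<Sum>j<n. (r\<^sup>2) ^ j) = (1 - (r\<^sup>2) ^ n) / (1 - r\<^sup>2)" using r2 by (simp add: sum_gp_strict)
      also have "\<dots> \<le> 1 / \<kappa>" using r2 \<kappa> by (intro frac_le) (auto simp: r_def)
      finally show ?thesis by (simp add: mult_left_mono)
    qed
    finally show ?thesis by (simp add: mult_left_mono)
  qed
  \<comment> \<open>If \<open>1 + z U\<close> nearly kills \<open>X\<close>, then \<open>Z\<close>,
    the image of \<open>X\<close> under \<open>1 + r z U\<close>, has norm at most
    \<open>2 * \<kappa> * norm X\<close>. Since \<open>T k\<close> maps \<open>Z\<close> back to
    \<open>X\<close> up to a remainder of at most half its norm, \<open>T k\<close> is
    large.\<close>
  have big: "1 / (16 * \<kappa>\<^sup>2) \<le> (norm (T k))\<^sup>2" if nl: "\<not> low d \<kappa> (one_fm d + smult_fm (?z k) U)" for k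
  proof -
    obtain X where X: "supp_le d X" "norm ((one_fm d + smult_fm (?z k) U) * X) < \<kappa> * norm X"
      using nl unfolding low_def by (meson not_le)
    define Z where "Z = X + smult_fm (of_real r * ?z k) (U * X)"
    have X0: "norm X > 0"
      using order_le_less_trans[OF norm_ge_zero X(2)] \<kappa> by (simp add: zero_less_mult_iff)
    have nUX: "norm (U * X) = norm X" using norm_unitary_mult(1)[OF U X(1)] .
    have "Z = (one_fm d + smult_fm (?z k) U) * X - smult_fm (of_real \<kappa> * ?z k) (U * X)"
      unfolding Z_def using X(1)
      by (intro fm_eqI) (simp add: distrib_right one_fm_mult smult_fm_mult r_def algebra_simps)
    then have "norm Z \<le> norm ((one_fm d + smult_fm (?z k) U) * X) + norm (smult_fm (of_real \<kappa> * ?z k) (U * X))"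
      by (simp only: norm_triangle_ineq4)
    also have "norm (smult_fm (of_real \<kappa> * ?z k) (U * X)) = \<kappa> * norm X"
      using \<kappa> by (simp add: norm_smult_fm norm_mult norm_power nUX)
    finally have Z: "norm Z \<le> 2 * \<kappa> * norm X" using X(2) by simp
    have sZ: "supp_le d Z" using X sU by (auto simp: Z_def)
    have partial: "(\<Sum>j<m. smult_fm (?z k ^ j) (Y j)) * Z = X - smult_fm ((- of_real r * ?z k) ^ m) (pow_fm d U m * X)" for m
    proof (induction m)
      case 0 show ?case using X(1) by (simp add: one_fm_mult)
    next
      case (Suc m)
      have "smult_fm (?z k ^ m) (Y m) * Z = smult_fm ((- of_real r * ?z k) ^ m) (pow_fm d U m * Z)"
        by (simp add: Y_def smult_fm_mult mult.commute flip: power_mult_distrib)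
      also have "pow_fm d U m * Z = pow_fm d U m * X + smult_fm (of_real r * ?z k) (pow_fm d U (Suc m) * X)"
        by (simp add: Z_def distrib_left smult_fm_mult pow_fm_commute[OF sU] flip: mult.assoc)
      finally show ?case using Suc
        by (simp add: distrib_right smult_fm_add) (intro fm_eqI, simp add: algebra_simps)
    qed
    have "T k * Z = X - smult_fm ((- of_real r) ^ n) (pow_fm d U n * X)"
      unfolding T_def partial by (simp only: power_mult_distrib zn mult_1_right)
    then have "norm X - norm (smult_fm ((- of_real r) ^ n) (pow_fm d U n * X)) \<le> norm (T k * Z)"
      by (simp only: norm_triangle_ineq2)
    also have "norm (smult_fm ((- of_real r) ^ n) (pow_fm d U n * X)) = r ^ n * norm X"
      using r by (simp add: norm_smult_fm norm_power norm_unitary_mult(1)[OF unitary_pow_fm[OF U] X(1)])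
    also have "norm (T k * Z) \<le> norm (T k) * (2 * \<kappa> * norm X)"
      using norm_mult_ineq[of "T k" Z] mult_left_mono[OF Z norm_ge_zero[of "T k"]] by linarith
    finally have "norm X - r ^ n * norm X \<le> norm (T k) * (2 * \<kappa> * norm X)" .
    moreover have "r ^ n * norm X \<le> 1 / 2 * norm X" using n(2) by (intro mult_right_mono) (auto simp: r_def)
    ultimately have "1 / 2 * norm X \<le> (norm (T k) * (2 * \<kappa>)) * norm X" by (simp add: mult_ac)
    then have "1 / 2 \<le> norm (T k) * (2 * \<kappa>)" using X0 by (simp only: mult_le_cancel_right)
    then have "1 / (4 * \<kappa>) \<le> norm (T k)" using \<kappa> by (simp add: field_simps)
    then have "(1 / (4 * \<kappa>))\<^sup>2 \<le> (norm (T k))\<^sup>2" using \<kappa> by (intro power_mono) auto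
    then show ?thesis by (simp add: power_divide power_mult_distrib)
  qed
  define B where "B = {k. k < n \<and> \<not> low d \<kappa> (one_fm d + smult_fm (?z k) U)}"
  \<comment> \<open>Markov's inequality for the counting measure on the roots of unity.\<close>
  have "real (card B) * (1 / (16 * \<kappa>\<^sup>2)) = (\<Sum>k\<in>B. 1 / (16 * \<kappa>\<^sup>2))" by simp
  also have "\<dots> \<le> (\<Sum>k\<in>B. (norm (T k))\<^sup>2)" by (intro sum_mono big) (simp add: B_def)
  also have "\<dots> \<le> (\<Sum>k<n. (norm (T k))\<^sup>2)" by (intro sum_mono2) (auto simp: B_def)
  also have "\<dots> \<le> n * (d / \<kappa>)" by (rule sumT)
  finally show ?thesis using \<kappa> by (simp add: B_def field_simps power2_eq_square)
qed

lemma ex_power_le_half: "0 < \<kappa> \<Longrightarrow> \<kappa> < 1 \<Longrightarrow> \<exists>n>0. (1 - \<kappa>) ^ n \<le> (1 / 2 :: real)"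
proof -
  assume "0 < \<kappa>" "\<kappa> < 1"
  then obtain n where n: "(1 - \<kappa>) ^ n < 1 / 2" using real_arch_pow_inv[of "1 / 2" "1 - \<kappa>"] by auto
  then have "n > 0" by (cases n) auto
  with n show ?thesis by (auto intro: less_imp_le)
qed

lemma bounded_linear_conjugate: "bounded_linear (conjugate :: 'a::rc_field \<Rightarrow> 'a)"
  by (rule bounded_linear_intro[of _ 1]) (auto simp: conjugate_dist_add conjugate_scaleR)

lemma borel_measurable_conjugate:
  "f \<in> borel_measurable M \<Longrightarrow> (\<lambda>x. conjugate (f x :: 'a::rc_field)) \<in> borel_measurable M"
  by (rule measurable_compose[of f M borel])
    (auto intro!: borel_measurable_continuous_onI linear_continuous_on bounded_linear_conjugate)

lemma unitary_group_one: "(1\<^sub>m d :: 'a::rc_field mat) \<in> unitary_group d"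
  by (rule unitary_group_of_fm) (auto simp: Fm_one unitary_fm_def one_fm_mult)

lemma unitary_group_smult: "norm c = 1 \<Longrightarrow> U \<in> unitary_group d \<Longrightarrow> c \<cdot>\<^sub>m U \<in> unitary_group (d::nat)" for c :: "'a::rc_field"
  by (rule unitary_group_of_fm)
    (auto simp: Fm_smult_fm unitary_group_carrier intro!: unitary_fm_smult unitary_fm_Fm)

lemma unitary_group_adjoint: "U \<in> unitary_group d \<Longrightarrow> mat_adjoint U \<in> unitary_group d" for U :: "'a::rc_field mat"
  by (rule unitary_group_of_fm)
    (auto simp: Fm_adjoint unitary_group_carrier intro!: unitary_fm_adj unitary_fm_Fm)

context haar
begin

definition "C V Q = adj (Fm d (Q 0)) + adj (Fm d (V * Q (4::nat)))"

lemma supp_le_C: "supp_le d (C V Q)"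
  unfolding C_def by auto

lemma measurable_C:
  assumes V: "V \<in> unitary_group d" and ik: "i < d" "k < d"
  shows "(\<lambda>Q. ent (C V Q) i k) \<in> borel_measurable Om"
proof -
  have "(\<lambda>Q. V * Q 4) \<in> measurable Om \<mu>"
    by (rule measurable_compose[OF measurable_component measurable_const_mult[OF V]]) simp
  then show ?thesis
    unfolding C_def using ik
    by (auto simp: ent_Fm intro!: borel_measurable_add borel_measurable_conjugate measurable_entry_compose[of _ Om]
        measurable_component)
qed

lemma sets_low_C: "V \<in> unitary_group d \<Longrightarrow> c \<ge> 0 \<Longrightarrow> {Q \<in> space Om. \<not> low d c (C V Q)} \<in> sets Om"
  using measurable_low_event[of d "C V" Om "\<lambda>_. True" "\<lambda>x. c\<^sup>2 * sqv d x"] measurable_C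
  by (simp add: not_low_dense[OF supp_le_C d])

end

text \<open>Multiplying one of the two Haar matrices by the roots of unity leaves the law unchanged.\<close>

lemma complex_haar_near_singular:
  fixes \<mu> :: "complex mat measure"
  assumes "haar d \<mu>" and V: "V \<in> unitary_group d" and c: "0 < c" "c < 1"
  shows "measure (PiM {0..4} (\<lambda>_. \<mu>)) {Q \<in> space (PiM {0..4} (\<lambda>_. \<mu>)). \<not> low d c (haar.C d V Q)} \<le> 16 * c * d"
proof -
  interpret haar d \<mu> by fact
  obtain n where n: "n > 0" "(1 - c) ^ n \<le> 1 / 2" using ex_power_le_half[OF c] by blast
  let ?z = "\<lambda>k. cis (2 * pi / n) ^ k"
  \<comment> \<open>The conjugate compensates the adjoint that \<open>C\<close> applies to
    \<open>V * Q 4\<close>.\<close>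
  let ?U = "\<lambda>k. cnj (?z k) \<cdot>\<^sub>m 1\<^sub>m d"
  have U: "?U k \<in> unitary_group d" for k
    by (rule unitary_group_smult[OF _ unitary_group_one]) (simp add: norm_power)
  show ?thesis
  proof (rule Q.prob_le_average[where T = "\<lambda>k. act (1\<^sub>m d) (?U k)", OF n(1)])
    show "{Q \<in> space Om. \<not> low d c (C V Q)} \<in> sets Om" using sets_low_C[OF V] c by simp
    show "act (1\<^sub>m d) (?U k) \<in> measurable Om Om" "distr Om Om (act (1\<^sub>m d) (?U k)) = Om" for k
      using measurable_act[OF unitary_group_one U] distr_act[OF unitary_group_one U] by auto
    fix Q assume Q: "Q \<in> space Om"
    have uQ: "Q 0 \<in> unitary_group d" "Q 4 \<in> unitary_group d" using component_unitary[OF Q] by auto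
    note cQ = uQ[THEN unitary_group_carrier] unitary_group_carrier[OF V]
    \<comment> \<open>After splitting off the unitary factor \<open>adj (Fm d (Q 0))\<close>, the
      translated matrix is \<open>1 + z W\<close>, to which the count applies.\<close>
    define W where "W = Fm d (Q 0) * adj (Fm d (V * Q 4))"
    have W: "unitary_fm d W"
      unfolding W_def by (intro unitary_fm_mult unitary_fm_adj unitary_fm_Fm unitary_group_mult V uQ)
    have "low d c (C V (act (1\<^sub>m d) (?U k) Q))" if l: "low d c (one_fm d + smult_fm (?z k) W)" for k
    proof -
      have "V * (?U k * Q 4) = cnj (?z k) \<cdot>\<^sub>m (V * Q 4)"
        using cQ by (simp add: mult_smult_distrib[of _ d d _ d] mult_smult_assoc_mat[of _ d d _ d])
      then have "C V (act (1\<^sub>m d) (?U k) Q) = adj (Fm d (Q 0)) + smult_fm (?z k) (adj (Fm d (V * Q 4)))"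
        using cQ by (simp add: C_def act_def Fm_smult_fm mult_carrier_square)
      also have "\<dots> = adj (Fm d (Q 0)) * (one_fm d + smult_fm (?z k) W)"
        using unitary_cancel(1)[OF unitary_fm_Fm[OF uQ(1)], of "adj (Fm d (V * Q 4))"]
        by (simp add: W_def distrib_left smult_fm_mult mult_one_fm supp_le_adj)
      finally show ?thesis
        using low_unitary_mult[OF unitary_fm_adj[OF unitary_fm_Fm[OF uQ(1)]] l] W
        by (auto simp: unitary_fm_def)
    qed
    then have "card {k. k < n \<and> act (1\<^sub>m d) (?U k) Q \<in> {Q \<in> space Om. \<not> low d c (C V Q)}}
        \<le> card {k. k < n \<and> \<not> low d c (one_fm d + smult_fm (?z k) W)}"
      by (intro card_mono) auto
    with count_near_singular[OF W c n]
    show "real (card {k. k < n \<and> act (1\<^sub>m d) (?U k) Q \<in> {Q \<in> space Om. \<not> low d c (C V Q)}}) \<le> 16 * c * d * n"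
      by linarith
  qed (use c in simp)
qed

text \<open>The one-dimensional instance of the count above, applied to the square of the unit complex number
  in the direction of \<open>(p, -q)\<close>.\<close>

lemma count_near_orthogonal:
  fixes p q :: real
  assumes v: "0 < v" and n: "n > 0" "(1 - 2 * v) ^ n \<le> 1 / 2" "2 * v < 1" and pq: "p\<^sup>2 + q\<^sup>2 \<le> 1"
  shows "(p\<^sup>2 + q\<^sup>2) * card {k. k < n \<and> \<bar>cos (pi * k / n) * p + sin (pi * k / n) * q\<bar> < v} \<le> 32 * v * sqrt (p\<^sup>2 + q\<^sup>2) * n"
    (is "_ * real (card ?B) \<le> _")
proof (cases "p\<^sup>2 + q\<^sup>2 = 0")
  case False
  note pq0 = this
  define \<rho> where "\<rho> = sqrt (p\<^sup>2 + q\<^sup>2)"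
  have \<rho>: "\<rho> > 0" "\<rho> \<le> 1" "\<rho>\<^sup>2 = p\<^sup>2 + q\<^sup>2"
    using False pq by (auto simp: \<rho>_def sum_power2_gt_zero_iff)
  \<comment> \<open>For unit complex \<open>x\<close>, the modulus of \<open>1 + x\<^sup>2\<close>
    is twice that of the real part of \<open>x\<close>. Normalizing by \<rho> turns the threshold
    \<open>v\<close> into this \<kappa>.\<close>
  define \<kappa> where "\<kappa> = 2 * v / \<rho>"
  have \<kappa>: "\<kappa> \<ge> 2 * v" using \<rho> v by (simp add: \<kappa>_def field_simps mult_le_cancel_left1)
  have "real (card ?B) \<le> 16 * \<kappa> * n"
  \<comment> \<open>The count above needs \<kappa> below one; otherwise the trivial bound
    \<open>n\<close> already suffices.\<close>
  proof (cases "\<kappa> < 1")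
    case False
    have "card ?B \<le> card {..<n}" by (intro card_mono) auto
    then have "real (card ?B) \<le> n" by simp
    also have "\<dots> \<le> 16 * \<kappa> * n" using False by (simp add: mult_le_cancel_right1)
    finally show ?thesis .
  next
    case True
    define c where "c = Complex (p / \<rho>) (- (q / \<rho>))"
    have "(norm c)\<^sup>2 = (p\<^sup>2 + q\<^sup>2) / \<rho>\<^sup>2" by (simp add: c_def cmod_power2 power_divide add_divide_distrib)
    also have "\<dots> = 1" unfolding \<rho>(3) using pq0 by simp
    finally have nc: "norm c = 1" using norm_ge_zero[of c] by (auto simp: power2_eq_1_iff)
    define U where "U = unit_fm 0 0 (c\<^sup>2)"
    have U: "unitary_fm 1 U"
    proof -
      have "cnj (c\<^sup>2) * c\<^sup>2 = 1"
        using nc complex_norm_square[of "c\<^sup>2"] by (simp add: norm_power mult.commute)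
      moreover have s: "supp_le 1 U" by (auto simp: supp_le_def U_def ent_unit)
      ultimately show ?thesis
        by (auto simp: unitary_fm_def U_def ent_mult[of 1] ent_unit ent_one supp_le_def mult.commute intro!: fm_eqI)
    qed
    have "?B \<subseteq> {k. k < n \<and> \<not> low 1 \<kappa> (one_fm 1 + smult_fm (cis (2 * pi / n) ^ k) U)}"
    proof safe
      fix k assume k: "k < n" "\<bar>cos (pi * k / n) * p + sin (pi * k / n) * q\<bar> < v"
        and l: "low 1 \<kappa> (one_fm 1 + smult_fm (cis (2 * pi / n) ^ k) U)"
      \<comment> \<open>Half of the angle of the root of unity: the linear form is \<rho> times the
        real part of \<open>z * c\<close>, and squaring \<open>z\<close> restores the root of
        unity.\<close>
      define z where "z = cis (pi * k / n)"
      have z2: "cis (2 * pi / n) ^ k = z\<^sup>2" by (simp add: z_def Complex.DeMoivre mult_ac)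
      have s: "supp_le 1 (unit_fm 0 0 (1::complex))" by (auto simp: supp_le_def ent_unit)
      have "(one_fm 1 + smult_fm (z\<^sup>2) U) * unit_fm 0 0 1 = unit_fm 0 0 (1 + (z * c)\<^sup>2)"
        using U by (intro fm_eqI)
          (auto simp: ent_mult'[OF s] ent_unit ent_one U_def power_mult_distrib)
      then have "\<kappa> \<le> norm (1 + (z * c)\<^sup>2)" using lowD[OF l s] z2 by simp
      also have "\<dots> = norm (cnj (z * c)) * norm (1 + (z * c)\<^sup>2)" using nc by (simp add: norm_mult z_def)
      also have "\<dots> = norm (cnj (z * c) + z * c)"
      proof -
        have "cnj (z * c) * (z * c) = 1"
          using nc complex_norm_square[of "z * c"] by (simp add: norm_mult z_def mult.commute)
        then have "cnj (z * c) * (1 + (z * c)\<^sup>2) = cnj (z * c) + z * c"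
          by (simp only: distrib_left mult_1_right power2_eq_square mult.assoc[symmetric] mult_1_left)
        then show ?thesis by (metis norm_mult)
      qed
      also have "cnj (z * c) + z * c = of_real (2 * Re (z * c))"
        by (simp only: complex_add_cnj add.commute)
      also have "norm (complex_of_real (2 * Re (z * c))) = 2 * \<bar>(cos (pi * k / n) * p + sin (pi * k / n) * q) / \<rho>\<bar>"
      proof -
        have "Re (z * c) = (cos (pi * k / n) * p + sin (pi * k / n) * q) / \<rho>"
          by (simp add: z_def c_def add_divide_distrib)
        then show ?thesis unfolding norm_of_real by (metis abs_mult abs_numeral)
      qed
      also have "\<dots> = 2 * \<bar>cos (pi * k / n) * p + sin (pi * k / n) * q\<bar> / \<rho>" using \<rho> by simp
      also have "\<dots> < 2 * v / \<rho>" using k(2) \<rho> by (intro divide_strict_right_mono) auto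
      finally show False by (simp add: \<kappa>_def)
    qed
    then have "real (card ?B) \<le> card {k. k < n \<and> \<not> low 1 \<kappa> (one_fm 1 + smult_fm (cis (2 * pi / n) ^ k) U)}"
      by (intro of_nat_mono card_mono) auto
    also have "\<dots> \<le> 16 * \<kappa> * 1 * n"
    proof -
      have "(1 - \<kappa>) ^ n \<le> (1 - 2 * v) ^ n" using \<kappa> True by (intro power_mono) auto
      then show ?thesis using count_near_singular[OF U _ True n(1)] n(2) \<kappa> v by simp
    qed
    finally show ?thesis by simp
  qed
  then have "\<rho>\<^sup>2 * real (card ?B) \<le> \<rho>\<^sup>2 * (16 * \<kappa> * n)" by (intro mult_left_mono) auto
  also have "\<dots> = 32 * v * \<rho> * n" using \<rho>(1) by (simp add: \<kappa>_def power2_eq_square)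
  finally show ?thesis by (simp only: \<rho>(3) \<rho>_def[symmetric])
qed simp

section \<open>Householder reflections and a small-ball bound for one Haar coordinate\<close>

definition reflection :: "nat \<Rightarrow> (nat \<Rightarrow> real) \<Rightarrow> real mat" where
  "reflection d w = mat d d (\<lambda>(r, c). (if r = c then 1 else 0) - 2 * w r * w c)"

lemma reflection_unitary:
  assumes w: "(\<Sum>k<d. (w k)\<^sup>2) = 1"
  shows "reflection d w \<in> unitary_group d"
proof -
  have R: "reflection d w \<in> carrier_mat d d" by (simp add: reflection_def)
  have adj: "mat_adjoint (reflection d w) = reflection d w"
    by (rule eq_matI) (use carrier_matD[OF R] carrier_matD[OF adjoint_carrier[OF R]] in
        \<open>auto simp: index_adjoint[OF R]\<close>, auto simp: reflection_def)
  have "reflection d w * reflection d w = 1\<^sub>m d"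
  proof (rule eq_matI)
    fix r c assume "r < dim_row (1\<^sub>m d)" "c < dim_col (1\<^sub>m d)"
    then have rc: "r < d" "c < d" by auto
    have "(reflection d w * reflection d w) $$ (r, c) =
      (\<Sum>k<d. ((if r = k then 1 else 0) - 2 * w r * w k) * ((if k = c then 1 else 0) - 2 * w k * w c))"
      using rc by (simp add: reflection_def scalar_prod_def atLeast0LessThan)
    also have "\<dots> = (\<Sum>k<d. (if k = r then (if r = c then 1 else 0) - 2 * w r * w c else 0)
        - (if k = c then 2 * w r * w c else 0) + 4 * w r * w c * (w k)\<^sup>2)"
      by (intro sum.cong refl) (auto simp: algebra_simps power2_eq_square)
    also have "\<dots> = (if r = c then 1 else 0)"
      using rc w by (simp add: sum.distrib sum_subtractf sum.delta flip: sum_distrib_left)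
    finally show "(reflection d w * reflection d w) $$ (r, c) = 1\<^sub>m d $$ (r, c)" using rc by simp
  qed (use R in auto)
  then show ?thesis using R by (simp add: unitary_group_def adj)
qed

lemma det_coordinate_reflection:
  assumes "i < d" shows "det (reflection d (\<lambda>k. if k = i then 1 else 0)) = -1"
proof -
  have "reflection d (\<lambda>k. if k = i then 1 else 0) = multrow_mat d i (-1)"
    by (rule eq_matI) (auto simp: reflection_def)
  then show ?thesis using det_multrow_mat[OF assms, of "-1"] by simp
qed

definition act_vec :: "nat \<Rightarrow> real mat \<Rightarrow> (nat \<Rightarrow> real) \<Rightarrow> nat \<Rightarrow> real" where
  "act_vec d V y r = (\<Sum>k<d. V $$ (r, k) * y k)"

lemma act_vec_mult:
  assumes "A \<in> carrier_mat d d" "V \<in> carrier_mat d d" "r < d"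
  shows "act_vec d (A * V) y r = (\<Sum>m<d. A $$ (r, m) * act_vec d V y m)"
proof -
  have "act_vec d (A * V) y r = (\<Sum>k<d. \<Sum>m<d. A $$ (r, m) * V $$ (m, k) * y k)"
    unfolding act_vec_def using assms
    by (intro sum.cong refl) (simp add: scalar_prod_def atLeast0LessThan sum_distrib_right)
  also have "\<dots> = (\<Sum>m<d. \<Sum>k<d. A $$ (r, m) * V $$ (m, k) * y k)" by (rule sum.swap)
  finally show ?thesis by (simp add: act_vec_def sum_distrib_left mult.assoc)
qed

lemma act_vec_vec_fm: "V \<in> carrier_mat d d \<Longrightarrow> d > 0 \<Longrightarrow> Fm d V * vec_fm d y = vec_fm d (act_vec d V y)"
  by (subst mult_vec_fm_ent) (auto simp: act_vec_def ent_Fm ent_vec_fm intro!: fm_eqI sum.cong)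

lemma sqv_act_vec:
  assumes V: "V \<in> unitary_group d" and d: "d > 0"
  shows "sqv d (act_vec d V y) = sqv d y"
  using norm_unitary_mult(1)[OF unitary_fm_Fm[OF V] supp_le_vec_fm[OF d], of y]
  by (simp add: act_vec_vec_fm[OF unitary_group_carrier[OF V] d] flip: sqv_vec_fm[OF d])

text \<open>Reflecting along a unit vector at angle \<psi> in a coordinate plane acts there through
  the angle \<open>2 * \<psi>\<close>. So these reflections produce the same linear forms, up to
  sign, as rotations would.\<close>

lemma act_vec_plane_reflection:
  fixes \<psi> :: real
  assumes ij: "i < d" "j < d" "i \<noteq> j" and V: "V \<in> carrier_mat d d"
  defines "w \<equiv> (\<lambda>k. if k = i then cos \<psi> else if k = j then sin \<psi> else 0)"
  shows "reflection d w \<in> unitary_group d"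
    and "act_vec d (reflection d w * V) y i = - (cos (2 * \<psi>) * act_vec d V y i + sin (2 * \<psi>) * act_vec d V y j)"
    and "act_vec d (reflection d w * V) y j = cos (2 * \<psi>) * act_vec d V y j - sin (2 * \<psi>) * act_vec d V y i"
proof -
  have s: "(\<Sum>k<d. w k * f k) = cos \<psi> * f i + sin \<psi> * f j" for f
  proof -
    have "(\<Sum>k<d. w k * f k) = (\<Sum>k<d. (if k = i then cos \<psi> * f i else 0) + (if k = j then sin \<psi> * f j else 0))"
      using ij by (intro sum.cong) (auto simp: w_def)
    then show ?thesis using ij by (simp add: sum.distrib sum.delta)
  qed
  have "(\<Sum>k<d. (w k)\<^sup>2) = 1" using s[of w] ij by (simp add: power2_eq_square[symmetric] w_def) (simp add: power2_eq_square)?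
  then show "reflection d w \<in> unitary_group d" by (rule reflection_unitary)
  have R: "reflection d w \<in> carrier_mat d d" by (simp add: reflection_def)
  have e: "act_vec d (reflection d w * V) y r = act_vec d V y r - 2 * w r * (cos \<psi> * act_vec d V y i + sin \<psi> * act_vec d V y j)"
    if r: "r < d" for r
  proof -
    have "act_vec d (reflection d w * V) y r = (\<Sum>m<d. (if m = r then act_vec d V y r else 0) - 2 * w r * (w m * act_vec d V y m))"
      unfolding act_vec_mult[OF R V r] using r
      by (intro sum.cong refl) (simp add: reflection_def algebra_simps)
    then show ?thesis using r by (simp add: sum_subtractf sum.delta s flip: sum_distrib_left)
  qed
  have tr: "cos (2 * \<psi>) = 2 * (cos \<psi>)\<^sup>2 - 1" "cos (2 * \<psi>) = 1 - 2 * (sin \<psi>)\<^sup>2" "sin (2 * \<psi>) = 2 * sin \<psi> * cos \<psi>"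
    by (rule cos_double_cos cos_double_sin sin_double)+
  show "act_vec d (reflection d w * V) y i = - (cos (2 * \<psi>) * act_vec d V y i + sin (2 * \<psi>) * act_vec d V y j)"
    unfolding e[OF ij(1)] tr(1,3) by (simp add: w_def algebra_simps power2_eq_square)
  show "act_vec d (reflection d w * V) y j = cos (2 * \<psi>) * act_vec d V y j - sin (2 * \<psi>) * act_vec d V y i"
    unfolding e[OF ij(2)] tr(2,3) using ij by (simp add: w_def algebra_simps power2_eq_square)
qed

text \<open>Averaging over rotations in the plane of the coordinates \<open>i\<close> and \<open>j\<close> and weighting by the squared
  length \<open>\<rho>\<^sub>j\<^sup>2\<close> of the projection to that plane makes the sharp dependence on \<open>d\<close> come out, since
  these weights sum up to at least one.\<close>

lemma haar_coordinate_small_ball: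
  fixes \<mu> :: "real mat measure"
  assumes "haar d \<mu>" and y: "sqv d y = 1" and i: "i < d" and v: "v > 0"
  shows "measure \<mu> {V \<in> space \<mu>. \<bar>act_vec d V y i\<bar> < v} \<le> 48 * sqrt d * v"
proof -
  interpret haar d \<mu> by fact
  define a where "a r V = act_vec d V y r" for r V
  have carr: "V \<in> space \<mu> \<Longrightarrow> V \<in> carrier_mat d d" for V by (simp add: space_haar unitary_group_carrier)
  have meas: "a r \<in> borel_measurable \<mu>" if "r < d" for r
    unfolding a_def[abs_def] act_vec_def using that
    by (intro borel_measurable_sum borel_measurable_times measurable_entry_haar) auto
  have sum1: "(\<Sum>r<d. (a r V)\<^sup>2) = 1" if "V \<in> space \<mu>" for V
    using sqv_act_vec[of V d y] that y d by (simp add: space_haar sqv_def a_def)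
  have le1: "(a r V)\<^sup>2 \<le> 1" if "V \<in> space \<mu>" "r < d" for r V
    unfolding sum1[OF that(1), symmetric] using that(2) by (intro member_le_sum) auto
  have int: "integrable \<mu> f" if "f \<in> borel_measurable \<mu>" "\<And>V. V \<in> space \<mu> \<Longrightarrow> \<bar>f V\<bar> \<le> B" for f :: "_ \<Rightarrow> real" and B
    using that by (intro integrable_const_bound[of _ B]) auto
  have int_a: "integrable \<mu> (\<lambda>V. (a r V)\<^sup>2)" if "r < d" for r
    using meas[OF that] le1[OF _ that] by (intro int[of _ 1]) auto
  have inv: "(\<integral>V. f V \<partial>\<mu>) = (\<integral>V. f (U * V) \<partial>\<mu>)" if "U \<in> unitary_group d" "f \<in> borel_measurable \<mu>" for f :: "_ \<Rightarrow> real" and U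
    using integral_distr[OF measurable_const_mult[OF that(1)] that(2)] distr_mult[OF that(1)] by simp
  have moment: "(\<integral>V. (a r V)\<^sup>2 \<partial>\<mu>) = 1 / d" if r: "r < d" for r
  proof -
    have eq: "(\<integral>V. (a r V)\<^sup>2 \<partial>\<mu>) = (\<integral>V. (a j V)\<^sup>2 \<partial>\<mu>)" if j: "j < d" for j
    proof (cases "j = r")
      case False
      \<comment> \<open>At the angle \<open>pi / 4\<close> the reflection exchanges the two
        coordinates up to sign. Hence all coordinates have the same second moment, and these sum to
        one.\<close>
      let ?w = "\<lambda>k. if k = r then cos (pi / 4) else if k = j then sin (pi / 4) else 0 :: real"
      note pr = act_vec_plane_reflection[OF r j False[symmetric], where \<psi> = "pi / 4"]
      have "(\<integral>V. (a r V)\<^sup>2 \<partial>\<mu>) = (\<integral>V. (a r (reflection d ?w * V))\<^sup>2 \<partial>\<mu>)"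
        by (rule inv[OF pr(1)[of "1\<^sub>m d"]]) (use meas[OF r] in auto)
      also have "\<dots> = (\<integral>V. (a j V)\<^sup>2 \<partial>\<mu>)"
        by (intro Bochner_Integration.integral_cong refl) (simp add: a_def pr(2)[OF carr])
      finally show ?thesis .
    qed simp
    have "real d * (\<integral>V. (a r V)\<^sup>2 \<partial>\<mu>) = (\<Sum>j<d. \<integral>V. (a r V)\<^sup>2 \<partial>\<mu>)" by simp
    also have "\<dots> = (\<Sum>j<d. \<integral>V. (a j V)\<^sup>2 \<partial>\<mu>)" by (intro sum.cong refl eq) simp
    also have "\<dots> = (\<integral>V. (\<Sum>j<d. (a j V)\<^sup>2) \<partial>\<mu>)" using int_a by (intro Bochner_Integration.integral_sum[symmetric]) auto
    also have "\<dots> = (\<integral>V. 1 \<partial>\<mu>)" using sum1 by (intro Bochner_Integration.integral_cong) auto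
    finally show ?thesis using d by (simp add: field_simps prob_space)
  qed
  let ?S = "{V \<in> space \<mu>. \<bar>a i V\<bar> < v}"
  have S: "?S \<in> sets \<mu>" using meas[OF i] by measurable
  have one_le: "1 \<le> sqrt d" using d by simp
  \<comment> \<open>For large \<open>v\<close> the bound exceeds one, and in dimension one the
    coordinate has modulus one. Only from dimension two on is there a second coordinate to average
    with.\<close>
  consider "2 * v \<ge> 1" | "2 * v < 1" "d = 1" | "2 * v < 1" "d \<ge> 2" using d by linarith
  then have "prob ?S \<le> 48 * sqrt d * v"
  proof cases
    case 1
    have "prob ?S \<le> 1" by simp
    also have "1 \<le> 1 * v * 48" using 1 by simp
    also have "\<dots> \<le> sqrt d * v * 48" using v one_le by (intro mult_right_mono) auto
    also have "\<dots> = 48 * sqrt d * v" by simp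
    finally show ?thesis .
  next
    case 2
    have "?S = {}"
    proof (intro equals0I)
      fix V assume V: "V \<in> ?S"
      then have "(a 0 V)\<^sup>2 = 1" using sum1[of V] 2 by simp
      moreover have "i = 0" using i 2 by simp
      ultimately have "\<bar>a i V\<bar> = 1" by (auto simp: power2_eq_1_iff)
      with V 2 show False by simp
    qed
    then show ?thesis using v by (simp only: measure_empty) simp
  next
    case 3
    obtain n where n: "n > 0" "(1 - 2 * v) ^ n \<le> 1 / 2" using ex_power_le_half[of "2 * v"] v 3 by auto
    define \<rho> where "\<rho> j V = sqrt ((a i V)\<^sup>2 + (a j V)\<^sup>2)" for j V
    have \<rho>2: "(\<rho> j V)\<^sup>2 = (a i V)\<^sup>2 + (a j V)\<^sup>2" "\<rho> j V \<ge> 0" for j V by (auto simp: \<rho>_def)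
    have \<rho>1: "(a i V)\<^sup>2 + (a j V)\<^sup>2 \<le> 1" if "V \<in> space \<mu>" "j < d" "j \<noteq> i" for j V
    proof -
      have "(\<Sum>r\<in>{i, j}. (a r V)\<^sup>2) \<le> (\<Sum>r<d. (a r V)\<^sup>2)" using i that by (intro sum_mono2) auto
      with sum1[OF that(1)] that show ?thesis by simp
    qed
    have m\<rho>: "\<rho> j \<in> borel_measurable \<mu>" if "j < d" for j
      unfolding \<rho>_def[abs_def] using meas[OF i] meas[OF that] by measurable
    have step: "(\<integral>V. (\<rho> j V)\<^sup>2 * indicator ?S V \<partial>\<mu>) \<le> 48 * v / sqrt d" if j: "j < d" "j \<noteq> i" for j
    proof -
      define f where "f V = (\<rho> j V)\<^sup>2 * (if \<bar>a i V\<bar> < v then 1 else 0)" for V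
      have mf: "f \<in> borel_measurable \<mu>" unfolding f_def[abs_def] using m\<rho>[OF j(1)] meas[OF i] by measurable
      \<comment> \<open>The angle is halved here because the reflection doubles it; the forms that
        result are those of \<open>count_near_orthogonal\<close>.\<close>
      define R where "R k = reflection d (\<lambda>m. if m = i then cos (pi * k / (2 * n)) else if m = j then sin (pi * k / (2 * n)) else 0)" for k :: nat
      note pr = act_vec_plane_reflection[OF i j(1) j(2)[symmetric], where \<psi> = "pi * real k / (2 * n)" for k, folded R_def]
      have R: "R k \<in> unitary_group d" for k using pr(1)[of "1\<^sub>m d"] by simp
      define h where "h k V = (if \<bar>cos (pi * k / n) * a i V + sin (pi * k / n) * a j V\<bar> < v then 1 else 0 :: real)" for k :: nat and V
      have fR: "f (R k * V) = (\<rho> j V)\<^sup>2 * h k V" if V: "V \<in> space \<mu>" for k V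
      proof -
        have ai: "a i (R k * V) = - (cos (pi * k / n) * a i V + sin (pi * k / n) * a j V)"
          and aj: "a j (R k * V) = cos (pi * k / n) * a j V - sin (pi * k / n) * a i V"
          using pr(2,3)[OF carr[OF V], of k y] by (simp_all add: a_def)
        have id: "(- (c * x + s * z))\<^sup>2 + (c * z - s * x)\<^sup>2 = (c\<^sup>2 + s\<^sup>2) * (x\<^sup>2 + z\<^sup>2)" for c s x z :: real
          by (simp add: power2_eq_square algebra_simps)
        show ?thesis
          by (simp only: f_def h_def \<rho>2(1) ai aj abs_minus_cancel id sin_cos_squared_add2 mult_1_left)
      qed
      have mh: "h k \<in> borel_measurable \<mu>" for k
        unfolding h_def[abs_def] using meas[OF i] meas[OF j(1)] by measurable
      have ih: "integrable \<mu> (\<lambda>V. (\<rho> j V)\<^sup>2 * h k V)" for k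
      proof (rule int[of _ 1])
        show "(\<lambda>V. (\<rho> j V)\<^sup>2 * h k V) \<in> borel_measurable \<mu>"
          by (intro borel_measurable_times borel_measurable_power m\<rho> j mh)
      qed (use \<rho>1[OF _ j] in \<open>auto simp: \<rho>2 h_def\<close>)
      have i\<rho>: "integrable \<mu> (\<rho> j)"
        using \<rho>1[OF _ j] m\<rho>[OF j(1)] by (intro int[of _ 1]) (auto simp: \<rho>_def)
      have "real n * (\<integral>V. f V \<partial>\<mu>) = (\<Sum>k<n. \<integral>V. (\<rho> j V)\<^sup>2 * h k V \<partial>\<mu>)"
      proof -
        have "(\<integral>V. f V \<partial>\<mu>) = (\<integral>V. (\<rho> j V)\<^sup>2 * h k V \<partial>\<mu>)" for k
          unfolding inv[OF R mf, of k] by (intro Bochner_Integration.integral_cong refl fR)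
        then show ?thesis by simp
      qed
      also have "\<dots> = (\<integral>V. (\<Sum>k<n. (\<rho> j V)\<^sup>2 * h k V) \<partial>\<mu>)"
        using ih by (intro Bochner_Integration.integral_sum[symmetric])
      also have "\<dots> \<le> (\<integral>V. 32 * v * n * \<rho> j V \<partial>\<mu>)"
      proof (intro integral_mono Bochner_Integration.integrable_sum ih integrable_mult_right i\<rho>)
        fix V assume V: "V \<in> space \<mu>"
        have "(\<Sum>k<n. (\<rho> j V)\<^sup>2 * h k V) = (\<rho> j V)\<^sup>2 * real (card {k. k < n \<and> \<bar>cos (pi * k / n) * a i V + sin (pi * k / n) * a j V\<bar> < v})"
          by (simp add: h_def sum_distrib_left[symmetric] sum.If_cases Int_def conj_commute lessThan_def)
        also have "\<dots> \<le> 32 * v * \<rho> j V * n"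
          using count_near_orthogonal[OF v n 3(1) \<rho>1[OF V j]] by (simp add: \<rho>2 \<rho>_def[symmetric])
        finally show "(\<Sum>k<n. (\<rho> j V)\<^sup>2 * h k V) \<le> 32 * v * n * \<rho> j V" by (simp add: mult_ac)
      qed
      also have "\<dots> = 32 * v * n * (\<integral>V. \<rho> j V \<partial>\<mu>)" by simp
      finally have "(\<integral>V. f V \<partial>\<mu>) \<le> 32 * v * (\<integral>V. \<rho> j V \<partial>\<mu>)" using n by (simp add: mult_ac)
      \<comment> \<open>The arithmetic-geometric mean inequality, balanced at the typical size
        \<open>1 / sqrt d\<close> of \<rho>, reduces its mean to the second moment
        \<open>2 / d\<close>.\<close>
      also have "(\<integral>V. \<rho> j V \<partial>\<mu>) \<le> (\<integral>V. sqrt d / 2 * ((a i V)\<^sup>2 + (a j V)\<^sup>2) + 1 / (2 * sqrt d) \<partial>\<mu>)"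
      proof (intro integral_mono i\<rho> Bochner_Integration.integrable_add integrable_mult_right int_a i j(1) integrable_const)
        fix V
        have "0 \<le> (sqrt d * \<rho> j V - 1)\<^sup>2 / (2 * sqrt d)" by simp
        also have "\<dots> = sqrt d / 2 * (\<rho> j V)\<^sup>2 + 1 / (2 * sqrt d) - \<rho> j V"
          using d by (simp add: power2_diff power_mult_distrib field_simps real_sqrt_mult_self power2_eq_square[of "sqrt d"])
        finally show "\<rho> j V \<le> sqrt d / 2 * ((a i V)\<^sup>2 + (a j V)\<^sup>2) + 1 / (2 * sqrt d)" by (simp add: \<rho>2)
      qed
      also have "\<dots> = sqrt d / 2 * (2 / d) + 1 / (2 * sqrt d)"
        using int_a[OF i] int_a[OF j(1)] by (simp add: moment i j prob_space)
      also have "\<dots> = 3 / (2 * sqrt d)"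
        using d real_sqrt_mult_self[of d] by (simp add: field_simps)
      finally have "(\<integral>V. f V \<partial>\<mu>) \<le> 32 * v * (3 / (2 * sqrt d))" using v by simp
      moreover have "(\<integral>V. f V \<partial>\<mu>) = (\<integral>V. (\<rho> j V)\<^sup>2 * indicator ?S V \<partial>\<mu>)"
        by (intro Bochner_Integration.integral_cong) (auto simp: f_def)
      ultimately show ?thesis by simp
    qed
    have iS: "integrable \<mu> (\<lambda>V. (\<rho> j V)\<^sup>2 * indicator ?S V)" if j: "j < d" "j \<noteq> i" for j
    proof (rule int[of _ 1])
      show "(\<lambda>V. (\<rho> j V)\<^sup>2 * indicator ?S V) \<in> borel_measurable \<mu>"
        by (intro borel_measurable_times borel_measurable_power m\<rho> j borel_measurable_indicator S)
    qed (use \<rho>1[OF _ j] in \<open>auto simp: \<rho>2 indicator_def\<close>)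
    have "prob ?S = (\<integral>V. indicator ?S V \<partial>\<mu>)" using S by simp
    also have "\<dots> \<le> (\<integral>V. (\<Sum>j\<in>{..<d} - {i}. (\<rho> j V)\<^sup>2 * indicator ?S V) \<partial>\<mu>)"
    proof (intro integral_mono Bochner_Integration.integrable_sum iS)
      show "integrable \<mu> (indicator ?S :: _ \<Rightarrow> real)" using S by (intro int[of _ 1]) (auto simp: indicator_def)
      fix V assume V: "V \<in> space \<mu>"
      \<comment> \<open>Each weight contains the square of the \<open>i\<close>-th coordinate. As at
        least one index \<open>j\<close> remains, the weights together cover the full unit
        norm.\<close>
      have "1 \<le> (\<Sum>j\<in>{..<d} - {i}. (\<rho> j V)\<^sup>2)"
      proof -
        have "1 = (a i V)\<^sup>2 + (\<Sum>j\<in>{..<d} - {i}. (a j V)\<^sup>2)"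
          unfolding sum1[OF V, symmetric] using i by (intro sum.remove) auto
        also have "\<dots> \<le> (\<Sum>j\<in>{..<d} - {i}. (a i V)\<^sup>2) + (\<Sum>j\<in>{..<d} - {i}. (a j V)\<^sup>2)"
        proof -
          have "real (card ({..<d} - {i})) \<ge> 1" using i 3 by simp
          from mult_right_mono[OF this, of "(a i V)\<^sup>2"] show ?thesis by simp
        qed
        finally show ?thesis by (simp add: \<rho>2 sum.distrib)
      qed
      then show "indicator ?S V \<le> (\<Sum>j\<in>{..<d} - {i}. (\<rho> j V)\<^sup>2 * indicator ?S V)"
        by (auto simp: indicator_def)
    qed auto
    also have "\<dots> = (\<Sum>j\<in>{..<d} - {i}. \<integral>V. (\<rho> j V)\<^sup>2 * indicator ?S V \<partial>\<mu>)"
      using iS by (intro Bochner_Integration.integral_sum) auto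
    also have "\<dots> \<le> (\<Sum>j\<in>{..<d} - {i}. 48 * v / sqrt d)" by (intro sum_mono step) auto
    also have "\<dots> = real (card ({..<d} - {i})) * (48 * v / sqrt d)" by simp
    also have "\<dots> \<le> d * (48 * v / sqrt d)"
    proof (rule mult_right_mono)
      have "card ({..<d} - {i}) \<le> card {..<d}" by (intro card_mono) auto
      then show "real (card ({..<d} - {i})) \<le> d" by simp
    qed (use v in simp)
    also have "\<dots> = 48 * sqrt d * v" using d real_sqrt_mult_self[of d] by (simp add: field_simps)
    finally show ?thesis .
  qed
  then show ?thesis by (simp add: a_def)
qed

lemma mat_adjoint_real: "A \<in> carrier_mat n m \<Longrightarrow> mat_adjoint A = transpose_mat (A :: real mat)"
proof (rule eq_matI)
  assume A: "A \<in> carrier_mat n m"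
  show "dim_row (mat_adjoint A) = dim_row (transpose_mat A)" "dim_col (mat_adjoint A) = dim_col (transpose_mat A)"
    using carrier_matD[OF A] carrier_matD[OF adjoint_carrier[OF A]] by auto
  show "mat_adjoint A $$ (i, j) = transpose_mat A $$ (i, j)"
    if "i < dim_row (transpose_mat A)" "j < dim_col (transpose_mat A)" for i j
    using that A by (auto simp: index_adjoint[OF A])
qed

lemma det_adjoint_real: "A \<in> carrier_mat d d \<Longrightarrow> det (mat_adjoint A) = det (A :: real mat)"
  by (simp add: mat_adjoint_real det_transpose)

lemma det_orthogonal:
  assumes "U \<in> unitary_group d" shows "det U * det U = 1" "det U = 1 \<or> det U = (-1 :: real)"
proof -
  have c: "U \<in> carrier_mat d d" "mat_adjoint U * U = 1\<^sub>m d" using assms by (auto simp: unitary_group_def)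
  have "det (mat_adjoint U * U) = det U * det U"
    using c(1) by (simp add: det_mult[of _ d] det_adjoint_real)
  then show "det U * det U = 1" by (simp add: c(2))
  then show "det U = 1 \<or> det U = -1" by (metis power2_eq_1_iff power2_eq_square)
qed

text \<open>\<open>det (1 + M) = det M \<cdot> det (M\<^sup>T + 1)\<close> vanishes when \<open>det M = - 1\<close>.\<close>

lemma minus_one_eigenvector:
  fixes M :: "real mat"
  assumes M: "M \<in> unitary_group d" and det: "det M = - 1" and d: "d > 0"
  obtains y where "sqv d y = 1" "Fm d M * vec_fm d y = - vec_fm d y"
proof -
  have c: "M \<in> carrier_mat d d" "mat_adjoint M * M = 1\<^sub>m d" using M by (auto simp: unitary_group_def)
  define A where "A = 1\<^sub>m d + M"
  have A: "A \<in> carrier_mat d d" using c by (simp add: A_def)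
  have "mat_adjoint A * M = A"
  proof (rule Fm_inj[of _ d])
    show "Fm d (mat_adjoint A * M) = Fm d A"
      using c A unitary_fm_Fm[OF M]
      by (simp add: Fm_arith Fm_adjoint A_def Fm_one distrib_right one_fm_mult unitary_fm_def add.commute)
  qed (use A c in \<open>auto intro!: mult_carrier_square\<close>)
  moreover have "det (mat_adjoint A * M) = - det A"
    using A c by (simp add: det_mult[of _ d] det_adjoint_real det)
  ultimately have "det A = 0" by simp
  then obtain v where v: "v \<in> carrier_vec d" "v \<noteq> 0\<^sub>v d" "A *\<^sub>v v = 0\<^sub>v d"
    using det_0_iff_vec_prod_zero[OF A] by blast
  define \<rho> where "\<rho> = sqrt (sqv d (\<lambda>i. v $ i))"
  have "sqv d (\<lambda>i. v $ i) \<noteq> 0"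
  proof
    assume "sqv d (\<lambda>i. v $ i) = 0"
    then have "\<forall>i<d. v $ i = 0" by (auto simp: sqv_def sum_nonneg_eq_0_iff)
    then have "v = 0\<^sub>v d" using v(1) by (intro eq_vecI) auto
    with v(2) show False ..
  qed
  then have \<rho>: "\<rho> > 0" "\<rho>\<^sup>2 = sqv d (\<lambda>i. v $ i)"
    using sum_nonneg[of "{..<d}" "\<lambda>i. (norm (v $ i))\<^sup>2"] by (auto simp: \<rho>_def sqv_def)
  define y where "y i = v $ i / \<rho>" for i
  have "sqv d y = 1"
    using \<rho> by (simp add: y_def sqv_def power_divide flip: sum_divide_distrib) (metis less_irrefl zero_less_power)
  moreover have "Fm d M * vec_fm d y = - vec_fm d y"
  proof (rule fm_eqI)
    fix i j
    have "(\<Sum>k<d. ent (Fm d M) i k * y k) = - y i" if i: "i < d"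
    proof -
      have "0 = (A *\<^sub>v v) $ i / \<rho>" using v(3) i by simp
      also have "\<dots> = (\<Sum>k<d. ((if i = k then 1 else 0) + M $$ (i, k)) * v $ k) / \<rho>"
        using c(1) v(1) i by (simp add: A_def scalar_prod_def atLeast0LessThan eq_commute[of i])
      also have "\<dots> = (\<Sum>k<d. (if k = i then y i else 0) + ent (Fm d M) i k * y k)"
        using i unfolding sum_divide_distrib y_def
        by (intro sum.cong refl) (auto simp: ent_Fm distrib_right add_divide_distrib)
      also have "\<dots> = y i + (\<Sum>k<d. ent (Fm d M) i k * y k)"
        using i by (simp add: sum.distrib sum.delta)
      finally show ?thesis by simp
    qed
    then show "ent (Fm d M * vec_fm d y) i j = ent (- vec_fm d y) i j"
      by (simp add: mult_vec_fm_ent d ent_vec_fm)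
  qed
  ultimately show ?thesis by (rule that)
qed

abbreviation coord_reflection :: "nat \<Rightarrow> nat \<Rightarrow> real mat" where
  "coord_reflection d i \<equiv> reflection d (\<lambda>k. if k = i then 1 else 0)"

lemma coord_reflection:
  assumes "i < d"
  shows "coord_reflection d i \<in> unitary_group d" "Fm d (coord_reflection d i) = one_fm d - unit_fm i i 2"
    "coord_reflection d i \<in> carrier_mat d d"
proof -
  show u: "coord_reflection d i \<in> unitary_group d"
    by (rule reflection_unitary) (use assms in \<open>simp add: if_distrib[where f = "\<lambda>x. x\<^sup>2"] cong: if_cong\<close>)
  show "Fm d (coord_reflection d i) = one_fm d - unit_fm i i 2"
    using assms by (intro fm_eqI) (auto simp: ent_Fm ent_one ent_unit reflection_def)
  show "coord_reflection d i \<in> carrier_mat d d" using u by (rule unitary_group_carrier)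
qed

text \<open>With \<open>h\<close> the reflection in the \<open>i\<close>-th coordinate, \<open>h m y = - y\<close> gives
  \<open>(1 + m) y = 2 y\<^sub>i e\<^sub>i\<close>, and \<open>1 + m\<^sup>T = m\<^sup>T (1 + m)\<close>.\<close>

lemma reflected_kernel_bound:
  fixes m X :: "real fm"
  assumes m: "unitary_fm d m" and i: "i < d" and y: "sqv d y = 1" and X: "supp_le d X"
    and ker: "Fm d (coord_reflection d i) * (m * vec_fm d y) = - vec_fm d y"
  shows "2 * \<bar>y i\<bar> * \<bar>ent X i 0\<bar> \<le> norm ((one_fm d + m) * X)"
proof -
  define Y where "Y = vec_fm d y"
  have d: "d > 0" using i by simp
  have sY: "supp_le d Y" "supp_le d m" using d m by (auto simp: Y_def supp_le_vec_fm unitary_fm_def)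
  define h where "h = Fm d (coord_reflection d i)"
  have h: "unitary_fm d h" "h = one_fm d - unit_fm i i 2"
    unfolding h_def by (rule unitary_fm_Fm[OF coord_reflection(1)[OF i]], rule coord_reflection(2)[OF i])
  have ah: "adj h = h" unfolding h(2) by (rule fm_eqI) (auto simp: ent_one ent_unit)
  have si: "supp_le d (unit_fm i i (2::real))" using i by (auto simp: supp_le_def ent_unit)
  have hY: "h * Y = Y - unit_fm i 0 (2 * y i)"
    unfolding h(2) left_diff_distrib one_fm_mult[OF sY(1)] using i
    by (intro fm_eqI) (auto simp: ent_mult[OF si] ent_unit Y_def ent_vec_fm if_distrib[where f = "\<lambda>x. x * _"] sum.delta cong: if_cong)
  have "m * Y = adj h * (h * (m * Y))" using unitary_cancel(1)[OF h(1) supp_le_mult[OF sY(2,1)]] by simp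
  also have "\<dots> = - (h * Y)" using ker by (simp add: ah flip: h_def Y_def)
  finally have mY: "(one_fm d + m) * Y = unit_fm i 0 (2 * y i)"
    using one_fm_mult[OF sY(1)] by (simp add: hY distrib_right)
  \<comment> \<open>The entry of \<open>X\<close> is extracted by pairing with
    \<open>(1 + m) Y\<close>; moving \<open>1 + m\<close> to the other side then allows
    Cauchy-Schwarz with the unit vector \<open>Y\<close>.\<close>
  have "\<bar>inner (unit_fm i 0 (2 * y i)) X\<bar> = \<bar>inner Y (adj (one_fm d + m) * X)\<bar>"
    unfolding mY[symmetric] inner_mult_left_adj ..
  also have "adj (one_fm d + m) * X = adj m * ((one_fm d + m) * X)"
    using m sY(2) X unitary_cancel(1)[OF m X] by (simp add: distrib_right distrib_left one_fm_mult add.commute)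
  also have "\<bar>inner Y \<dots>\<bar> \<le> norm Y * norm (adj m * ((one_fm d + m) * X))" by (rule Cauchy_Schwarz_ineq2)
  also have "\<dots> = norm ((one_fm d + m) * X)"
  proof -
    have "(norm Y)\<^sup>2 = 1" unfolding Y_def sqv_vec_fm[OF d] by (rule y)
    then have "norm Y = 1" by (simp add: power2_eq_1_iff)
        (metis norm_ge_zero one_neq_neg_one zero_le_one neg_0_le_iff_le norm_minus_cancel abs_norm_cancel abs_minus_cancel abs_one)
    moreover have "supp_le d ((one_fm d + m) * X)" using X sY by auto
    ultimately show ?thesis using norm_unitary_mult(2)[OF m] by simp
  qed
  finally show ?thesis by (simp add: inner_unit abs_mult)
qed

lemma measurable_det:
  assumes "\<And>i j. i < d \<Longrightarrow> j < d \<Longrightarrow> (\<lambda>\<omega>. A \<omega> $$ (i, j) :: real) \<in> borel_measurable M"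
    and A: "\<And>\<omega>. \<omega> \<in> space M \<Longrightarrow> A \<omega> \<in> carrier_mat d d"
  shows "(\<lambda>\<omega>. det (A \<omega>)) \<in> borel_measurable M"
proof -
  have "(\<lambda>\<omega>. \<Sum>p | p permutes {0..<d}. signof p * (\<Prod>i = 0..<d. A \<omega> $$ (i, p i))) \<in> borel_measurable M"
    using assms(1) permutes_in_image
    by (intro borel_measurable_sum borel_measurable_times borel_measurable_prod borel_measurable_const) fastforce
  then show ?thesis by (subst measurable_cong[OF det_def'[OF A]])
qed

section \<open>The two orientations of the real Haar pair\<close>

context
  fixes d :: nat and \<mu> :: "real mat measure" and V :: "real mat"
  assumes haar_d: "haar d \<mu>" and V: "V \<in> unitary_group d"
begin

interpretation haar d \<mu> by (rule haar_d)

definition "orient Q = det (Q 0) * det (V * Q (4::nat))"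

lemma orient_cases: "Q \<in> space Om \<Longrightarrow> orient Q = 1 \<or> orient Q = -1"
  using det_orthogonal(2)[OF component_unitary[of Q 0]] det_orthogonal(2)[OF unitary_group_mult[OF V component_unitary[of Q 4]]]
  by (auto simp: orient_def)

lemma measurable_orient: "orient \<in> borel_measurable Om"
  unfolding orient_def
proof (intro borel_measurable_times measurable_det[of d])
  have "(\<lambda>Q. V * Q 4) \<in> measurable Om \<mu>"
    by (rule measurable_compose[OF measurable_component measurable_const_mult[OF V]]) simp
  then show "(\<lambda>Q. (V * Q 4) $$ (i, j)) \<in> borel_measurable Om" if "i < d" "j < d" for i j
    using that by (rule measurable_entry_compose)
qed (auto intro!: measurable_entry_compose measurable_component unitary_group_carrier component_unitary unitary_group_mult V)

lemma sets_orient: "{Q \<in> space Om. orient Q = c} \<in> sets Om"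
  using borel_measurable_eq[OF measurable_orient borel_measurable_const[of c]] by simp

text \<open>Multiplying the component 0 by a reflection preserves the law and changes the sign of
  the orientation, so both values are equally likely.\<close>

lemma prob_orient:
  assumes c: "c = 1 \<or> c = -1"
  shows "measure Om {Q \<in> space Om. orient Q = c} = 1 / 2"
proof -
  let ?H = "coord_reflection d 0" and ?E = "\<lambda>c. {Q \<in> space Om. orient Q = c}"
  have H: "?H \<in> unitary_group d" using coord_reflection(1) d by blast
  have m: "act ?H (1\<^sub>m d) \<in> measurable Om Om" by (rule measurable_act[OF H unitary_group_one])
  have "measure Om (?E 1) = measure (distr Om Om (act ?H (1\<^sub>m d))) (?E 1)"
    by (simp add: distr_act[OF H unitary_group_one])
  also have "\<dots> = measure Om (act ?H (1\<^sub>m d) -` ?E 1 \<inter> space Om)"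
    by (rule measure_distr[OF m sets_orient])
  also have "act ?H (1\<^sub>m d) -` ?E 1 \<inter> space Om = ?E (-1)"
  proof -
    have "orient (act ?H (1\<^sub>m d) Q) = - orient Q" if Q: "Q \<in> space Om" for Q
    proof -
      have c: "Q 0 \<in> carrier_mat d d" "Q 4 \<in> carrier_mat d d"
        using component_unitary[OF Q] by (auto intro: unitary_group_carrier)
      then show ?thesis
        using det_coordinate_reflection[of 0 d] d coord_reflection(3)[OF d]
        by (simp add: orient_def act_def det_mult[of _ d])
    qed
    then show ?thesis using measurable_space[OF m] by (auto simp: minus_equation_iff)
  qed
  finally have eq: "measure Om (?E 1) = measure Om (?E (-1))" .
  have "1 = measure Om (?E 1 \<union> ?E (-1))"
    using orient_cases by (subst Q.prob_space[symmetric]) (intro arg_cong[where f = "measure Om"], auto)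
  also have "\<dots> = measure Om (?E 1) + measure Om (?E (-1))"
    by (intro Q.finite_measure_Union sets_orient) auto
  finally show ?thesis using eq c by auto
qed

lemma C_unitary:
  assumes Q: "Q \<in> space Om"
  shows "Q 0 * mat_adjoint (V * Q 4) \<in> unitary_group d" "det (Q 0 * mat_adjoint (V * Q 4)) = orient Q"
    "Fm d (Q 0) * C V Q = one_fm d + Fm d (Q 0 * mat_adjoint (V * Q 4))"
proof -
  have u: "Q 0 \<in> unitary_group d" "V * Q 4 \<in> unitary_group d"
    using component_unitary[OF Q] unitary_group_mult[OF V] by auto
  note c = u[THEN unitary_group_carrier]
  show "Q 0 * mat_adjoint (V * Q 4) \<in> unitary_group d"
    by (intro unitary_group_mult unitary_group_adjoint u)
  show "det (Q 0 * mat_adjoint (V * Q 4)) = orient Q"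
    unfolding orient_def using c by (subst det_mult[of _ d]) (auto simp: det_adjoint_real)
  show "Fm d (Q 0) * C V Q = one_fm d + Fm d (Q 0 * mat_adjoint (V * Q 4))"
    using c unitary_fm_Fm[OF u(1)]
    by (subst Fm_arith(3)) (auto simp: C_def distrib_left unitary_fm_def Fm_adjoint)
qed

lemma norm_C_mult:
  assumes Q: "Q \<in> space Om" and X: "supp_le d X"
  shows "norm (C V Q * X) = norm ((one_fm d + Fm d (Q 0 * mat_adjoint (V * Q 4))) * X)"
  using norm_unitary_mult(1)[OF unitary_fm_Fm[OF component_unitary[OF Q, of 0]], of "C V Q * X"] X
  by (simp add: supp_le_C supp_le_mult flip: mult.assoc C_unitary(3)[OF Q])

lemma orient_singular:
  assumes Q: "Q \<in> space Om" and o: "orient Q = -1"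
  shows "\<exists>X\<in>sph d. C V Q * X = 0"
proof -
  obtain y where y: "sqv d y = 1" "Fm d (Q 0 * mat_adjoint (V * Q 4)) * vec_fm d y = - vec_fm d y"
    using minus_one_eigenvector[OF C_unitary(1)[OF Q]] C_unitary(2)[OF Q] o d by metis
  have s: "supp_le d (vec_fm d y)" by (rule supp_le_vec_fm[OF d])
  have "norm (C V Q * vec_fm d y) = 0"
    unfolding norm_C_mult[OF Q s] by (simp add: distrib_right one_fm_mult[OF s] y)
  moreover have "(norm (vec_fm d y))\<^sup>2 = 1" using sqv_vec_fm[OF d] y by metis
  then have "norm (vec_fm d y) = 1" using norm_ge_zero[of "vec_fm d y"] by (auto simp: power2_eq_1_iff)
  ultimately show ?thesis using s by (intro bexI[of _ "vec_fm d y"]) (auto simp: sph_def)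
qed

text \<open>Near-singularity witnessed by a vector whose \<open>i\<close>-th coordinate carries at
  least the share \<open>1 / d\<close> of its squared length. Fixing \<open>i\<close> tells in which
  coordinate to reflect.\<close>

definition "bad_coord (\<gamma> :: real) i Q \<longleftrightarrow> orient Q = 1 \<and>
  (\<exists>x\<in>dense_vectors :: (nat \<Rightarrow> real) set. sqv d x \<le> d * (x i)\<^sup>2 \<and> sqv d (mulv d (C V Q) x) < \<gamma>\<^sup>2 * sqv d x)"

lemma sets_bad_coord: "{Q \<in> space Om. bad_coord \<gamma> i Q} \<in> sets Om"
proof -
  have "{Q \<in> space Om. bad_coord \<gamma> i Q} = {Q \<in> space Om. orient Q = 1} \<inter>
      {Q \<in> space Om. \<exists>x\<in>dense_vectors. sqv d x \<le> d * (x i)\<^sup>2 \<and> sqv d (mulv d (C V Q) x) < \<gamma>\<^sup>2 * sqv d x}"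
    by (auto simp: bad_coord_def)
  then show ?thesis
    using measurable_C[OF V] by (simp only:) (intro sets.Int sets_orient measurable_low_event)
qed

text \<open>By \<open>reflected_kernel_bound\<close>,
  \<open>2 * \<bar>y i\<bar> * \<bar>x i\<bar>\<close> is at most the length of \<open>C V Q\<close>
  applied to \<open>x\<close>, which is below \<gamma> times the length of \<open>x\<close> and
  hence below \<open>\<gamma> * sqrt d * \<bar>x i\<bar>\<close>. The factor
  \<open>\<bar>x i\<bar>\<close> cancels.\<close>

lemma bad_coord_kernel:
  fixes \<gamma> :: real
  assumes Q: "Q \<in> space Om" and bad: "bad_coord \<gamma> i Q" and \<gamma>: "\<gamma> > 0" and i: "i < d" and y: "sqv d y = 1"
    and ker: "Fm d (coord_reflection d i) * (Fm d (Q 0 * mat_adjoint (V * Q 4)) * vec_fm d y) = - vec_fm d y"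
  shows "\<bar>y i\<bar> < \<gamma> * sqrt d / 2"
proof -
  obtain x :: "nat \<Rightarrow> real" where x: "sqv d x \<le> d * (x i)\<^sup>2" "sqv d (mulv d (C V Q) x) < \<gamma>\<^sup>2 * sqv d x"
    using bad by (auto simp: bad_coord_def)
  define X where "X = vec_fm d x"
  have X: "supp_le d X" "ent X i 0 = x i" using d i by (auto simp: X_def supp_le_vec_fm ent_vec_fm)
  have "(2 * \<bar>y i\<bar> * \<bar>x i\<bar>)\<^sup>2 \<le> (norm (C V Q * X))\<^sup>2"
    using reflected_kernel_bound[OF unitary_fm_Fm[OF C_unitary(1)[OF Q]] i y X(1) ker]
    by (intro power_mono) (auto simp: X(2) norm_C_mult[OF Q X(1)])
  also have "\<dots> = sqv d (mulv d (C V Q) x)"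
    unfolding X_def mulv_vec_fm[OF supp_le_C d] by (rule sqv_vec_fm[OF d])
  also note x(2)
  also have "\<gamma>\<^sup>2 * sqv d x \<le> \<gamma>\<^sup>2 * (d * (x i)\<^sup>2)" using x(1) by (intro mult_left_mono) auto
  also have "\<dots> = (\<gamma> * sqrt d * \<bar>x i\<bar>)\<^sup>2" by (simp add: power_mult_distrib)
  finally have "2 * \<bar>y i\<bar> * \<bar>x i\<bar> < \<gamma> * sqrt d * \<bar>x i\<bar>"
    by (rule power_less_imp_less_base) (use \<gamma> in simp)
  then have "2 * \<bar>y i\<bar> < \<gamma> * sqrt d" by (simp add: mult_less_cancel_right)
  then show ?thesis by simp
qed

text \<open>The law is invariant under conjugating \<open>M = Q\<^sub>0 (V Q\<^sub>4)\<^sup>T\<close> so that \<open>H M\<close> becomes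
  \<open>U H M U\<^sup>T\<close>, where \<open>H\<close> is the reflection; the kernel vector \<open>y\<close> becomes \<open>U y\<close>, a Haar-random unit
  vector.\<close>

lemma prob_bad_coord:
  fixes \<gamma> :: real
  assumes \<gamma>: "\<gamma> > 0" and i: "i < d"
  shows "measure Om {Q \<in> space Om. bad_coord \<gamma> i Q} \<le> 24 * d * \<gamma>"
proof -
  let ?H = "coord_reflection d i" and ?E = "{Q \<in> space Om. bad_coord \<gamma> i Q}"
  define T where "T U = act (?H * (U * ?H)) (mat_adjoint V * (U * V))" for U
  note H = coord_reflection[OF i]
  have uT: "?H * (U * ?H) \<in> unitary_group d" "mat_adjoint V * (U * V) \<in> unitary_group d" if "U \<in> unitary_group d" for U
    using that H V by (auto intro!: unitary_group_mult unitary_group_adjoint)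
  have mT: "T U \<in> measurable Om Om" "distr Om Om (T U) = Om" if "U \<in> space \<mu>" for U
    using that uT unfolding T_def space_haar by (auto intro!: measurable_act distr_act)
  have mT2: "(\<lambda>(U, Q). T U Q) \<in> measurable (\<mu> \<Otimes>\<^sub>M Om) Om"
    unfolding T_def case_prod_beta using H V unitary_group_adjoint[OF V]
    by (intro measurable_act_pair measurable_mult_haar measurable_fst measurable_snd measurable_const) (auto simp: space_haar)
  have meas: "(\<lambda>(U, Q). indicator ?E (T U Q) :: ennreal) \<in> borel_measurable (\<mu> \<Otimes>\<^sub>M Om)"
    using measurable_compose[OF mT2 borel_measurable_indicator[OF sets_bad_coord[of \<gamma> i], where 'b = ennreal]]
    by (simp add: case_prod_beta)
  interpret pair_sigma_finite \<mu> Om ..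
  \<comment> \<open>Average over an additional independent Haar matrix \<open>U\<close>, exchange
    the integrals, and bound the integral over \<open>U\<close> for each fixed
    \<open>Q\<close>.\<close>
  have "emeasure Om ?E = (\<integral>\<^sup>+U. emeasure Om ?E \<partial>\<mu>)" by (simp add: emeasure_space_1)
  also have "\<dots> = (\<integral>\<^sup>+U. (\<integral>\<^sup>+Q. indicator ?E (T U Q) \<partial>Om) \<partial>\<mu>)"
  proof (intro nn_integral_cong)
    fix U assume U: "U \<in> space \<mu>"
    have "emeasure Om ?E = (\<integral>\<^sup>+Q. indicator ?E Q \<partial>distr Om Om (T U))" using mT(2)[OF U] sets_bad_coord by simp
    also have "\<dots> = (\<integral>\<^sup>+Q. indicator ?E (T U Q) \<partial>Om)"
      by (rule nn_integral_distr[OF mT(1)[OF U] borel_measurable_indicator]) (simp add: sets_bad_coord)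
    finally show "emeasure Om ?E = (\<integral>\<^sup>+Q. indicator ?E (T U Q) \<partial>Om)" .
  qed
  also have "\<dots> = (\<integral>\<^sup>+Q. (\<integral>\<^sup>+U. indicator ?E (T U Q) \<partial>\<mu>) \<partial>Om)"
    using Fubini'[OF meas] by simp
  also have "\<dots> \<le> (\<integral>\<^sup>+Q. ennreal (24 * d * \<gamma>) \<partial>Om)"
  proof (intro nn_integral_mono)
    fix Q assume Q: "Q \<in> space Om"
    define M where "M = Q 0 * mat_adjoint (V * Q 4)"
    have M: "M \<in> unitary_group d" "det M = orient Q" using C_unitary[OF Q] by (auto simp: M_def)
    show "(\<integral>\<^sup>+U. indicator ?E (T U Q) \<partial>\<mu>) \<le> ennreal (24 * d * \<gamma>)"
    proof (cases "orient Q = 1")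
      case False
      \<comment> \<open>The determinants of \<open>U\<close> and of the reflection enter twice, and
        those added by conjugating with \<open>V\<close> cancel as well, so the maps respect the
        event defining the orientation.\<close>
      have "orient (T U Q) = orient Q" if U: "U \<in> space \<mu>" for U
      proof -
        have u: "U \<in> unitary_group d" "Q 0 \<in> unitary_group d" "Q 4 \<in> unitary_group d"
          using U component_unitary[OF Q] by (auto simp: space_haar)
        note c = u[THEN unitary_group_carrier] unitary_group_carrier[OF V] H(3)
        have "orient (T U Q) = det (?H * (U * ?H) * Q 0) * det (V * (mat_adjoint V * (U * V) * Q 4))"
          by (simp only: orient_def T_def act_def fun_upd_same fun_upd_other zero_neq_numeral not_False_eq_True)
        also have "det (?H * (U * ?H) * Q 0) = (det ?H * det ?H) * det U * det (Q 0)"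
          using c by (simp add: det_mult[of _ d] mult_carrier_square)
        also have "det (V * (mat_adjoint V * (U * V) * Q 4)) = (det V * det V) * det U * (det V * det (Q 4))"
          using c(3,4,1) by (simp add: det_mult[of _ d] mult_carrier_square det_adjoint_real)
        also have "(det ?H * det ?H) * det U * det (Q 0) * ((det V * det V) * det U * (det V * det (Q 4)))
          = (det U * det U) * (det (Q 0) * (det V * det (Q 4)))"
          unfolding det_orthogonal(1)[OF V] det_orthogonal(1)[OF H(1)] by (simp only: mult_1_left mult_ac)
        also have "\<dots> = orient Q"
          unfolding det_orthogonal(1)[OF u(1)] orient_def using det_mult[OF c(4,3)] by simp
        finally show ?thesis .
      qed
      with False have "(\<integral>\<^sup>+U. indicator ?E (T U Q) \<partial>\<mu>) = (\<integral>\<^sup>+U. 0 \<partial>\<mu>)"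
        by (intro nn_integral_cong) (auto simp: bad_coord_def indicator_def)
      then show ?thesis by simp
    next
      case True
      \<comment> \<open>In the orientation 1 the matrix \<open>1 + M\<close> may be invertible, but
        one reflection makes the determinant negative and creates an exact eigenvector for
        -1.\<close>
      have "det (?H * M) = -1"
        using det_coordinate_reflection[OF i] M True unitary_group_carrier[OF M(1)] H(3) by (simp add: det_mult[of _ d])
      then obtain y where y: "sqv d y = 1" "Fm d (?H * M) * vec_fm d y = - vec_fm d y"
        using minus_one_eigenvector[OF unitary_group_mult[OF H(1) M(1)]] d by metis
      have "(\<integral>\<^sup>+U. indicator ?E (T U Q) \<partial>\<mu>) \<le> (\<integral>\<^sup>+U. indicator {U \<in> space \<mu>. \<bar>act_vec d U y i\<bar> < \<gamma> * sqrt d / 2} U \<partial>\<mu>)"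
      proof (intro nn_integral_mono)
        fix U assume U: "U \<in> space \<mu>"
        have "\<bar>act_vec d U y i\<bar> < \<gamma> * sqrt d / 2" if bad: "bad_coord \<gamma> i (T U Q)"
        proof (rule bad_coord_kernel[OF measurable_space[OF mT(1)[OF U] Q] bad \<gamma> i])
          have u: "U \<in> unitary_group d" "Q 0 \<in> unitary_group d" "Q 4 \<in> unitary_group d"
            using U component_unitary[OF Q] by (auto simp: space_haar)
          show "sqv d (act_vec d U y) = 1" using sqv_act_vec[OF u(1) d] y(1) by simp
          note c = u[THEN unitary_group_carrier] unitary_group_carrier[OF V] H(3)
          let ?h = "Fm d ?H" and ?u = "Fm d U" and ?v = "Fm d V"
          have uh: "unitary_fm d ?h" "unitary_fm d ?u" "unitary_fm d ?v" using H(1) u V unitary_fm_Fm by auto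
          have ah: "adj ?h = ?h" unfolding H(2) by (rule fm_eqI) (auto simp: ent_one ent_unit)
          have T0: "T U Q 0 = ?H * (U * ?H) * Q 0" "T U Q 4 = mat_adjoint V * (U * V) * Q 4"
            by (simp_all only: T_def act_def fun_upd_same fun_upd_other zero_neq_numeral not_False_eq_True)
          have "Fm d (T U Q 0) = ?h * (?u * (?h * Fm d (Q 0)))"
            unfolding T0 using c by (simp only: Fm_arith(3) mult_carrier_square mult.assoc)
          moreover have "Fm d (V * T U Q 4) = ?u * (?v * Fm d (Q 4))"
            unfolding T0 using c unitary_cancel(2)[OF uh(3)] uh
            by (simp add: Fm_arith(3) Fm_adjoint mult_carrier_square mult.assoc supp_le_mult)
          moreover have "Fm d M = Fm d (Q 0) * (adj (Fm d (Q 4)) * adj ?v)"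
            unfolding M_def using c by (simp add: Fm_arith(3) Fm_adjoint mult_carrier_square)
          moreover have "T U Q 0 \<in> carrier_mat d d" "V * T U Q 4 \<in> carrier_mat d d"
            using component_unitary[OF measurable_space[OF mT(1)[OF U] Q]] unitary_group_mult[OF V]
            by (simp_all add: unitary_group_carrier)
          ultimately have "Fm d (T U Q 0 * mat_adjoint (V * T U Q 4)) = ?h * (?u * (?h * (Fm d M * adj ?u)))"
            by (simp add: Fm_arith(3) Fm_adjoint mult.assoc)
          moreover have "adj ?u * vec_fm d (act_vec d U y) = vec_fm d y"
            unfolding act_vec_vec_fm[OF c(1) d, symmetric] by (rule unitary_cancel(1)[OF uh(2) supp_le_vec_fm[OF d]])
          moreover have "?h * (?h * X) = X" if "supp_le d X" for X
            using unitary_cancel(1)[OF uh(1) that] by (simp add: ah)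
          moreover have "?h * (Fm d M * vec_fm d y) = - vec_fm d y"
            using y(2) unitary_group_carrier[OF M(1)] c by (simp add: Fm_arith(3) mult.assoc)
          ultimately show "?h * (Fm d (T U Q 0 * mat_adjoint (V * T U Q 4)) * vec_fm d (act_vec d U y)) = - vec_fm d (act_vec d U y)"
            using act_vec_vec_fm[OF c(1) d, of y] by (simp add: mult.assoc supp_le_mult supp_le_vec_fm[OF d] supp_le_arith)
        qed
        then show "(indicator ?E (T U Q) :: ennreal) \<le> indicator {U \<in> space \<mu>. \<bar>act_vec d U y i\<bar> < \<gamma> * sqrt d / 2} U"
          using U by (auto simp: indicator_def)
      qed
      also have "\<dots> = emeasure \<mu> {U \<in> space \<mu>. \<bar>act_vec d U y i\<bar> < \<gamma> * sqrt d / 2}"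
      proof (rule nn_integral_indicator)
        have "(\<lambda>U. act_vec d U y i) \<in> borel_measurable \<mu>"
          unfolding act_vec_def using i
          by (intro borel_measurable_sum borel_measurable_times measurable_entry_haar) auto
        then show "{U \<in> space \<mu>. \<bar>act_vec d U y i\<bar> < \<gamma> * sqrt d / 2} \<in> sets \<mu>" by measurable
      qed
      also have "\<dots> \<le> ennreal (48 * sqrt d * (\<gamma> * sqrt d / 2))"
        unfolding emeasure_eq_measure
        using \<gamma> d by (intro ennreal_leI haar_coordinate_small_ball[OF haar_d y(1) i]) auto
      also have "48 * sqrt d * (\<gamma> * sqrt d / 2) = 24 * d * \<gamma>" using real_sqrt_mult_self[of d] by simp
      finally show ?thesis .
    qed
  qed
  also have "\<dots> = ennreal (24 * d * \<gamma>)" by (simp add: Q.emeasure_space_1)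
  finally show ?thesis using \<gamma> by (simp add: Q.emeasure_eq_measure)
qed

text \<open>Every vector has a coordinate carrying at least the average share of its squared length,
  so the events \<open>bad_coord\<close> cover; the union bound contributes the second factor
  \<open>d\<close>.\<close>

lemma real_haar_near_singular:
  fixes \<gamma> :: real
  assumes \<gamma>: "\<gamma> > 0"
  shows "measure Om {Q \<in> space Om. orient Q = 1 \<and> \<not> low d \<gamma> (C V Q)} \<le> 24 * d\<^sup>2 * \<gamma>"
proof -
  have "{Q \<in> space Om. orient Q = 1 \<and> \<not> low d \<gamma> (C V Q)} \<subseteq> (\<Union>i<d. {Q \<in> space Om. bad_coord \<gamma> i Q})"
  proof safe
    fix Q assume Q: "Q \<in> space Om" "orient Q = 1" "\<not> low d \<gamma> (C V Q)"
    then obtain x where x: "x \<in> dense_vectors" "sqv d (mulv d (C V Q) x) < \<gamma>\<^sup>2 * sqv d x"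
      using not_low_dense[OF supp_le_C d] \<gamma> by (meson less_imp_le)
    have "\<exists>i<d. sqv d x \<le> d * (x i)\<^sup>2"
    proof (rule ccontr)
      assume "\<not> ?thesis"
      then have "(\<Sum>i<d. d * (x i)\<^sup>2) < (\<Sum>i<d. sqv d x)" using d by (intro sum_strict_mono) auto
      then show False by (simp add: sqv_def flip: sum_distrib_left)
    qed
    with x Q show "Q \<in> (\<Union>i<d. {Q \<in> space Om. bad_coord \<gamma> i Q})" by (auto simp: bad_coord_def)
  qed
  then have "measure Om {Q \<in> space Om. orient Q = 1 \<and> \<not> low d \<gamma> (C V Q)} \<le> measure Om (\<Union>i<d. {Q \<in> space Om. bad_coord \<gamma> i Q})"
    by (intro Q.finite_measure_mono sets.finite_UN) (auto intro: sets_bad_coord)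
  also have "\<dots> \<le> (\<Sum>i<d. measure Om {Q \<in> space Om. bad_coord \<gamma> i Q})"
    by (intro Q.finite_measure_subadditive_finite) (auto intro: sets_bad_coord)
  also have "\<dots> \<le> (\<Sum>i<d. 24 * d * \<gamma>)" by (intro sum_mono prob_bad_coord[OF \<gamma>]) auto
  finally show ?thesis by (simp add: power2_eq_square)
qed

end

section \<open>Gaussian matrices\<close>

text \<open>Coefficients of a linear form may vanish, and a vanishing summand has no density. Such
  summands are dropped before the sum rule for independent normal variables is applied.\<close>

lemma (in prob_space) sum_indep_normal_degenerate:
  fixes X :: "'i \<Rightarrow> 'a \<Rightarrow> real"
  assumes I: "finite I" "indep_vars (\<lambda>_. borel) X I"
    and X: "\<And>i. i \<in> I \<Longrightarrow> \<tau> i > 0 \<and> distributed M lborel (X i) (normal_density 0 (\<tau> i)) \<or> \<tau> i = 0 \<and> (\<forall>\<omega>. X i \<omega> = 0)"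
    and ne: "(\<Sum>i\<in>I. (\<tau> i)\<^sup>2) \<noteq> 0"
  shows "distributed M lborel (\<lambda>\<omega>. \<Sum>i\<in>I. X i \<omega>) (normal_density 0 (sqrt (\<Sum>i\<in>I. (\<tau> i)\<^sup>2)))"
proof -
  define J where "J = {i \<in> I. \<tau> i \<noteq> 0}"
  have J: "finite J" "J \<subseteq> I" using I by (auto simp: J_def)
  have out: "\<tau> i = 0 \<and> (\<forall>\<omega>. X i \<omega> = 0)" if "i \<in> I - J" for i using X[of i] that by (auto simp: J_def)
  have eq: "(\<Sum>i\<in>I. (\<tau> i)\<^sup>2) = (\<Sum>i\<in>J. (\<tau> i)\<^sup>2)" "(\<Sum>i\<in>I. X i \<omega>) = (\<Sum>i\<in>J. X i \<omega>)" for \<omega>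
    using I J out by (auto intro!: sum.mono_neutral_right)
  have "J \<noteq> {}" using ne by (auto simp: eq)
  then have "distributed M lborel (\<lambda>\<omega>. \<Sum>i\<in>J. X i \<omega>) (normal_density (\<Sum>i\<in>J. 0) (sqrt (\<Sum>i\<in>J. (\<tau> i)\<^sup>2)))"
    using X J by (intro sum_indep_normal indep_vars_subset[OF I(2)]) (auto simp: J_def)
  then show ?thesis by (simp add: eq)
qed

text \<open>The threshold 1/2 admits both standard deviations that occur, 1 over the reals and
  \<open>sqrt (1 / 2)\<close> for the real part of a complex Gaussian.\<close>

lemma normal_density_le: "\<sigma> \<ge> 1 / 2 \<Longrightarrow> normal_density 0 \<sigma> x \<le> 1"
proof -
  assume \<sigma>: "\<sigma> \<ge> 1 / 2"
  have "1 \<le> 2 * pi * (1 / 2)\<^sup>2" using pi_gt3 by (simp add: power2_eq_square)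
  also have "\<dots> \<le> 2 * pi * \<sigma>\<^sup>2" using \<sigma> by (intro mult_left_mono power_mono) auto
  finally have "1 \<le> sqrt (2 * pi * \<sigma>\<^sup>2)" by simp
  then have "1 / sqrt (2 * pi * \<sigma>\<^sup>2) * exp (- (x - 0)\<^sup>2 / (2 * \<sigma>\<^sup>2)) \<le> 1 * 1"
    by (intro mult_mono) auto
  then show ?thesis by (simp add: normal_density_def)
qed

lemma second_moment_normal:
  assumes "\<sigma> > 0" shows "(\<integral>\<^sup>+x. ennreal (x\<^sup>2) \<partial>density lborel (normal_density 0 \<sigma>)) = ennreal (\<sigma>\<^sup>2)"
proof -
  have "(\<integral>\<^sup>+x. ennreal (x\<^sup>2) \<partial>density lborel (normal_density 0 \<sigma>)) = (\<integral>\<^sup>+x. ennreal (normal_density 0 \<sigma> x * (x - 0) ^ (2 * 1)) \<partial>lborel)"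
    by (subst nn_integral_density) (auto simp: ennreal_mult'[symmetric] normal_density_nonneg)
  also have "\<dots> = ennreal (\<integral>x. normal_density 0 \<sigma> x * (x - 0) ^ (2 * 1) \<partial>lborel)"
    using integrable_normal_moment[OF assms, of 0 2]
    by (intro nn_integral_eq_integral) (auto simp: normal_density_nonneg)
  also have "\<dots> = ennreal (\<sigma>\<^sup>2)" unfolding integral_normal_moment_even[OF assms] by simp
  finally show ?thesis .
qed

lemma distributed_id: "sets M = sets N \<Longrightarrow> M = density N f \<Longrightarrow> f \<in> borel_measurable N \<Longrightarrow> distributed M N (\<lambda>x. x) f"
  by (auto simp: distributed_def distr_id2 intro: measurable_ident_sets)

text \<open>The common features of both standard Gaussians. Pairing with 1 takes the real part, and
  \<kappa> is the standard deviation of the real part.\<close>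

locale gaussian =
  fixes \<nu> :: "'a::rc_field measure" and \<kappa> :: real
  assumes prob_nu: "prob_space \<nu>" and sets_nu: "sets \<nu> = sets borel" and kappa: "\<kappa> \<ge> 1 / 2"
    and normal: "c \<noteq> 0 \<Longrightarrow> distributed \<nu> lborel (\<lambda>x. inner (c * x) 1) (normal_density 0 (\<kappa> * norm c))"
    and second_moment: "(\<integral>\<^sup>+x. ennreal ((norm x)\<^sup>2) \<partial>\<nu>) = 1"

lemma gaussian_real: "gaussian std_gaussian_real 1"
proof (rule gaussian.intro)
  show ps: "prob_space std_gaussian_real" unfolding std_gaussian_real_def by (rule prob_space_normal_density) simp
  show s: "sets std_gaussian_real = sets borel" by (simp add: std_gaussian_real_def)
  interpret prob_space std_gaussian_real by fact
  have d: "distributed std_gaussian_real lborel (\<lambda>x. x) (normal_density 0 1)"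
    by (rule distributed_id) (auto simp: std_gaussian_real_def)
  show "distributed std_gaussian_real lborel (\<lambda>x. inner (c * x) 1) (normal_density 0 (1 * norm c))" if "c \<noteq> 0" for c :: real
    using normal_density_affine[OF d _ that, of 0] by simp
  show "(\<integral>\<^sup>+x. ennreal ((norm x)\<^sup>2) \<partial>std_gaussian_real) = 1"
    using second_moment_normal[of 1] by (simp add: std_gaussian_real_def)
qed simp

lemma gaussian_complex: "gaussian std_gaussian_complex (sqrt (1 / 2))"
proof (rule gaussian.intro)
  define N where "N = density lborel (normal_density 0 (sqrt (1 / 2)))"
  define F where "F = (\<lambda>(x, y). Complex x y)"
  have \<nu>: "std_gaussian_complex = distr (N \<Otimes>\<^sub>M N) borel F" by (simp add: std_gaussian_complex_def N_def F_def)
  interpret N: prob_space N unfolding N_def by (rule prob_space_normal_density) simp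
  interpret NN: pair_prob_space N N ..
  have sN: "sets N = sets borel" by (simp add: N_def)
  have fst: "fst \<in> borel_measurable (N \<Otimes>\<^sub>M N)" and snd: "snd \<in> borel_measurable (N \<Otimes>\<^sub>M N)"
    using measurable_fst[of N N] measurable_snd[of N N] measurable_cong_sets[OF refl sN] by blast+
  note [measurable] = fst snd
  have distr_fst: "distr (N \<Otimes>\<^sub>M N) N fst = N" by (rule N.distr_pair_fst)
  have "distr (N \<Otimes>\<^sub>M N) N snd = distr (distr (N \<Otimes>\<^sub>M N) (N \<Otimes>\<^sub>M N) (\<lambda>(x, y). (y, x))) N fst"
    by (subst distr_distr) (auto simp: comp_def case_prod_beta intro: measurable_pair_swap')
  then have distr_snd: "distr (N \<Otimes>\<^sub>M N) N snd = N"
    by (simp only: NN.distr_pair_swap[symmetric] distr_fst)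
  have to: "distr (N \<Otimes>\<^sub>M N) K f = distr (N \<Otimes>\<^sub>M N) N f" if "sets K = sets borel" for K f
    by (rule distr_cong) (auto simp: that sN)
  have F: "F \<in> measurable (N \<Otimes>\<^sub>M N) borel"
  proof -
    have "F = (\<lambda>z. complex_of_real (fst z) + \<i> * complex_of_real (snd z))"
      by (auto simp: F_def complex_eq_iff)
    then show ?thesis by simp
  qed
  show "prob_space std_gaussian_complex" unfolding \<nu> by (rule NN.P.prob_space_distr[OF F])
  show "sets std_gaussian_complex = sets borel" by (simp add: \<nu>)
  have n: "distributed (N \<Otimes>\<^sub>M N) lborel fst (normal_density 0 (sqrt (1 / 2)))"
    "distributed (N \<Otimes>\<^sub>M N) lborel snd (normal_density 0 (sqrt (1 / 2)))"
  proof -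
    show "distributed (N \<Otimes>\<^sub>M N) lborel fst (normal_density 0 (sqrt (1 / 2)))"
        "distributed (N \<Otimes>\<^sub>M N) lborel snd (normal_density 0 (sqrt (1 / 2)))"
      using fst snd distr_fst distr_snd by (auto simp: distributed_def to) (simp_all add: N_def)
  qed
  have ind: "NN.P.indep_var borel fst borel snd"
    unfolding NN.P.indep_var_distribution_eq
  proof (intro conjI fst snd)
    have "distr (N \<Otimes>\<^sub>M N) borel fst = N" "distr (N \<Otimes>\<^sub>M N) borel snd = N"
      by (simp_all add: to distr_fst distr_snd)
    moreover have "distr (N \<Otimes>\<^sub>M N) (borel \<Otimes>\<^sub>M borel) (\<lambda>x. (fst x, snd x)) = N \<Otimes>\<^sub>M N"
      by (simp add: distr_id2 sets_pair_measure_cong[OF sN sN])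
    ultimately show "distr (N \<Otimes>\<^sub>M N) borel fst \<Otimes>\<^sub>M distr (N \<Otimes>\<^sub>M N) borel snd = distr (N \<Otimes>\<^sub>M N) (borel \<Otimes>\<^sub>M borel) (\<lambda>x. (fst x, snd x))"
      by simp
  qed
  show "distributed std_gaussian_complex lborel (\<lambda>x. inner (c * x) 1) (normal_density 0 (sqrt (1 / 2) * norm c))" if c: "c \<noteq> 0" for c
  proof -
    define \<alpha> where "\<alpha> = case_bool (Re c) (- Im c)"
    define X where "X b = (\<lambda>z. \<alpha> b * case_bool fst snd b (z :: real \<times> real))" for b
    define \<tau> where "\<tau> b = \<bar>\<alpha> b\<bar> * sqrt (1 / 2)" for b
    have "NN.P.indep_vars (\<lambda>_. borel) (case_bool fst snd) UNIV"
      using ind unfolding NN.P.indep_var_def by (rule NN.P.indep_vars_cong[THEN iffD1, rotated -1]) (auto split: bool.split)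
    from NN.P.indep_vars_compose2[OF this, of "\<lambda>b x. \<alpha> b * x" "\<lambda>_. borel"]
    have iX: "NN.P.indep_vars (\<lambda>_. borel) X UNIV" by (simp add: X_def[abs_def])
    have dX: "\<tau> b > 0 \<and> distributed (N \<Otimes>\<^sub>M N) lborel (X b) (normal_density 0 (\<tau> b)) \<or> \<tau> b = 0 \<and> (\<forall>\<omega>. X b \<omega> = 0)" for b
    proof (cases "\<alpha> b = 0")
      case False
      have "distributed (N \<Otimes>\<^sub>M N) lborel (case_bool fst snd b) (normal_density 0 (sqrt (1 / 2)))"
        using n by (cases b) auto
      from NN.P.normal_density_affine[OF this _ False, of 0] show ?thesis
        using False by (simp add: X_def \<tau>_def)
    qed (simp add: X_def \<tau>_def)
    have s: "(\<Sum>b\<in>UNIV. (\<tau> b)\<^sup>2) = (sqrt (1 / 2) * norm c)\<^sup>2"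
      by (simp add: UNIV_bool \<tau>_def \<alpha>_def power_mult_distrib cmod_power2 real_sqrt_divide power_divide)
    have "distributed (N \<Otimes>\<^sub>M N) lborel (\<lambda>\<omega>. \<Sum>b\<in>UNIV. X b \<omega>) (normal_density 0 (sqrt (\<Sum>b\<in>UNIV. (\<tau> b)\<^sup>2)))"
      by (rule NN.P.sum_indep_normal_degenerate[OF _ iX dX]) (use c in \<open>auto simp: s\<close>)
    moreover have "(\<lambda>\<omega>. \<Sum>b\<in>UNIV. X b \<omega>) = (\<lambda>z. inner (c * F z) 1)"
      by (auto simp: UNIV_bool X_def \<alpha>_def F_def inner_complex_def)
    moreover have "sqrt ((sqrt (1 / 2) * norm c)\<^sup>2) = sqrt (1 / 2) * norm c" by (simp add: abs_mult)
    ultimately have dist: "distributed (N \<Otimes>\<^sub>M N) lborel (\<lambda>z. inner (c * F z) 1) (normal_density 0 (sqrt (1 / 2) * norm c))"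
      by (simp only: s)
    have m: "(\<lambda>x. inner (c * x) 1) \<in> borel_measurable (borel :: complex measure)" by measurable
    have "distr (distr (N \<Otimes>\<^sub>M N) borel F) lborel (\<lambda>x. inner (c * x) 1) = distr (N \<Otimes>\<^sub>M N) lborel (\<lambda>z. inner (c * F z) 1)"
      using F m by (subst distr_distr) (auto simp: comp_def)
    with dist m show ?thesis unfolding \<nu> distributed_def by simp
  qed
  show "(\<integral>\<^sup>+x. ennreal ((norm x)\<^sup>2) \<partial>std_gaussian_complex) = 1"
  proof -
    have h: "(\<integral>\<^sup>+x. ennreal (x\<^sup>2) \<partial>N) = ennreal (1 / 2)"
      unfolding N_def by (subst second_moment_normal) (auto simp: real_sqrt_pow2)
    have "(\<integral>\<^sup>+x. ennreal ((norm x)\<^sup>2) \<partial>std_gaussian_complex) = (\<integral>\<^sup>+z. ennreal ((norm (F z))\<^sup>2) \<partial>(N \<Otimes>\<^sub>M N))"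
      unfolding \<nu> by (rule nn_integral_distr[OF F]) measurable
    also have "\<dots> = (\<integral>\<^sup>+z. ennreal ((fst z)\<^sup>2) + ennreal ((snd z)\<^sup>2) \<partial>(N \<Otimes>\<^sub>M N))"
      by (intro nn_integral_cong) (auto simp: F_def cmod_power2)
    also have "\<dots> = (\<integral>\<^sup>+z. ennreal ((fst z)\<^sup>2) \<partial>(N \<Otimes>\<^sub>M N)) + (\<integral>\<^sup>+z. ennreal ((snd z)\<^sup>2) \<partial>(N \<Otimes>\<^sub>M N))"
      by (rule nn_integral_add) measurable
    also have "(\<integral>\<^sup>+z. ennreal ((fst z)\<^sup>2) \<partial>(N \<Otimes>\<^sub>M N)) = (\<integral>\<^sup>+x. ennreal (x\<^sup>2) \<partial>distr (N \<Otimes>\<^sub>M N) N fst)"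
      by (rule nn_integral_distr[symmetric]) (auto simp: N_def)
    also have "(\<integral>\<^sup>+z. ennreal ((snd z)\<^sup>2) \<partial>(N \<Otimes>\<^sub>M N)) = (\<integral>\<^sup>+x. ennreal (x\<^sup>2) \<partial>distr (N \<Otimes>\<^sub>M N) N snd)"
      by (rule nn_integral_distr[symmetric]) (auto simp: N_def)
    finally show ?thesis
      unfolding distr_fst distr_snd by (simp only: h) (subst ennreal_plus[symmetric], auto)
  qed
qed (rule real_le_rsqrt, simp add: power2_eq_square)

context gaussian
begin

sublocale nu: prob_space \<nu> by (rule prob_nu)

sublocale P: product_sigma_finite "\<lambda>_ :: nat \<times> nat. \<nu>" ..

lemma prob_PiM: "prob_space (PiM I (\<lambda>_. \<nu>))"
  by (rule prob_space_PiM) (rule prob_nu)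

lemma measurable_coordinate: "p \<in> I \<Longrightarrow> (\<lambda>g. g p) \<in> borel_measurable (PiM I (\<lambda>_. \<nu>))"
  using measurable_component_singleton[of p I "\<lambda>_. \<nu>"] measurable_cong_sets[OF refl sets_nu] by blast

text \<open>The modulus dominates the real part. The real part of the normalized linear form is
  normal with standard deviation \<kappa>, whose density is at most one, so an interval of length
  \<open>2 * v\<close> has probability at most \<open>2 * v\<close>.\<close>

lemma small_ball:
  fixes w :: "nat \<times> nat \<Rightarrow> 'a"
  assumes I: "finite I" and w: "(\<Sum>p\<in>I. (norm (w p))\<^sup>2) = 1" and v: "v > 0"
  shows "emeasure (PiM I (\<lambda>_. \<nu>)) {g \<in> space (PiM I (\<lambda>_. \<nu>)). norm (\<Sum>p\<in>I. w p * g p) < v} \<le> ennreal (2 * v)"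
proof -
  let ?M = "PiM I (\<lambda>_. \<nu>)"
  interpret M: prob_space ?M by (rule prob_PiM)
  have ne: "I \<noteq> {}" using w by auto
  have comp: "distr ?M \<nu> (\<lambda>g. g p) = \<nu>" if "p \<in> I" for p
    using that by (intro distr_PiM_component prob_nu)
  define X where "X p = (\<lambda>g. inner (w p * (g :: nat \<times> nat \<Rightarrow> 'a) p) 1)" for p
  have dX: "\<kappa> * norm (w p) > 0 \<and> distributed ?M lborel (X p) (normal_density 0 (\<kappa> * norm (w p))) \<or>
      \<kappa> * norm (w p) = 0 \<and> (\<forall>g. X p g = 0)" if p: "p \<in> I" for p
  proof (cases "w p = 0")
    case False
    note n = normal[OF False]
    have m: "(\<lambda>x. inner (w p * x) 1) \<in> measurable \<nu> lborel" using n by (simp add: distributed_def)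
    have "distr ?M lborel (X p) = distr (distr ?M \<nu> (\<lambda>g. g p)) lborel (\<lambda>x. inner (w p * x) 1)"
      unfolding X_def using p m by (subst distr_distr) (auto simp: comp_def)
    also have "\<dots> = density lborel (normal_density 0 (\<kappa> * norm (w p)))"
      unfolding comp[OF p] using n by (simp add: distributed_def)
    finally have "distributed ?M lborel (X p) (normal_density 0 (\<kappa> * norm (w p)))"
      using measurable_compose[OF measurable_component_singleton[OF p] m] by (simp add: distributed_def X_def)
    then show ?thesis using False kappa by simp
  qed (simp add: X_def)
  have "M.indep_vars (\<lambda>_. \<nu>) (\<lambda>p g. g p) I"
  proof (subst M.indep_vars_iff_distr_eq_PiM'[OF ne])
    have "distr ?M ?M (\<lambda>g. \<lambda>p\<in>I. g p) = distr ?M ?M (\<lambda>g. g)"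
      by (intro distr_cong refl) (auto simp: space_PiM PiE_def)
    also have "\<dots> = PiM I (\<lambda>p. distr ?M \<nu> (\<lambda>g. g p))"
      by (simp add: distr_id2) (intro PiM_cong refl comp[symmetric])
    finally show "distr ?M ?M (\<lambda>g. \<lambda>p\<in>I. g p) = PiM I (\<lambda>p. distr ?M \<nu> (\<lambda>g. g p))" .
  qed auto
  moreover have "(\<lambda>x. inner (c * x) 1) \<in> borel_measurable \<nu>" for c :: 'a
    by (subst measurable_cong_sets[OF sets_nu refl]) simp
  ultimately have iX: "M.indep_vars (\<lambda>_. borel) X I"
    unfolding X_def by (rule M.indep_vars_compose2)
  have k: "(\<Sum>p\<in>I. (\<kappa> * norm (w p))\<^sup>2) = \<kappa>\<^sup>2"
    using w by (simp add: power_mult_distrib flip: sum_distrib_left)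
  have "distributed ?M lborel (\<lambda>g. \<Sum>p\<in>I. X p g) (normal_density 0 (sqrt (\<Sum>p\<in>I. (\<kappa> * norm (w p))\<^sup>2)))"
    by (rule M.sum_indep_normal_degenerate[OF I iX dX]) (use kappa in \<open>auto simp: k\<close>)
  then have dist: "distributed ?M lborel (\<lambda>g. \<Sum>p\<in>I. X p g) (normal_density 0 \<kappa>)" using kappa by (simp add: k)
  have sub: "{g \<in> space ?M. norm (\<Sum>p\<in>I. w p * g p) < v} \<subseteq> (\<lambda>g. \<Sum>p\<in>I. X p g) -` {-v..v} \<inter> space ?M"
  proof
    fix g assume g: "g \<in> {g \<in> space ?M. norm (\<Sum>p\<in>I. w p * g p) < v}"
    have "\<bar>\<Sum>p\<in>I. X p g\<bar> \<le> norm (\<Sum>p\<in>I. w p * g p) * norm (1 :: 'a)"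
      unfolding X_def inner_sum_left[symmetric] by (rule Cauchy_Schwarz_ineq2)
    with g show "g \<in> (\<lambda>g. \<Sum>p\<in>I. X p g) -` {-v..v} \<inter> space ?M" by auto
  qed
  have "emeasure ?M {g \<in> space ?M. norm (\<Sum>p\<in>I. w p * g p) < v} \<le> emeasure ?M ((\<lambda>g. \<Sum>p\<in>I. X p g) -` {-v..v} \<inter> space ?M)"
    using dist by (intro emeasure_mono sub measurable_sets[of _ _ lborel]) (auto simp: distributed_def)
  also have "\<dots> = (\<integral>\<^sup>+x. ennreal (normal_density 0 \<kappa> x) * indicator {-v..v} x \<partial>lborel)"
    by (rule distributed_emeasure[OF dist]) simp
  also have "\<dots> \<le> (\<integral>\<^sup>+x. indicator {-v..v} x \<partial>lborel)"
    using normal_density_le[OF kappa] by (intro nn_integral_mono) (auto simp: indicator_def ennreal_le_1)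
  also have "\<dots> = ennreal (2 * v)" using v by simp
  finally show ?thesis .
qed

end

text \<open>The matrix whose rows are the other columns, with row \<open>i\<close> set to zero, is
  singular; its kernel supplies \<open>w\<close>. The pairing is bilinear, without conjugation, as
  the distance argument uses it.\<close>

lemma ex_unit_normal:
  fixes f :: "nat \<times> nat \<Rightarrow> 'a::rc_field"
  assumes i: "i < d"
  obtains w where "(\<Sum>r<d. (norm (w r))\<^sup>2) = 1" "\<And>k. k < d \<Longrightarrow> k \<noteq> i \<Longrightarrow> (\<Sum>r<d. w r * f (r, k)) = 0"
proof -
  define A where "A = mat d d (\<lambda>(k, r). if k = i then 0 else f (r, k))"
  have A: "A \<in> carrier_mat d d" by (simp add: A_def)
  have "(\<Prod>k = 0..<d. A $$ (k, p k)) = 0" if "p permutes {0..<d}" for p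
  proof (rule prod_zero)
    have "p i < d" using i permutes_in_image[OF that, of i] by simp
    then show "\<exists>k\<in>{0..<d}. A $$ (k, p k) = 0" using i by (intro bexI[of _ i]) (auto simp: A_def)
  qed simp
  then have "det A = 0" unfolding det_def'[OF A] by (intro sum.neutral) auto
  then obtain v where v: "v \<in> carrier_vec d" "v \<noteq> 0\<^sub>v d" "A *\<^sub>v v = 0\<^sub>v d"
    using det_0_iff_vec_prod_zero[OF A] by blast
  define \<rho> where "\<rho> = sqrt (sqv d (\<lambda>r. v $ r))"
  have "sqv d (\<lambda>i. v $ i) \<noteq> 0"
  proof
    assume "sqv d (\<lambda>i. v $ i) = 0"
    then have "\<forall>i<d. v $ i = 0" by (auto simp: sqv_def sum_nonneg_eq_0_iff)
    then have "v = 0\<^sub>v d" using v(1) by (intro eq_vecI) auto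
    with v(2) show False ..
  qed
  moreover have "sqv d (\<lambda>r. v $ r) \<ge> 0" by (simp add: sqv_def sum_nonneg)
  ultimately have \<rho>: "\<rho> > 0" "\<rho>\<^sup>2 = sqv d (\<lambda>r. v $ r)" by (auto simp: \<rho>_def)
  show ?thesis
  proof (rule that[of "\<lambda>r. v $ r / of_real \<rho>"])
    have "(\<Sum>r<d. (norm (v $ r / of_real \<rho>))\<^sup>2) = sqv d (\<lambda>r. v $ r) / \<rho>\<^sup>2"
      by (simp add: norm_divide power_divide sqv_def sum_divide_distrib)
    then show "(\<Sum>r<d. (norm (v $ r / of_real \<rho>))\<^sup>2) = 1" using \<rho>(1) by (simp flip: \<rho>(2))
    fix k assume k: "k < d" "k \<noteq> i"
    have "(\<Sum>r<d. v $ r / of_real \<rho> * f (r, k)) = (\<Sum>r<d. A $$ (k, r) * v $ r) / of_real \<rho>"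
      unfolding sum_divide_distrib using k by (intro sum.cong refl) (simp add: A_def mult.commute)
    also have "(\<Sum>r<d. A $$ (k, r) * v $ r) = (A *\<^sub>v v) $ k"
      using k v(1) A by (simp add: scalar_prod_def atLeast0LessThan)
    finally show "(\<Sum>r<d. v $ r / of_real \<rho> * f (r, k)) = 0" using v(3) k by simp
  qed
qed


lemma norm_sum_mult_le:
  fixes w u :: "nat \<Rightarrow> 'a::rc_field"
  assumes "(\<Sum>r<d. (norm (w r))\<^sup>2) = 1"
  shows "(norm (\<Sum>r<d. w r * u r))\<^sup>2 \<le> sqv d u"
proof -
  have "norm (\<Sum>r<d. w r * u r) \<le> (\<Sum>r<d. \<bar>norm (w r)\<bar> * \<bar>norm (u r)\<bar>)"
    by (rule sum_norm_le) (simp add: norm_mult)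
  also have "\<dots> \<le> L2_set (\<lambda>r. norm (w r)) {..<d} * L2_set (\<lambda>r. norm (u r)) {..<d}"
    by (rule L2_set_mult_ineq)
  finally have "norm (\<Sum>r<d. w r * u r) \<le> sqrt (sqv d u)" using assms by (simp add: L2_set_def sqv_def)
  then have "(norm (\<Sum>r<d. w r * u r))\<^sup>2 \<le> (sqrt (sqv d u))\<^sup>2" by (rule power_mono) simp
  then show ?thesis by (simp add: sqv_def sum_nonneg)
qed

section \<open>Smallest singular value and norm of a Gaussian matrix\<close>

context gaussian
begin

context
  fixes d :: nat
  assumes d: "d > 0"
begin

abbreviation "E \<equiv> {..<d} \<times> {..<d}"
abbreviation "GM \<equiv> PiM E (\<lambda>_. \<nu>)"

interpretation GM: prob_space GM by (rule prob_PiM)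

definition "fm_of f = Fm d (mat d d f)"

lemma ent_fm_of: "i < d \<Longrightarrow> k < d \<Longrightarrow> ent (fm_of f) i k = f (i, k)"
  by (simp add: fm_of_def ent_Fm)

lemma supp_le_fm_of: "supp_le d (fm_of f)" by (simp add: fm_of_def)

lemma measurable_fm_of: "i < d \<Longrightarrow> k < d \<Longrightarrow> (\<lambda>f. ent (fm_of f) i k) \<in> borel_measurable GM"
  using measurable_coordinate[of "(i, k)" E] by (simp add: ent_fm_of)

text \<open>Near-singularity witnessed by a vector whose \<open>i\<close>-th coordinate carries at
  least the share 4^(-l) of its squared length.\<close>

definition "bad_level (\<eta> :: real) i l = {f \<in> space GM. \<exists>x\<in>dense_vectors.
  sqv d x \<le> 4 ^ l * (norm (x i))\<^sup>2 \<and> sqv d (mulv d (fm_of f) x) < \<eta>\<^sup>2 * sqv d x}"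

lemma sets_bad_level: "bad_level \<eta> i l \<in> sets GM"
  unfolding bad_level_def by (rule measurable_low_event[OF measurable_fm_of])

text \<open>Fix all columns but the \<open>i\<close>-th and let the unit vector \<open>w\<close>
  annihilate them. Applying \<open>w\<close> to the image of \<open>z\<close> leaves only column
  \<open>i\<close>, multiplied by \<open>z i\<close>. As \<open>z i\<close> is not small, the
  Gaussian linear form of this column lies below \<open>\<eta> * 2 ^ l\<close>, which
  \<open>small_ball\<close> makes unlikely.\<close>

lemma prob_bad_level:
  fixes \<eta> :: real
  assumes \<eta>: "\<eta> > 0" and i: "i < d"
  shows "GM.prob (bad_level \<eta> i l) \<le> 2 * (\<eta> * 2 ^ l)"
proof -
  define J where "J = {..<d} \<times> ({..<d} - {i})"
  define K where "K = {..<d} \<times> {i}"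
  have JK: "J \<inter> K = {}" "finite J" "finite K" "E = J \<union> K" using i by (auto simp: J_def K_def)
  have sumK: "(\<Sum>p\<in>K. g p) = (\<Sum>r<d. g (r, i))" for g :: "_ \<Rightarrow> 'b::comm_monoid_add"
    unfolding K_def by (simp add: sum.cartesian_product[symmetric, of "\<lambda>a b. g (a, b)", simplified case_prod_eta])
  have "emeasure GM (bad_level \<eta> i l) = (\<integral>\<^sup>+f. indicator (bad_level \<eta> i l) f \<partial>GM)"
    using sets_bad_level by simp
  also have "\<dots> = (\<integral>\<^sup>+x. (\<integral>\<^sup>+y. indicator (bad_level \<eta> i l) (merge J K (x, y)) \<partial>PiM K (\<lambda>_. \<nu>)) \<partial>PiM J (\<lambda>_. \<nu>))"
    unfolding JK(4) by (rule P.product_nn_integral_fold[OF JK(1-3)])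
      (use sets_bad_level in \<open>simp add: JK(4)[symmetric]\<close>)
  also have "\<dots> \<le> (\<integral>\<^sup>+x. ennreal (2 * (\<eta> * 2 ^ l)) \<partial>PiM J (\<lambda>_. \<nu>))"
  proof (rule nn_integral_mono)
    fix x :: "nat \<times> nat \<Rightarrow> 'a"
    obtain w where w: "(\<Sum>r<d. (norm (w r))\<^sup>2) = 1" "\<And>k. k < d \<Longrightarrow> k \<noteq> i \<Longrightarrow> (\<Sum>r<d. w r * x (r, k)) = 0"
      using ex_unit_normal[OF i] by metis
    have "(\<integral>\<^sup>+y. indicator (bad_level \<eta> i l) (merge J K (x, y)) \<partial>PiM K (\<lambda>_. \<nu>))
      \<le> (\<integral>\<^sup>+y. indicator {y \<in> space (PiM K (\<lambda>_. \<nu>)). norm (\<Sum>p\<in>K. w (fst p) * y p) < \<eta> * 2 ^ l} y \<partial>PiM K (\<lambda>_. \<nu>))"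
    proof (rule nn_integral_mono)
      fix y assume y: "y \<in> space (PiM K (\<lambda>_. \<nu>))"
      define f where "f = merge J K (x, y)"
      have f: "f (r, k) = (if k = i then y (r, i) else x (r, k))" if "r < d" "k < d" for r k
        using that by (auto simp: f_def merge_def J_def K_def)
      have "norm (\<Sum>r<d. w r * y (r, i)) < \<eta> * 2 ^ l" if bad: "f \<in> bad_level \<eta> i l"
      proof -
        obtain z where z: "sqv d z \<le> 4 ^ l * (norm (z i))\<^sup>2" "sqv d (mulv d (fm_of f) z) < \<eta>\<^sup>2 * sqv d z"
          using bad unfolding bad_level_def by blast
        have "(\<Sum>r<d. w r * mulv d (fm_of f) z r) = (\<Sum>r<d. \<Sum>k<d. w r * f (r, k) * z k)"
          by (intro sum.cong refl) (simp add: mulv_def ent_fm_of sum_distrib_left mult.assoc)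
        also have "\<dots> = (\<Sum>k<d. (\<Sum>r<d. w r * f (r, k)) * z k)"
          unfolding sum_distrib_right by (rule sum.swap)
        also have "\<dots> = (\<Sum>k<d. if k = i then (\<Sum>r<d. w r * y (r, i)) * z i else 0)"
        proof (intro sum.cong refl)
          fix k assume k: "k \<in> {..<d}"
          have "(\<Sum>r<d. w r * f (r, k)) = (\<Sum>r<d. w r * (if k = i then y (r, i) else x (r, k)))"
            using k by (intro sum.cong refl) (simp add: f)
          with w(2)[of k] k show "(\<Sum>r<d. w r * f (r, k)) * z k = (if k = i then (\<Sum>r<d. w r * y (r, i)) * z i else 0)"
            by (cases "k = i") simp_all
        qed
        also have "\<dots> = (\<Sum>r<d. w r * y (r, i)) * z i" using i by (simp add: sum.delta)
        finally have "(norm (\<Sum>r<d. w r * y (r, i)) * norm (z i))\<^sup>2 \<le> sqv d (mulv d (fm_of f) z)"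
          using norm_sum_mult_le[OF w(1), of "mulv d (fm_of f) z"] by (simp add: norm_mult)
        also note z(2)
        also have "\<eta>\<^sup>2 * sqv d z \<le> \<eta>\<^sup>2 * (4 ^ l * (norm (z i))\<^sup>2)" using z(1) by (intro mult_left_mono) auto
        also have "\<dots> = (\<eta> * 2 ^ l * norm (z i))\<^sup>2"
          by (simp add: power_mult_distrib flip: power_mult) (simp add: mult.commute[of l] power_mult)
        finally have "norm (\<Sum>r<d. w r * y (r, i)) * norm (z i) < \<eta> * 2 ^ l * norm (z i)"
          by (rule power_less_imp_less_base) (use \<eta> in simp)
        then show ?thesis by (simp add: mult_less_cancel_right)
      qed
      then show "(indicator (bad_level \<eta> i l) (merge J K (x, y)) :: ennreal)
        \<le> indicator {y \<in> space (PiM K (\<lambda>_. \<nu>)). norm (\<Sum>p\<in>K. w (fst p) * y p) < \<eta> * 2 ^ l} y"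
        using y unfolding sumK f_def[symmetric] by (auto simp: indicator_def)
    qed
    also have "\<dots> = emeasure (PiM K (\<lambda>_. \<nu>)) {y \<in> space (PiM K (\<lambda>_. \<nu>)). norm (\<Sum>p\<in>K. w (fst p) * y p) < \<eta> * 2 ^ l}"
    proof (rule nn_integral_indicator)
      have "(\<lambda>y. norm (\<Sum>p\<in>K. w (fst p) * y p)) \<in> borel_measurable (PiM K (\<lambda>_. \<nu>))"
        by (rule measurable_compose[of "\<lambda>y. \<Sum>p\<in>K. w (fst p) * y p" _ borel norm])
          (auto intro!: borel_measurable_sum borel_measurable_times measurable_coordinate)
      then show "{y \<in> space (PiM K (\<lambda>_. \<nu>)). norm (\<Sum>p\<in>K. w (fst p) * y p) < \<eta> * 2 ^ l} \<in> sets (PiM K (\<lambda>_. \<nu>))"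
        by measurable
    qed
    also have "\<dots> \<le> ennreal (2 * (\<eta> * 2 ^ l))"
      using w(1) \<eta> by (intro small_ball JK(3)) (auto simp: sumK)
    finally show "(\<integral>\<^sup>+y. indicator (bad_level \<eta> i l) (merge J K (x, y)) \<partial>PiM K (\<lambda>_. \<nu>)) \<le> ennreal (2 * (\<eta> * 2 ^ l))" .
  qed
  also have "\<dots> = ennreal (2 * (\<eta> * 2 ^ l))"
    using prob_space.emeasure_space_1[OF prob_PiM, of J] by simp
  finally show ?thesis using \<eta> by (simp add: GM.emeasure_eq_measure)
qed

text \<open>The distance argument only controls the coordinate \<open>x\<^sub>i\<close> when it is not small, so the
  coordinates are weighted by their squares and split dyadically.\<close>

lemma gaussian_near_singular:
  fixes \<eta> :: real
  assumes \<eta>: "\<eta> > 0"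
  shows "GM.prob {f \<in> space GM. \<not> low d \<eta> (fm_of f)} \<le> 32 * d * \<eta>"
proof -
  \<comment> \<open>Coordinates below level \<open>L\<close> carry together at most half of the
    squared length; the final factor 2 makes up for them.\<close>
  obtain L where L: "(1 / 4) ^ L < 1 / (2 * real d)" using real_arch_pow_inv[of "1 / (2 * real d)" "1 / 4"] d by auto
  let ?B = "{f \<in> space GM. \<not> low d \<eta> (fm_of f)}"
  have B: "?B \<in> sets GM"
    using measurable_low_event[of d fm_of GM "\<lambda>_. True" "\<lambda>x. \<eta>\<^sup>2 * sqv d x"] measurable_fm_of \<eta>
    by (simp add: not_low_dense[OF supp_le_fm_of d])
  \<comment> \<open>At the least level \<open>l\<close> that a coordinate meets, its share is at
    most \<open>4 * (1 / 4) ^ l\<close>. This weight makes the shares of the bad coordinates sum to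
    at least one half.\<close>
  define c where "c i l f = 4 * (1 / 4) ^ l * (indicator (bad_level \<eta> i l) f :: real)" for i l f
  have pointwise: "indicator ?B f \<le> 2 * (\<Sum>i<d. \<Sum>l\<le>L. c i l f)"
    (is "_ \<le> 2 * (\<Sum>i<d. ?s i)") if f: "f \<in> space GM" for f
  proof (cases "f \<in> ?B")
    case True
    then obtain x where x: "x \<in> dense_vectors" "sqv d (mulv d (fm_of f) x) < \<eta>\<^sup>2 * sqv d x"
      using not_low_dense[OF supp_le_fm_of d] \<eta> by (auto dest: less_imp_le)
    have "0 \<le> sqv d (mulv d (fm_of f) x)" by (simp add: sqv_def sum_nonneg)
    then have "0 < \<eta>\<^sup>2 * sqv d x" using x(2) by linarith
    then have x0: "sqv d x > 0" using \<eta> by (simp add: zero_less_mult_iff)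
    have s0: "0 \<le> c i l f" for i l by (simp add: c_def)
    have le: "(norm (x i))\<^sup>2 \<le> ((1 / 4) ^ L + ?s i) * sqv d x" if i: "i < d" for i
    proof (cases "sqv d x \<le> 4 ^ L * (norm (x i))\<^sup>2")
      case True
      define l where "l = (LEAST l. sqv d x \<le> 4 ^ l * (norm (x i))\<^sup>2)"
      have l: "sqv d x \<le> 4 ^ l * (norm (x i))\<^sup>2" unfolding l_def by (rule LeastI[of "\<lambda>l. sqv d x \<le> 4 ^ l * (norm (x i))\<^sup>2", OF True])
      have lL: "l \<le> L" unfolding l_def by (rule Least_le[of "\<lambda>l. sqv d x \<le> 4 ^ l * (norm (x i))\<^sup>2", OF True])
      have "f \<in> bad_level \<eta> i l" using f x l by (auto simp: bad_level_def)
      then have "4 * (1 / 4) ^ l = c i l f" by (simp add: c_def)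
      also have "\<dots> \<le> ?s i" using lL by (intro member_le_sum s0) auto
      finally have s: "4 * (1 / 4) ^ l \<le> ?s i" .
      have "(norm (x i))\<^sup>2 \<le> 4 * (1 / 4) ^ l * sqv d x"
      proof (cases l)
        case 0
        have "(norm (x i))\<^sup>2 \<le> sqv d x" unfolding sqv_def using i by (intro member_le_sum) auto
        then show ?thesis using 0 x0 by simp
      next
        case (Suc m)
        then have "\<not> sqv d x \<le> 4 ^ m * (norm (x i))\<^sup>2" unfolding l_def using not_less_Least by (metis lessI)
        then show ?thesis using Suc by (simp add: field_simps)
      qed
      also have "\<dots> \<le> ((1 / 4) ^ L + ?s i) * sqv d x"
        using s x0 zero_le_power[of "1 / 4 :: real" L] by (intro mult_right_mono) linarith+
      finally show ?thesis .
    next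
      case False
      then have "(norm (x i))\<^sup>2 \<le> (1 / 4) ^ L * sqv d x" by (simp add: field_simps)
      also have "\<dots> \<le> ((1 / 4) ^ L + ?s i) * sqv d x" using x0 sum_nonneg[OF s0] by (intro mult_right_mono) auto
      finally show ?thesis .
    qed
    have "sqv d x \<le> (\<Sum>i<d. ((1 / 4) ^ L + ?s i) * sqv d x)"
      using sum_mono[OF le, of "{..<d}"] by (simp add: sqv_def)
    also have "\<dots> = (d * (1 / 4) ^ L + (\<Sum>i<d. ?s i)) * sqv d x"
      by (simp add: sum.distrib flip: sum_distrib_right)
    finally have "1 \<le> d * (1 / 4) ^ L + (\<Sum>i<d. ?s i)" using x0 by (simp add: mult_le_cancel_right1)
    moreover have "d * (1 / 4) ^ L \<le> 1 / 2" using L d by (simp add: field_simps)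
    ultimately show ?thesis using True by simp
  qed (simp add: sum_nonneg c_def)
  have int: "integrable GM (indicator A :: _ \<Rightarrow> real)" if "A \<in> sets GM" for A
    using that by (simp add: GM.emeasure_eq_measure)
  have "GM.prob ?B = (\<integral>f. indicator ?B f \<partial>GM)" using B by simp
  also have "\<dots> \<le> (\<integral>f. 2 * (\<Sum>i<d. \<Sum>l\<le>L. c i l f) \<partial>GM)"
    unfolding c_def
    by (intro integral_mono pointwise[unfolded c_def] int B integrable_mult_right Bochner_Integration.integrable_sum sets_bad_level)
  also have "\<dots> = 2 * (\<Sum>i<d. \<Sum>l\<le>L. 4 * (1 / 4) ^ l * GM.prob (bad_level \<eta> i l))"
  proof -
    have ic: "integrable GM (c i l)" "(\<integral>f. c i l f \<partial>GM) = 4 * (1 / 4) ^ l * GM.prob (bad_level \<eta> i l)" for i l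
      using int[OF sets_bad_level] sets_bad_level by (simp_all add: c_def[abs_def])
    have "(\<integral>f. (\<Sum>i<d. \<Sum>l\<le>L. c i l f) \<partial>GM) = (\<Sum>i<d. \<Sum>l\<le>L. \<integral>f. c i l f \<partial>GM)"
      using ic(1) by (simp add: Bochner_Integration.integral_sum Bochner_Integration.integrable_sum)
    then show ?thesis by (simp only: ic(2) integral_mult_right_zero)
  qed
  \<comment> \<open>The probability grows like 2^l and the weight falls like 4^(-l), so the levels
    sum geometrically and the bound is linear in \<open>d\<close>. A single cutoff at the share
    \<open>1 / d\<close> would lose a further \<open>sqrt d\<close>.\<close>
  also have "\<dots> \<le> 2 * (\<Sum>i<d. \<Sum>l\<le>L. 4 * (1 / 4) ^ l * (2 * (\<eta> * 2 ^ l)))"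
    by (intro mult_left_mono sum_mono prob_bad_level \<eta>) auto
  also have "\<dots> = 16 * d * \<eta> * (\<Sum>l\<le>L. (1 / 2) ^ l)"
  proof -
    have "4 * (1 / 4) ^ l * (2 * (\<eta> * 2 ^ l)) = 8 * \<eta> * (1 / 2) ^ l" for l :: nat
    proof -
      have h: "(1 / 4) ^ l * 2 ^ l = ((1 / 2) ^ l :: real)" by (simp only: power_mult_distrib[symmetric]) simp
      have "4 * (1 / 4) ^ l * (2 * (\<eta> * 2 ^ l)) = 8 * \<eta> * ((1 / 4) ^ l * 2 ^ l)" by simp
      then show ?thesis unfolding h .
    qed
    then have "2 * (\<Sum>i<d. \<Sum>l\<le>L. 4 * (1 / 4) ^ l * (2 * (\<eta> * 2 ^ l))) = 2 * (\<Sum>i<d. 8 * \<eta> * (\<Sum>l\<le>L. (1 / 2) ^ l))"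
      by (simp only: sum_distrib_left[symmetric] sum_constant card_lessThan)
    then show ?thesis by simp
  qed
  also have "\<dots> \<le> 16 * d * \<eta> * 2"
  proof (rule mult_left_mono)
    have "(\<Sum>l\<le>n. (1 / 2) ^ l) = 2 - (1 / 2 :: real) ^ n" for n :: nat
      by (induction n) simp_all
    then show "(\<Sum>l\<le>L. (1 / 2) ^ l) \<le> (2 :: real)" by simp
  qed (use \<eta> in simp)
  finally show ?thesis by simp
qed

lemma gaussian_norm:
  fixes R :: real
  assumes R: "R > 0"
  shows "GM.prob {f \<in> space GM. (norm (fm_of f))\<^sup>2 > R} \<le> (real d)\<^sup>2 / R"
proof -
  have norm_eq: "(norm (fm_of f))\<^sup>2 = (\<Sum>i<d. \<Sum>k<d. (norm (f (i, k)))\<^sup>2)" for f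
    unfolding norm_fm_sq[OF supp_le_fm_of] by (intro sum.cong refl) (simp add: ent_fm_of)
  have mc: "(\<lambda>f. ennreal ((norm (f p))\<^sup>2)) \<in> borel_measurable GM" if "p \<in> E" for p
    by (rule measurable_compose[OF measurable_coordinate[OF that]]) measurable
  have m: "(\<lambda>f. (norm (fm_of f))\<^sup>2) \<in> borel_measurable GM"
    unfolding norm_eq
    by (intro borel_measurable_sum borel_measurable_power measurable_compose[OF measurable_coordinate, of _ _ norm]) auto
  have "(\<integral>\<^sup>+f. ennreal ((norm (fm_of f))\<^sup>2) \<partial>GM) = (\<integral>\<^sup>+f. (\<Sum>i<d. \<Sum>k<d. ennreal ((norm (f (i, k)))\<^sup>2)) \<partial>GM)"
    unfolding norm_eq by (simp add: sum_nonneg flip: sum_ennreal)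
  also have "\<dots> = (\<Sum>i<d. \<integral>\<^sup>+f. (\<Sum>k<d. ennreal ((norm (f (i, k)))\<^sup>2)) \<partial>GM)"
    by (intro nn_integral_sum borel_measurable_sum mc) auto
  also have "\<dots> = (\<Sum>i<d. \<Sum>k<d. \<integral>\<^sup>+f. ennreal ((norm (f (i, k)))\<^sup>2) \<partial>GM)"
    by (intro sum.cong refl nn_integral_sum mc) auto
  also have "\<dots> = (\<Sum>i<d. \<Sum>k<d. 1)"
  proof (intro sum.cong refl)
    fix i k assume "i \<in> {..<d}" "k \<in> {..<d}"
    then have p: "(i, k) \<in> E" by simp
    have "(\<integral>\<^sup>+f. ennreal ((norm (f (i, k)))\<^sup>2) \<partial>GM) = (\<integral>\<^sup>+x. ennreal ((norm x)\<^sup>2) \<partial>distr GM \<nu> (\<lambda>f. f (i, k)))"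
      using p sets_nu
      by (intro nn_integral_distr[symmetric] measurable_component_singleton) (auto simp: measurable_cong_sets[OF sets_nu refl] measurable_distr_eq1)
    also have "\<dots> = 1" unfolding distr_PiM_component[OF prob_nu p] by (rule second_moment)
    finally show "(\<integral>\<^sup>+f. ennreal ((norm (f (i, k)))\<^sup>2) \<partial>GM) = 1" .
  qed
  finally have moment: "(\<integral>\<^sup>+f. ennreal ((norm (fm_of f))\<^sup>2) \<partial>GM) = ennreal ((real d)\<^sup>2)"
    by (simp add: power2_eq_square ennreal_mult ennreal_of_nat_eq_real_of_nat)
  have "emeasure GM {f \<in> space GM. (norm (fm_of f))\<^sup>2 > R} \<le> emeasure GM {f \<in> space GM. 1 \<le> ennreal (1 / R) * ennreal ((norm (fm_of f))\<^sup>2)}"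
  proof (rule emeasure_mono)
    show "{f \<in> space GM. (norm (fm_of f))\<^sup>2 > R} \<subseteq> {f \<in> space GM. 1 \<le> ennreal (1 / R) * ennreal ((norm (fm_of f))\<^sup>2)}"
      using R by (auto simp: field_simps simp flip: ennreal_mult intro!: ennreal_ge_1[THEN iffD2])
    show "{f \<in> space GM. 1 \<le> ennreal (1 / R) * ennreal ((norm (fm_of f))\<^sup>2)} \<in> sets GM" using m by measurable
  qed
  also have "\<dots> \<le> ennreal (1 / R) * (\<integral>\<^sup>+f. ennreal ((norm (fm_of f))\<^sup>2) * indicator (space GM) f \<partial>GM)"
    by (rule nn_integral_Markov_inequality) (use m in measurable)
  also have "(\<integral>\<^sup>+f. ennreal ((norm (fm_of f))\<^sup>2) * indicator (space GM) f \<partial>GM) = (\<integral>\<^sup>+f. ennreal ((norm (fm_of f))\<^sup>2) \<partial>GM)"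
    by (intro nn_integral_cong) simp
  finally show ?thesis unfolding moment using R by (simp add: GM.emeasure_eq_measure flip: ennreal_mult)
qed

end

end

section \<open>Conclusion\<close>

text \<open>The numbers come from the probability budget: \<eta> makes
  \<open>32 * d * \<eta>\<close> equal to \<open>\<delta> / 8\<close>, the bound on \<open>N\<close>
  makes the Markov bound \<open>\<delta> / 8\<close>, and \<gamma> makes the real Haar bound
  \<open>24 * d\<^sup>2 * \<gamma>\<close> equal to \<open>\<delta>\<^sup>2 / 6\<close>.\<close>

lemma scale_bounds:
  fixes d \<delta> \<sigma> \<epsilon> N :: real
  assumes \<delta>: "0 < \<delta>" "\<delta> < 1" and d: "d \<ge> 1" and \<sigma>: "\<sigma> > 0" and \<epsilon>: "\<epsilon> > 0"
    and small: "\<epsilon> ^ 4 \<le> \<sigma> * \<delta> ^ 6 / (256 * 1000 ^ 4 * d ^ 9)" and N: "N\<^sup>2 \<le> 8 * d\<^sup>2 / \<delta>"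
  defines "\<eta> \<equiv> \<delta> / (256 * d)" and "\<gamma> \<equiv> (\<delta> / (12 * d))\<^sup>2"
  shows "9 * (\<epsilon>\<^sup>2 * \<eta>\<^sup>2 / 2 + 2 * \<epsilon>\<^sup>2 * N\<^sup>2) ^ 3 \<le> \<sigma> * (\<epsilon>\<^sup>2 * \<eta>\<^sup>2 * sqrt \<gamma> / 2)"
    and "\<epsilon> ^ 4 * N ^ 4 \<le> 2 / 5 * \<sigma>"
    and "10 / (\<sigma> * (\<epsilon>\<^sup>2 * \<eta>\<^sup>2 * sqrt \<gamma>)) + 125 * ln (18 * d) / (\<sigma> * sqrt \<sigma>)
      \<le> 16 * (1000 / \<delta>\<^sup>2)\<^sup>2 * d ^ 3 / (\<sigma> * \<epsilon>\<^sup>2)"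
proof -
  define u where "u = \<epsilon>\<^sup>2"
  have u: "u > 0" "\<epsilon> ^ 4 = u\<^sup>2" using \<epsilon> by (auto simp: u_def)
  have sg: "sqrt \<gamma> = \<delta> / (12 * d)" using \<delta> d by (simp add: \<gamma>_def)
  have pw: "d ^ n \<ge> 1" "\<delta> ^ n \<le> 1" "\<delta> ^ n > 0" "d ^ n > 0" for n
    using d \<delta> by (auto simp: power_le_one less_imp_le)
  have e1: "u * \<eta>\<^sup>2 / 2 + 2 * u * N\<^sup>2 \<le> u * (17 * d\<^sup>2 / \<delta>)"
  proof -
    have "\<eta> \<le> 1" "\<eta> \<ge> 0" using \<delta> d by (auto simp: \<eta>_def field_simps)
    then have "\<eta>\<^sup>2 \<le> 1" by (simp add: power_le_one)
    moreover have "1 \<le> d\<^sup>2 / \<delta>" using \<delta> pw[of 2] by (simp add: field_simps)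
    ultimately have "\<eta>\<^sup>2 / 2 + 2 * N\<^sup>2 \<le> 17 * d\<^sup>2 / \<delta>" using N by simp
    from mult_left_mono[OF this, of u] u show ?thesis by (simp add: algebra_simps)
  qed
  have "9 * (u * \<eta>\<^sup>2 / 2 + 2 * u * N\<^sup>2) ^ 3 \<le> 9 * (u * (17 * d\<^sup>2 / \<delta>)) ^ 3"
    using e1 u by (intro mult_left_mono power_mono) auto
  \<comment> \<open>The constant 44217 is 9 times the cube of 17, where 17 is 2 times 8 from the
    norm of \<open>G\<close> plus 1 for the \<eta> term.\<close>
  also have "\<dots> = u\<^sup>2 * (44217 * u * d ^ 6 / \<delta> ^ 3)"
    by (simp add: power_mult_distrib power_divide power2_eq_square power3_eq_cube flip: power_mult power_add) (simp add: eval_nat_numeral)?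
  also have "\<dots> \<le> \<sigma> * \<delta> ^ 6 / (256 * 1000 ^ 4 * d ^ 9) * (44217 * u * d ^ 6 / \<delta> ^ 3)"
    using small u \<delta> d by (intro mult_right_mono) (auto simp: u(2))
  also have "\<dots> = 44217 / (256 * 1000 ^ 4) * (\<sigma> * u * \<delta> ^ 3 / d ^ 3)"
    using \<delta> d by (simp add: field_simps eval_nat_numeral)
  \<comment> \<open>The constant 1572864 is 2 times 12 times the square of 256, from the
    denominators of \<eta> and \<open>sqrt \<gamma>\<close>.\<close>
  also have "\<dots> \<le> 1 / 1572864 * (\<sigma> * u * \<delta> ^ 3 / d ^ 3)"
    using \<sigma> u \<delta> d by (intro mult_right_mono) auto
  also have "\<dots> = \<sigma> * (u * \<eta>\<^sup>2 * sqrt \<gamma> / 2)"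
    unfolding sg \<eta>_def using d by (simp add: field_simps eval_nat_numeral)
  finally show "9 * (\<epsilon>\<^sup>2 * \<eta>\<^sup>2 / 2 + 2 * \<epsilon>\<^sup>2 * N\<^sup>2) ^ 3 \<le> \<sigma> * (\<epsilon>\<^sup>2 * \<eta>\<^sup>2 * sqrt \<gamma> / 2)" by (simp only: u_def)
  have "\<epsilon> ^ 4 * N ^ 4 = \<epsilon> ^ 4 * (N\<^sup>2)\<^sup>2" by simp
  also have "\<dots> \<le> \<sigma> * \<delta> ^ 6 / (256 * 1000 ^ 4 * d ^ 9) * (8 * d\<^sup>2 / \<delta>)\<^sup>2"
    using N small \<sigma> \<delta> d by (intro mult_mono power_mono) auto
  also have "\<dots> = 64 / (256 * 1000 ^ 4) * \<sigma> * (\<delta> ^ 4 / d ^ 5)"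
    using \<delta> d by (simp add: field_simps eval_nat_numeral)
  also have "\<dots> \<le> 64 / (256 * 1000 ^ 4) * \<sigma> * 1"
  proof (rule mult_left_mono)
    have "\<delta> ^ 4 \<le> d ^ 5" using pw(2)[of 4] pw(1)[of 5] by linarith
    then show "\<delta> ^ 4 / d ^ 5 \<le> 1" using pw(4)[of 5] by simp
  qed (use \<sigma> in simp)
  also have "\<dots> \<le> 2 / 5 * \<sigma>" using \<sigma> by simp
  finally show "\<epsilon> ^ 4 * N ^ 4 \<le> 2 / 5 * \<sigma>" .
  have us: "u \<le> sqrt \<sigma>"
  proof (rule real_le_rsqrt)
    have "1 * 1 \<le> 256 * 1000 ^ 4 * d ^ 9" using pw(1)[of 9] by (intro mult_mono) auto
    then have "\<delta> ^ 6 \<le> 256 * 1000 ^ 4 * d ^ 9" using pw(2)[of 6] by (simp only: mult_1_left order_trans)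
    then have "\<sigma> * \<delta> ^ 6 / (256 * 1000 ^ 4 * d ^ 9) \<le> \<sigma>" using \<sigma> pw(4)[of 9] by (simp add: field_simps)
    with small show "u\<^sup>2 \<le> \<sigma>" unfolding u(2) by linarith
  qed
  \<comment> \<open>The constant 7864320 is 10 times 12 times the square of 256.\<close>
  have "10 / (\<sigma> * (u * \<eta>\<^sup>2 * sqrt \<gamma>)) = 7864320 * d ^ 3 / (\<delta> ^ 3 * (\<sigma> * u))"
    unfolding sg \<eta>_def using d \<delta> \<sigma> u by (simp add: field_simps eval_nat_numeral)
  also have "\<dots> \<le> 8000000 * d ^ 3 / (\<delta> ^ 4 * (\<sigma> * u))"
    using pw \<sigma> u \<delta> d power_decreasing[of 3 4 \<delta>] by (intro frac_le mult_right_mono mult_pos_pos) auto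
  finally have 1: "10 / (\<sigma> * (u * \<eta>\<^sup>2 * sqrt \<gamma>)) \<le> 8000000 * d ^ 3 / (\<delta> ^ 4 * (\<sigma> * u))" .
  have "125 * ln (18 * d) / (\<sigma> * sqrt \<sigma>) \<le> 125 * (18 * d) / (\<sigma> * u)"
  proof (rule frac_le)
    have "ln (18 * d) \<le> 18 * d - 1" using d by (intro ln_le_minus_one) auto
    then show "125 * ln (18 * d) \<le> 125 * (18 * d)" by simp
  qed (use d \<sigma> u us in auto)
  also have "\<dots> \<le> 8000000 * d ^ 3 / (\<delta> ^ 4 * (\<sigma> * u))"
  proof (rule frac_le)
    have "d ^ 1 \<le> d ^ 3" using d by (intro power_increasing) auto
    then show "125 * (18 * d) \<le> 8000000 * d ^ 3" using d by simp
    show "\<delta> ^ 4 * (\<sigma> * u) \<le> \<sigma> * u" using mult_right_mono[OF pw(2)[of 4], of "\<sigma> * u"] \<sigma> u by simp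
  qed (use d \<sigma> u \<delta> in auto)
  finally have 2: "125 * ln (18 * d) / (\<sigma> * sqrt \<sigma>) \<le> 8000000 * d ^ 3 / (\<delta> ^ 4 * (\<sigma> * u))" .
  \<comment> \<open>The time on offer consists of two equal halves, one for the growth of
    \<open>P\<close> and one for the logarithmic term. The factor 1000 makes each half just large
    enough for 7864320.\<close>
  have eq: "16 * (1000 / \<delta>\<^sup>2)\<^sup>2 * d ^ 3 / (\<sigma> * u) = 2 * (8000000 * d ^ 3 / (\<delta> ^ 4 * (\<sigma> * u)))"
    by (simp add: power_divide)
  show "10 / (\<sigma> * (\<epsilon>\<^sup>2 * \<eta>\<^sup>2 * sqrt \<gamma>)) + 125 * ln (18 * d) / (\<sigma> * sqrt \<sigma>)
      \<le> 16 * (1000 / \<delta>\<^sup>2)\<^sup>2 * d ^ 3 / (\<sigma> * \<epsilon>\<^sup>2)"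
    unfolding u_def[symmetric] eq mult_2 by (rule add_mono[OF 1 2])
qed

text \<open>Taking fourth powers removes the root of \<sigma>. The result is stated with the powers
  of \<delta> and \<open>d\<close> that the smallness conditions consume.\<close>

lemma initial_scale:
  fixes d \<delta> \<sigma> \<epsilon> :: real
  assumes \<delta>: "0 < \<delta>" "\<delta> < 1" and d: "d \<ge> 1" and \<sigma>: "\<sigma> > 0" and \<epsilon>: "\<epsilon> > 0"
    and le: "\<epsilon> \<le> \<sigma> powr (1 / 4) / (4 * (1 / \<delta>)\<^sup>2 * (1000 / \<delta>\<^sup>2) * d powr (29 / 8))"
  shows "\<epsilon> ^ 4 \<le> \<sigma> * \<delta> ^ 6 / (256 * 1000 ^ 4 * d ^ 9)"
proof -
  have "d ^ 3 = d powr 3" using d by (simp add: powr_numeral)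
  also have "\<dots> \<le> d powr (29 / 8)" using d by (intro powr_mono) auto
  finally have d3: "d ^ 3 \<le> d powr (29 / 8)" .
  note le
  also have "\<sigma> powr (1 / 4) / (4 * (1 / \<delta>)\<^sup>2 * (1000 / \<delta>\<^sup>2) * d powr (29 / 8)) \<le> \<sigma> powr (1 / 4) / (4 * (1 / \<delta>)\<^sup>2 * (1000 / \<delta>\<^sup>2) * d ^ 3)"
    using \<delta> d d3 by (intro divide_left_mono mult_left_mono mult_pos_pos) auto
  also have "\<dots> = \<sigma> powr (1 / 4) * (\<delta> ^ 4 / (4000 * d ^ 3))"
    using \<delta> by (simp add: field_simps eval_nat_numeral)
  finally have "\<epsilon> ^ 4 \<le> (\<sigma> powr (1 / 4) * (\<delta> ^ 4 / (4000 * d ^ 3))) ^ 4" using \<epsilon> by (intro power_mono) auto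
  also have "\<dots> = (\<sigma> powr (1 / 4)) ^ 4 * (\<delta> ^ 16 / (256 * 1000 ^ 4 * d ^ 12))"
    by (simp add: power_mult_distrib power_divide flip: power_mult)
  also have "(\<sigma> powr (1 / 4)) ^ 4 = \<sigma>" using \<sigma> by (simp flip: powr_realpow powr_powr add: powr_powr)
  also have "\<sigma> * (\<delta> ^ 16 / (256 * 1000 ^ 4 * d ^ 12)) \<le> \<sigma> * (\<delta> ^ 6 / (256 * 1000 ^ 4 * d ^ 9))"
    using \<sigma> \<delta> d by (intro mult_left_mono frac_le power_decreasing power_increasing) auto
  finally show ?thesis by simp
qed

definition well_conditioned :: "nat \<Rightarrow> real \<Rightarrow> 'a::rc_field mat \<Rightarrow> bool" where
  "well_conditioned d \<delta> G \<longleftrightarrow> G \<in> carrier_mat d d \<and> low d (\<delta> / (256 * d)) (Fm d G) \<and> (norm (Fm d G))\<^sup>2 \<le> 8 * (real d)\<^sup>2 / \<delta>"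

context gaussian
begin

lemma measurable_mat: "mat d d \<in> measurable (PiM ({..<d} \<times> {..<d}) (\<lambda>_. \<nu>)) (mat_borel d)"
  by (rule measurable_mat_borelI) (auto intro: measurable_coordinate)

lemma prob_iid_mat: "prob_space (iid_mat \<nu> d)"
  unfolding iid_mat_def by (rule prob_space.prob_space_distr[OF prob_PiM measurable_mat])

text \<open>The lower bound on the singular values and the upper bound on the norm each fail with
  probability at most \<open>\<delta> / 8\<close>.\<close>

lemma well_conditioned_whp:
  assumes d: "d > 0" and \<delta>: "0 < \<delta>" "\<delta> < 1"
  shows "{G. well_conditioned d \<delta> G} \<in> sets (iid_mat \<nu> d)"
    and "measure (iid_mat \<nu> d) {G. well_conditioned d \<delta> G} \<ge> 1 - \<delta> / 4"
proof -
  let ?M = "PiM ({..<d} \<times> {..<d}) (\<lambda>_. \<nu>)" and ?\<eta> = "\<delta> / (256 * real d)" and ?R = "8 * (real d)\<^sup>2 / \<delta>"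
  interpret M: prob_space ?M by (rule prob_PiM)
  have \<eta>: "?\<eta> > 0" "?R > 0" using d \<delta> by auto
  have ent_m: "(\<lambda>G. ent (Fm d G) i k) \<in> borel_measurable (mat_borel d :: 'a mat measure)" if "i < d" "k < d" for i k
    using measurable_entry[OF that] that by (simp add: ent_Fm)
  have low: "{G \<in> space (mat_borel d). \<not> low d ?\<eta> (Fm d G :: 'a fm)} \<in> sets (mat_borel d)"
    using measurable_low_event[of d "Fm d" "mat_borel d" "\<lambda>_. True" "\<lambda>x. ?\<eta>\<^sup>2 * sqv d x", OF ent_m] \<eta>
    by (simp add: not_low_dense[OF supp_le_Fm d])
  have norm_m: "(\<lambda>G. (norm (Fm d G :: 'a fm))\<^sup>2) \<in> borel_measurable (mat_borel d)"
    unfolding norm_fm_sq[OF supp_le_Fm]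
    by (intro borel_measurable_sum borel_measurable_power measurable_compose[OF ent_m, of _ _ norm]) auto
  then have norm: "{G \<in> space (mat_borel d). (norm (Fm d G :: 'a fm))\<^sup>2 \<le> ?R} \<in> sets (mat_borel d)" by measurable
  have eq: "{G. well_conditioned d \<delta> G} = (space (mat_borel d) - {G \<in> space (mat_borel d). \<not> low d ?\<eta> (Fm d G :: 'a fm)})
      \<inter> {G \<in> space (mat_borel d). (norm (Fm d G))\<^sup>2 \<le> ?R}"
    by (auto simp: well_conditioned_def)
  have sets: "{G :: 'a mat. well_conditioned d \<delta> G} \<in> sets (mat_borel d)"
    unfolding eq using low norm by blast
  then show "{G. well_conditioned d \<delta> G} \<in> sets (iid_mat \<nu> d)" by (simp add: iid_mat_def)
  let ?B1 = "{f \<in> space ?M. \<not> low d ?\<eta> (fm_of d f)}" and ?B2 = "{f \<in> space ?M. (norm (fm_of d f))\<^sup>2 > ?R}"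
  have s: "?B1 \<in> sets ?M" "?B2 \<in> sets ?M"
  proof -
    have "?B1 = mat d d -` {G \<in> space (mat_borel d). \<not> low d ?\<eta> (Fm d G :: 'a fm)} \<inter> space ?M"
      by (auto simp: fm_of_def[OF d])
    then show "?B1 \<in> sets ?M" using measurable_sets[OF measurable_mat low] by simp
    have "?B2 = space ?M - mat d d -` {G \<in> space (mat_borel d). (norm (Fm d G :: 'a fm))\<^sup>2 \<le> ?R} \<inter> space ?M"
      by (auto simp: fm_of_def[OF d])
    then show "?B2 \<in> sets ?M" using measurable_sets[OF measurable_mat norm] by auto
  qed
  have "measure (iid_mat \<nu> d) {G. well_conditioned d \<delta> G} = M.prob (mat d d -` {G. well_conditioned d \<delta> G} \<inter> space ?M)"
    unfolding iid_mat_def by (rule measure_distr[OF measurable_mat sets])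
  also have "mat d d -` {G. well_conditioned d \<delta> G} \<inter> space ?M = space ?M - (?B1 \<union> ?B2)"
    by (auto simp: well_conditioned_def fm_of_def[OF d])
  also have "M.prob \<dots> = 1 - M.prob (?B1 \<union> ?B2)" using s by (intro M.prob_compl) auto
  also have "\<dots> \<ge> 1 - (M.prob ?B1 + M.prob ?B2)" using measure_Un_le[OF s] by simp
  moreover have "M.prob ?B1 \<le> 32 * d * ?\<eta>" by (rule gaussian_near_singular[OF d \<eta>(1)])
  moreover have "M.prob ?B2 \<le> (real d)\<^sup>2 / ?R" by (rule gaussian_norm[OF d \<eta>(2)])
  moreover have "32 * d * ?\<eta> = \<delta> / 8" "(real d)\<^sup>2 / ?R = \<delta> / 8" using d by (auto simp: field_simps)
  ultimately show "measure (iid_mat \<nu> d) {G. well_conditioned d \<delta> G} \<ge> 1 - \<delta> / 4" by simp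
qed

end

lemma powr_three_halves: "\<sigma> > 0 \<Longrightarrow> \<sigma> powr (3 / 2) = \<sigma> * sqrt (\<sigma> :: real)"
  using powr_add[of \<sigma> 1 "1 / 2"] by (simp add: powr_half_sqrt)

text \<open>\<open>V\<close> absorbs the phases and the unitary factor of the target.\<close>

locale problem =
  fixes d :: nat and \<Sigma> :: "'a::rc_field mat" and a :: real and s :: "nat \<Rightarrow> 'a" and \<epsilon> :: real and \<mu> :: "'a mat measure"
    and \<delta> :: real and U :: "'a fm" and V :: "'a mat"
  assumes setting: "setting (1 / \<delta>) (1000 / \<delta>\<^sup>2) d \<Sigma> a s \<epsilon> \<mu>" and \<delta>: "0 < \<delta>" "\<delta> < 1" and d: "d \<ge> 1"
    and U: "unitary_fm d U" "Fm d \<Sigma> = sigma_max \<Sigma> *\<^sub>R U"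
    and V: "V \<in> unitary_group d" "Fm d V = smult_fm (s 1 * s 2 * s 3 * s 4) (adj U)"

lemma ex_problem:
  fixes \<Sigma> :: "'a::rc_field mat"
  assumes "setting (1 / \<delta>) (1000 / \<delta>\<^sup>2) d \<Sigma> a s \<epsilon> \<mu>" "0 < \<delta>" "\<delta> < 1" "d \<ge> 1"
  obtains U V where "problem d \<Sigma> a s \<epsilon> \<mu> \<delta> U V"
proof -
  obtain U where U: "unitary_fm d U" "Fm d \<Sigma> = sigma_max \<Sigma> *\<^sub>R U"
  proof (rule scaled_unitary_of_singular_values[of \<Sigma> d "sigma_max \<Sigma>"])
    show "\<Sigma> \<in> carrier_mat d d" "sigma_max \<Sigma> > 0" "\<forall>\<sigma>\<in>singular_values \<Sigma>. \<sigma> = sigma_max \<Sigma>" "d > 0"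
      using assms by (simp_all add: setting_def)
  qed (use that in \<open>simp add: unitary_fm_def\<close>)
  have n: "norm (s 1 * s 2 * s 3 * s 4) = 1"
    using assms(1) by (simp add: setting_def norm_mult del: One_nat_def)
  then have u: "unitary_fm d (smult_fm (s 1 * s 2 * s 3 * s 4) (adj U))"
    by (rule unitary_fm_smult[OF _ unitary_fm_adj[OF U(1)]])
  then have "supp_le d (smult_fm (s 1 * s 2 * s 3 * s 4) (adj U))" by (simp only: unitary_fm_def)
  then obtain V where V: "V \<in> carrier_mat d d" "Fm d V = smult_fm (s 1 * s 2 * s 3 * s 4) (adj U)"
    by (rule Fm_surj)
  have "V \<in> unitary_group d" using u by (intro unitary_group_of_fm[OF V(1)]) (simp only: V(2))
  then show ?thesis by (intro that[of U V] problem.intro assms U V)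
qed

context problem
begin

definition "\<sigma> = sigma_max \<Sigma>"

lemma settingD:
  "\<Sigma> \<in> carrier_mat d d" "\<sigma> > 0" "a \<ge> 0" "\<forall>j\<in>{1..4}. norm (s j) = 1" "is_haar d \<mu>" "\<epsilon> > 0"
  "\<epsilon> ^ 4 \<le> \<sigma> * \<delta> ^ 6 / (256 * 1000 ^ 4 * real d ^ 9)"
proof -
  show *: "\<Sigma> \<in> carrier_mat d d" "\<sigma> > 0" "a \<ge> 0" "\<forall>j\<in>{1..4}. norm (s j) = 1" "is_haar d \<mu>" "\<epsilon> > 0"
    using setting by (auto simp: setting_def \<sigma>_def)
  show "\<epsilon> ^ 4 \<le> \<sigma> * \<delta> ^ 6 / (256 * 1000 ^ 4 * real d ^ 9)"
    using setting d by (intro initial_scale \<delta> *) (auto simp: setting_def \<sigma>_def)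
qed

lemma haar_mu: "haar d \<mu>" using settingD(5) d by (simp add: haar_def)

sublocale H: haar d \<mu> by (rule haar_mu)

lemma initialized:
  assumes "G \<in> carrier_mat d d" "Q \<in> space H.Om"
    "gradient_flow d a \<Sigma> W" "\<forall>j\<in>{1..4}. W 0 j = balanced_init s \<epsilon> (G, Q) j"
  shows "initialized d \<Sigma> \<sigma> a \<epsilon> s G Q W U"
  using assms d settingD(1-4,6) U H.component_unitary[OF assms(2)]
  by (intro initialized.intro) (auto simp: \<sigma>_def)

lemma C_eq: "Q \<in> space H.Om \<Longrightarrow> H.C V Q = adj (Fm d (Q 0)) + adj (smult_fm (s 1 * s 2 * s 3 * s 4) (adj U) * Fm d (Q 4))"
  using H.component_unitary[of Q 4] V by (simp add: H.C_def Fm_arith(3) unitary_group_carrier del: One_nat_def)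

lemma singular_stuck:
  assumes G: "G \<in> carrier_mat d d" and Q: "Q \<in> space H.Om" and X: "X \<in> sph d" "H.C V Q * X = 0"
  shows "along_flow d a \<Sigma> (balanced_init s \<epsilon> (G, Q))
    (\<lambda>L. \<not> (L \<longlongrightarrow> 0) at_top \<and> (\<forall>t\<ge>0. L t \<ge> 1 / 2 * (sigma_max \<Sigma>)\<^sup>2))"
  unfolding along_flow_def
proof (intro allI impI, elim conjE)
  fix W assume W: "gradient_flow d a \<Sigma> W" "\<forall>j\<in>{1..4}. W 0 j = balanced_init s \<epsilon> (G, Q) j"
  interpret I: initialized d \<Sigma> \<sigma> a \<epsilon> s G Q W U by (rule initialized[OF G Q W])
  have ge: "loss a \<Sigma> (W t) \<ge> 1 / 2 * \<sigma>\<^sup>2" if "t \<ge> 0" for t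
    using I.stuck[OF X(1) _ that] X(2) by (simp add: C_eq[OF Q] I.twist_def)
  have "\<not> ((\<lambda>t. loss a \<Sigma> (W t)) \<longlongrightarrow> 0) at_top"
  proof
    assume "((\<lambda>t. loss a \<Sigma> (W t)) \<longlongrightarrow> 0) at_top"
    then have "1 / 2 * \<sigma>\<^sup>2 \<le> 0"
      by (rule tendsto_lowerbound[OF _ eventually_mono[OF eventually_ge_at_top[of 0] ge]]) auto
    then show False using settingD(2) by simp
  qed
  with ge show "\<not> ((\<lambda>t. loss a \<Sigma> (W t)) \<longlongrightarrow> 0) at_top \<and> (\<forall>t\<ge>0. loss a \<Sigma> (W t) \<ge> 1 / 2 * (sigma_max \<Sigma>)\<^sup>2)"
    by (simp add: \<sigma>_def)
qed

text \<open>When \<open>e\<close> is at least \<open>d * \<sigma>\<^sup>2\<close> the logarithm in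
  the time bound is nonpositive and \<open>t\<close> may precede the waiting time; there the initial
  loss bound is enough. Otherwise \<open>t\<close> lies beyond the waiting time and the exponential
  decay applies.\<close>

lemma regular_converges:
  assumes G: "well_conditioned d \<delta> G" and Q: "Q \<in> space H.Om" and low: "low d ((\<delta> / (12 * real d))\<^sup>2) (H.C V Q)"
  shows "along_flow d a \<Sigma> (balanced_init s \<epsilon> (G, Q)) (fast_convergence (1000 / \<delta>\<^sup>2) d (sigma_max \<Sigma>) \<epsilon>)"
  unfolding along_flow_def fast_convergence_def
proof (intro allI impI, elim conjE)
  fix W :: "real \<Rightarrow> nat \<Rightarrow> 'a mat" and e t :: real
  assume W: "gradient_flow d a \<Sigma> W" "\<forall>j\<in>{1..4}. W 0 j = balanced_init s \<epsilon> (G, Q) j"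
    and e: "e > 0" and t: "t \<ge> 0" "t > conv_time (1000 / \<delta>\<^sup>2) d (sigma_max \<Sigma>) \<epsilon> e"
  have G': "G \<in> carrier_mat d d" using G by (simp add: well_conditioned_def)
  interpret I: initialized d \<Sigma> \<sigma> a \<epsilon> s G Q W U by (rule initialized[OF G' Q W])
  define T where "T = 16 * (1000 / \<delta>\<^sup>2)\<^sup>2 * real d ^ 3 / (\<sigma> * \<epsilon>\<^sup>2)"
  have d1: "real d \<ge> 1" using d by simp
  have N: "(norm (Fm d G))\<^sup>2 \<le> 8 * (real d)\<^sup>2 / \<delta>" using G by (simp add: well_conditioned_def)
  note b = scale_bounds[OF \<delta> d1 settingD(2,6,7) N]
  have p: "\<delta> / (12 * real d) \<le> 1" "0 < \<delta> / (12 * real d)" using \<delta> d1 by auto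
  have \<gamma>: "0 < (\<delta> / (12 * real d))\<^sup>2" "(\<delta> / (12 * real d))\<^sup>2 \<le> 1"
    by (rule zero_less_power[OF p(2)], rule power_le_one[OF less_imp_le[OF p(2)] p(1)])
  have \<eta>: "low d (\<delta> / (256 * real d)) (Fm d G)" "\<delta> / (256 * real d) > 0"
    using G \<delta> d1 by (auto simp: well_conditioned_def)
  have z: "low d ((\<delta> / (12 * real d))\<^sup>2) (adj (Fm d (Q 0)) + adj (I.twist * Fm d (Q 4)))"
    using low by (simp only: C_eq[OF Q] I.twist_def)
  have c1: "loss a \<Sigma> (W t) < d * \<sigma>\<^sup>2"
    and c2: "t \<ge> T \<Longrightarrow> loss a \<Sigma> (W t) < d * \<sigma>\<^sup>2 * exp (- (8 * (\<sigma> * sqrt \<sigma>) * (t - T)))"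
    using I.converges[OF \<eta> z \<gamma> b(1,2), of T t] b(3) t(1) by (auto simp: T_def)
  have ds: "d * \<sigma>\<^sup>2 > 0" "\<sigma> * sqrt \<sigma> > 0" using d1 settingD(2) by auto
  show "loss a \<Sigma> (W t) < e"
  proof (cases "e \<ge> d * \<sigma>\<^sup>2")
    case False
    have tT: "t - T > 1 / (8 * (\<sigma> * sqrt \<sigma>)) * ln (d * \<sigma>\<^sup>2 / e)"
      using t(2) settingD(2) by (simp add: conv_time_def T_def powr_three_halves flip: \<sigma>_def)
    have "ln (d * \<sigma>\<^sup>2 / e) > 0" using False e ds by simp
    then have "1 / (8 * (\<sigma> * sqrt \<sigma>)) * ln (d * \<sigma>\<^sup>2 / e) > 0" using ds by simp
    with tT have "t \<ge> T" by linarith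
    note c2[OF this]
    also have "d * \<sigma>\<^sup>2 * exp (- (8 * (\<sigma> * sqrt \<sigma>) * (t - T))) \<le> d * \<sigma>\<^sup>2 * exp (- ln (d * \<sigma>\<^sup>2 / e))"
    proof (intro mult_left_mono)
      have "ln (d * \<sigma>\<^sup>2 / e) \<le> (t - T) * (8 * (\<sigma> * sqrt \<sigma>))"
        using tT ds by (simp add: pos_divide_less_eq less_imp_le)
      then show "exp (- (8 * (\<sigma> * sqrt \<sigma>) * (t - T))) \<le> exp (- ln (d * \<sigma>\<^sup>2 / e))"
        by (simp add: mult.commute)
    qed (use ds in simp)
    also have "\<dots> = e"
    proof -
      have "x * exp (- ln (x / e)) = e" if "x > 0" for x using that e by (simp add: exp_minus)
      from this[OF ds(1)] show ?thesis .
    qed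
    finally show ?thesis .
  qed (use c1 in simp)
qed

end

text \<open>\<open>G\<close> and the unitary matrices are independent, so conditions imposed on them
  separately have the product of their probabilities.\<close>

lemma with_prob_rectangle:
  assumes "prob_space M" "prob_space N" and A: "A \<in> sets M" "B \<in> sets N"
    and p: "p \<le> measure M A * measure N B" and E: "\<And>x y. x \<in> A \<Longrightarrow> y \<in> B \<Longrightarrow> E (x, y)"
  shows "with_prob_at_least (M \<Otimes>\<^sub>M N) p E"
proof -
  interpret M: prob_space M by fact
  interpret N: prob_space N by fact
  interpret MN: pair_prob_space M N ..
  have "ennreal (MN.P.prob (A \<times> B)) = ennreal (M.prob A * N.prob B)"
    using N.emeasure_pair_measure_Times[OF A]
    by (simp add: MN.P.emeasure_eq_measure M.emeasure_eq_measure N.emeasure_eq_measure ennreal_mult)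
  then have "measure (M \<Otimes>\<^sub>M N) (A \<times> B) = M.prob A * N.prob B" by (simp add: ennreal_inj)
  then show ?thesis unfolding with_prob_at_least_def
    using A p E by (intro bexI[of _ "A \<times> B"]) auto
qed

lemma complex_converges:
  fixes \<Sigma> :: "complex mat"
  assumes "setting (1 / \<delta>) (1000 / \<delta>\<^sup>2) d \<Sigma> a s \<epsilon> \<mu>" and \<delta>: "0 < \<delta>" "\<delta> < 1" and d: "d \<ge> 1"
  shows "with_prob_at_least (init_law std_gaussian_complex \<mu> d) (1 - \<delta>)
    (\<lambda>\<omega>. along_flow d a \<Sigma> (balanced_init s \<epsilon> \<omega>) (fast_convergence (1000 / \<delta>\<^sup>2) d (sigma_max \<Sigma>) \<epsilon>))"
proof -
  obtain U V where "problem d \<Sigma> a s \<epsilon> \<mu> \<delta> U V" using ex_problem[OF assms] .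
  then interpret problem d \<Sigma> a s \<epsilon> \<mu> \<delta> U V .
  interpret g: gaussian std_gaussian_complex "sqrt (1 / 2)" by (rule gaussian_complex)
  have d0: "d > 0" using d by simp
  let ?\<gamma> = "(\<delta> / (12 * real d))\<^sup>2"
  let ?B = "{Q \<in> space H.Om. \<not> low d ?\<gamma> (H.C V Q)}"
  have "\<delta> / (12 * real d) < 1" "0 < \<delta> / (12 * real d)" using \<delta> d by auto
  then have \<gamma>: "0 < ?\<gamma>" "?\<gamma> < 1"
    using power_Suc_less_one[of "\<delta> / (12 * real d)" 1] by (auto simp only: zero_less_power numeral_2_eq_2 One_nat_def)
  have B: "?B \<in> sets H.Om" using \<gamma> by (intro H.sets_low_C[OF V(1)]) auto
  have "H.Q.prob ?B \<le> 16 * ?\<gamma> * d" by (rule complex_haar_near_singular[OF haar_mu V(1) \<gamma>])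
  also have "\<dots> = \<delta> * \<delta> / (9 * d)" using d by (simp add: field_simps power2_eq_square)
  also have "\<dots> \<le> \<delta> * 1 / (9 * 1)" using \<delta> d by (intro frac_le mult_left_mono) auto
  finally have pB: "H.Q.prob (space H.Om - ?B) \<ge> 1 - \<delta> / 4" using H.Q.prob_compl[OF B] \<delta> by simp
  have pG: "measure (iid_mat std_gaussian_complex d) {G. well_conditioned d \<delta> G} \<ge> 1 - \<delta> / 4"
    by (rule g.well_conditioned_whp[OF d0 \<delta>])
  show ?thesis unfolding init_law_def
  proof (rule with_prob_rectangle[OF g.prob_iid_mat H.Q.prob_space_axioms g.well_conditioned_whp(1)[OF d0 \<delta>]])
    show "space H.Om - ?B \<in> sets H.Om" using B by blast
    have "(1 - \<delta> / 4) * (1 - \<delta> / 4) = 1 - \<delta> + (\<delta> / 2 + \<delta> * \<delta> / 16)" by (simp add: field_simps)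
    moreover have "0 \<le> \<delta> / 2 + \<delta> * \<delta> / 16" using \<delta> by simp
    ultimately have "1 - \<delta> \<le> (1 - \<delta> / 4) * (1 - \<delta> / 4)" by linarith
    also have "\<dots> \<le> measure (iid_mat std_gaussian_complex d) {G. well_conditioned d \<delta> G} * H.Q.prob (space H.Om - ?B)"
      using pG pB \<delta> by (intro mult_mono) auto
    finally show "1 - \<delta> \<le> measure (iid_mat std_gaussian_complex d) {G. well_conditioned d \<delta> G} * H.Q.prob (space H.Om - ?B)" .
  qed (auto intro!: regular_converges)
qed

lemma real_converges:
  fixes \<Sigma> :: "real mat"
  assumes "setting (1 / \<delta>) (1000 / \<delta>\<^sup>2) d \<Sigma> a s \<epsilon> \<mu>" and \<delta>: "0 < \<delta>" "\<delta> < 1" and d: "d \<ge> 1"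
  shows "with_prob_at_least (init_law std_gaussian_real \<mu> d) (1 / 2)
      (\<lambda>\<omega>. along_flow d a \<Sigma> (balanced_init s \<epsilon> \<omega>)
        (\<lambda>L. \<not> (L \<longlongrightarrow> 0) at_top \<and> (\<forall>t\<ge>0. L t \<ge> 1 / 2 * (sigma_max \<Sigma>)\<^sup>2)))" (is ?stuck)
    and "with_prob_at_least (init_law std_gaussian_real \<mu> d) (1 / 2 * (1 - \<delta>))
    (\<lambda>\<omega>. along_flow d a \<Sigma> (balanced_init s \<epsilon> \<omega>) (fast_convergence (1000 / \<delta>\<^sup>2) d (sigma_max \<Sigma>) \<epsilon>))" (is ?conv)
proof -
  obtain U V where "problem d \<Sigma> a s \<epsilon> \<mu> \<delta> U V" using ex_problem[OF assms] .
  then interpret problem d \<Sigma> a s \<epsilon> \<mu> \<delta> U V .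
  interpret g: gaussian std_gaussian_real 1 by (rule gaussian_real)
  have d0: "d > 0" using d by simp
  note O = haar_mu V(1)
  let ?or = "\<lambda>c. {Q \<in> space H.Om. orient V Q = c}"
  show ?stuck unfolding init_law_def
  proof (rule with_prob_rectangle[OF g.prob_iid_mat H.Q.prob_space_axioms sets.top sets_orient[OF O]])
    \<comment> \<open>Being stuck depends on the orientation alone, so the event is the full space
      of matrices \<open>G\<close> times half of the space of unitary matrices.\<close>
    show "1 / 2 \<le> measure (iid_mat std_gaussian_real d) (space (iid_mat std_gaussian_real d)) * H.Q.prob (?or (-1))"
      using prob_orient[OF O] prob_space.prob_space[OF g.prob_iid_mat] by simp
    fix G Q assume G: "G \<in> space (iid_mat std_gaussian_real d)" and Q: "Q \<in> ?or (-1)"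
    have "G \<in> carrier_mat d d" using G by (simp add: iid_mat_def)
    moreover obtain X where "X \<in> sph d" "H.C V Q * X = 0" using orient_singular[OF O] Q by auto
    ultimately show "along_flow d a \<Sigma> (balanced_init s \<epsilon> (G, Q))
      (\<lambda>L. \<not> (L \<longlongrightarrow> 0) at_top \<and> (\<forall>t\<ge>0. L t \<ge> 1 / 2 * (sigma_max \<Sigma>)\<^sup>2))"
      using Q by (intro singular_stuck) auto
  qed
  let ?\<gamma> = "(\<delta> / (12 * real d))\<^sup>2"
  let ?B = "{Q \<in> space H.Om. orient V Q = 1 \<and> \<not> low d ?\<gamma> (H.C V Q)}"
  have \<gamma>: "0 < ?\<gamma>" using \<delta> d by simp
  have "?B = ?or 1 \<inter> {Q \<in> space H.Om. \<not> low d ?\<gamma> (H.C V Q)}" by auto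
  then have B: "?B \<in> sets H.Om" using \<gamma> by (simp only:) (intro sets.Int sets_orient[OF O] H.sets_low_C[OF V(1)], auto)
  have "H.Q.prob ?B \<le> 24 * d\<^sup>2 * ?\<gamma>" by (rule real_haar_near_singular[OF O \<gamma>])
  also have "\<dots> = \<delta> * \<delta> / 6" using d by (simp add: field_simps power2_eq_square)
  also have "\<dots> \<le> \<delta> * 1 / 6" using \<delta> by (intro divide_right_mono mult_left_mono) auto
  finally have "H.Q.prob ?B \<le> \<delta> / 4" using \<delta> by simp
  moreover have "H.Q.prob (?or 1 - ?B) = H.Q.prob (?or 1) - H.Q.prob ?B"
    by (rule H.Q.finite_measure_Diff[OF sets_orient[OF O] B]) auto
  ultimately have pB: "H.Q.prob (?or 1 - ?B) \<ge> 1 / 2 - \<delta> / 4" using prob_orient[OF O, of 1] by simp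
  have pG: "measure (iid_mat std_gaussian_real d) {G. well_conditioned d \<delta> G} \<ge> 1 - \<delta> / 4"
    by (rule g.well_conditioned_whp[OF d0 \<delta>])
  show ?conv unfolding init_law_def
  proof (rule with_prob_rectangle[OF g.prob_iid_mat H.Q.prob_space_axioms g.well_conditioned_whp(1)[OF d0 \<delta>]])
    show "?or 1 - ?B \<in> sets H.Om" by (intro sets.Diff sets_orient[OF O] B)
    have "(1 - \<delta> / 4) * (1 / 2 - \<delta> / 4) = 1 / 2 * (1 - \<delta>) + (\<delta> / 8 + \<delta> * \<delta> / 16)" by (simp add: field_simps)
    then have "1 / 2 * (1 - \<delta>) \<le> (1 - \<delta> / 4) * (1 / 2 - \<delta> / 4)" using \<delta> by simp
    also have "\<dots> \<le> measure (iid_mat std_gaussian_real d) {G. well_conditioned d \<delta> G} * H.Q.prob (?or 1 - ?B)"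
      using pG pB \<delta> by (intro mult_mono) auto
    finally show "1 / 2 * (1 - \<delta>) \<le> measure (iid_mat std_gaussian_real d) {G. well_conditioned d \<delta> G} * H.Q.prob (?or 1 - ?B)" .
  qed (auto intro!: regular_converges)
qed

theorem theorem37:
  shows "\<exists>f1 f2' :: real \<Rightarrow> real.
    (\<forall>\<delta>\<in>{0<..<1}. f1 \<delta> > 0 \<and> f2' \<delta> > 0) \<and>
    f1 \<in> O[principal {0<..<1}](\<lambda>\<delta>. 1 / \<delta>) \<and>
    f2' \<in> O[principal {0<..<1}](\<lambda>\<delta>. 1 / \<delta>\<^sup>2) \<and>
    (\<forall>d\<ge>1. \<forall>\<delta>\<in>{0<..<1}.
      (\<forall>(\<Sigma> :: real mat) a s \<epsilon> \<mu>. setting (f1 \<delta>) (f2' \<delta>) d \<Sigma> a s \<epsilon> \<mu> \<longrightarrow>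
        with_prob_at_least (init_law std_gaussian_real \<mu> d) (1 / 2)
          (\<lambda>\<omega>. along_flow d a \<Sigma> (balanced_init s \<epsilon> \<omega>)
             (\<lambda>L. \<not> (L \<longlongrightarrow> 0) at_top \<and> (\<forall>t\<ge>0. L t \<ge> 1 / 2 * (sigma_max \<Sigma>)\<^sup>2))) \<and>
        with_prob_at_least (init_law std_gaussian_real \<mu> d) (1 / 2 * (1 - \<delta>))
          (\<lambda>\<omega>. along_flow d a \<Sigma> (balanced_init s \<epsilon> \<omega>)
             (fast_convergence (f2' \<delta>) d (sigma_max \<Sigma>) \<epsilon>))) \<and>
      (\<forall>(\<Sigma> :: complex mat) a s \<epsilon> \<mu>. setting (f1 \<delta>) (f2' \<delta>) d \<Sigma> a s \<epsilon> \<mu> \<longrightarrow>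
        with_prob_at_least (init_law std_gaussian_complex \<mu> d) (1 - \<delta>)
          (\<lambda>\<omega>. along_flow d a \<Sigma> (balanced_init s \<epsilon> \<omega>)
             (fast_convergence (f2' \<delta>) d (sigma_max \<Sigma>) \<epsilon>))))"
\<comment> \<open>With these choices the scale condition is of order \<delta>^4 / d^(29/8), and the
  squared second function provides the 10^6 / \<delta>^4 that pays for the waiting time.\<close>
proof (rule exI[of _ "\<lambda>\<delta>. 1 / \<delta>"], rule exI[of _ "\<lambda>\<delta>. 1000 / \<delta>\<^sup>2"], intro conjI)
  show "(\<lambda>\<delta>. 1000 / \<delta>\<^sup>2) \<in> O[principal {0<..<1}](\<lambda>\<delta>. 1 / \<delta>\<^sup>2 :: real)"
    by (rule bigoI[of _ 1000]) simp
  show "(\<lambda>\<delta>. 1 / \<delta>) \<in> O[principal {0<..<1}](\<lambda>\<delta>. 1 / \<delta> :: real)" by (rule landau_o.big_refl)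
qed (simp, intro allI impI ballI conjI, (rule real_converges complex_converges, assumption, simp, simp, assumption)+)

end
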